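(* Let $E=\mathbb C^2$ (basis $e_1,e_2$), $F=\mathbb C^3$ (basis $f_1,f_2,f_3$), let $SL(E)\times SL(F)\times\mathbb C^*$ act on $X=E\otimes S_2F$, and let $A=\mathrm{Sym}(E^*\otimes S_2F^* )$. Let $\mathcal O_9$ be the orbit of $e_2\otimes f_1f_3+e_1\otimes f_2f_3+e_1\otimes f_1^2$, the codimension-$2$ orbit of pencils of symmetric $3\times3$ matrices whose determinant is a cube of a linear form but which have no member of rank $1$. Then the minimal graded equivariant free resolution of $\mathbb C[\overline{\mathcal O_9}]$ over $A$ has the terms $$0\to S_{5,4}E^*\otimes S_{6,6,6}F^*\otimes A(-9)\to S_{4,2}E^*\otimes S_{4,4,4}F^*\otimes A(-6)\to A;$$ it is the resolution of the ideal of binary cubics that are cubes of linear forms (the cone over the rational normal cubic curve) with the binary cubic replaced by the covariant $S_{3,0}E^*\otimes S_{2,2,2}F^*$ (the determinant of the pencil).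
   Context: Everything is over $\mathbb C$. $S_\lambda$ denotes the Schur functor: $S_\lambda V$ is the irreducible $GL(V)$-module attached to the weakly decreasing sequence $\lambda$. $A$ is graded with $A_1=E^*\otimes S_2F^*$ and $A(-d)$ is the free graded module generated in degree $d$. An element of $X$ is viewed as a symmetric $3\times3$ matrix of linear forms in two variables; its determinant is a binary cubic. A member of the pencil is the matrix obtained by contraction with a nonzero element of $E^*$. *)

theory Defs
  imports "HOL-Analysis.Analysis" "HOL-Library.Function_Algebras"
begin

interpretation cfun: vector_space "\<lambda>c (f :: 'a \<Rightarrow> complex) x. c * f x"
  by standard (auto simp: plus_fun_def algebra_simps)

type_synonym matE = "complex^2^2"
type_synonym matF = "complex^3^3"

section \<open>The representation spaces\<close>

text \<open>
  \<open>E \<otimes> S\<^sub>2F\<close>: a pencil \<open>M\<close> is \<open>e\<^sub>1 \<otimes> M$1 + e\<^sub>2 \<otimes> M$2\<close>, where the product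
  \<open>uv \<in> S\<^sub>2F\<close> is identified with the symmetric matrix \<open>(u v\<^sup>T + v u\<^sup>T)/2\<close>.
\<close>

typedef pencil = "{M :: complex^3^3^2. \<forall>i. transpose (M $ i) = M $ i}"
  by (rule exI[of _ 0]) (simp add: transpose_def vec_eq_iff)

setup_lifting type_definition_pencil

definition sprod :: "complex^3 \<Rightarrow> complex^3 \<Rightarrow> matF" where
  "sprod u v = (\<chi> r s. (u $ r * v $ s + v $ r * u $ s) / 2)"

definition tens :: "complex^2 \<Rightarrow> matF \<Rightarrow> complex^3^3^2" where
  "tens e S = (\<chi> i r s. e $ i * S $ r $ s)"

lemma tens_sprod_sym: "tens e (sprod u v) $ i $ r $ s = tens e (sprod u v) $ i $ s $ r"
  by (simp add: tens_def sprod_def add.commute)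

lift_definition pencil_entry :: "pencil \<Rightarrow> 2 \<Rightarrow> 3 \<Rightarrow> 3 \<Rightarrow> complex" is
  "\<lambda>M i r s. M $ i $ r $ s" .

lift_definition pencil_dilate :: "complex \<Rightarrow> pencil \<Rightarrow> pencil" is
  "\<lambda>t M. \<chi> i r s. t * M $ i $ r $ s"
  by (simp add: transpose_def vec_eq_iff)

lift_definition pencil_act :: "matE \<Rightarrow> matF \<Rightarrow> pencil \<Rightarrow> pencil" is
  "\<lambda>g h M. \<chi> i. \<Sum>j\<in>UNIV. (\<chi> r s. g $ i $ j * (h ** M $ j ** transpose h) $ r $ s)"
proof -
  fix g :: matE and h :: matF and M :: "complex^3^3^2"
  assume M: "\<And>i. transpose (M $ i) = M $ i"
  have "transpose (h ** M $ j ** transpose h) = h ** M $ j ** transpose h" for j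
    using M by (simp add: matrix_transpose_mul matrix_mul_assoc)
  then have "(h ** M $ j ** transpose h) $ r $ s = (h ** M $ j ** transpose h) $ s $ r" for j r s
    by (metis (no_types, lifting) transpose_def vec_lambda_beta)
  then show "transpose ((\<chi> i. \<Sum>j\<in>UNIV. (\<chi> r s. g $ i $ j * (h ** M $ j ** transpose h) $ r $ s)) $ i)
      = (\<chi> i. \<Sum>j\<in>UNIV. (\<chi> r s. g $ i $ j * (h ** M $ j ** transpose h) $ r $ s)) $ i" for i
    by (auto simp: transpose_def vec_eq_iff intro!: sum.cong)
qed

text \<open>Contraction of a pencil with \<open>\<xi> \<in> E\<^sup>*\<close>.\<close>

definition pencil_member :: "pencil \<Rightarrow> complex^2 \<Rightarrow> matF" where
  "pencil_member M \<xi> = (\<chi> r s. \<Sum>i\<in>UNIV. \<xi> $ i * pencil_entry M i r s)"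

text \<open>Binary cubics are cubic forms on \<open>E\<^sup>*\<close>, i.e. elements of \<open>S\<^sub>3E\<close>.\<close>

definition cubic_forms :: "(complex^2 \<Rightarrow> complex) set" where
  "cubic_forms = {q. \<exists>a b c d. \<forall>\<xi>.
    q \<xi> = a * (\<xi>$1)^3 + b * (\<xi>$1)^2 * \<xi>$2 + c * \<xi>$1 * (\<xi>$2)^2 + d * (\<xi>$2)^3}"

lemma cubic_forms_scale:
  assumes "q \<in> cubic_forms" shows "(\<lambda>\<xi>. t * q \<xi>) \<in> cubic_forms"
proof -
  from assms obtain a b c d where
    "\<forall>\<xi>. q \<xi> = a * (\<xi>$1)^3 + b * (\<xi>$1)^2 * \<xi>$2 + c * \<xi>$1 * (\<xi>$2)^2 + d * (\<xi>$2)^3"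
    unfolding cubic_forms_def by blast
  then have "\<forall>\<xi>. t * q \<xi>
      = (t*a) * (\<xi>$1)^3 + (t*b) * (\<xi>$1)^2 * \<xi>$2 + (t*c) * \<xi>$1 * (\<xi>$2)^2 + (t*d) * (\<xi>$2)^3"
    by (simp add: algebra_simps)
  then show ?thesis unfolding cubic_forms_def by blast
qed

lemma cubic_forms_add:
  assumes "p \<in> cubic_forms" "q \<in> cubic_forms" shows "(\<lambda>\<xi>. p \<xi> + q \<xi>) \<in> cubic_forms"
proof -
  from assms obtain a b c d a' b' c' d' where
    "\<forall>\<xi>. p \<xi> = a * (\<xi>$1)^3 + b * (\<xi>$1)^2 * \<xi>$2 + c * \<xi>$1 * (\<xi>$2)^2 + d * (\<xi>$2)^3"
    "\<forall>\<xi>. q \<xi> = a' * (\<xi>$1)^3 + b' * (\<xi>$1)^2 * \<xi>$2 + c' * \<xi>$1 * (\<xi>$2)^2 + d' * (\<xi>$2)^3"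
    unfolding cubic_forms_def by blast
  then have "\<forall>\<xi>. p \<xi> + q \<xi> = (a + a') * (\<xi>$1)^3 + (b + b') * (\<xi>$1)^2 * \<xi>$2
      + (c + c') * \<xi>$1 * (\<xi>$2)^2 + (d + d') * (\<xi>$2)^3"
    by (simp add: algebra_simps)
  then show ?thesis unfolding cubic_forms_def by blast
qed

lemma cubic_forms_diff:
  assumes "p \<in> cubic_forms" "q \<in> cubic_forms" shows "(\<lambda>\<xi>. p \<xi> - q \<xi>) \<in> cubic_forms"
  using cubic_forms_add[OF assms(1) cubic_forms_scale[OF assms(2), of "-1"]] by simp

lemma cubic_forms_prod:
  "(\<lambda>\<xi>. (a * \<xi>$1 + b * \<xi>$2) * (c * \<xi>$1 + d * \<xi>$2) * (e * \<xi>$1 + f * \<xi>$2)) \<in> cubic_forms"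
proof -
  have "(a * x + b * y) * (c * x + d * y) * (e * x + f * y)
      = (a * c * e) * x^3 + (a * c * f + a * d * e + b * c * e) * x^2 * y
        + (a * d * f + b * c * f + b * d * e) * x * y^2 + (b * d * f) * y^3" for x y :: complex
    by algebra
  then show ?thesis unfolding cubic_forms_def by blast
qed

typedef binary_cubic = cubic_forms
  using cubic_forms_scale[OF cubic_forms_prod] by blast

setup_lifting type_definition_binary_cubic

lift_definition cubic_eval :: "binary_cubic \<Rightarrow> complex^2 \<Rightarrow> complex" is "\<lambda>q. q" .

lift_definition cubic_dilate :: "complex \<Rightarrow> binary_cubic \<Rightarrow> binary_cubic" is
  "\<lambda>t q \<xi>. t * q \<xi>"
  by (rule cubic_forms_scale)

text \<open>
  The target of the determinant is \<open>S\<^sub>3E \<otimes> S\<^sub>2\<^sub>,\<^sub>2\<^sub>,\<^sub>2F\<close>, hence the factor \<open>(det h)\<^sup>2\<close>.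
\<close>

lift_definition cubic_act :: "matE \<Rightarrow> matF \<Rightarrow> binary_cubic \<Rightarrow> binary_cubic" is
  "\<lambda>g h q \<xi>. (det h)^2 * q (transpose g *v \<xi>)"
proof (rule cubic_forms_scale)
  fix g :: matE and q :: "complex^2 \<Rightarrow> complex"
  assume "q \<in> cubic_forms"
  then obtain a b c d where q:
    "\<And>\<xi>. q \<xi> = a * (\<xi>$1)^3 + b * (\<xi>$1)^2 * \<xi>$2 + c * \<xi>$1 * (\<xi>$2)^2 + d * (\<xi>$2)^3"
    unfolding cubic_forms_def by blast
  define L1 L2 where "L1 = (\<lambda>\<xi>::complex^2. g$1$1 * \<xi>$1 + g$2$1 * \<xi>$2)"
    and "L2 = (\<lambda>\<xi>::complex^2. g$1$2 * \<xi>$1 + g$2$2 * \<xi>$2)"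
  have "(transpose g *v \<xi>)$1 = L1 \<xi>" "(transpose g *v \<xi>)$2 = L2 \<xi>" for \<xi>
    by (simp_all add: transpose_def matrix_vector_mult_def sum_2 L1_def L2_def)
  then have eq: "(\<lambda>\<xi>. q (transpose g *v \<xi>)) = (\<lambda>\<xi>. a * (L1 \<xi> * L1 \<xi> * L1 \<xi>)
      + b * (L1 \<xi> * L1 \<xi> * L2 \<xi>) + c * (L1 \<xi> * L2 \<xi> * L2 \<xi>) + d * (L2 \<xi> * L2 \<xi> * L2 \<xi>))"
    by (simp add: q power2_eq_square power3_eq_cube mult.assoc)
  show "(\<lambda>\<xi>. q (transpose g *v \<xi>)) \<in> cubic_forms"
    unfolding eq unfolding L1_def L2_def
    by (intro cubic_forms_add cubic_forms_scale cubic_forms_prod)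
qed

lift_definition det_cubic :: "pencil \<Rightarrow> binary_cubic" is
  "\<lambda>M \<xi>. det (\<chi> r s. \<Sum>i\<in>UNIV. \<xi> $ i * M $ i $ r $ s)"
proof -
  fix M :: "complex^3^3^2"
  have *: "\<xi> $ 1 * M $ 1 $ r $ s + \<xi> $ 2 * M $ 2 $ r $ s
      = M $ 1 $ r $ s * \<xi> $ 1 + M $ 2 $ r $ s * \<xi> $ 2" for r s and \<xi> :: "complex^2"
    by (simp add: mult.commute)
  show "(\<lambda>\<xi>. det (\<chi> r s. \<Sum>i\<in>UNIV. \<xi> $ i * M $ i $ r $ s)) \<in> cubic_forms"
    unfolding det_3 vec_lambda_beta sum_2 *
    by (intro cubic_forms_add cubic_forms_diff cubic_forms_prod)
qed

lemma cubic_eval_det_cubic: "cubic_eval (det_cubic M) \<xi> = det (pencil_member M \<xi>)"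
  unfolding pencil_member_def by transfer simp

section \<open>Schur functors\<close>

text \<open>
  \<open>S\<^sub>\<lambda>V\<close> for \<open>V\<close> of dimension \<open>n\<close>, \<open>\<lambda> = (\<lambda>\<^sub>1 \<ge> \<dots> \<ge> \<lambda>\<^sub>n \<ge> 0)\<close>, is realised inside the
  polynomial functions of an \<open>n \<times> n\<close> matrix \<open>P\<close> (Deruyts' construction): it is the
  \<open>GL(V)\<close>-submodule generated by the highest weight vector
  \<open>\<Prod>\<^sub>k \<Delta>\<^sub>k(P)\<^bsup>\<lambda>\<^sub>k - \<lambda>\<^sub>k\<^sub>+\<^sub>1\<^esup>\<close>, \<open>\<Delta>\<^sub>k\<close> being the leading principal \<open>k \<times> k\<close> minor, where
  \<open>k \<in> GL(V)\<close> acts by \<open>(k\<cdot>f)(P) = f(k\<^sup>T P)\<close>. For \<open>\<lambda> = (1)\<close> the entries \<open>P\<^sub>i\<^sub>1\<close> of the first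
  column are the basis of \<open>V\<close>. On \<open>S\<^sub>\<lambda>V\<^sup>*\<close>, \<open>g \<in> GL(V)\<close> acts through \<open>k = (g\<^sup>-\<^sup>1)\<^sup>T\<close>, i.e. by
  \<open>(g\<cdot>f)(P) = f(g\<^sup>-\<^sup>1 P)\<close>. The list \<open>bs\<close> enumerates the basis vectors in order.
\<close>

definition principal_minor :: "'n::finite set \<Rightarrow> complex^'n^'n \<Rightarrow> complex" where
  "principal_minor K P =
     det (\<chi> i j. if i \<in> K \<and> j \<in> K then P $ i $ j else if i = j then 1 else 0)"

definition highest_weight_vector :: "'n::finite list \<Rightarrow> nat list \<Rightarrow> complex^'n^'n \<Rightarrow> complex" where
  "highest_weight_vector bs l P =
     (\<Prod>k<length bs. principal_minor (set (take (Suc k) bs)) P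
        ^ (l ! k - (if Suc k < length l then l ! Suc k else 0)))"

lemma highest_weight_vector_2:
  "highest_weight_vector [1, 2] [a, b] (P :: matE) = (P $ 1 $ 1) ^ (a - b) * det P ^ b"
proof -
  have "principal_minor {1} P = P $ 1 $ 1" "principal_minor {1, 2} P = det P"
    by (simp_all add: principal_minor_def det_2)
  then show ?thesis
    by (simp add: highest_weight_vector_def lessThan_Suc insert_commute mult.commute)
qed

lemma highest_weight_vector_3:
  "highest_weight_vector [1, 2, 3] [a, b, c] (P :: matF) =
     (P $ 1 $ 1) ^ (a - b) * (P $ 1 $ 1 * P $ 2 $ 2 - P $ 1 $ 2 * P $ 2 $ 1) ^ (b - c) * det P ^ c"
proof -
  have "principal_minor {1} P = P $ 1 $ 1" "principal_minor {1, 2, 3} P = det P"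
    "principal_minor {1, 2} P = P $ 1 $ 1 * P $ 2 $ 2 - P $ 1 $ 2 * P $ 2 $ 1"
    by (simp_all add: principal_minor_def det_3)
  then show ?thesis
    by (simp add: highest_weight_vector_def lessThan_Suc insert_commute mult.commute mult.left_commute)
qed

definition schur :: "'n::finite list \<Rightarrow> nat list \<Rightarrow> (complex^'n^'n \<Rightarrow> complex) set" where
  "schur bs l = cfun.span {(\<lambda>P. highest_weight_vector bs l (transpose k ** P)) | k. invertible k}"

text \<open>
  The tensor product \<open>S\<^sub>\<lambda>E\<^sup>* \<otimes> S\<^sub>\<mu>F\<^sup>*\<close> as functions of two matrices, with its
  \<open>GL(E) \<times> GL(F)\<close>-action. Here and below a tensor product of two spaces of functions is the
  span of the products \<open>(x, y) \<mapsto> f x * h y\<close> in the functions on the product.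
\<close>

type_synonym frames = "matE \<times> matF"

definition schur_tensor :: "nat list \<Rightarrow> nat list \<Rightarrow> (frames \<Rightarrow> complex) set" where
  "schur_tensor l m =
     cfun.span {(\<lambda>(P, Q). f P * h Q) | f h. f \<in> schur [1, 2] l \<and> h \<in> schur [1, 2, 3] m}"

definition frames_act :: "matE \<Rightarrow> matF \<Rightarrow> (frames \<Rightarrow> complex) \<Rightarrow> frames \<Rightarrow> complex" where
  "frames_act g h w = (\<lambda>(P, Q). w (matrix_inv g ** P, matrix_inv h ** Q))"

section \<open>Coordinate rings and equivariant graded modules\<close>

text \<open>
  Since the ground field is infinite, the symmetric algebra \<open>Sym(U\<^sup>*)\<close> of a vector space \<open>U\<close>
  is the algebra of polynomial functions on \<open>U\<close>.
\<close>

inductive_set polys :: "('x \<Rightarrow> complex) set \<Rightarrow> ('x \<Rightarrow> complex) set"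
  for L :: "('x \<Rightarrow> complex) set" where
  const: "(\<lambda>_. c) \<in> polys L"
| gen: "l \<in> L \<Longrightarrow> l \<in> polys L"
| add: "a \<in> polys L \<Longrightarrow> b \<in> polys L \<Longrightarrow> (\<lambda>x. a x + b x) \<in> polys L"
| mult: "a \<in> polys L \<Longrightarrow> b \<in> polys L \<Longrightarrow> (\<lambda>x. a x * b x) \<in> polys L"

text \<open>
  A vector space with an action of \<open>GL(E) \<times> GL(F)\<close>: a spanning set of linear forms,
  scalar multiplication, and the action.
\<close>

record 'x gspace =
  forms :: "('x \<Rightarrow> complex) set"
  dilate :: "complex \<Rightarrow> 'x \<Rightarrow> 'x"
  gact :: "matE \<Rightarrow> matF \<Rightarrow> 'x \<Rightarrow> 'x"

definition pencil_space :: "pencil gspace" where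
  "pencil_space = \<lparr>forms = {(\<lambda>M. pencil_entry M i r s) | i r s. True},
     dilate = pencil_dilate, gact = pencil_act\<rparr>"

definition cubic_space :: "binary_cubic gspace" where
  "cubic_space = \<lparr>forms = {(\<lambda>q. cubic_eval q \<xi>) | \<xi>. True},
     dilate = cubic_dilate, gact = cubic_act\<rparr>"

abbreviation poly_ring :: "'x gspace \<Rightarrow> ('x \<Rightarrow> complex) set" where
  "poly_ring G \<equiv> polys (forms G)"

definition homogeneous :: "'x gspace \<Rightarrow> nat \<Rightarrow> ('x \<Rightarrow> complex) set" where
  "homogeneous G n = {a \<in> poly_ring G. \<forall>t x. a (dilate G t x) = t ^ n * a x}"

definition irrelevant_ideal :: "'x gspace \<Rightarrow> ('x \<Rightarrow> complex) set" where
  "irrelevant_ideal G = {a \<in> poly_ring G. \<forall>x. a (dilate G 0 x) = 0}"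

definition zariski_closure :: "'x gspace \<Rightarrow> 'x set \<Rightarrow> 'x set" where
  "zariski_closure G S = {x. \<forall>a \<in> poly_ring G. (\<forall>s\<in>S. a s = 0) \<longrightarrow> a x = 0}"

record ('x, 'm) gmodule =
  mcar :: "'m set"
  msmul :: "('x \<Rightarrow> complex) \<Rightarrow> 'm \<Rightarrow> 'm"
  mact :: "matE \<Rightarrow> matF \<Rightarrow> 'm \<Rightarrow> 'm"
  mdeg :: "nat \<Rightarrow> 'm set"

text \<open>
  The coordinate ring of a subset \<open>Z\<close>: restrictions to \<open>Z\<close> of polynomial functions, encoded as
  functions extended by zero. The case \<open>Z = UNIV\<close> is the polynomial ring itself.
\<close>

definition restr :: "'x set \<Rightarrow> ('x \<Rightarrow> complex) \<Rightarrow> 'x \<Rightarrow> complex" where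
  "restr Z a = (\<lambda>x. if x \<in> Z then a x else 0)"

definition coord_ring :: "'x gspace \<Rightarrow> 'x set \<Rightarrow> ('x, 'x \<Rightarrow> complex) gmodule" where
  "coord_ring G Z = \<lparr>
     mcar = restr Z ` poly_ring G,
     msmul = (\<lambda>a m x. a x * m x),
     mact = (\<lambda>g h m x. m (gact G (matrix_inv g) (matrix_inv h) x)),
     mdeg = (\<lambda>n. restr Z ` homogeneous G n)\<rparr>"

text \<open>
  The free module \<open>S\<^sub>\<lambda>E\<^sup>* \<otimes> S\<^sub>\<mu>F\<^sup>* \<otimes> A(-d)\<close>. Multiplying the homogeneity condition by \<open>t\<^sup>d\<close>
  avoids the exponent \<open>n - d\<close>; for \<open>n < d\<close> it forces the element to vanish.
\<close>

definition free_module ::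
  "'x gspace \<Rightarrow> nat list \<times> nat list \<times> nat \<Rightarrow> ('x, 'x \<times> frames \<Rightarrow> complex) gmodule" where
  "free_module G = (\<lambda>(l, m, d).
     let car = cfun.span {(\<lambda>(x, w). a x * f w) | a f. a \<in> poly_ring G \<and> f \<in> schur_tensor l m}
     in \<lparr>
       mcar = car,
       msmul = (\<lambda>a \<phi> (x, w). a x * \<phi> (x, w)),
       mact = (\<lambda>g h \<phi> (x, w).
          frames_act g h (\<lambda>w'. \<phi> (gact G (matrix_inv g) (matrix_inv h) x, w')) w),
       mdeg = (\<lambda>n. {\<phi> \<in> car. \<forall>t x w. t ^ d * \<phi> (dilate G t x, w) = t ^ n * \<phi> (x, w)})\<rparr>)"

definition equivariant_graded_hom ::
  "'x gspace \<Rightarrow> ('x, 'm::ab_group_add) gmodule \<Rightarrow> ('x, 'n::ab_group_add) gmodule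
    \<Rightarrow> ('m \<Rightarrow> 'n) \<Rightarrow> bool" where
  "equivariant_graded_hom G M N f \<longleftrightarrow>
     (\<forall>m \<in> mcar M. f m \<in> mcar N) \<and>
     (\<forall>m \<in> mcar M. \<forall>m' \<in> mcar M. f (m + m') = f m + f m') \<and>
     (\<forall>a \<in> poly_ring G. \<forall>m \<in> mcar M. f (msmul M a m) = msmul N a (f m)) \<and>
     (\<forall>g h. invertible g \<longrightarrow> invertible h \<longrightarrow>
        (\<forall>m \<in> mcar M. f (mact M g h m) = mact N g h (f m))) \<and>
     (\<forall>n. \<forall>m \<in> mdeg M n. f m \<in> mdeg N n)"

definition irrelevant_multiple ::
  "'x gspace \<Rightarrow> ('x, 'm::ab_group_add) gmodule \<Rightarrow> 'm set" where
  "irrelevant_multiple G M = {(\<Sum>i<k. msmul M (a i) (m i)) | (k::nat) a m.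
     \<forall>i<k. a i \<in> irrelevant_ideal G \<and> m i \<in> mcar M}"

text \<open>
  \<open>0 \<rightarrow> F\<^sub>2 \<rightarrow> F\<^sub>1 \<rightarrow> A \<rightarrow> \<complex>[Z] \<rightarrow> 0\<close> is exact, equivariant and graded, and minimal in the sense
  that the differentials have image in the irrelevant ideal times the target.
\<close>

definition minimal_free_resolution ::
  "'x gspace \<Rightarrow> 'x set
    \<Rightarrow> nat list \<times> nat list \<times> nat \<Rightarrow> nat list \<times> nat list \<times> nat
    \<Rightarrow> (('x \<times> frames \<Rightarrow> complex) \<Rightarrow> 'x \<Rightarrow> complex)
    \<Rightarrow> (('x \<times> frames \<Rightarrow> complex) \<Rightarrow> 'x \<times> frames \<Rightarrow> complex) \<Rightarrow> bool" where
  "minimal_free_resolution G Z \<tau>1 \<tau>2 d1 d2 \<longleftrightarrow>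
     (let F0 = coord_ring G UNIV; F1 = free_module G \<tau>1; F2 = free_module G \<tau>2;
          C = coord_ring G Z in
      equivariant_graded_hom G F2 F1 d2 \<and>
      equivariant_graded_hom G F1 F0 d1 \<and>
      equivariant_graded_hom G F0 C (restr Z) \<and>
      inj_on d2 (mcar F2) \<and>
      d2 ` mcar F2 = {\<phi> \<in> mcar F1. d1 \<phi> = 0} \<and>
      d1 ` mcar F1 = {a \<in> mcar F0. restr Z a = 0} \<and>
      restr Z ` mcar F0 = mcar C \<and>
      d2 ` mcar F2 \<subseteq> irrelevant_multiple G F1 \<and>
      d1 ` mcar F1 \<subseteq> irrelevant_multiple G F0)"

text \<open>Base change of an element of a free module along \<open>\<delta>\<close>.\<close>

definition pullback :: "('x \<Rightarrow> 'y) \<Rightarrow> ('y \<times> frames \<Rightarrow> complex) \<Rightarrow> 'x \<times> frames \<Rightarrow> complex" where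
  "pullback \<delta> \<phi> = (\<lambda>(x, w). \<phi> (\<delta> x, w))"

section \<open>Dimension\<close>

text \<open>
  The dimension of the closure of \<open>S\<close> is the transcendence degree of its coordinate ring: the
  largest \<open>n\<close> such that some \<open>n\<close> polynomial functions are algebraically independent on \<open>S\<close>.
\<close>

definition alg_independent_on :: "'x set \<Rightarrow> nat \<Rightarrow> (nat \<Rightarrow> 'x \<Rightarrow> complex) \<Rightarrow> bool" where
  "alg_independent_on S n F \<longleftrightarrow>
     (\<forall>p \<in> polys {(\<lambda>v :: nat \<Rightarrow> complex. v i) | i. i < n}.
        (\<forall>x\<in>S. p (\<lambda>i. F i x) = 0) \<longrightarrow> (\<forall>v. p v = 0))"

definition has_dim :: "'x gspace \<Rightarrow> 'x set \<Rightarrow> nat \<Rightarrow> bool" where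
  "has_dim G S n \<longleftrightarrow>
     (\<exists>F. (\<forall>i<n. F i \<in> poly_ring G) \<and> alg_independent_on S n F) \<and>
     \<not> (\<exists>F. (\<forall>i<Suc n. F i \<in> poly_ring G) \<and> alg_independent_on S (Suc n) F)"

definition has_codim :: "'x gspace \<Rightarrow> 'x set \<Rightarrow> nat \<Rightarrow> bool" where
  "has_codim G S k \<longleftrightarrow> (\<exists>n. has_dim G S n \<and> has_dim G UNIV (n + k))"

section \<open>The orbit and the cone over the rational normal cubic\<close>

lift_definition pencil9 :: pencil is
  "tens (axis 2 1) (sprod (axis 1 1) (axis 3 1))
   + tens (axis 1 1) (sprod (axis 2 1) (axis 3 1))
   + tens (axis 1 1) (sprod (axis 1 1) (axis 1 1))"
proof -
  have sym: "transpose (A $ i) = A $ i"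
    if "\<And>r s. A $ i $ r $ s = A $ i $ s $ r" for A :: "complex^3^3^2" and i
    using that by (simp add: transpose_def vec_eq_iff)
  show "transpose ((tens (axis 2 1) (sprod (axis 1 1) (axis 3 1))
   + tens (axis 1 1) (sprod (axis 2 1) (axis 3 1))
   + tens (axis 1 1) (sprod (axis 1 1) (axis 1 1))) $ i)
   = (tens (axis 2 1) (sprod (axis 1 1) (axis 3 1))
   + tens (axis 1 1) (sprod (axis 2 1) (axis 3 1))
   + tens (axis 1 1) (sprod (axis 1 1) (axis 1 1))) $ i" for i
  proof (rule sym)
    fix r s
    show "(tens (axis 2 1) (sprod (axis 1 1) (axis 3 1))
   + tens (axis 1 1) (sprod (axis 2 1) (axis 3 1))
   + tens (axis 1 1) (sprod (axis 1 1) (axis 1 1))) $ i $ r $ s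
   = (tens (axis 2 1) (sprod (axis 1 1) (axis 3 1))
   + tens (axis 1 1) (sprod (axis 2 1) (axis 3 1))
   + tens (axis 1 1) (sprod (axis 1 1) (axis 1 1))) $ i $ s $ r"
      unfolding vector_add_component by (intro arg_cong2[where f = "(+)"] tens_sprod_sym)
  qed
qed

definition orbit9 :: "pencil set" where
  "orbit9 = {pencil_dilate t (pencil_act g h pencil9) | t g h. t \<noteq> 0 \<and> det g = 1 \<and> det h = 1}"

definition cubes :: "binary_cubic set" where
  "cubes = {q. \<exists>u :: complex^2. \<forall>\<xi>. cubic_eval q \<xi> = (u $ 1 * \<xi> $ 1 + u $ 2 * \<xi> $ 2) ^ 3}"

text \<open>
  Pencils whose determinant is the cube of a (nonzero) linear form and which have no member of
  rank at most one. Members of rank \<open>0\<close> have to be excluded as well: for nondegenerate \<open>S\<close>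
  the pencil \<open>e \<otimes> S\<close> has members of rank \<open>0\<close> and \<open>3\<close> only, and its determinant is a cube.
\<close>

definition cube_pencils :: "pencil set" where
  "cube_pencils = {M. (\<exists>u :: complex^2. u \<noteq> 0 \<and>
        (\<forall>\<xi>. det (pencil_member M \<xi>) = (u $ 1 * \<xi> $ 1 + u $ 2 * \<xi> $ 2) ^ 3)) \<and>
      (\<forall>\<xi>. \<xi> \<noteq> 0 \<longrightarrow> \<not> rank (pencil_member M \<xi>) \<le> 1)}"

end

theory Submission
  imports Defs
begin

text \<open>
  The minors \<open>ac - b\<^sup>2\<close>, \<open>ad - bc\<close>, \<open>bd - c\<^sup>2\<close> of the Hessian cut out the cubes \<open>ax\<^sup>3 + 3bx\<^sup>2y + 3cxy\<^sup>2 + dy\<^sup>3\<close>, and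
  their syzygies are those of Hilbert--Burch. In suitable linear coordinates the coefficients
  \<open>a, b, c, d\<close> of the determinant of a pencil have the cubes of four of the coordinates as leading terms,
  so the coordinate ring of the pencils is free over the polynomial ring in \<open>a, b, c, d\<close> and the
  remaining eight coordinates; this carries the exactness of the complex over from binary cubics.

  It remains to see that the pulled back ideal contains every polynomial \<open>f\<close> vanishing on the orbit. Two of
  the entries enter the determinant affinely, with the determinant of a \<open>2 \<times> 2\<close> block as coefficient.
  Modulo the ideal a power of the discriminant \<open>D\<close> of that block times \<open>f\<close> is therefore affine in the two entries,
  hence zero, as generically the fibre over the other ten coordinates consists of three
  non-collinear points. Finally \<open>D\<close> is a non-zero-divisor modulo the ideal: it is invertible on one
  fibre of the finite map given by the free presentation, and Krull's intersection theorem applies.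
\<close>

text \<open>Freeness carries exactness over, but not radicality: the pullback of a prime ideal along
  a flat map need not be radical. This is why the vanishing ideal needs an argument of its own, and
  why \<open>block_disc\<close> must be cancelled without knowing that the quotient is a domain.
  What is available is that the cone is parametrised by affine space: a function that vanishes to
  all orders at one parameter value is zero, so a unit on a single fibre suffices. The coordinates
  come from the sequence 0, 0, \<open>v 8\<close>, \<open>v 9\<close>, \<open>v 10\<close>,
  \<open>v 11\<close>, 0, 0: modulo the other eight coordinates the two matrices are the Hankel
  matrices on its first five and on its last five terms. There \<open>3 * cB\<close> is -v9^3 + 3 v8
  v9 v10 - 3 v8^2 v11, and unequal weights single out the cube. Both resolutions are instances of
  one argument about a map to binary cubics that is homogeneous of degree k, with twists 2k and 3k:
  the determinant has k = 3, the identity k = 1. Polynomials are functions throughout, so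
  independence is tested by growth along curves and cancellation by restriction to lines.\<close>

lemma sum_fun_apply: "(\<Sum>i\<in>I. f i) x = (\<Sum>i\<in>I. f i x)"
  by (induction I rule: infinite_finite_induct) auto

section \<open>Rings of polynomial functions\<close>

lemma polys_cmul: "f \<in> polys L \<Longrightarrow> (\<lambda>x. c * f x) \<in> polys L"
  using polys.mult[OF polys.const] by blast

lemma polys_minus: "f \<in> polys L \<Longrightarrow> (\<lambda>x. - f x) \<in> polys L"
  using polys_cmul[of f L "-1"] by simp

lemma polys_diff: "f \<in> polys L \<Longrightarrow> g \<in> polys L \<Longrightarrow> (\<lambda>x. f x - g x) \<in> polys L"
  using polys.add[OF _ polys_minus] by fastforce

lemma polys_power: "f \<in> polys L \<Longrightarrow> (\<lambda>x. f x ^ n) \<in> polys L"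
  by (induction n) (auto intro: polys.const polys.mult)

lemma polys_divc: "f \<in> polys L \<Longrightarrow> (\<lambda>x. f x / c) \<in> polys L"
  using polys_cmul[of f L "inverse c"] by (simp add: field_simps)

lemma polys_sum: "(\<And>i. i \<in> I \<Longrightarrow> f i \<in> polys L) \<Longrightarrow> (\<lambda>x. \<Sum>i\<in>I. f i x) \<in> polys L"
  by (induction I rule: infinite_finite_induct) (auto intro: polys.const polys.add)

lemma polys_prod: "(\<And>i. i \<in> I \<Longrightarrow> f i \<in> polys L) \<Longrightarrow> (\<lambda>x. \<Prod>i\<in>I. f i x) \<in> polys L"
  by (induction I rule: infinite_finite_induct) (auto intro: polys.const polys.mult)

lemmas polys_intros = polys.const polys.add polys_cmul polys_minus polys_diff polys_power
  polys_divc polys.mult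

lemma polys_compose:
  assumes "f \<in> polys L" "\<And>l. l \<in> L \<Longrightarrow> (\<lambda>x. l (h x)) \<in> polys L'"
  shows "(\<lambda>x. f (h x)) \<in> polys L'"
  using assms(1) by induction (auto intro: assms(2) polys.intros)

definition cpoly :: "nat \<Rightarrow> ((nat \<Rightarrow> complex) \<Rightarrow> complex) set" where
  "cpoly n = polys {(\<lambda>v. v i) | i. i < n}"

lemma cpoly_var: "i < n \<Longrightarrow> (\<lambda>v. v i) \<in> cpoly n"
  unfolding cpoly_def by (rule polys.gen) auto

lemmas cpoly_intros = polys_intros[where L = "{(\<lambda>v :: nat \<Rightarrow> complex. v i) | i. i < n}" for n, folded cpoly_def] cpoly_var
lemmas cpoly_sum = polys_sum[where L = "{(\<lambda>v :: nat \<Rightarrow> complex. v i) | i. i < n}" for n, folded cpoly_def]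
lemmas cpoly_prod = polys_prod[where L = "{(\<lambda>v :: nat \<Rightarrow> complex. v i) | i. i < n}" for n, folded cpoly_def]

lemma cpoly_induct [consumes 1, case_names const var add mult]:
  assumes "f \<in> cpoly n" "\<And>c. P (\<lambda>_. c)" "\<And>i. i < n \<Longrightarrow> P (\<lambda>v. v i)"
    "\<And>a b. a \<in> cpoly n \<Longrightarrow> P a \<Longrightarrow> b \<in> cpoly n \<Longrightarrow> P b \<Longrightarrow> P (\<lambda>x. a x + b x)"
    "\<And>a b. a \<in> cpoly n \<Longrightarrow> P a \<Longrightarrow> b \<in> cpoly n \<Longrightarrow> P b \<Longrightarrow> P (\<lambda>x. a x * b x)"
  shows "P f"
  using assms unfolding cpoly_def by (induction rule: polys.induct) auto

lemma cpoly_compose: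
  assumes "f \<in> cpoly n" "\<And>i. i < n \<Longrightarrow> (\<lambda>x. h x i) \<in> polys L'"
  shows "(\<lambda>x. f (h x)) \<in> polys L'"
  by (rule polys_compose[OF assms(1)[unfolded cpoly_def]]) (use assms(2) in auto)

lemma cpoly_subst:
  assumes "f \<in> cpoly n" "\<And>i. i < n \<Longrightarrow> (\<lambda>x. h x i) \<in> cpoly m"
  shows "(\<lambda>x. f (h x)) \<in> cpoly m"
  using assms(2) unfolding cpoly_def[of m] by (rule cpoly_compose[OF assms(1)])

lemma cpoly_cong_vars:
  assumes "f \<in> cpoly n" "\<And>i. i < n \<Longrightarrow> v i = w i" shows "f v = f w"
  using assms(1) by (induction rule: cpoly_induct) (auto simp: assms(2))

lemma cpoly_on_line:
  assumes "f \<in> cpoly n"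
  shows "\<exists>p. \<forall>\<tau>. f (\<lambda>i. x i + \<tau> * u i) = poly p \<tau>"
  using assms
proof (induction rule: cpoly_induct)
  case (const c) show ?case by (rule exI[of _ "[:c:]"]) simp
next
  case (var i) show ?case by (rule exI[of _ "[:x i, u i:]"]) simp
next
  case (add a b)
  then obtain p q where "\<forall>\<tau>. a (\<lambda>i. x i + \<tau> * u i) = poly p \<tau>" "\<forall>\<tau>. b (\<lambda>i. x i + \<tau> * u i) = poly q \<tau>" by blast
  then show ?case by (intro exI[of _ "p + q"]) simp
next
  case (mult a b)
  then obtain p q where "\<forall>\<tau>. a (\<lambda>i. x i + \<tau> * u i) = poly p \<tau>" "\<forall>\<tau>. b (\<lambda>i. x i + \<tau> * u i) = poly q \<tau>" by blast
  then show ?case by (intro exI[of _ "p * q"]) simp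
qed

text \<open>On the line from \<open>x\<close> to \<open>y\<close> both functions are univariate
  polynomials with product zero; the first is nonzero at parameter 0, so the second is zero, also at
  parameter 1. The point \<open>x\<close> is the witness that \<open>f\<close> is not the zero
  polynomial.\<close>

lemma cpoly_domain:
  assumes f: "f \<in> cpoly n" and g: "g \<in> cpoly n" and fg: "\<And>v. f v * g v = 0" and "f x \<noteq> 0"
  shows "g y = 0"
proof -
  obtain p where p: "\<And>\<tau>. f (\<lambda>i. x i + \<tau> * (y i - x i)) = poly p \<tau>"
    using cpoly_on_line[OF f, of x "\<lambda>i. y i - x i"] by blast
  obtain q where q: "\<And>\<tau>. g (\<lambda>i. x i + \<tau> * (y i - x i)) = poly q \<tau>"
    using cpoly_on_line[OF g, of x "\<lambda>i. y i - x i"] by blast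
  have "poly (p * q) \<tau> = 0" for \<tau> using fg[of "\<lambda>i. x i + \<tau> * (y i - x i)"] p q by simp
  then have "p * q = 0" by (metis poly_all_0_iff_0)
  moreover have "poly p 0 \<noteq> 0" using p[of 0] \<open>f x \<noteq> 0\<close> by simp
  ultimately have "q = 0" by auto
  then show ?thesis using q[of 1] by simp
qed

text \<open>The remainder theorem in one variable; in the product case the quotient obeys a Leibniz
  rule with one factor evaluated at \<open>c\<close>.\<close>

lemma cpoly_split_var:
  assumes "f \<in> cpoly n" "i < n"
  shows "\<exists>g \<in> cpoly n. \<forall>v. f v = f (v(i := c)) + (v i - c) * g v"
  using assms(1)
proof (induction rule: cpoly_induct)
  case (const c)
  show ?case by (rule bexI[of _ "\<lambda>_. 0"]) (auto intro: cpoly_intros)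
next
  case (var j)
  show ?case by (rule bexI[of _ "\<lambda>_. if i = j then 1 else 0"]) (auto intro: cpoly_intros)
next
  case (add a b)
  then obtain g h where *: "g \<in> cpoly n" "h \<in> cpoly n" "\<And>v. a v = a (v(i := c)) + (v i - c) * g v"
    "\<And>v. b v = b (v(i := c)) + (v i - c) * h v" by blast
  show ?case
  proof (rule bexI[of _ "\<lambda>v. g v + h v"], intro allI)
    fix v show "a v + b v = a (v(i := c)) + b (v(i := c)) + (v i - c) * (g v + h v)"
      using *(3)[of v] *(4)[of v] by algebra
  qed (use *(1,2) in \<open>auto intro: cpoly_intros\<close>)
next
  case (mult a b)
  then obtain g h where *: "g \<in> cpoly n" "h \<in> cpoly n" "\<And>v. a v = a (v(i := c)) + (v i - c) * g v"
    "\<And>v. b v = b (v(i := c)) + (v i - c) * h v" by blast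
  have fu: "(\<lambda>v. b (v(i := c))) \<in> cpoly n"
  proof (rule cpoly_subst[OF mult.hyps(2)])
    show "(\<lambda>v. (v(i := c)) j) \<in> cpoly n" if "j < n" for j
      using that by (cases "j = i") (auto intro: cpoly_intros)
  qed
  show ?case
  proof (rule bexI[of _ "\<lambda>v. a v * h v + g v * b (v(i := c))"], intro allI)
    fix v show "a v * b v = a (v(i := c)) * b (v(i := c)) + (v i - c) * (a v * h v + g v * b (v(i := c)))"
      using *(3)[of v] *(4)[of v] by algebra
  qed (intro cpoly_intros *(1,2) mult.hyps fu)
qed

section \<open>Monomials\<close>

definition mon :: "nat \<Rightarrow> (nat \<Rightarrow> nat) \<Rightarrow> (nat \<Rightarrow> complex) \<Rightarrow> complex" where
  "mon n \<alpha> v = (\<Prod>i<n. v i ^ \<alpha> i)"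

definition expbox :: "nat \<Rightarrow> nat \<Rightarrow> (nat \<Rightarrow> nat) set" where
  "expbox n B = {\<alpha>. (\<forall>i<n. \<alpha> i < B) \<and> (\<forall>i\<ge>n. \<alpha> i = 0)}"

definition expos :: "nat \<Rightarrow> (nat \<Rightarrow> nat) set" where
  "expos n = {\<alpha>. \<forall>i\<ge>n. \<alpha> i = 0}"

lemma mon_add: "mon n (\<lambda>i. \<alpha> i + \<beta> i) v = mon n \<alpha> v * mon n \<beta> v"
  by (simp add: mon_def power_add prod.distrib)

lemma mon_cpoly: "mon n \<alpha> \<in> cpoly n"
  unfolding mon_def[abs_def] by (intro cpoly_prod cpoly_intros) auto

lemma bij_betw_expbox: "bij_betw (\<lambda>\<alpha>. restrict \<alpha> {..<n}) (expbox n B) ({..<n} \<rightarrow>\<^sub>E {..<B})"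
proof (rule bij_betw_byWitness[where f' = "\<lambda>\<alpha> i. if i < n then \<alpha> i else 0"])
  show "\<forall>\<alpha>\<in>expbox n B. (\<lambda>i. if i < n then restrict \<alpha> {..<n} i else 0) = \<alpha>"
    by (auto simp: expbox_def)
  show "\<forall>\<alpha>\<in>{..<n} \<rightarrow>\<^sub>E {..<B}. restrict (\<lambda>i. if i < n then \<alpha> i else 0) {..<n} = \<alpha>"
  proof (intro ballI ext)
    fix \<alpha> i assume "\<alpha> \<in> {..<n} \<rightarrow>\<^sub>E {..<B}"
    then show "restrict (\<lambda>i. if i < n then \<alpha> i else 0) {..<n} i = \<alpha> i"
      using PiE_arb[of \<alpha> "{..<n}" _ i] by (cases "i < n") auto
  qed
  show "(\<lambda>\<alpha>. restrict \<alpha> {..<n}) ` expbox n B \<subseteq> {..<n} \<rightarrow>\<^sub>E {..<B}"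
    by (rule image_subsetI, rule PiE_I) (auto simp: expbox_def)
  show "(\<lambda>\<alpha> i. if i < n then \<alpha> i else 0) ` ({..<n} \<rightarrow>\<^sub>E {..<B}) \<subseteq> expbox n B"
  proof (rule image_subsetI)
    fix \<alpha> assume "\<alpha> \<in> {..<n} \<rightarrow>\<^sub>E {..<B}"
    then show "(\<lambda>i. if i < n then \<alpha> i else 0) \<in> expbox n B"
      unfolding expbox_def PiE_iff by simp
  qed
qed

lemma finite_expbox: "finite (expbox n B)" and card_expbox: "card (expbox n B) = B ^ n"
proof -
  have "finite ({..<n} \<rightarrow>\<^sub>E {..<B})" by (intro finite_PiE) auto
  then show "finite (expbox n B)" using bij_betw_finite[OF bij_betw_expbox] by blast
  show "card (expbox n B) = B ^ n" using bij_betw_same_card[OF bij_betw_expbox[of n B]] by (simp add: card_PiE)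
qed

lemma expbox_expos: "expbox n B \<subseteq> expos n" by (auto simp: expbox_def expos_def)

lemma finite_expos_expbox:
  assumes "finite K" "K \<subseteq> expos n" shows "\<exists>B. K \<subseteq> expbox n B"
proof -
  define B where "B = Suc (Max (insert 0 ((\<lambda>(\<alpha>, i). \<alpha> i) ` (K \<times> {..<n}))))"
  have "\<alpha> i < B" if "\<alpha> \<in> K" "i < n" for \<alpha> i
  proof -
    have "\<alpha> i \<in> insert 0 ((\<lambda>(\<alpha>, i). \<alpha> i) ` (K \<times> {..<n}))" using that by force
    then show ?thesis unfolding B_def less_Suc_eq_le using assms(1) by (intro Max_ge) auto
  qed
  then show ?thesis using assms(2) by (intro exI[of _ B]) (auto simp: expbox_def expos_def)
qed

text \<open>Three exponent sets are allowed so that one lemma serves all polynomials, degree boxes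
  and the weight filtration.\<close>

lemma span_mon_mult:
  assumes "f \<in> cfun.span (mon n ` M)" "g \<in> cfun.span (mon n ` M')"
    and M: "\<And>\<alpha> \<beta>. \<alpha> \<in> M \<Longrightarrow> \<beta> \<in> M' \<Longrightarrow> (\<lambda>i. \<alpha> i + \<beta> i) \<in> M''"
  shows "(\<lambda>v. f v * g v) \<in> cfun.span (mon n ` M'')"
proof -
  have 1: "(\<lambda>v. mon n \<alpha> v * g v) \<in> cfun.span (mon n ` M'')" if "\<alpha> \<in> M" for \<alpha>
    using assms(2)
  proof (induction rule: cfun.span_induct_alt)
    case base show ?case using cfun.span_zero by (simp add: zero_fun_def)
  next
    case (step c x y)
    then obtain \<beta> where \<beta>: "x = mon n \<beta>" "\<beta> \<in> M'" by auto
    have "(\<lambda>v. mon n \<alpha> v * x v) = mon n (\<lambda>i. \<alpha> i + \<beta> i)" by (simp add: fun_eq_iff mon_add \<beta>)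
    then have "(\<lambda>v. mon n \<alpha> v * x v) \<in> cfun.span (mon n ` M'')"
      using M[OF that \<beta>(2)] by (auto intro: cfun.span_base)
    from cfun.span_add[OF cfun.span_scale[OF this, of c] step(2)]
    show ?case by (simp add: plus_fun_def algebra_simps)
  qed
  from assms(1) show ?thesis
  proof (induction rule: cfun.span_induct_alt)
    case base show ?case using cfun.span_zero by (simp add: zero_fun_def)
  next
    case (step c x y)
    then obtain \<beta> where \<beta>: "x = mon n \<beta>" "\<beta> \<in> M" by auto
    from cfun.span_add[OF cfun.span_scale[OF 1[OF \<beta>(2)], of c] step(2)]
    show ?case by (simp add: plus_fun_def algebra_simps \<beta>)
  qed
qed

lemma cpoly_rep:
  assumes "f \<in> cpoly n"
  shows "\<exists>K c. finite K \<and> K \<subseteq> expos n \<and> (\<forall>v. f v = (\<Sum>\<alpha>\<in>K. c \<alpha> * mon n \<alpha> v))"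
proof -
  have gen: "f \<in> cfun.span (mon n ` expos n)"
    using assms
  proof (induction rule: cpoly_induct)
    case (const c)
    have "mon n (\<lambda>_. 0) = (\<lambda>_. 1)" by (simp add: mon_def[abs_def])
    moreover have "mon n (\<lambda>_. 0) \<in> cfun.span (mon n ` expos n)" by (rule cfun.span_base) (auto simp: expos_def)
    ultimately show ?case using cfun.span_scale[of "\<lambda>_. 1" _ c] by fastforce
  next
    case (var i)
    have "mon n ((\<lambda>_. 0)(i := 1)) v = v i" for v
    proof -
      have "mon n ((\<lambda>_. 0)(i := 1)) v = (\<Prod>j<n. if j = i then v i else 1)"
        unfolding mon_def by (rule prod.cong) auto
      also have "\<dots> = v i" using var by simp
      finally show ?thesis .
    qed
    then have "(\<lambda>v. v i) = mon n ((\<lambda>_. 0)(i := 1))" by (simp add: fun_eq_iff)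
    then show ?case using var by (auto intro!: cfun.span_base simp: expos_def)
  next
    case (add a b)
    then show ?case using cfun.span_add[of a _ b] by (simp add: plus_fun_def)
  next
    case (mult a b)
    show ?case by (rule span_mon_mult[OF mult.IH]) (auto simp: expos_def)
  qed
  from gen show ?thesis
  proof (induction rule: cfun.span_induct_alt)
    case base show ?case by (rule exI[of _ "{}"]) auto
  next
    case (step c x y)
    then obtain K d \<beta> where *: "finite K" "K \<subseteq> expos n" "\<forall>v. y v = (\<Sum>\<alpha>\<in>K. d \<alpha> * mon n \<alpha> v)"
      "x = mon n \<beta>" "\<beta> \<in> expos n" by auto
    \<comment> \<open>\<open>\<beta>\<close> may already belong to \<open>K\<close>, and
      \<open>d\<close> is arbitrary outside \<open>K\<close>; hence the two conditionals.\<close>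
    have "(\<Sum>\<alpha>\<in>insert \<beta> K. ((if \<alpha> \<in> K then d \<alpha> else 0) + (if \<alpha> = \<beta> then c else 0)) * mon n \<alpha> v)
      = c * mon n \<beta> v + (\<Sum>\<alpha>\<in>K. d \<alpha> * mon n \<alpha> v)" for v
    proof -
      have "(\<Sum>\<alpha>\<in>insert \<beta> K. (if \<alpha> \<in> K then d \<alpha> else 0) * mon n \<alpha> v) = (\<Sum>\<alpha>\<in>K. d \<alpha> * mon n \<alpha> v)"
        by (rule sum.mono_neutral_cong_right) (use * in auto)
      moreover have "(\<Sum>\<alpha>\<in>insert \<beta> K. (if \<alpha> = \<beta> then c else 0) * mon n \<alpha> v) = (\<Sum>\<alpha>\<in>{\<beta>}. c * mon n \<alpha> v)"
        by (rule sum.mono_neutral_cong_right) (use * in auto)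
      ultimately show ?thesis by (simp add: distrib_right sum.distrib)
    qed
    then show ?case using * by (intro exI[of _ "insert \<beta> K"] exI[of _ "\<lambda>\<alpha>. (if \<alpha> \<in> K then d \<alpha> else 0) + (if \<alpha> = \<beta> then c else 0)"]) auto
  qed
qed

section \<open>Independence by growth along curves\<close>

text \<open>Divide by the largest power that occurs with a nonzero coefficient. As the exponents are
  distinct, exactly one summand keeps a nonzero limit, while the whole sum is eventually
  zero.\<close>

lemma growth_indep:
  fixes g :: "'k \<Rightarrow> real \<Rightarrow> complex" and n :: "'k \<Rightarrow> nat"
  assumes "finite K" and lim: "\<And>k. k \<in> K \<Longrightarrow> ((\<lambda>\<tau>. g k \<tau> / of_real \<tau> ^ n k) \<longlongrightarrow> l k) at_top"
    and nz: "\<And>k. k \<in> K \<Longrightarrow> l k \<noteq> 0" and inj: "inj_on n K"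
    and zero: "eventually (\<lambda>\<tau>. (\<Sum>k\<in>K. c k * g k \<tau>) = 0) at_top"
    and "k0 \<in> K"
  shows "c k0 = 0"
proof (rule ccontr)
  assume "c k0 \<noteq> 0"
  define K' where "K' = {k \<in> K. c k \<noteq> 0}"
  have K': "finite K'" "K' \<noteq> {}" "K' \<subseteq> K" using assms \<open>c k0 \<noteq> 0\<close> by (auto simp: K'_def)
  define m where "m = Max (n ` K')"
  have "m \<in> n ` K'" unfolding m_def by (rule Max_in) (use K' in auto)
  then obtain k where k: "k \<in> K'" "n k = m" by auto
  have le: "n j \<le> m" if "j \<in> K'" for j unfolding m_def by (rule Max_ge) (use K' that in auto)
  have *: "((\<lambda>\<tau>. g j \<tau> / of_real \<tau> ^ m) \<longlongrightarrow> (if j = k then l k else 0)) at_top" if j: "j \<in> K'" for j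
  proof (cases "j = k")
    case True then show ?thesis using lim[of k] k K' by auto
  next
    case False
    then have lt: "n j < m" using inj le[OF j] j k K' by (metis inj_onD le_neq_implies_less subsetD)
    have "((\<lambda>\<tau>. inverse \<tau> ^ (m - n j)) \<longlongrightarrow> (0::real) ^ (m - n j)) at_top"
      by (intro tendsto_power tendsto_inverse_0_at_top filterlim_ident)
    then have "((\<lambda>\<tau>. complex_of_real (inverse \<tau> ^ (m - n j))) \<longlongrightarrow> of_real 0) at_top"
      using lt by (intro tendsto_of_real) (simp add: power_0_left)
    then have "((\<lambda>\<tau>. g j \<tau> / of_real \<tau> ^ n j * complex_of_real (inverse \<tau> ^ (m - n j))) \<longlongrightarrow> l j * of_real 0) at_top"
      using lim[of j] j K' by (intro tendsto_mult) auto
    moreover have "\<forall>\<^sub>F \<tau> in at_top. g j \<tau> / of_real \<tau> ^ n j * complex_of_real (inverse \<tau> ^ (m - n j)) = g j \<tau> / of_real \<tau> ^ m"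
      using eventually_gt_at_top[of "0::real"]
    proof eventually_elim
      case (elim \<tau>)
      have "complex_of_real \<tau> ^ m = of_real \<tau> ^ n j * of_real \<tau> ^ (m - n j)"
        using lt by (simp flip: power_add)
      then show ?case using elim by (simp add: field_simps)
    qed
    ultimately show ?thesis using False by (simp add: tendsto_cong)
  qed
  have "((\<lambda>\<tau>. \<Sum>j\<in>K'. c j * (g j \<tau> / of_real \<tau> ^ m)) \<longlongrightarrow> (\<Sum>j\<in>K'. c j * (if j = k then l k else 0))) at_top"
    by (intro tendsto_sum tendsto_mult tendsto_const *)
  moreover have "(\<Sum>j\<in>K'. c j * (if j = k then l k else 0)) = c k * l k"
  proof -
    have "(\<Sum>j\<in>K'. c j * (if j = k then l k else 0)) = (\<Sum>j\<in>K'. if j = k then c k * l k else 0)"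
      by (rule sum.cong) auto
    then show ?thesis using K' k by simp
  qed
  moreover have "\<forall>\<^sub>F \<tau> in at_top. (\<Sum>j\<in>K'. c j * (g j \<tau> / of_real \<tau> ^ m)) = 0"
    using zero
  proof eventually_elim
    case (elim \<tau>)
    have "(\<Sum>j\<in>K'. c j * g j \<tau>) = (\<Sum>k\<in>K. c k * g k \<tau>)"
      by (rule sum.mono_neutral_left) (use assms in \<open>auto simp: K'_def\<close>)
    then have "(\<Sum>j\<in>K'. c j * g j \<tau>) / of_real \<tau> ^ m = 0" using elim by simp
    then show ?case by (simp add: sum_divide_distrib)
  qed
  ultimately have "((\<lambda>\<tau>::real. 0::complex) \<longlongrightarrow> c k * l k) at_top"
    using tendsto_cong by fastforce
  then have "c k * l k = 0" using tendsto_unique[OF _ _ tendsto_const] by (metis trivial_limit_at_top_linorder)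
  then show False using k nz[of k] K' by (auto simp: K'_def)
qed

lemma mon_growth_indep:
  assumes "finite K" and lim: "\<And>i. i < n \<Longrightarrow> ((\<lambda>\<tau>. h i \<tau> / of_real \<tau> ^ \<kappa> i) \<longlongrightarrow> l i) at_top"
    and nz: "\<And>i. i < n \<Longrightarrow> l i \<noteq> 0" and inj: "inj_on (\<lambda>\<alpha>. \<Sum>i<n. \<alpha> i * \<kappa> i) K"
    and zero: "eventually (\<lambda>\<tau>. (\<Sum>\<alpha>\<in>K. c \<alpha> * mon n \<alpha> (\<lambda>i. h i \<tau>)) = 0) at_top"
    and "\<alpha> \<in> K"
  shows "c \<alpha> = 0"
proof (rule growth_indep[where g = "\<lambda>\<alpha> \<tau>. mon n \<alpha> (\<lambda>i. h i \<tau>)" and l = "\<lambda>\<alpha>. \<Prod>i<n. l i ^ \<alpha> i"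
      and n = "\<lambda>\<alpha>. \<Sum>i<n. \<alpha> i * \<kappa> i" and K = K and c = c])
  fix \<alpha> assume "\<alpha> \<in> K"
  have "((\<lambda>\<tau>. \<Prod>i<n. (h i \<tau> / of_real \<tau> ^ \<kappa> i) ^ \<alpha> i) \<longlongrightarrow> (\<Prod>i<n. l i ^ \<alpha> i)) at_top"
    by (intro tendsto_prod tendsto_power lim) auto
  moreover have "(\<Prod>i<n. (h i \<tau> / of_real \<tau> ^ \<kappa> i) ^ \<alpha> i) = mon n \<alpha> (\<lambda>i. h i \<tau>) / of_real \<tau> ^ (\<Sum>i<n. \<alpha> i * \<kappa> i)" for \<tau>
  proof -
    have "of_real \<tau> ^ (\<Sum>i<n. \<alpha> i * \<kappa> i) = (\<Prod>i<n. (complex_of_real \<tau> ^ \<kappa> i) ^ \<alpha> i)"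
      unfolding power_sum by (rule prod.cong) (simp_all add: mult.commute[of "\<alpha> _"] power_mult)
    then show ?thesis unfolding mon_def power_divide prod_dividef by simp
  qed
  ultimately show "((\<lambda>\<tau>. mon n \<alpha> (\<lambda>i. h i \<tau>) / of_real \<tau> ^ (\<Sum>i<n. \<alpha> i * \<kappa> i)) \<longlongrightarrow> (\<Prod>i<n. l i ^ \<alpha> i)) at_top"
    by simp
qed (use assms in auto)

text \<open>Uniqueness of digits in base \<open>B\<close>: reduction modulo \<open>B\<close> reads
  off the lowest one.\<close>

lemma kronecker_inj:
  assumes "\<And>i. i < n \<Longrightarrow> \<alpha> i < (B::nat)" "\<And>i. i < n \<Longrightarrow> \<beta> i < B"
    "(\<Sum>i<n. \<alpha> i * B ^ i) = (\<Sum>i<n. \<beta> i * B ^ i)" "i < n"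
  shows "\<alpha> i = \<beta> i"
  using assms
proof (induction n arbitrary: \<alpha> \<beta> i)
  case 0 then show ?case by simp
next
  case (Suc n)
  have dec: "(\<Sum>i<Suc n. \<gamma> i * B ^ i) = \<gamma> 0 + B * (\<Sum>i<n. \<gamma> (Suc i) * B ^ i)" for \<gamma> :: "nat \<Rightarrow> nat"
    by (simp add: sum.lessThan_Suc_shift sum_distrib_left mult_ac del: sum.lessThan_Suc)
  have B: "B > 0" "\<alpha> 0 < B" "\<beta> 0 < B" using Suc.prems(1)[of 0] Suc.prems(2)[of 0] by auto
  have eq: "\<alpha> 0 + B * (\<Sum>i<n. \<alpha> (Suc i) * B ^ i) = \<beta> 0 + B * (\<Sum>i<n. \<beta> (Suc i) * B ^ i)"
    using Suc.prems(3) unfolding dec .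
  have 0: "\<alpha> 0 = \<beta> 0" using arg_cong[OF eq, of "\<lambda>x. x mod B"] B by simp
  then have "(\<Sum>i<n. \<alpha> (Suc i) * B ^ i) = (\<Sum>i<n. \<beta> (Suc i) * B ^ i)" using eq B by simp
  then show ?case using Suc.IH[of "\<lambda>i. \<alpha> (Suc i)" "\<lambda>i. \<beta> (Suc i)" "i - 1"] Suc.prems 0
    by (cases i) auto
qed

lemma kronecker_inj_expbox: "inj_on (\<lambda>\<alpha>. \<Sum>i<n. \<alpha> i * B ^ i) (expbox n B)"
proof (rule inj_onI, rule ext)
  fix \<alpha> \<beta> i
  assume *: "\<alpha> \<in> expbox n B" "\<beta> \<in> expbox n B" "(\<Sum>i<n. \<alpha> i * B ^ i) = (\<Sum>i<n. \<beta> i * B ^ i)"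
  show "\<alpha> i = \<beta> i"
    using kronecker_inj[of n \<alpha> B \<beta> i] * by (cases "i < n") (auto simp: expbox_def)
qed

text \<open>Kronecker substitution: along the curve with coordinates tau^(B^i) distinct monomials
  have distinct growth.\<close>

lemma mon_indep:
  assumes "finite K" "K \<subseteq> expos n" "\<And>v. (\<Sum>\<alpha>\<in>K. c \<alpha> * mon n \<alpha> v) = 0" "\<alpha> \<in> K"
  shows "c \<alpha> = 0"
proof -
  obtain B where B: "K \<subseteq> expbox n B" using finite_expos_expbox[OF assms(1,2)] by blast
  show ?thesis
  proof (rule mon_growth_indep[where n = n and K = K and h = "\<lambda>i \<tau>. of_real \<tau> ^ (B ^ i)" and \<kappa> = "\<lambda>i. B ^ i" and l = "\<lambda>_. 1" and c = c])
    show "((\<lambda>\<tau>. complex_of_real \<tau> ^ B ^ i / complex_of_real \<tau> ^ B ^ i) \<longlongrightarrow> 1) at_top" for i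
      by (rule tendsto_eventually) (use eventually_gt_at_top[of "0::real"] in eventually_elim, simp)
    show "inj_on (\<lambda>\<alpha>. \<Sum>i<n. \<alpha> i * B ^ i) K" using kronecker_inj_expbox B by (rule inj_on_subset)
  qed (use assms in auto)
qed

text \<open>The curve may depend on \<open>B\<close> because no degree bound for \<open>P\<close> is
  known in advance; it only has to separate the monomials in a box that contains the
  support.\<close>

lemma cpoly_zero_by_growth:
  assumes P: "P \<in> cpoly n"
    and curve: "\<And>B. \<exists>h \<kappa> l. (\<forall>i<n. ((\<lambda>\<tau>. h i \<tau> / of_real \<tau> ^ \<kappa> i) \<longlongrightarrow> l i) at_top \<and> l i \<noteq> 0) \<and>
       inj_on (\<lambda>\<alpha>. \<Sum>i<n. \<alpha> i * \<kappa> i) (expbox n B) \<and> (\<forall>\<^sub>F \<tau> in at_top. P (\<lambda>i. h i (\<tau>::real)) = 0)"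
  shows "P v = 0"
proof -
  obtain K c where K: "finite K" "K \<subseteq> expos n" "\<And>v. P v = (\<Sum>\<alpha>\<in>K. c \<alpha> * mon n \<alpha> v)"
    using cpoly_rep[OF P] by blast
  obtain B where B: "K \<subseteq> expbox n B" using finite_expos_expbox[OF K(1,2)] by blast
  obtain h \<kappa> l where h: "\<And>i. i < n \<Longrightarrow> ((\<lambda>\<tau>. h i \<tau> / of_real \<tau> ^ \<kappa> i) \<longlongrightarrow> l i) at_top"
    "\<And>i. i < n \<Longrightarrow> l i \<noteq> 0" "inj_on (\<lambda>\<alpha>. \<Sum>i<n. \<alpha> i * \<kappa> i) (expbox n B)" "\<forall>\<^sub>F \<tau> in at_top. P (\<lambda>i. h i (\<tau>::real)) = 0"
    using curve[of B] by blast
  have "c \<alpha> = 0" if "\<alpha> \<in> K" for \<alpha>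
    by (rule mon_growth_indep[OF K(1) h(1,2) inj_on_subset[OF h(3) B] h(4)[unfolded K(3)] that])
  then show ?thesis using K(3) by simp
qed

section \<open>Algebraic dependence\<close>

text \<open>Stated for families: if two members coincide, their difference is already a nontrivial
  relation, and otherwise dimension counting applies to the image.\<close>

lemma family_dependent:
  fixes f :: "'i \<Rightarrow> 'a \<Rightarrow> complex"
  assumes "finite I" "finite T" "f ` I \<subseteq> cfun.span T" "card T < card I"
  shows "\<exists>c. (\<exists>i\<in>I. c i \<noteq> 0) \<and> (\<forall>x. (\<Sum>i\<in>I. c i * f i x) = 0)"
proof (cases "inj_on f I")
  case True
  have "cfun.dependent (f ` I)"
    using cfun.independent_span_bound[OF assms(2) _ assms(3)] assms(4) card_image[OF True] by force
  then obtain u where u: "\<exists>v\<in>f ` I. u v \<noteq> 0" "(\<Sum>v\<in>f ` I. (\<lambda>x. u v * v x)) = 0"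
    using cfun.dependent_finite[of "f ` I"] assms(1) by auto
  have "(\<Sum>i\<in>I. u (f i) * f i x) = (\<Sum>v\<in>f ` I. (\<lambda>x. u v * v x)) x" for x
    by (simp add: sum_fun_apply sum.reindex[OF True])
  then have "(\<Sum>i\<in>I. u (f i) * f i x) = 0" for x using u(2) by simp
  then show ?thesis using u(1) by (intro exI[of _ "\<lambda>i. u (f i)"]) auto
next
  case False
  then obtain i j where ij: "i \<in> I" "j \<in> I" "i \<noteq> j" "f i = f j" by (auto simp: inj_on_def)
  define c :: "'i \<Rightarrow> complex" where "c k = (if k = i then 1 else 0) - (if k = j then 1 else 0)" for k
  have "c k * f k x = (if k = i then f i x else 0) - (if k = j then f j x else 0)" for k x
    by (simp add: c_def left_diff_distrib)
  then have "(\<Sum>k\<in>I. c k * f k x) = f i x - f j x" for x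
    using ij assms(1) by (simp add: sum_subtractf)
  then show ?thesis using ij by (intro exI[of _ c]) (auto simp: c_def)
qed

lemma cpoly_degree:
  assumes "f \<in> cpoly n"
  shows "\<exists>d. f \<in> cfun.span (mon n ` expbox n d)"
proof -
  obtain K c where K: "finite K" "K \<subseteq> expos n" "\<forall>v. f v = (\<Sum>\<alpha>\<in>K. c \<alpha> * mon n \<alpha> v)"
    using cpoly_rep[OF assms] by blast
  obtain B where B: "K \<subseteq> expbox n B" using finite_expos_expbox[OF K(1,2)] by blast
  have "f = (\<Sum>\<alpha>\<in>K. (\<lambda>v. c \<alpha> * mon n \<alpha> v))" using K(3) by (simp add: fun_eq_iff sum_fun_apply)
  also have "\<dots> \<in> cfun.span (mon n ` expbox n B)"
    by (intro cfun.span_sum cfun.span_scale cfun.span_base) (use B in auto)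
  finally show ?thesis by blast
qed

lemma span_mon_mono: "B \<le> B' \<Longrightarrow> cfun.span (mon n ` expbox n B) \<subseteq> cfun.span (mon n ` expbox n B')"
  by (intro cfun.span_mono image_mono) (auto simp: expbox_def)

text \<open>The box with bound \<open>Suc d\<close> means degree at most \<open>d\<close> in each
  variable, so that degrees add under multiplication.\<close>

lemma span_mon_power:
  assumes "f \<in> cfun.span (mon n ` expbox n (Suc d))"
  shows "(\<lambda>v. f v ^ k) \<in> cfun.span (mon n ` expbox n (Suc (k * d)))"
proof (induction k)
  case 0
  have "mon n (\<lambda>_. 0) = (\<lambda>_. 1)" by (simp add: mon_def[abs_def])
  moreover have "mon n (\<lambda>_. 0) \<in> cfun.span (mon n ` expbox n (Suc 0))"
    by (intro cfun.span_base imageI) (simp add: expbox_def)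
  ultimately show ?case by simp
next
  case (Suc k)
  have "(\<lambda>v. f v * f v ^ k) \<in> cfun.span (mon n ` expbox n (Suc (Suc k * d)))"
    by (rule span_mon_mult[OF assms Suc]) (auto simp: expbox_def less_Suc_eq_le intro!: add_mono)
  then show ?case by simp
qed

lemma span_mon_prod:
  assumes "\<And>j. j < m \<Longrightarrow> f j \<in> cfun.span (mon n ` expbox n (Suc d))"
  shows "(\<lambda>v. \<Prod>j<m. f j v) \<in> cfun.span (mon n ` expbox n (Suc (m * d)))"
  using assms
proof (induction m)
  case 0
  have "mon n (\<lambda>_. 0) = (\<lambda>_. 1)" by (simp add: mon_def[abs_def])
  moreover have "mon n (\<lambda>_. 0) \<in> cfun.span (mon n ` expbox n (Suc 0))"
    by (intro cfun.span_base imageI) (simp add: expbox_def)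
  ultimately show ?case by simp
next
  case (Suc m)
  have "(\<lambda>v. f m v * (\<Prod>j<m. f j v)) \<in> cfun.span (mon n ` expbox n (Suc (Suc m * d)))"
    by (rule span_mon_mult[OF Suc.prems[of m]]) (use Suc in \<open>auto simp: expbox_def less_Suc_eq_le intro!: add_mono\<close>)
  then show ?case by (simp add: mult.commute)
qed

text \<open>Counting: there are B^(n+1) monomials of degree below \<open>B\<close> in the
  \<open>F i\<close>, but they lie in a space whose dimension grows only like B^n.\<close>

lemma cpoly_alg_dependent:
  fixes F :: "nat \<Rightarrow> (nat \<Rightarrow> complex) \<Rightarrow> complex"
  assumes "\<And>i. i < Suc n \<Longrightarrow> F i \<in> cpoly n"
  shows "\<exists>p \<in> cpoly (Suc n). (\<forall>v. p (\<lambda>i. F i v) = 0) \<and> (\<exists>v. p v \<noteq> 0)"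
proof -
  have "\<exists>d. \<forall>i<Suc n. F i \<in> cfun.span (mon n ` expbox n (Suc d))"
  proof -
    have "\<forall>i. \<exists>d. i < Suc n \<longrightarrow> F i \<in> cfun.span (mon n ` expbox n d)" using assms cpoly_degree by blast
    then obtain d where d: "\<And>i. i < Suc n \<Longrightarrow> F i \<in> cfun.span (mon n ` expbox n (d i))" by metis
    have "d i \<le> Suc (\<Sum>j<Suc n. d j)" if "i < Suc n" for i
      using that by (intro le_SucI member_le_sum) auto
    then show ?thesis using d span_mon_mono by blast
  qed
  then obtain d where d: "\<And>i. i < Suc n \<Longrightarrow> F i \<in> cfun.span (mon n ` expbox n (Suc d))" by blast
  \<comment> \<open>Chosen to exceed the constant in the estimate of the dimension by (B * const)^n
    = B^n * const^n.\<close>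
  define B where "B = Suc ((Suc n * d + 1) ^ n)"
  let ?I = "expbox (Suc n) B" and ?T = "mon n ` expbox n (Suc (Suc n * (B * d)))"
  have in_span: "(\<lambda>v. mon (Suc n) \<alpha> (\<lambda>i. F i v)) \<in> cfun.span ?T" if \<alpha>: "\<alpha> \<in> ?I" for \<alpha>
    unfolding mon_def[of "Suc n"]
  proof (rule span_mon_prod)
    fix j assume j: "j < Suc n"
    have "(\<lambda>v. F j v ^ \<alpha> j) \<in> cfun.span (mon n ` expbox n (Suc (\<alpha> j * d)))" by (rule span_mon_power[OF d[OF j]])
    moreover have "\<alpha> j * d \<le> B * d" using \<alpha> j by (intro mult_right_mono) (auto simp: expbox_def intro: less_imp_le)
    ultimately show "(\<lambda>v. F j v ^ \<alpha> j) \<in> cfun.span (mon n ` expbox n (Suc (B * d)))"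
      using span_mon_mono by blast
  qed
  have "card ?T \<le> card (expbox n (Suc (Suc n * (B * d))))" using finite_expbox by (rule card_image_le)
  also have "\<dots> = (Suc (Suc n * (B * d))) ^ n" by (rule card_expbox)
  also have "\<dots> \<le> (B * (Suc n * d + 1)) ^ n" by (rule power_mono) (auto simp: B_def algebra_simps)
  also have "\<dots> = B ^ n * (Suc n * d + 1) ^ n" by (rule power_mult_distrib)
  also have "\<dots> < B ^ n * B" by (rule mult_strict_left_mono) (auto simp: B_def)
  also have "\<dots> = card ?I" by (simp add: card_expbox mult.commute)
  finally obtain c where c: "\<exists>\<alpha>\<in>?I. c \<alpha> \<noteq> 0" "\<And>v. (\<Sum>\<alpha>\<in>?I. c \<alpha> * mon (Suc n) \<alpha> (\<lambda>i. F i v)) = 0"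
    using family_dependent[of ?I ?T "\<lambda>\<alpha> v. mon (Suc n) \<alpha> (\<lambda>i. F i v)"] in_span finite_expbox by blast
  define p where "p = (\<lambda>v. \<Sum>\<alpha>\<in>?I. c \<alpha> * mon (Suc n) \<alpha> v)"
  have "p \<in> cpoly (Suc n)" unfolding p_def by (intro cpoly_sum cpoly_intros mon_cpoly)
  moreover have "\<exists>v. p v \<noteq> 0"
  proof (rule ccontr)
    assume "\<nexists>v. p v \<noteq> 0"
    then have 0: "(\<Sum>\<alpha>\<in>?I. c \<alpha> * mon (Suc n) \<alpha> v) = 0" for v unfolding p_def by simp
    have "c \<alpha> = 0" if "\<alpha> \<in> ?I" for \<alpha>
      by (rule mon_indep[OF finite_expbox expbox_expos 0 that])
    then show False using c(1) by blast
  qed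
  moreover have "p (\<lambda>i. F i v) = 0" for v unfolding p_def by (rule c(2))
  ultimately show ?thesis by blast
qed

section \<open>The cone over the twisted cubic\<close>

definition ideal3 :: "('x \<Rightarrow> complex) set \<Rightarrow> ('x \<Rightarrow> complex) \<Rightarrow> ('x \<Rightarrow> complex) \<Rightarrow> ('x \<Rightarrow> complex) \<Rightarrow> ('x \<Rightarrow> complex) set" where
  "ideal3 R f g h = {(\<lambda>x. p x * f x + q x * g x + r x * h x) | p q r. p \<in> R \<and> q \<in> R \<and> r \<in> R}"

lemma ideal3I:
  "p \<in> R \<Longrightarrow> q \<in> R \<Longrightarrow> r \<in> R \<Longrightarrow> (\<And>x. F x = p x * f x + q x * g x + r x * h x) \<Longrightarrow> F \<in> ideal3 R f g h"
  unfolding ideal3_def by blast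

lemma ideal3E:
  assumes "F \<in> ideal3 R f g h"
  obtains p q r where "p \<in> R" "q \<in> R" "r \<in> R" "\<And>x. F x = p x * f x + q x * g x + r x * h x"
  using assms unfolding ideal3_def by blast

lemma ideal3_add:
  assumes "F \<in> ideal3 (polys L) f g h" "G \<in> ideal3 (polys L) f g h"
  shows "(\<lambda>x. F x + G x) \<in> ideal3 (polys L) f g h"
proof -
  obtain p q r where 1: "p \<in> polys L" "q \<in> polys L" "r \<in> polys L" "\<And>x. F x = p x * f x + q x * g x + r x * h x"
    using ideal3E[OF assms(1)] by metis
  obtain p' q' r' where 2: "p' \<in> polys L" "q' \<in> polys L" "r' \<in> polys L" "\<And>x. G x = p' x * f x + q' x * g x + r' x * h x"
    using ideal3E[OF assms(2)] by metis
  show ?thesis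
    by (rule ideal3I[OF polys.add[OF 1(1) 2(1)] polys.add[OF 1(2) 2(2)] polys.add[OF 1(3) 2(3)]])
      (simp add: 1(4) 2(4) algebra_simps)
qed

lemma ideal3_mult:
  assumes "F \<in> ideal3 (polys L) f g h" "a \<in> polys L"
  shows "(\<lambda>x. a x * F x) \<in> ideal3 (polys L) f g h"
proof -
  obtain p q r where 1: "p \<in> polys L" "q \<in> polys L" "r \<in> polys L" "\<And>x. F x = p x * f x + q x * g x + r x * h x"
    using ideal3E[OF assms(1)] by metis
  show ?thesis
    by (rule ideal3I[OF polys.mult[OF assms(2) 1(1)] polys.mult[OF assms(2) 1(2)] polys.mult[OF assms(2) 1(3)]])
      (simp add: 1(4) algebra_simps)
qed

lemma ideal3_zero: "(\<lambda>x. 0) \<in> ideal3 (polys L) f g h"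
  by (rule ideal3I[OF polys.const[of 0] polys.const[of 0] polys.const[of 0]]) simp

lemma ideal3_gens:
  "f \<in> ideal3 (polys L) f g h" "g \<in> ideal3 (polys L) f g h" "h \<in> ideal3 (polys L) f g h"
  by (rule ideal3I[OF polys.const[of 1] polys.const[of 0] polys.const[of 0]], simp)
    (rule ideal3I[OF polys.const[of 0] polys.const[of 1] polys.const[of 0]], simp,
     rule ideal3I[OF polys.const[of 0] polys.const[of 0] polys.const[of 1]], simp)

lemma ideal3_diff:
  "F \<in> ideal3 (polys L) f g h \<Longrightarrow> G \<in> ideal3 (polys L) f g h \<Longrightarrow> (\<lambda>x. F x - G x) \<in> ideal3 (polys L) f g h"
  using ideal3_add[OF _ ideal3_mult[OF _ polys.const[of "-1"]]] by fastforce

lemma ideal3_sum: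
  "(\<And>i. i \<in> I \<Longrightarrow> F i \<in> ideal3 (polys L) f g h) \<Longrightarrow> (\<lambda>x. \<Sum>i\<in>I. F i x) \<in> ideal3 (polys L) f g h"
  by (induction I rule: infinite_finite_induct) (auto intro: ideal3_zero ideal3_add)

lemmas ideal3_cpoly = ideal3_add[where L = "{(\<lambda>v :: nat \<Rightarrow> complex. v i) | i. i < n}" for n, folded cpoly_def]
  ideal3_mult[where L = "{(\<lambda>v :: nat \<Rightarrow> complex. v i) | i. i < n}" for n, folded cpoly_def]
  ideal3_zero[where L = "{(\<lambda>v :: nat \<Rightarrow> complex. v i) | i. i < n}" for n, folded cpoly_def]
  ideal3_gens[where L = "{(\<lambda>v :: nat \<Rightarrow> complex. v i) | i. i < n}" for n, folded cpoly_def]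
  ideal3_diff[where L = "{(\<lambda>v :: nat \<Rightarrow> complex. v i) | i. i < n}" for n, folded cpoly_def]
  ideal3_sum[where L = "{(\<lambda>v :: nat \<Rightarrow> complex. v i) | i. i < n}" for n, folded cpoly_def]

text \<open>
  Coordinates \<open>8, \<dots>, 11\<close> are the coefficients of \<open>a x\<^sup>3 + 3 b x\<^sup>2 y + 3 c x y\<^sup>2 + d y\<^sup>3\<close>;
  coordinates \<open>0, \<dots>, 7\<close> are parameters.
\<close>

definition mn1 :: "(nat \<Rightarrow> complex) \<Rightarrow> complex" where "mn1 u = u 8 * u 10 - (u 9)\<^sup>2"
definition mn2 :: "(nat \<Rightarrow> complex) \<Rightarrow> complex" where "mn2 u = u 8 * u 11 - u 9 * u 10"
definition mn3 :: "(nat \<Rightarrow> complex) \<Rightarrow> complex" where "mn3 u = u 9 * u 11 - (u 10)\<^sup>2"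

lemma mn_cpoly: "mn1 \<in> cpoly 12" "mn2 \<in> cpoly 12" "mn3 \<in> cpoly 12"
  unfolding mn1_def[abs_def] mn2_def[abs_def] mn3_def[abs_def] by (intro cpoly_intros; simp)+

abbreviation "cone_ideal \<equiv> ideal3 (cpoly 12) mn1 mn2 mn3"

text \<open>The three minors rewrite b^2, bc and c^2 as ac, ad and bd. Hence 1, b, c generate the
  quotient over the polynomials in a, d and the parameters.\<close>

lemma cone_normal_form:
  assumes "f \<in> cpoly 12"
  shows "\<exists>f0 f1 f2 I. f0 \<in> cpoly 12 \<and> f1 \<in> cpoly 12 \<and> f2 \<in> cpoly 12 \<and> I \<in> cone_ideal \<and>
    (\<forall>u x y. f0 (u(9 := x, 10 := y)) = f0 u \<and> f1 (u(9 := x, 10 := y)) = f1 u \<and> f2 (u(9 := x, 10 := y)) = f2 u) \<and>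
    (\<forall>u. f u = f0 u + f1 u * u 9 + f2 u * u 10 + I u)"
  using assms
proof (induction rule: cpoly_induct)
  case (const c)
  show ?case
    by (rule exI[of _ "\<lambda>_. c"], rule exI[of _ "\<lambda>_. 0"], rule exI[of _ "\<lambda>_. 0"], rule exI[of _ "\<lambda>_. 0"])
      (auto intro: cpoly_intros ideal3_cpoly)
next
  case (var i)
  show ?case
    by (rule exI[of _ "\<lambda>u. if i = 9 \<or> i = 10 then 0 else u i"], rule exI[of _ "\<lambda>_. if i = 9 then 1 else 0"],
        rule exI[of _ "\<lambda>_. if i = 10 then 1 else 0"], rule exI[of _ "\<lambda>_. 0"])
      (use var in \<open>auto intro: cpoly_intros ideal3_cpoly\<close>)
next
  case (add a b)
  then obtain f0 f1 f2 I g0 g1 g2 H where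
    f: "f0 \<in> cpoly 12" "f1 \<in> cpoly 12" "f2 \<in> cpoly 12" "I \<in> cone_ideal" and
    fi: "\<And>u x y. f0 (u(9 := x, 10 := y)) = f0 u" "\<And>u x y. f1 (u(9 := x, 10 := y)) = f1 u" "\<And>u x y. f2 (u(9 := x, 10 := y)) = f2 u"
    and fe: "\<And>u. a u = f0 u + f1 u * u 9 + f2 u * u 10 + I u" and
    g: "g0 \<in> cpoly 12" "g1 \<in> cpoly 12" "g2 \<in> cpoly 12" "H \<in> cone_ideal" and
    gi: "\<And>u x y. g0 (u(9 := x, 10 := y)) = g0 u" "\<And>u x y. g1 (u(9 := x, 10 := y)) = g1 u" "\<And>u x y. g2 (u(9 := x, 10 := y)) = g2 u"
    and ge: "\<And>u. b u = g0 u + g1 u * u 9 + g2 u * u 10 + H u"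
    by metis
  show ?case
    by (rule exI[of _ "\<lambda>u. f0 u + g0 u"], rule exI[of _ "\<lambda>u. f1 u + g1 u"], rule exI[of _ "\<lambda>u. f2 u + g2 u"],
        rule exI[of _ "\<lambda>u. I u + H u"])
      (intro conjI allI cpoly_intros ideal3_cpoly f g; (simp only: fi gi)?; simp add: fe ge algebra_simps)
next
  case (mult a b)
  then obtain f0 f1 f2 I g0 g1 g2 H where
    f: "f0 \<in> cpoly 12" "f1 \<in> cpoly 12" "f2 \<in> cpoly 12" "I \<in> cone_ideal" and
    fi: "\<And>u x y. f0 (u(9 := x, 10 := y)) = f0 u" "\<And>u x y. f1 (u(9 := x, 10 := y)) = f1 u" "\<And>u x y. f2 (u(9 := x, 10 := y)) = f2 u"
    and fe: "\<And>u. a u = f0 u + f1 u * u 9 + f2 u * u 10 + I u" and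
    g: "g0 \<in> cpoly 12" "g1 \<in> cpoly 12" "g2 \<in> cpoly 12" "H \<in> cone_ideal" and
    gi: "\<And>u x y. g0 (u(9 := x, 10 := y)) = g0 u" "\<And>u x y. g1 (u(9 := x, 10 := y)) = g1 u" "\<And>u x y. g2 (u(9 := x, 10 := y)) = g2 u"
    and ge: "\<And>u. b u = g0 u + g1 u * u 9 + g2 u * u 10 + H u"
    by metis
  \<comment> \<open>The first bracket is the difference between \<open>a u * b u\<close> and the
    product of the two normal forms; the second records the rewriting of the quadratic monomials in
    coordinates 9 and 10.\<close>
  define I' where "I' = (\<lambda>u. (b u * I u + (a u - I u) * H u) -
     (f1 u * g1 u * mn1 u + (f1 u * g2 u + f2 u * g1 u) * mn2 u + f2 u * g2 u * mn3 u))"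
  have aI: "(\<lambda>u. a u - I u) \<in> cpoly 12"
    unfolding fe by (simp, intro cpoly_intros f; simp)
  have I': "I' \<in> cone_ideal"
    unfolding I'_def
    by (intro ideal3_cpoly f g aI mult.hyps cpoly_intros)
  let ?h0 = "\<lambda>u. f0 u * g0 u + (f1 u * g2 u + f2 u * g1 u) * (u 8 * u 11)"
  let ?h1 = "\<lambda>u. f0 u * g1 u + f1 u * g0 u + f2 u * g2 u * u 11"
  let ?h2 = "\<lambda>u. f0 u * g2 u + f2 u * g0 u + f1 u * g1 u * u 8"
  have "a u * b u = ?h0 u + ?h1 u * u 9 + ?h2 u * u 10 + I' u" for u
    unfolding I'_def fe ge mn1_def mn2_def mn3_def by algebra
  moreover have "?h0 \<in> cpoly 12" "?h1 \<in> cpoly 12" "?h2 \<in> cpoly 12" by (intro cpoly_intros f g; simp)+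
  moreover have "?h0 (u(9 := x, 10 := y)) = ?h0 u" "?h1 (u(9 := x, 10 := y)) = ?h1 u"
    "?h2 (u(9 := x, 10 := y)) = ?h2 u" for u x y unfolding fi gi by simp_all
  ultimately show ?case using I'
    apply (rule_tac exI[of _ ?h0], rule_tac exI[of _ ?h1], rule_tac exI[of _ ?h2], rule_tac exI[of _ I'])
    apply (intro conjI allI; assumption?)
    done
qed

text \<open>The cone as image of (s, t) -> (s^3, s^2 t, s t^2, t^3) with s = \<open>w 8\<close>, t =
  \<open>w 9\<close>. Pulling back to these ten variables lets cancellation in a polynomial ring
  replace arguments in the coordinate ring of the cone.\<close>

definition cone_pt :: "(nat \<Rightarrow> complex) \<Rightarrow> nat \<Rightarrow> complex" where
  "cone_pt w = (\<lambda>i. if i < 8 then w i else if i = 8 then (w 8)^3 else if i = 9 then (w 8)\<^sup>2 * w 9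
     else if i = 10 then w 8 * (w 9)\<^sup>2 else if i = 11 then (w 9)^3 else 0)"

lemma cone_pt_minors [simp]: "mn1 (cone_pt w) = 0" "mn2 (cone_pt w) = 0" "mn3 (cone_pt w) = 0"
  by (simp_all add: mn1_def mn2_def mn3_def cone_pt_def power2_eq_square power3_eq_cube)

lemma cone_pt_cpoly: "P \<in> cpoly 12 \<Longrightarrow> (\<lambda>w. P (cone_pt w)) \<in> cpoly 10"
proof (rule cpoly_subst, assumption)
  fix i :: nat assume "i < 12"
  then consider "i < 8" | "i = 8" | "i = 9" | "i = 10" | "i = 11" by linarith
  then show "(\<lambda>w. cone_pt w i) \<in> cpoly 10"
    unfolding cone_pt_def by cases (simp_all add: cpoly_intros)
qed

lemma complex_cube_root: "\<exists>s::complex. s ^ 3 = z"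
proof (cases "z = 0")
  case False
  then have "exp (Ln z / 3) ^ 3 = z" by (simp flip: exp_of_nat_mult)
  then show ?thesis by blast
qed auto

lemma primitive_cube_root_unity: "\<exists>\<omega>::complex. 1 + \<omega> + \<omega>\<^sup>2 = 0 \<and> \<omega> ^ 3 = 1"
proof -
  obtain r w :: complex where r: "r\<^sup>2 = -3" and w: "2 * w = r - 1"
    using power2_csqrt by (metis nonzero_mult_div_cancel_left times_divide_eq_right zero_neq_numeral)
  have "4 * (1 + w + w\<^sup>2) = 0" using r w by algebra
  then have 1: "1 + w + w\<^sup>2 = 0" by (metis mult_eq_0_iff zero_neq_numeral)
  then have "w ^ 3 = 1" by algebra
  with 1 show ?thesis by blast
qed

lemma cone_ideal_radical:
  assumes P: "P \<in> cpoly 12" and 0: "\<And>w. P (cone_pt w) = 0"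
  shows "P \<in> cone_ideal"
proof -
  obtain f0 f1 f2 I where f: "f0 \<in> cpoly 12" "f1 \<in> cpoly 12" "f2 \<in> cpoly 12" "I \<in> cone_ideal" and
    fi: "\<And>u x y. f0 (u(9 := x, 10 := y)) = f0 u" "\<And>u x y. f1 (u(9 := x, 10 := y)) = f1 u" "\<And>u x y. f2 (u(9 := x, 10 := y)) = f2 u"
    and fe: "\<And>u. P u = f0 u + f1 u * u 9 + f2 u * u 10 + I u"
    using cone_normal_form[OF P] by metis
  have I0: "I (cone_pt w) = 0" for w using ideal3E[OF f(4)] by (metis cone_pt_minors add.right_neutral mult_zero_right)
  obtain \<omega> :: complex where sum0: "1 + \<omega> + \<omega>\<^sup>2 = 0" and \<omega>3: "\<omega> ^ 3 = 1"
    using primitive_cube_root_unity by blast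
  \<comment> \<open>Twisting \<open>t\<close> by a cube root of unity fixes \<open>a = s\<^sup>3\<close> and \<open>d = t\<^sup>3\<close> and separates \<open>1, b, c\<close>.\<close>
  have nz: "f0 (cone_pt w) = 0 \<and> f1 (cone_pt w) * ((w 8)\<^sup>2 * w 9) = 0 \<and> f2 (cone_pt w) * (w 8 * (w 9)\<^sup>2) = 0" for w
  proof -
    have tw: "f0 (cone_pt w) + f1 (cone_pt w) * ((w 8)\<^sup>2 * (\<zeta> * w 9)) + f2 (cone_pt w) * (w 8 * (\<zeta> * w 9)\<^sup>2) = 0"
      if "\<zeta> ^ 3 = 1" for \<zeta>
    proof -
      have "cone_pt (w(9 := \<zeta> * w 9)) = (cone_pt w)(9 := (w 8)\<^sup>2 * (\<zeta> * w 9), 10 := w 8 * (\<zeta> * w 9)\<^sup>2)"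
        using that by (auto simp: cone_pt_def fun_eq_iff power_mult_distrib)
      then show ?thesis using 0[of "w(9 := \<zeta> * w 9)"] I0[of "w(9 := \<zeta> * w 9)"]
        by (simp only: fe fi) simp
    qed
    have "(\<omega>\<^sup>2)^3 = 1" using \<omega>3 by algebra
    note e = tw[OF power_one] tw[OF \<omega>3] tw[OF this]
    have "3 * f0 (cone_pt w) = 0" using e sum0 \<omega>3 by algebra
    moreover have "3 * (f1 (cone_pt w) * ((w 8)\<^sup>2 * w 9)) = 0" using e sum0 \<omega>3 by algebra
    moreover have "3 * (f2 (cone_pt w) * (w 8 * (w 9)\<^sup>2)) = 0" using e sum0 \<omega>3 by algebra
    ultimately show ?thesis by simp
  qed
  have fd: "(\<lambda>w. w 8) \<in> cpoly 10" "(\<lambda>w. w 9) \<in> cpoly 10" by (simp_all add: cpoly_intros)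
  \<comment> \<open>A function that ignores coordinates 9 and 10 sees only s^3 and t^3, and every
    pair of complex numbers is a pair of cubes.\<close>
  have surj: "g u = 0" if gi: "\<And>u x y. g (u(9 := x, 10 := y)) = g u" and g0: "\<And>w. g (cone_pt w) = 0" and "g \<in> cpoly 12" for g u
  proof -
    obtain s t where st: "s ^ 3 = u 8" "t ^ 3 = u 11" using complex_cube_root by metis
    have "g u = g ((cone_pt (u(8 := s, 9 := t)))(9 := u 9, 10 := u 10))"
    proof (rule cpoly_cong_vars[OF \<open>g \<in> cpoly 12\<close>])
      fix i :: nat assume "i < 12"
      then consider "i < 8" | "i = 8" | "i = 9" | "i = 10" | "i = 11" by linarith
      then show "u i = ((cone_pt (u(8 := s, 9 := t)))(9 := u 9, 10 := u 10)) i"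
        by cases (simp_all add: cone_pt_def st)
    qed
    also have "\<dots> = 0" unfolding gi by (rule g0)
    finally show ?thesis .
  qed
  have f0: "f0 u = 0" for u by (rule surj[OF fi(1) _ f(1)]) (use nz in blast)
  have f1: "f1 u = 0" for u
  proof (rule surj[OF fi(2) _ f(2)])
    fix w :: "nat \<Rightarrow> complex"
    show "f1 (cone_pt w) = 0"
      by (rule cpoly_domain[of "\<lambda>w. (w 8)\<^sup>2 * w 9" 10 "\<lambda>w. f1 (cone_pt w)" "\<lambda>_. 1"])
        (use nz f in \<open>auto intro!: cpoly_intros cone_pt_cpoly simp: mult.commute\<close>)
  qed
  have f2: "f2 u = 0" for u
  proof (rule surj[OF fi(3) _ f(3)])
    fix w :: "nat \<Rightarrow> complex"
    show "f2 (cone_pt w) = 0"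
      by (rule cpoly_domain[of "\<lambda>w. w 8 * (w 9)\<^sup>2" 10 "\<lambda>w. f2 (cone_pt w)" "\<lambda>_. 1"])
        (use nz f in \<open>auto intro!: cpoly_intros cone_pt_cpoly simp: mult.commute\<close>)
  qed
  have "P = I" using fe f0 f1 f2 by (simp add: fun_eq_iff)
  then show ?thesis using f(4) by simp
qed

text \<open>Division with remainder: up to sign \<open>mn1\<close> is monic of degree 2 in
  coordinate 9.\<close>

lemma div_mn1:
  assumes "f \<in> cpoly 12"
  shows "\<exists>g r0 r1. g \<in> cpoly 12 \<and> r0 \<in> cpoly 12 \<and> r1 \<in> cpoly 12 \<and>
    (\<forall>u x. r0 (u(9 := x)) = r0 u \<and> r1 (u(9 := x)) = r1 u) \<and>
    (\<forall>u. f u = g u * mn1 u + r1 u * u 9 + r0 u)"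
  using assms
proof (induction rule: cpoly_induct)
  case (const c)
  show ?case
    by (rule exI[of _ "\<lambda>_. 0"], rule exI[of _ "\<lambda>_. c"], rule exI[of _ "\<lambda>_. 0"])
      (auto intro: cpoly_intros)
next
  case (var i)
  show ?case
    by (rule exI[of _ "\<lambda>_. 0"], rule exI[of _ "\<lambda>u. if i = 9 then 0 else u i"],
        rule exI[of _ "\<lambda>_. if i = 9 then 1 else 0"])
      (use var in \<open>auto intro: cpoly_intros\<close>)
next
  case (add a b)
  then obtain g r0 r1 h s0 s1 where
    f: "g \<in> cpoly 12" "r0 \<in> cpoly 12" "r1 \<in> cpoly 12" "h \<in> cpoly 12" "s0 \<in> cpoly 12" "s1 \<in> cpoly 12" and
    fi: "\<And>u x. r0 (u(9 := x)) = r0 u" "\<And>u x. r1 (u(9 := x)) = r1 u" "\<And>u x. s0 (u(9 := x)) = s0 u" "\<And>u x. s1 (u(9 := x)) = s1 u"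
    and fe: "\<And>u. a u = g u * mn1 u + r1 u * u 9 + r0 u" "\<And>u. b u = h u * mn1 u + s1 u * u 9 + s0 u"
    by metis
  show ?case
    by (rule exI[of _ "\<lambda>u. g u + h u"], rule exI[of _ "\<lambda>u. r0 u + s0 u"], rule exI[of _ "\<lambda>u. r1 u + s1 u"])
      (intro conjI allI cpoly_intros f; (simp only: fi)?; simp add: fe algebra_simps)
next
  case (mult a b)
  then obtain g r0 r1 h s0 s1 where
    f: "g \<in> cpoly 12" "r0 \<in> cpoly 12" "r1 \<in> cpoly 12" "h \<in> cpoly 12" "s0 \<in> cpoly 12" "s1 \<in> cpoly 12" and
    fi: "\<And>u x. r0 (u(9 := x)) = r0 u" "\<And>u x. r1 (u(9 := x)) = r1 u" "\<And>u x. s0 (u(9 := x)) = s0 u" "\<And>u x. s1 (u(9 := x)) = s1 u"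
    and fe: "\<And>u. a u = g u * mn1 u + r1 u * u 9 + r0 u" "\<And>u. b u = h u * mn1 u + s1 u * u 9 + s0 u"
    by metis
  let ?g = "\<lambda>u. g u * b u + (r1 u * u 9 + r0 u) * h u - r1 u * s1 u"
  let ?r0 = "\<lambda>u. r0 u * s0 u + r1 u * s1 u * (u 8 * u 10)"
  let ?r1 = "\<lambda>u. r1 u * s0 u + r0 u * s1 u"
  have "?g \<in> cpoly 12" "?r0 \<in> cpoly 12" "?r1 \<in> cpoly 12"
    by (intro cpoly_intros f mult.hyps; simp)+
  moreover have "a u * b u = ?g u * mn1 u + ?r1 u * u 9 + ?r0 u" for u
    unfolding fe mn1_def by algebra
  moreover have "?r0 (u(9 := x)) = ?r0 u" "?r1 (u(9 := x)) = ?r1 u" for u x unfolding fi by simp_all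
  ultimately show ?case
    apply (rule_tac exI[of _ ?g], rule_tac exI[of _ ?r0], rule_tac exI[of _ ?r1])
    apply (intro conjI allI; assumption?)
    done
qed

text \<open>Hilbert--Burch for the matrix with rows \<open>(a, b, c)\<close> and \<open>(b, c, d)\<close>.\<close>

lemma cone_syzygies:
  assumes x: "x \<in> cpoly 12" and y: "y \<in> cpoly 12" and z: "z \<in> cpoly 12"
    and rel: "\<And>u. x u * mn1 u + y u * mn2 u + z u * mn3 u = 0"
  shows "\<exists>p q. p \<in> cpoly 12 \<and> q \<in> cpoly 12 \<and>
    (\<forall>u. x u = p u * u 10 + q u * u 11 \<and> y u = - p u * u 9 - q u * u 10 \<and> z u = p u * u 8 + q u * u 9)"
proof -
  \<comment> \<open>Where coordinates 9 and 10 vanish, the relation reduces to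
    \<open>u 8 * u 11\<close> times \<open>y\<close>. So \<open>y\<close> lies in the ideal of these
    two coordinates, which are the middle entries of the two syzygies up to sign.\<close>
  obtain y1 where y1: "y1 \<in> cpoly 12" "\<And>u. y u = y (u(9 := 0)) + (u 9 - 0) * y1 u"
    using cpoly_split_var[OF y, of 9 0] by auto
  obtain y2 where y2: "y2 \<in> cpoly 12" "\<And>u. y u = y (u(10 := 0)) + (u 10 - 0) * y2 u"
    using cpoly_split_var[OF y, of 10 0] by auto
  define y2' where "y2' = (\<lambda>u. y2 (u(9 := 0)))"
  define y0 where "y0 = (\<lambda>u. y (u(9 := 0, 10 := 0)))"
  have upd: "(\<lambda>u. f (u(9 := 0))) \<in> cpoly 12" "(\<lambda>u. f (u(9 := 0, 10 := 0))) \<in> cpoly 12" if "f \<in> cpoly 12" for f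
  proof -
    show "(\<lambda>u. f (u(9 := 0))) \<in> cpoly 12"
    proof (rule cpoly_subst[OF that])
      show "(\<lambda>v. (v(9 := 0)) j) \<in> cpoly 12" if "j < 12" for j :: nat
        using that by (cases "j = 9") (auto intro: cpoly_intros)
    qed
    show "(\<lambda>u. f (u(9 := 0, 10 := 0))) \<in> cpoly 12"
    proof (rule cpoly_subst[OF that])
      show "(\<lambda>v. (v(9 := 0, 10 := 0)) j) \<in> cpoly 12" if "j < 12" for j :: nat
        using that by (cases "j = 9"; cases "j = 10") (auto intro: cpoly_intros)
    qed
  qed
  have y2'c: "y2' \<in> cpoly 12" and y0c: "y0 \<in> cpoly 12" unfolding y2'_def y0_def using upd y2(1) y by blast+
  have ysplit: "y u = y0 u + u 9 * y1 u + u 10 * y2' u" for u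
    using y1(2)[of u] y2(2)[of "u(9 := 0)"] by (simp add: y0_def y2'_def)
  have y0z: "y0 u = 0" for u
  proof (rule cpoly_domain[of "\<lambda>u. u 8 * u 11" 12 y0 "\<lambda>_. 1"])
    fix u show "u 8 * u 11 * y0 u = 0"
      using rel[of "u(9 := 0, 10 := 0)"] by (simp add: mn1_def mn2_def mn3_def y0_def mult.commute)
  qed (auto intro!: cpoly_intros y0c)
  \<comment> \<open>Adding \<open>y1\<close> times (c, -b, a) and \<open>y2'\<close> times (d, -c,
    b) removes the middle component.\<close>
  define x' where "x' = (\<lambda>u. x u + y1 u * u 10 + y2' u * u 11)"
  define z' where "z' = (\<lambda>u. z u + y1 u * u 8 + y2' u * u 9)"
  have x'c: "x' \<in> cpoly 12" and z'c: "z' \<in> cpoly 12"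
    unfolding x'_def z'_def by (intro cpoly_intros x z y1 y2'c; simp)+
  have rel': "x' u * mn1 u + z' u * mn3 u = 0" for u
    using rel[of u] ysplit[of u] y0z[of u] unfolding x'_def z'_def mn1_def mn2_def mn3_def by algebra
  \<comment> \<open>What remains is a relation between \<open>mn1\<close> and \<open>mn3\<close>
    alone. It should be a multiple of the Koszul relation, so the remainder of \<open>z'\<close>
    modulo \<open>mn1\<close> has to vanish.\<close>
  obtain g r0 r1 where g: "g \<in> cpoly 12" "r0 \<in> cpoly 12" "r1 \<in> cpoly 12"
    and r: "\<And>u x. r0 (u(9 := x)) = r0 u" "\<And>u x. r1 (u(9 := x)) = r1 u"
    and ge: "\<And>u. z' u = g u * mn1 u + r1 u * u 9 + r0 u"
    using div_mn1[OF z'c] by metis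
  define sq where "sq = (\<lambda>u::nat \<Rightarrow> complex. u(8 := (u 8)\<^sup>2, 10 := (u 10)\<^sup>2))"
  have sqc: "(\<lambda>u. f (sq u)) \<in> cpoly 12" if "f \<in> cpoly 12" for f
  proof (rule cpoly_subst[OF that])
    show "(\<lambda>v. sq v j) \<in> cpoly 12" if "j < 12" for j :: nat
      unfolding sq_def using that by (cases "j = 8"; cases "j = 10") (auto intro!: cpoly_intros)
  qed
  \<comment> \<open>On \<open>b\<^sup>2 = ac\<close>, parametrised by \<open>a = \<alpha>\<^sup>2\<close>, \<open>c = \<gamma>\<^sup>2\<close>, \<open>b = \<plusminus> \<alpha> \<gamma>\<close>, the remainder vanishes.\<close>
  have pm: "r1 (sq u) * (\<epsilon> * (u 8 * u 10)) + r0 (sq u) = 0" if \<epsilon>: "\<epsilon>\<^sup>2 = 1" for \<epsilon> u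
  proof (rule cpoly_domain[of "\<lambda>u. \<epsilon> * (u 8 * u 10) * u 11 - (u 10)^4" 12 "\<lambda>u. r1 (sq u) * (\<epsilon> * (u 8 * u 10)) + r0 (sq u)" "(\<lambda>_. 0)(10 := 1)"])
    fix u
    let ?v = "(sq u)(9 := \<epsilon> * (u 8 * u 10))"
    have "mn1 ?v = 0" using \<epsilon> by (simp add: mn1_def sq_def power_mult_distrib)
    moreover have "mn3 ?v = \<epsilon> * (u 8 * u 10) * u 11 - (u 10)^4"
      by (simp add: mn3_def sq_def flip: power_mult)
    moreover have "z' ?v = g ?v * mn1 ?v + r1 (sq u) * (\<epsilon> * (u 8 * u 10)) + r0 (sq u)"
      unfolding ge r by simp
    ultimately show "(\<epsilon> * (u 8 * u 10) * u 11 - (u 10)^4) * (r1 (sq u) * (\<epsilon> * (u 8 * u 10)) + r0 (sq u)) = 0"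
      using rel'[of ?v] by auto
  next
    show "(\<lambda>u. r1 (sq u) * (\<epsilon> * (u 8 * u 10)) + r0 (sq u)) \<in> cpoly 12"
      by (intro cpoly_intros sqc g; simp)
    show "(\<lambda>u. \<epsilon> * (u 8 * u 10) * u 11 - (u 10)^4) \<in> cpoly 12" by (intro cpoly_intros; simp)
  qed simp
  have r0s: "r0 (sq u) = 0" for u
    using pm[of 1 u] pm[of "-1" u] by (simp add: algebra_simps eq_neg_iff_add_eq_0)
  have r1s: "r1 (sq u) = 0" for u
  proof (rule cpoly_domain[of "\<lambda>u. u 8 * u 10" 12 "\<lambda>u. r1 (sq u)" "\<lambda>_. 1"])
    show "u 8 * u 10 * r1 (sq u) = 0" for u using pm[of 1 u] r0s[of u] by auto
  qed (auto intro!: cpoly_intros sqc g)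
  have sqsurj: "\<exists>v. sq v = u" for u
    by (rule exI[of _ "u(8 := csqrt (u 8), 10 := csqrt (u 10))"]) (auto simp: sq_def)
  have r0z: "r0 u = 0" and r1z: "r1 u = 0" for u using r0s r1s sqsurj[of u] by metis+
  have x'e: "x' u + g u * mn3 u = 0" for u
  proof (rule cpoly_domain[of mn1 12 "\<lambda>u. x' u + g u * mn3 u" "(\<lambda>_. 0)(9 := 1)"])
    show "mn1 u * (x' u + g u * mn3 u) = 0" for u
      using rel'[of u] ge[of u] r0z[of u] r1z[of u] by algebra
    show "(\<lambda>u. x' u + g u * mn3 u) \<in> cpoly 12" by (intro cpoly_intros x'c g mn_cpoly)
  qed (simp_all add: mn_cpoly, simp add: mn1_def)
  show ?thesis
  proof (intro exI conjI allI)
    \<comment> \<open>The Koszul relation (-\<open>mn3\<close>, 0, \<open>mn1\<close>) is c times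
      the first syzygy minus b times the second.\<close>
    show "(\<lambda>u. g u * u 10 - y1 u) \<in> cpoly 12" "(\<lambda>u. - (g u * u 9) - y2' u) \<in> cpoly 12"
      by (intro cpoly_intros g y1 y2'c; simp)+
    fix u
    have gz: "z' u = g u * mn1 u" using ge[of u] r0z[of u] r1z[of u] by simp
    show "x u = (g u * u 10 - y1 u) * u 10 + (- (g u * u 9) - y2' u) * u 11"
      using x'e[of u] unfolding x'_def mn3_def by algebra
    show "y u = - (g u * u 10 - y1 u) * u 9 - (- (g u * u 9) - y2' u) * u 10"
      using ysplit[of u] y0z[of u] by algebra
    show "z u = (g u * u 10 - y1 u) * u 8 + (- (g u * u 9) - y2' u) * u 9"
      using gz unfolding z'_def mn1_def by algebra
  qed
qed

section \<open>The determinant in coordinates\<close>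

text \<open>The determinant of the symmetric matrix with rows (a, b, c), (b, d, e), (c, e,
  f).\<close>

definition sdet :: "complex \<Rightarrow> complex \<Rightarrow> complex \<Rightarrow> complex \<Rightarrow> complex \<Rightarrow> complex \<Rightarrow> complex" where
  "sdet a b c d e f = a * d * f + 2 * b * e * c - a * e\<^sup>2 - d * c\<^sup>2 - f * b\<^sup>2"

text \<open>The derivative of \<open>sdet\<close> at the first matrix in the direction of the second.\<close>

definition spol :: "complex \<Rightarrow> complex \<Rightarrow> complex \<Rightarrow> complex \<Rightarrow> complex \<Rightarrow> complex \<Rightarrow>
    complex \<Rightarrow> complex \<Rightarrow> complex \<Rightarrow> complex \<Rightarrow> complex \<Rightarrow> complex \<Rightarrow> complex" where
  "spol a b c d e f a' b' c' d' e' f' = a' * (d * f - e\<^sup>2) + 2 * b' * (e * c - b * f) + 2 * c' * (b * e - d * c)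
     + d' * (a * f - c\<^sup>2) + 2 * e' * (b * c - a * e) + f' * (a * d - b\<^sup>2)"

lemma sdet_pencil:
  "sdet (x * a + y * a') (x * b + y * b') (x * c + y * c') (x * d + y * d') (x * e + y * e') (x * f + y * f')
   = sdet a b c d e f * x^3 + spol a b c d e f a' b' c' d' e' f' * x\<^sup>2 * y
     + spol a' b' c' d' e' f' a b c d e f * x * y\<^sup>2 + sdet a' b' c' d' e' f' * y^3"
  unfolding sdet_def spol_def by algebra

text \<open>
  Linear coordinates on the pencils, chosen such that modulo the first eight coordinates the
  pencil is a pair of Hankel matrices and the coefficients of its determinant have the leading
  terms \<open>- v\<^sub>8\<^sup>3\<close>, \<open>- v\<^sub>9\<^sup>3\<close>, \<open>- v\<^sub>1\<^sub>0\<^sup>3\<close>, \<open>- v\<^sub>1\<^sub>1\<^sup>3\<close>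
  for the weights \<open>wt\<close> below.
\<close>

definition cA :: "(nat \<Rightarrow> complex) \<Rightarrow> complex" where
  "cA v = sdet (v 0) (v 2) (v 8) (v 8 + v 4) (v 9) (v 10)"
text \<open>The divisor 3 fits the normalisation of cubics with binomial coefficients 1, 3, 3,
  1.\<close>

definition cB :: "(nat \<Rightarrow> complex) \<Rightarrow> complex" where
  "cB v = spol (v 0) (v 2) (v 8) (v 8 + v 4) (v 9) (v 10)
     (v 1 + v 9) (v 10 + v 3) (v 11) (v 11 + v 5) (v 6) (v 7) / 3"
definition cC :: "(nat \<Rightarrow> complex) \<Rightarrow> complex" where
  "cC v = spol (v 1 + v 9) (v 10 + v 3) (v 11) (v 11 + v 5) (v 6) (v 7)
     (v 0) (v 2) (v 8) (v 8 + v 4) (v 9) (v 10) / 3"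
definition cD :: "(nat \<Rightarrow> complex) \<Rightarrow> complex" where
  "cD v = sdet (v 1 + v 9) (v 10 + v 3) (v 11) (v 11 + v 5) (v 6) (v 7)"

text \<open>A self-map of affine 12-space, so that source and target share the ring
  \<open>cpoly 12\<close>. The freeness proved below has a basis of 3^4 monomials.\<close>

definition detmap :: "(nat \<Rightarrow> complex) \<Rightarrow> nat \<Rightarrow> complex" where
  "detmap v = (\<lambda>i. if i < 8 then v i else if i = 8 then cA v else if i = 9 then cB v
     else if i = 10 then cC v else if i = 11 then cD v else 0)"

lemma detmap_simps [simp]:
  "i < 8 \<Longrightarrow> detmap v i = v i" "detmap v 8 = cA v" "detmap v 9 = cB v" "detmap v 10 = cC v" "detmap v 11 = cD v"
  by (simp_all add: detmap_def)

lemma coeff_cpoly: "cA \<in> cpoly 12" "cB \<in> cpoly 12" "cC \<in> cpoly 12" "cD \<in> cpoly 12"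
  unfolding cA_def[abs_def] cB_def[abs_def] cC_def[abs_def] cD_def[abs_def] sdet_def spol_def
  by (intro cpoly_intros; simp)+

lemma detmap_cpoly: "P \<in> cpoly 12 \<Longrightarrow> (\<lambda>v. P (detmap v)) \<in> cpoly 12"
proof (rule cpoly_subst, assumption)
  fix i :: nat assume "i < 12"
  then consider "i < 8" | "i = 8" | "i = 9" | "i = 10" | "i = 11" by linarith
  then show "(\<lambda>v. detmap v i) \<in> cpoly 12"
    by cases (simp_all add: cpoly_intros coeff_cpoly)
qed

section \<open>Freeness over the coefficients of the determinant\<close>

text \<open>Weight 5 inside and 4 outside separates v9^3 (weight 15) from v8 v9 v10 (14) and v8^2
  v11 (12), and symmetrically for \<open>cC\<close>; equal weights would tie.\<close>

definition wt :: "(nat \<Rightarrow> nat) \<Rightarrow> nat" where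
  "wt \<beta> = 4 * \<beta> 8 + 5 * \<beta> 9 + 5 * \<beta> 10 + 4 * \<beta> 11"

text \<open>The strict bound makes \<open>filt (wt \<beta>)\<close> the home of remainders after a
  leading term with exponent \<open>\<beta>\<close>.\<close>

definition filt :: "nat \<Rightarrow> ((nat \<Rightarrow> complex) \<Rightarrow> complex) set" where
  "filt k = cfun.span (mon 12 ` {\<gamma> \<in> expos 12. wt \<gamma> < k})"

lemma filt_mono: "f \<in> filt k \<Longrightarrow> k \<le> l \<Longrightarrow> f \<in> filt l"
  unfolding filt_def by (rule subsetD[OF cfun.span_mono]) auto

lemma filt_mult: "f \<in> filt (Suc k) \<Longrightarrow> g \<in> filt l \<Longrightarrow> (\<lambda>v. f v * g v) \<in> filt (k + l)"
  unfolding filt_def by (erule (1) span_mon_mult) (auto simp: wt_def expos_def)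

lemma filt_add: "f \<in> filt k \<Longrightarrow> g \<in> filt k \<Longrightarrow> (\<lambda>v. f v + g v) \<in> filt k"
  using cfun.span_add[of f _ g] by (simp add: filt_def plus_fun_def)

lemma filt_cmul: "f \<in> filt k \<Longrightarrow> (\<lambda>v. c * f v) \<in> filt k"
  unfolding filt_def by (rule cfun.span_scale)

lemma filt_mon: "\<beta> \<in> expos 12 \<Longrightarrow> wt \<beta> < k \<Longrightarrow> mon 12 \<beta> \<in> filt k"
  unfolding filt_def by (rule cfun.span_base) auto

lemma mon_single: "i < n \<Longrightarrow> mon n ((\<lambda>_. 0)(i := k)) v = v i ^ k"
proof -
  assume i: "i < n"
  have "mon n ((\<lambda>_. 0)(i := k)) v = (\<Prod>j<n. if j = i then v i ^ k else 1)"
    unfolding mon_def by (rule prod.cong) auto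
  then show ?thesis using i by simp
qed

definition filt_le :: "nat \<Rightarrow> ((nat \<Rightarrow> complex) \<Rightarrow> complex) set" where "filt_le k = filt (Suc k)"

lemma filt_le_var:
  assumes "i < 12" "wt ((\<lambda>_. 0)(i := 1)) \<le> k" shows "(\<lambda>v. v i) \<in> filt_le k"
proof -
  have "mon 12 ((\<lambda>_. 0)(i := 1)) \<in> filt_le k"
    unfolding filt_le_def using assms by (intro filt_mon) (auto simp: expos_def)
  moreover have "mon 12 ((\<lambda>_. 0)(i := 1)) = (\<lambda>v. v i)" using mon_single[OF assms(1)] by (simp add: fun_eq_iff)
  ultimately show ?thesis by simp
qed

lemma filt_le_vars:
  "(\<lambda>v. v 0) \<in> filt_le 0" "(\<lambda>v. v 1) \<in> filt_le 0" "(\<lambda>v. v 2) \<in> filt_le 0" "(\<lambda>v. v 3) \<in> filt_le 0"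
  "(\<lambda>v. v 4) \<in> filt_le 0" "(\<lambda>v. v 5) \<in> filt_le 0" "(\<lambda>v. v 6) \<in> filt_le 0" "(\<lambda>v. v 7) \<in> filt_le 0"
  "(\<lambda>v. v 8) \<in> filt_le 4" "(\<lambda>v. v 9) \<in> filt_le 5" "(\<lambda>v. v 10) \<in> filt_le 5" "(\<lambda>v. v 11) \<in> filt_le 4"
  "(\<lambda>v. c) \<in> filt_le 0"
proof -
  show "(\<lambda>v. c) \<in> filt_le 0"
    using filt_cmul[OF filt_mon[of "\<lambda>_. 0" "Suc 0"], of c] unfolding filt_le_def
    by (simp add: expos_def wt_def mon_def)
  have *: "(\<lambda>v. v i) \<in> filt_le k" if "i < 12" "wt ((\<lambda>_. 0)(i := 1)) \<le> k" for i k
    using that by (rule filt_le_var)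
  note u = *[of 0] *[of 1] *[of 2] *[of 3] *[of 4] *[of 5] *[of 6] *[of 7] *[of 8] *[of 9] *[of 10] *[of 11]
  show "(\<lambda>v. v 0) \<in> filt_le 0" "(\<lambda>v. v 1) \<in> filt_le 0" "(\<lambda>v. v 2) \<in> filt_le 0" "(\<lambda>v. v 3) \<in> filt_le 0"
  "(\<lambda>v. v 4) \<in> filt_le 0" "(\<lambda>v. v 5) \<in> filt_le 0" "(\<lambda>v. v 6) \<in> filt_le 0" "(\<lambda>v. v 7) \<in> filt_le 0"
  "(\<lambda>v. v 8) \<in> filt_le 4" "(\<lambda>v. v 9) \<in> filt_le 5" "(\<lambda>v. v 10) \<in> filt_le 5" "(\<lambda>v. v 11) \<in> filt_le 4"
    by (rule u; simp add: wt_def)+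
qed

lemma filt_le_mono: "f \<in> filt_le k \<Longrightarrow> k \<le> l \<Longrightarrow> f \<in> filt_le l"
  unfolding filt_le_def by (erule filt_mono) simp

lemma filt_le_add: "f \<in> filt_le k \<Longrightarrow> g \<in> filt_le l \<Longrightarrow> (\<lambda>v. f v + g v) \<in> filt_le (max k l)"
  by (auto simp: filt_le_def intro!: filt_add elim: filt_mono)

lemma filt_le_diff: "f \<in> filt_le k \<Longrightarrow> g \<in> filt_le l \<Longrightarrow> (\<lambda>v. f v - g v) \<in> filt_le (max k l)"
  using filt_le_add[of f k "\<lambda>v. -1 * g v" l] filt_cmul[of g "Suc l" "-1"] by (simp add: filt_le_def)

lemma filt_le_mult: "f \<in> filt_le k \<Longrightarrow> g \<in> filt_le l \<Longrightarrow> (\<lambda>v. f v * g v) \<in> filt_le (k + l)"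
  unfolding filt_le_def using filt_mult by fastforce

lemma filt_le_square: "f \<in> filt_le k \<Longrightarrow> (\<lambda>v. (f v)\<^sup>2) \<in> filt_le (k + k)"
  unfolding power2_eq_square by (rule filt_le_mult)

lemmas filt_le_rules = filt_le_vars filt_le_add filt_le_diff filt_le_square filt_le_mult

text \<open>The expansions are written with the cube already cancelled, because a bound taken term
  by term cannot see cancellation. Applying \<open>filt_le_rules\<close> computes a weight bound,
  which is then compared with 11 or 14.\<close>

lemma coeff_filt:
  "(\<lambda>v. cA v - (-1) * v 8 ^ 3) \<in> filt_le 11" "(\<lambda>v. cB v - (-1/3) * v 9 ^ 3) \<in> filt_le 14"
  "(\<lambda>v. cC v - (-1/3) * v 10 ^ 3) \<in> filt_le 14" "(\<lambda>v. cD v - (-1) * v 11 ^ 3) \<in> filt_le 11"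
proof -
  have A: "cA v - (-1) * v 8 ^ 3 = v 0 * (v 8 + v 4) * v 10 + 2 * v 2 * v 9 * v 8 - v 0 * (v 9)\<^sup>2
      - v 4 * (v 8)\<^sup>2 - v 10 * (v 2)\<^sup>2" for v
    unfolding cA_def sdet_def by algebra
  show "(\<lambda>v. cA v - (-1) * v 8 ^ 3) \<in> filt_le 11"
    unfolding A by (rule filt_le_mono, (rule filt_le_rules)+, simp)
  have D: "cD v - (-1) * v 11 ^ 3 = (v 1 + v 9) * (v 11 + v 5) * v 7 + 2 * (v 10 + v 3) * v 6 * v 11
      - (v 1 + v 9) * (v 6)\<^sup>2 - v 5 * (v 11)\<^sup>2 - v 7 * (v 10 + v 3)\<^sup>2" for v
    unfolding cD_def sdet_def by algebra
  show "(\<lambda>v. cD v - (-1) * v 11 ^ 3) \<in> filt_le 11"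
    unfolding D by (rule filt_le_mono, (rule filt_le_rules)+, simp)
  have B: "cB v - (-1/3) * v 9 ^ 3 = (1/3) * ((v 1 + v 9) * ((v 8 + v 4) * v 10) - v 1 * (v 9)\<^sup>2
      + 2 * (v 10 + v 3) * (v 9 * v 8 - v 2 * v 10) + 2 * v 11 * (v 2 * v 9 - (v 8 + v 4) * v 8)
      + (v 11 + v 5) * (v 0 * v 10 - (v 8)\<^sup>2) + 2 * v 6 * (v 2 * v 8 - v 0 * v 9) + v 7 * (v 0 * (v 8 + v 4) - (v 2)\<^sup>2))" for v
    unfolding cB_def spol_def by (simp add: field_simps) algebra
  show "(\<lambda>v. cB v - (-1/3) * v 9 ^ 3) \<in> filt_le 14"
    unfolding B by (rule filt_le_mono, (rule filt_le_rules)+, simp)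
  have C: "cC v - (-1/3) * v 10 ^ 3 = (1/3) * (v 0 * ((v 11 + v 5) * v 7 - (v 6)\<^sup>2)
      + 2 * v 2 * (v 6 * v 11 - (v 10 + v 3) * v 7) + 2 * v 8 * ((v 10 + v 3) * v 6 - (v 11 + v 5) * v 11)
      + (v 8 + v 4) * ((v 1 + v 9) * v 7 - (v 11)\<^sup>2) + 2 * v 9 * ((v 10 + v 3) * v 11 - (v 1 + v 9) * v 6)
      + v 10 * ((v 1 + v 9) * (v 11 + v 5)) - v 10 * v 3 * (2 * v 10 + v 3))" for v
    unfolding cC_def spol_def by (simp add: field_simps) algebra
  show "(\<lambda>v. cC v - (-1/3) * v 10 ^ 3) \<in> filt_le 14"
    unfolding C by (rule filt_le_mono, (rule filt_le_rules)+, simp)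
qed

text \<open>No monomial order is involved: the part of top weight has to be a single monomial, and
  everything else has strictly smaller weight.\<close>

definition leads :: "((nat \<Rightarrow> complex) \<Rightarrow> complex) \<Rightarrow> (nat \<Rightarrow> nat) \<Rightarrow> bool" where
  "leads f \<beta> \<longleftrightarrow> \<beta> \<in> expos 12 \<and> (\<exists>s. s \<noteq> 0 \<and> (\<lambda>v. f v - s * mon 12 \<beta> v) \<in> filt (wt \<beta>))"

lemma leads_filt: "leads f \<beta> \<Longrightarrow> f \<in> filt (Suc (wt \<beta>))"
proof -
  assume "leads f \<beta>"
  then obtain s where "\<beta> \<in> expos 12" "(\<lambda>v. f v - s * mon 12 \<beta> v) \<in> filt (Suc (wt \<beta>))"
    unfolding leads_def using filt_mono by (meson le_SucI order_refl)
  from filt_add[OF this(2) filt_cmul[OF filt_mon[OF this(1)], of _ s]] show ?thesis by simp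
qed

lemma leads_mult:
  assumes f: "leads f \<beta>" and g: "leads g \<gamma>"
  shows "leads (\<lambda>v. f v * g v) (\<lambda>i. \<beta> i + \<gamma> i)"
proof -
  obtain s where s: "s \<noteq> 0" "(\<lambda>v. f v - s * mon 12 \<beta> v) \<in> filt (wt \<beta>)" "\<beta> \<in> expos 12" using f unfolding leads_def by blast
  obtain t where t: "t \<noteq> 0" "(\<lambda>v. g v - t * mon 12 \<gamma> v) \<in> filt (wt \<gamma>)" "\<gamma> \<in> expos 12" using g unfolding leads_def by blast
  have w: "wt (\<lambda>i. \<beta> i + \<gamma> i) = wt \<gamma> + wt \<beta>" by (simp add: wt_def)
  have "(\<lambda>v. g v * (f v - s * mon 12 \<beta> v)) \<in> filt (wt \<gamma> + wt \<beta>)" by (rule filt_mult[OF leads_filt[OF g] s(2)])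
  moreover have "(\<lambda>v. mon 12 \<beta> v * (g v - t * mon 12 \<gamma> v)) \<in> filt (wt \<beta> + wt \<gamma>)"
    by (rule filt_mult[OF filt_mon[OF s(3)] t(2)]) simp
  ultimately have "(\<lambda>v. g v * (f v - s * mon 12 \<beta> v) + s * (mon 12 \<beta> v * (g v - t * mon 12 \<gamma> v))) \<in> filt (wt \<gamma> + wt \<beta>)"
    by (intro filt_add filt_cmul) (simp_all add: add.commute)
  moreover have "g v * (f v - s * mon 12 \<beta> v) + s * (mon 12 \<beta> v * (g v - t * mon 12 \<gamma> v))
      = f v * g v - (s * t) * mon 12 (\<lambda>i. \<beta> i + \<gamma> i) v" for v
    unfolding mon_add by algebra
  ultimately have "(\<lambda>v. f v * g v - (s * t) * mon 12 (\<lambda>i. \<beta> i + \<gamma> i) v) \<in> filt (wt (\<lambda>i. \<beta> i + \<gamma> i))"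
    unfolding w by simp
  moreover have "(\<lambda>i. \<beta> i + \<gamma> i) \<in> expos 12" using s t by (simp add: expos_def)
  ultimately show ?thesis unfolding leads_def using s(1) t(1) by (intro conjI exI[of _ "s * t"]) auto
qed

lemma leads_mon: "\<beta> \<in> expos 12 \<Longrightarrow> leads (mon 12 \<beta>) \<beta>"
  using filt_cmul[of "mon 12 \<beta>" "wt \<beta>" 0] cfun.span_zero[of "mon 12 ` {\<gamma> \<in> expos 12. wt \<gamma> < wt \<beta>}"]
  unfolding leads_def filt_def by (intro conjI exI[of _ 1]) (simp_all add: zero_fun_def)

lemma leads_power:
  assumes "leads f \<beta>" shows "leads (\<lambda>v. f v ^ k) (\<lambda>i. k * \<beta> i)"
proof (induction k)
  case 0
  have "mon 12 (\<lambda>i. 0) = (\<lambda>v. 1)" by (simp add: mon_def[abs_def])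
  then show ?case using leads_mon[of "\<lambda>i. 0"] by (simp add: expos_def)
next
  case (Suc k)
  from leads_mult[OF assms Suc] show ?case by simp
qed

lemma leads_coeff:
  "leads cA ((\<lambda>_. 0)(8 := 3))" "leads cB ((\<lambda>_. 0)(9 := 3))" "leads cC ((\<lambda>_. 0)(10 := 3))" "leads cD ((\<lambda>_. 0)(11 := 3))"
proof -
  have *: "leads f ((\<lambda>_. 0)(i := 3))" if "(\<lambda>v. f v - s * v i ^ 3) \<in> filt_le k" "s \<noteq> 0" "i < 12" "k < wt ((\<lambda>_. 0)(i := 3))" for f s i k
    unfolding leads_def
  proof (intro conjI exI[of _ s])
    show "(\<lambda>v. f v - s * mon 12 ((\<lambda>_. 0)(i := 3)) v) \<in> filt (wt ((\<lambda>_. 0)(i := 3)))"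
      unfolding mon_single[OF \<open>i < 12\<close>] using that(1,4) unfolding filt_le_def by (elim filt_mono) simp
  qed (use that in \<open>auto simp: expos_def\<close>)
  show "leads cA ((\<lambda>_. 0)(8 := 3))" by (rule *[OF coeff_filt(1)]) (simp_all add: wt_def)
  show "leads cB ((\<lambda>_. 0)(9 := 3))" by (rule *[OF coeff_filt(2)]) (simp_all add: wt_def)
  show "leads cC ((\<lambda>_. 0)(10 := 3))" by (rule *[OF coeff_filt(3)]) (simp_all add: wt_def)
  show "leads cD ((\<lambda>_. 0)(11 := 3))" by (rule *[OF coeff_filt(4)]) (simp_all add: wt_def)
qed

text \<open>The monomials with these exponents form the module basis.\<close>

definition resid :: "(nat \<Rightarrow> nat) set" where
  "resid = {e \<in> expos 12. (\<forall>i<8. e i = 0) \<and> (\<forall>i. e i < 3)}"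

lemma finite_resid: "finite resid"
  by (rule finite_subset[OF _ finite_expbox[of 12 3]]) (auto simp: resid_def expos_def expbox_def)

text \<open>The leading exponent of the product of the basis monomial \<open>e\<close> with the
  monomial \<open>\<gamma>\<close> in \<open>detmap\<close>. From coordinate 8 on it is a division
  by 3 with remainder, which explains both injectivity and surjectivity.\<close>

definition comb :: "(nat \<Rightarrow> nat) \<times> (nat \<Rightarrow> nat) \<Rightarrow> nat \<Rightarrow> nat" where
  "comb = (\<lambda>(e, \<gamma>) i. if i < 8 then \<gamma> i else e i + 3 * \<gamma> i)"

lemma comb_inj: "inj_on comb (resid \<times> expos 12)"
proof (rule inj_onI)
  fix p q assume pq: "p \<in> resid \<times> expos 12" "q \<in> resid \<times> expos 12" "comb p = comb q"
  obtain e \<gamma> e' \<gamma>' where [simp]: "p = (e, \<gamma>)" "q = (e', \<gamma>')" by (cases p; cases q) auto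
  have "e i = e' i \<and> \<gamma> i = \<gamma>' i" for i
  proof (cases "i < 8")
    case True
    have "comb p i = comb q i" using pq(3) by simp
    then show ?thesis using True pq(1,2) by (simp add: comb_def resid_def)
  next
    case False
    then have eq: "e i + 3 * \<gamma> i = e' i + 3 * \<gamma>' i" using fun_cong[OF pq(3), of i] by (auto simp: comb_def)
    moreover have "e i < 3" "e' i < 3" using pq by (auto simp: resid_def)
    ultimately show ?thesis by presburger
  qed
  then show "p = q" by (simp add: fun_eq_iff)
qed

lemma comb_surj:
  assumes "\<beta> \<in> expos 12"
  shows "\<exists>e \<gamma>. e \<in> resid \<and> \<gamma> \<in> expos 12 \<and> comb (e, \<gamma>) = \<beta>"
  by (rule exI[of _ "\<lambda>i. if i < 8 then 0 else \<beta> i mod 3"], rule exI[of _ "\<lambda>i. if i < 8 then \<beta> i else \<beta> i div 3"])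
    (use assms in \<open>auto simp: comb_def resid_def expos_def fun_eq_iff\<close>)

lemma mon12_split:
  "mon 12 \<gamma> u = (\<Prod>i<8. u i ^ \<gamma> i) * u 8 ^ \<gamma> 8 * u 9 ^ \<gamma> 9 * u 10 ^ \<gamma> 10 * u 11 ^ \<gamma> 11"
proof -
  have "{..<12::nat} = {..<8} \<union> {8, 9, 10, 11}" by auto
  then show ?thesis unfolding mon_def by (simp add: prod.union_disjoint mult.assoc)
qed

lemma leads_comb:
  assumes "e \<in> resid" "\<gamma> \<in> expos 12"
  shows "leads (\<lambda>v. mon 12 e v * mon 12 \<gamma> (detmap v)) (comb (e, \<gamma>))"
proof -
  define \<rho> where "\<rho> = (\<lambda>i. if i < 8 then \<gamma> i else 0)"
  have \<rho>: "\<rho> \<in> expos 12" "e \<in> expos 12" using assms by (auto simp: \<rho>_def expos_def resid_def)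
  have "mon 12 \<rho> v = (\<Prod>i<8. v i ^ \<gamma> i)" for v by (simp add: mon12_split \<rho>_def)
  then have eq: "mon 12 e v * mon 12 \<gamma> (detmap v)
      = mon 12 e v * (mon 12 \<rho> v * (cA v ^ \<gamma> 8 * (cB v ^ \<gamma> 9 * (cC v ^ \<gamma> 10 * cD v ^ \<gamma> 11))))" for v
    unfolding mon12_split[of \<gamma>] by (simp add: mult.assoc)
  have "leads (\<lambda>v. mon 12 e v * (mon 12 \<rho> v * (cA v ^ \<gamma> 8 * (cB v ^ \<gamma> 9 * (cC v ^ \<gamma> 10 * cD v ^ \<gamma> 11)))))
    (\<lambda>i. e i + (\<rho> i + (\<gamma> 8 * ((\<lambda>_. 0)(8 := 3)) i + (\<gamma> 9 * ((\<lambda>_. 0)(9 := 3)) i + (\<gamma> 10 * ((\<lambda>_. 0)(10 := 3)) i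
       + \<gamma> 11 * ((\<lambda>_. 0)(11 := 3)) i)))))"
    by (intro leads_mult leads_power leads_coeff leads_mon \<rho>)
  moreover have "e i + (\<rho> i + (\<gamma> 8 * ((\<lambda>_. 0)(8 := 3)) i + (\<gamma> 9 * ((\<lambda>_. 0)(9 := 3)) i + (\<gamma> 10 * ((\<lambda>_. 0)(10 := 3)) i
       + \<gamma> 11 * ((\<lambda>_. 0)(11 := 3)) i)))) = comb (e, \<gamma>) i" for i
  proof (cases "i < 8")
    case True
    then show ?thesis using assms by (auto simp: comb_def \<rho>_def resid_def)
  next
    case False
    then consider "i = 8" | "i = 9" | "i = 10" | "i = 11" | "i \<ge> 12" by linarith
    then show ?thesis by cases (use assms in \<open>auto simp: comb_def \<rho>_def expos_def resid_def\<close>)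
  qed
  ultimately show ?thesis unfolding eq by simp
qed

definition free_comb :: "((nat \<Rightarrow> nat) \<Rightarrow> (nat \<Rightarrow> complex) \<Rightarrow> complex) \<Rightarrow> (nat \<Rightarrow> complex) \<Rightarrow> complex" where
  "free_comb P v = (\<Sum>e\<in>resid. mon 12 e v * P e (detmap v))"

text \<open>Induction on the weight: \<open>comb\<close> provides a basis product with any
  prescribed leading exponent, and the difference has smaller weight.\<close>

lemma free_comb_span:
  assumes "f \<in> cpoly 12"
  shows "\<exists>P. (\<forall>e. P e \<in> cpoly 12) \<and> f = free_comb P"
proof -
  let ?G = "(\<lambda>(e, \<gamma>) v. mon 12 e v * mon 12 \<gamma> (detmap v)) ` (resid \<times> expos 12)"
  have mon_span: "mon 12 \<beta> \<in> cfun.span ?G" if "\<beta> \<in> expos 12" for \<beta>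
    using that
  proof (induction "wt \<beta>" arbitrary: \<beta> rule: less_induct)
    case less
    obtain e \<gamma> where e: "e \<in> resid" "\<gamma> \<in> expos 12" "comb (e, \<gamma>) = \<beta>" using comb_surj[OF less.prems] by blast
    let ?g = "\<lambda>v. mon 12 e v * mon 12 \<gamma> (detmap v)"
    obtain s where s: "s \<noteq> 0" "(\<lambda>v. ?g v - s * mon 12 \<beta> v) \<in> filt (wt \<beta>)"
      using leads_comb[OF e(1,2)] unfolding leads_def e(3) by blast
    have "filt (wt \<beta>) \<subseteq> cfun.span ?G"
      unfolding filt_def by (rule cfun.span_minimal) (use less.hyps in auto)
    then have "(\<lambda>v. ?g v - s * mon 12 \<beta> v) \<in> cfun.span ?G" using s(2) by blast
    moreover have "?g \<in> cfun.span ?G" by (rule cfun.span_base) (use e in force)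
    ultimately have "(\<lambda>v. ?g v - (?g v - s * mon 12 \<beta> v)) \<in> cfun.span ?G"
      using cfun.span_diff[of ?g _ "\<lambda>v. ?g v - s * mon 12 \<beta> v"] by (simp add: fun_diff_def)
    from cfun.span_scale[OF this, of "1 / s"] show ?case using s(1) by simp
  qed
  obtain K c where K: "finite K" "K \<subseteq> expos 12" "\<forall>v. f v = (\<Sum>\<alpha>\<in>K. c \<alpha> * mon 12 \<alpha> v)"
    using cpoly_rep[OF assms] by blast
  have "f = (\<Sum>\<alpha>\<in>K. (\<lambda>v. c \<alpha> * mon 12 \<alpha> v))" using K(3) by (simp add: fun_eq_iff sum_fun_apply)
  also have "\<dots> \<in> cfun.span ?G"
    by (intro cfun.span_sum cfun.span_scale mon_span) (use K in auto)
  finally show ?thesis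
  proof (induction rule: cfun.span_induct_alt)
    case base
    show ?case by (rule exI[of _ "\<lambda>_ _. 0"]) (auto simp: free_comb_def fun_eq_iff intro: cpoly_intros)
  next
    case (step c x y)
    obtain P where P: "\<And>e. P e \<in> cpoly 12" "y = free_comb P" using step(2) by blast
    obtain e \<gamma> where e: "e \<in> resid" "\<gamma> \<in> expos 12" "x = (\<lambda>v. mon 12 e v * mon 12 \<gamma> (detmap v))" using step(1) by auto
    let ?Q = "\<lambda>e' u. P e' u + (if e' = e then c * mon 12 \<gamma> u else 0)"
    have "?Q e' \<in> cpoly 12" for e' by (cases "e' = e") (auto intro!: cpoly_intros P mon_cpoly)
    moreover have "c * x v + y v = free_comb ?Q v" for v
    proof -
      have "free_comb ?Q v = free_comb P v + (\<Sum>e'\<in>resid. if e' = e then c * mon 12 e v * mon 12 \<gamma> (detmap v) else 0)"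
        unfolding free_comb_def sum.distrib[symmetric] by (rule sum.cong) (auto simp: algebra_simps)
      then show ?thesis using e finite_resid P by simp
    qed
    ultimately show ?case by (intro exI[of _ ?Q]) (auto simp: fun_eq_iff)
  qed
qed

text \<open>Among the terms with nonzero coefficient, those of maximal weight contribute distinct
  leading monomials, which cannot cancel each other; all other contributions have smaller
  weight.\<close>

lemma leading_indep:
  assumes "finite K" and lead: "\<And>k. k \<in> K \<Longrightarrow> leads (g k) (b k)" and inj: "inj_on b K"
    and zero: "\<And>v. (\<Sum>k\<in>K. c k * g k v) = 0" and "k \<in> K"
  shows "c k = 0"
proof (rule ccontr)
  assume "c k \<noteq> 0"
  define K' where "K' = {k \<in> K. c k \<noteq> 0}"
  have K': "finite K'" "K' \<noteq> {}" "K' \<subseteq> K" using assms \<open>c k \<noteq> 0\<close> by (auto simp: K'_def)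
  define m where "m = Max ((\<lambda>k. wt (b k)) ` K')"
  have "m \<in> (\<lambda>k. wt (b k)) ` K'" unfolding m_def by (rule Max_in) (use K' in auto)
  then obtain k0 where k0: "k0 \<in> K'" "wt (b k0) = m" by auto
  have le: "wt (b j) \<le> m" if "j \<in> K'" for j unfolding m_def by (rule Max_ge) (use K' that in auto)
  define T where "T = {k \<in> K'. wt (b k) = m}"
  have "\<forall>k\<in>K'. \<exists>s. s \<noteq> 0 \<and> (\<lambda>v. g k v - s * mon 12 (b k) v) \<in> filt (wt (b k))"
    using lead K' unfolding leads_def by blast
  then obtain s where s: "\<And>k. k \<in> K' \<Longrightarrow> s k \<noteq> 0" "\<And>k. k \<in> K' \<Longrightarrow> (\<lambda>v. g k v - s k * mon 12 (b k) v) \<in> filt (wt (b k))"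
    by metis
  \<comment> \<open>The whole sum with the top monomials removed; it lies strictly below weight
    \<open>m\<close>.\<close>
  define R where "R = (\<lambda>v. \<Sum>k\<in>K'. if k \<in> T then c k * (g k v - s k * mon 12 (b k) v) else c k * g k v)"
  have "R = (\<Sum>k\<in>K'. (\<lambda>v. if k \<in> T then c k * (g k v - s k * mon 12 (b k) v) else c k * g k v))"
    by (simp add: R_def fun_eq_iff sum_fun_apply)
  also have "\<dots> \<in> filt m"
    unfolding filt_def
  proof (rule cfun.span_sum, fold filt_def)
    fix k assume k: "k \<in> K'"
    show "(\<lambda>v. if k \<in> T then c k * (g k v - s k * mon 12 (b k) v) else c k * g k v) \<in> filt m"
    proof (cases "k \<in> T")
      case True
      then show ?thesis using filt_cmul[OF s(2)[OF k], of "c k"] by (simp add: T_def)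
    next
      case False
      then have "Suc (wt (b k)) \<le> m" using le[OF k] k by (auto simp: T_def)
      then show ?thesis using False filt_cmul[OF filt_mono[OF leads_filt[OF lead]], of k m "c k"] k K' by auto
    qed
  qed
  finally have "R \<in> filt m" .
  then obtain t r where t: "finite t" "t \<subseteq> mon 12 ` {\<gamma> \<in> expos 12. wt \<gamma> < m}" "R = (\<Sum>a\<in>t. (\<lambda>x. r a * a x))"
    unfolding filt_def cfun.span_explicit by auto
  obtain D where D: "D \<subseteq> {\<gamma> \<in> expos 12. wt \<gamma> < m}" "finite D" "t = mon 12 ` D" "inj_on (mon 12) D"
  proof -
    from t(2) obtain D where "D \<subseteq> {\<gamma> \<in> expos 12. wt \<gamma> < m}" "inj_on (mon 12) D" "t = mon 12 ` D"
      unfolding subset_image_inj by blast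
    then show ?thesis using that t(1) finite_image_iff[of "mon 12" D] by blast
  qed
  have R: "R v = (\<Sum>\<gamma>\<in>D. r (mon 12 \<gamma>) * mon 12 \<gamma> v)" for v
    unfolding t(3) D(3) by (simp add: sum_fun_apply sum.reindex[OF D(4)])
  have injT: "inj_on b T" by (rule inj_on_subset[OF inj]) (auto simp: T_def K'_def)
  have disj: "b ` T \<inter> D = {}" using D(1) by (auto simp: T_def)
  define d where "d = (\<lambda>\<gamma>. if \<gamma> \<in> D then r (mon 12 \<gamma>) else c (the_inv_into T b \<gamma>) * s (the_inv_into T b \<gamma>))"
  have "(\<Sum>\<gamma>\<in>b ` T \<union> D. d \<gamma> * mon 12 \<gamma> v) = 0" for v
  proof -
    have "(\<Sum>\<gamma>\<in>b ` T. d \<gamma> * mon 12 \<gamma> v) = (\<Sum>k\<in>T. c k * s k * mon 12 (b k) v)"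
      unfolding sum.reindex[OF injT]
      by (rule sum.cong) (use disj in \<open>auto simp: d_def the_inv_into_f_f[OF injT]\<close>)
    moreover have "(\<Sum>\<gamma>\<in>D. d \<gamma> * mon 12 \<gamma> v) = R v" unfolding R by (rule sum.cong) (auto simp: d_def)
    moreover have "R v + (\<Sum>k\<in>T. c k * s k * mon 12 (b k) v) = (\<Sum>k\<in>K'. c k * g k v)"
    proof -
      have "(\<Sum>k\<in>T. c k * s k * mon 12 (b k) v) = (\<Sum>k\<in>K'. if k \<in> T then c k * s k * mon 12 (b k) v else 0)"
        by (rule sum.mono_neutral_cong_left) (use K' in \<open>auto simp: T_def\<close>)
      then show ?thesis unfolding R_def
        by (simp only: sum.distrib[symmetric]) (rule sum.cong, auto simp: algebra_simps)
    qed
    moreover have "(\<Sum>k\<in>K'. c k * g k v) = (\<Sum>k\<in>K. c k * g k v)"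
      by (rule sum.mono_neutral_left) (use assms in \<open>auto simp: K'_def\<close>)
    ultimately show ?thesis
      using zero[of v] disj D(2) K' by (subst sum.union_disjoint) (auto simp: T_def add.commute)
  qed
  then have "d (b k0) = 0"
    by (rule mon_indep[rotated 2]) (use D K' lead k0 in \<open>auto simp: T_def leads_def\<close>)
  moreover have "k0 \<in> T" using k0 by (simp add: T_def)
  moreover from this disj have "b k0 \<notin> D" by blast
  ultimately show False
    using s(1)[OF k0(1)] k0(1) by (simp add: d_def the_inv_into_f_f[OF injT] K'_def)
qed

lemma free_comb_inj:
  assumes P: "\<And>e. e \<in> resid \<Longrightarrow> P e \<in> cpoly 12" and 0: "\<And>v. free_comb P v = 0" and e: "e \<in> resid"
  shows "P e u = 0"
proof -
  have "\<forall>e\<in>resid. \<exists>K c. finite K \<and> K \<subseteq> expos 12 \<and> (\<forall>v. P e v = (\<Sum>\<alpha>\<in>K. c \<alpha> * mon 12 \<alpha> v))"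
    using cpoly_rep P by blast
  from bchoice[OF this] obtain K where "\<forall>e\<in>resid. \<exists>c. finite (K e) \<and> K e \<subseteq> expos 12 \<and> (\<forall>v. P e v = (\<Sum>\<alpha>\<in>K e. c \<alpha> * mon 12 \<alpha> v))"
    by blast
  from bchoice[OF this] obtain c where "\<forall>e\<in>resid. finite (K e) \<and> K e \<subseteq> expos 12 \<and> (\<forall>v. P e v = (\<Sum>\<alpha>\<in>K e. c e \<alpha> * mon 12 \<alpha> v))"
    by blast
  then have K: "\<And>e. e \<in> resid \<Longrightarrow> finite (K e)" "\<And>e. e \<in> resid \<Longrightarrow> K e \<subseteq> expos 12"
    "\<And>e v. e \<in> resid \<Longrightarrow> P e v = (\<Sum>\<alpha>\<in>K e. c e \<alpha> * mon 12 \<alpha> v)" by simp_all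
  have "c (fst p) (snd p) = 0" if "p \<in> (SIGMA e:resid. K e)" for p
  proof (rule leading_indep[where K = "SIGMA e:resid. K e" and b = comb
        and g = "\<lambda>p v. mon 12 (fst p) v * mon 12 (snd p) (detmap v)" and c = "\<lambda>p. c (fst p) (snd p)"])
    show "finite (SIGMA e:resid. K e)" using finite_resid K(1) by blast
    show "inj_on comb (SIGMA e:resid. K e)" by (rule inj_on_subset[OF comb_inj]) (use K(2) in auto)
    show "(\<Sum>k\<in>(SIGMA e:resid. K e). c (fst k) (snd k) * (mon 12 (fst k) v * mon 12 (snd k) (detmap v))) = 0" for v
    proof -
      have "(\<Sum>k\<in>(SIGMA e:resid. K e). c (fst k) (snd k) * (mon 12 (fst k) v * mon 12 (snd k) (detmap v)))
          = (\<Sum>e\<in>resid. \<Sum>\<alpha>\<in>K e. c e \<alpha> * (mon 12 e v * mon 12 \<alpha> (detmap v)))"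
        using finite_resid K(1) by (subst sum.Sigma) (auto simp: case_prod_unfold)
      also have "\<dots> = free_comb P v" unfolding free_comb_def
        by (rule sum.cong) (auto simp: K(3) sum_distrib_left algebra_simps)
      finally show ?thesis using 0 by simp
    qed
    show "leads (\<lambda>v. mon 12 (fst k) v * mon 12 (snd k) (detmap v)) (comb k)" if "k \<in> (SIGMA e:resid. K e)" for k
    proof -
      obtain e \<alpha> where k: "k = (e, \<alpha>)" "e \<in> resid" "\<alpha> \<in> K e" using \<open>k \<in> _\<close> by (cases k) auto
      then have "\<alpha> \<in> expos 12" using K(2) by blast
      then show ?thesis using leads_comb k by simp
    qed
  qed (rule that)
  then have "c e \<alpha> = 0" if "\<alpha> \<in> K e" for \<alpha> using that e by force
  then show ?thesis using K(3)[OF e] by simp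
qed

section \<open>The pulled back ideal\<close>

lemma free_comb_cpoly:
  assumes "\<And>e. e \<in> resid \<Longrightarrow> P e \<in> cpoly 12" shows "free_comb P \<in> cpoly 12"
  unfolding free_comb_def[abs_def] by (intro cpoly_sum cpoly_intros mon_cpoly detmap_cpoly assms)

lemma free_comb_cong: "(\<And>e u. e \<in> resid \<Longrightarrow> P e u = Q e u) \<Longrightarrow> free_comb P = free_comb Q"
  by (simp add: free_comb_def fun_eq_iff)

lemma free_comb_add: "free_comb P v + free_comb Q v = free_comb (\<lambda>e u. P e u + Q e u) v"
  by (simp add: free_comb_def sum.distrib algebra_simps)

lemma free_comb_mult: "free_comb P v * Q (detmap v) = free_comb (\<lambda>e u. P e u * Q u) v"
  by (simp add: free_comb_def sum_distrib_right mult.assoc)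

lemma free_comb_sum: "(\<Sum>i\<in>I. free_comb (P i) v) = free_comb (\<lambda>e u. \<Sum>i\<in>I. P i e u) v"
  unfolding free_comb_def by (simp add: sum.swap[of _ I] sum_distrib_left)

lemma free_comb_unique:
  assumes "\<And>e. e \<in> resid \<Longrightarrow> P e \<in> cpoly 12" "\<And>e. e \<in> resid \<Longrightarrow> Q e \<in> cpoly 12"
    "free_comb P = free_comb Q" "e \<in> resid"
  shows "P e u = Q e u"
proof -
  have "(\<lambda>u. P e u + (-1) * Q e u) u = 0"
  proof (rule free_comb_inj[where P = "\<lambda>e u. P e u + (-1) * Q e u"])
    show "free_comb (\<lambda>e u. P e u + (-1) * Q e u) v = 0" for v
    proof -
      have "free_comb (\<lambda>e u. (-1) * Q e u) v = - free_comb Q v" by (simp add: free_comb_def sum_negf)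
      then show ?thesis unfolding free_comb_add[symmetric] assms(3) by simp
    qed
  qed (use assms in \<open>auto intro!: cpoly_intros\<close>)
  then show ?thesis by simp
qed

abbreviation "pulled_ideal \<equiv> ideal3 (cpoly 12) (\<lambda>v. mn1 (detmap v)) (\<lambda>v. mn2 (detmap v)) (\<lambda>v. mn3 (detmap v))"

text \<open>Flat base change by hand: with respect to the free basis the relation splits into
  components, each a syzygy of the minors on the cone, and the solutions are reassembled.\<close>

lemma pulled_syzygies:
  assumes "x \<in> cpoly 12" "y \<in> cpoly 12" "z \<in> cpoly 12"
    and rel: "\<And>v. x v * mn1 (detmap v) + y v * mn2 (detmap v) + z v * mn3 (detmap v) = 0"
  shows "\<exists>p q. p \<in> cpoly 12 \<and> q \<in> cpoly 12 \<and>
    (\<forall>v. x v = p v * cC v + q v * cD v \<and> y v = - p v * cB v - q v * cC v \<and> z v = p v * cA v + q v * cB v)"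
proof -
  obtain X where X: "\<And>e. X e \<in> cpoly 12" "x = free_comb X" using free_comb_span[OF assms(1)] by blast
  obtain Y where Y: "\<And>e. Y e \<in> cpoly 12" "y = free_comb Y" using free_comb_span[OF assms(2)] by blast
  obtain Z where Z: "\<And>e. Z e \<in> cpoly 12" "z = free_comb Z" using free_comb_span[OF assms(3)] by blast
  have "X e u * mn1 u + Y e u * mn2 u + Z e u * mn3 u = 0" if "e \<in> resid" for e u
  proof (rule free_comb_inj[where P = "\<lambda>e u. X e u * mn1 u + Y e u * mn2 u + Z e u * mn3 u", OF _ _ that])
    show "free_comb (\<lambda>e u. X e u * mn1 u + Y e u * mn2 u + Z e u * mn3 u) v = 0" for v
      using rel[of v] unfolding X(2) Y(2) Z(2) free_comb_mult free_comb_add .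
  qed (intro cpoly_intros X Y Z mn_cpoly)
  then have "\<forall>e\<in>resid. \<exists>p q. p \<in> cpoly 12 \<and> q \<in> cpoly 12 \<and>
    (\<forall>u. X e u = p u * u 10 + q u * u 11 \<and> Y e u = - p u * u 9 - q u * u 10 \<and> Z e u = p u * u 8 + q u * u 9)"
    using cone_syzygies[OF X(1) Y(1) Z(1)] by blast
  from bchoice[OF this] obtain P where "\<forall>e\<in>resid. \<exists>q. P e \<in> cpoly 12 \<and> q \<in> cpoly 12 \<and>
    (\<forall>u. X e u = P e u * u 10 + q u * u 11 \<and> Y e u = - P e u * u 9 - q u * u 10 \<and> Z e u = P e u * u 8 + q u * u 9)"
    by blast
  from bchoice[OF this] obtain Q where PQ: "\<forall>e\<in>resid. P e \<in> cpoly 12 \<and> Q e \<in> cpoly 12 \<and>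
    (\<forall>u. X e u = P e u * u 10 + Q e u * u 11 \<and> Y e u = - P e u * u 9 - Q e u * u 10 \<and> Z e u = P e u * u 8 + Q e u * u 9)"
    by blast
  show ?thesis
  proof (intro exI conjI allI)
    show "free_comb P \<in> cpoly 12" "free_comb Q \<in> cpoly 12" using PQ by (auto intro: free_comb_cpoly)
    fix v
    have "x v = free_comb (\<lambda>e u. P e u * u 10 + Q e u * u 11) v" unfolding X(2)
      by (rule fun_cong[OF free_comb_cong]) (use PQ in auto)
    then show "x v = free_comb P v * cC v + free_comb Q v * cD v"
      using free_comb_mult[of P v "\<lambda>u. u 10"] free_comb_mult[of Q v "\<lambda>u. u 11"] by (simp add: free_comb_add)
    have "y v = free_comb (\<lambda>e u. P e u * (- u 9) + Q e u * (- u 10)) v" unfolding Y(2)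
      by (rule fun_cong[OF free_comb_cong]) (use PQ in auto)
    then show "y v = - free_comb P v * cB v - free_comb Q v * cC v"
      using free_comb_mult[of P v "\<lambda>u. - u 9"] free_comb_mult[of Q v "\<lambda>u. - u 10"]
      unfolding free_comb_add[symmetric] by simp
    have "z v = free_comb (\<lambda>e u. P e u * u 8 + Q e u * u 9) v" unfolding Z(2)
      by (rule fun_cong[OF free_comb_cong]) (use PQ in auto)
    then show "z v = free_comb P v * cA v + free_comb Q v * cB v"
      using free_comb_mult[of P v "\<lambda>u. u 8"] free_comb_mult[of Q v "\<lambda>u. u 9"] by (simp add: free_comb_add)
  qed
qed

text \<open>Together with the converse below this describes the ideal by components: all of them
  have to vanish on the cone. Membership in the ideal then comes from
  \<open>cone_ideal_radical\<close>.\<close>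

lemma pulled_ideal_free_comb:
  assumes P: "\<And>e. e \<in> resid \<Longrightarrow> P e \<in> cpoly 12" and 0: "\<And>e w. e \<in> resid \<Longrightarrow> P e (cone_pt w) = 0"
  shows "free_comb P \<in> pulled_ideal"
proof -
  have "(\<lambda>v. mon 12 e v * P e (detmap v)) \<in> pulled_ideal" if e: "e \<in> resid" for e
  proof -
    obtain p q r where pqr: "p \<in> cpoly 12" "q \<in> cpoly 12" "r \<in> cpoly 12" "\<And>u. P e u = p u * mn1 u + q u * mn2 u + r u * mn3 u"
      using ideal3E[OF cone_ideal_radical[OF P[OF e] 0[OF e]]] by metis
    have "(\<lambda>v. P e (detmap v)) \<in> pulled_ideal"
      unfolding pqr(4) by (rule ideal3I[OF detmap_cpoly[OF pqr(1)] detmap_cpoly[OF pqr(2)] detmap_cpoly[OF pqr(3)]]) simp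
    then show ?thesis by (rule ideal3_cpoly(2)) (rule mon_cpoly)
  qed
  then show ?thesis unfolding free_comb_def[abs_def] by (rule ideal3_cpoly)
qed

lemma pulled_ideal_components:
  assumes "f \<in> pulled_ideal"
  shows "\<exists>P. (\<forall>e. P e \<in> cpoly 12) \<and> f = free_comb P \<and> (\<forall>e w. P e (cone_pt w) = 0)"
proof -
  obtain x y z where xyz: "x \<in> cpoly 12" "y \<in> cpoly 12" "z \<in> cpoly 12"
    "\<And>v. f v = x v * mn1 (detmap v) + y v * mn2 (detmap v) + z v * mn3 (detmap v)"
    using ideal3E[OF assms] by metis
  obtain X where X: "\<And>e. X e \<in> cpoly 12" "x = free_comb X" using free_comb_span[OF xyz(1)] by blast
  obtain Y where Y: "\<And>e. Y e \<in> cpoly 12" "y = free_comb Y" using free_comb_span[OF xyz(2)] by blast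
  obtain Z where Z: "\<And>e. Z e \<in> cpoly 12" "z = free_comb Z" using free_comb_span[OF xyz(3)] by blast
  let ?P = "\<lambda>e u. X e u * mn1 u + Y e u * mn2 u + Z e u * mn3 u"
  have "f = free_comb ?P"
    by (rule ext) (simp add: xyz(4) X(2) Y(2) Z(2) free_comb_mult free_comb_add)
  moreover have "?P e \<in> cpoly 12" for e by (intro cpoly_intros X Y Z mn_cpoly)
  ultimately show ?thesis by (intro exI[of _ ?P]) simp
qed

section \<open>Krull intersection\<close>

text \<open>
  The base point: the cubic \<open>y\<^sup>3\<close> (\<open>s = 0\<close>, \<open>t = 1\<close>) and the parameter values at which
  \<open>block_disc\<close> below is invertible modulo the fibre.
\<close>

definition krull_pt :: "nat \<Rightarrow> complex" where
  "krull_pt = (\<lambda>i. if i = 4 \<or> i = 9 then 1 else 0)"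

text \<open>Order of vanishing along every line through the base point. It is measured on the
  parameter space of the cone and replaces powers of a maximal ideal.\<close>

definition vanish_order :: "nat \<Rightarrow> ((nat \<Rightarrow> complex) \<Rightarrow> complex) \<Rightarrow> bool" where
  "vanish_order k g \<longleftrightarrow> (\<forall>u. \<exists>p. \<forall>\<tau>. g (\<lambda>i. krull_pt i + \<tau> * u i) = \<tau> ^ k * poly p \<tau>)"

lemma vanish_order_0: "g \<in> cpoly 10 \<Longrightarrow> vanish_order 0 g"
  unfolding vanish_order_def using cpoly_on_line by simp

lemma vanish_order_1:
  assumes "g \<in> cpoly 10" "g krull_pt = 0" shows "vanish_order 1 g"
  unfolding vanish_order_def
proof
  fix u
  obtain p where p: "\<And>\<tau>. g (\<lambda>i. krull_pt i + \<tau> * u i) = poly p \<tau>" using cpoly_on_line[OF assms(1)] by blast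
  then have "poly p 0 = 0" using assms(2) p[of 0] by simp
  then obtain q where "p = [:0, 1:] * q" using poly_eq_0_iff_dvd[of p 0] by (auto simp: dvd_def)
  then show "\<exists>p. \<forall>\<tau>. g (\<lambda>i. krull_pt i + \<tau> * u i) = \<tau> ^ 1 * poly p \<tau>"
    using p by (intro exI[of _ q]) simp
qed

lemma vanish_order_mult:
  assumes "vanish_order j f" "vanish_order k g" shows "vanish_order (j + k) (\<lambda>x. f x * g x)"
  unfolding vanish_order_def
proof
  fix u
  obtain p q where "\<And>\<tau>. f (\<lambda>i. krull_pt i + \<tau> * u i) = \<tau> ^ j * poly p \<tau>"
    "\<And>\<tau>. g (\<lambda>i. krull_pt i + \<tau> * u i) = \<tau> ^ k * poly q \<tau>" using assms unfolding vanish_order_def by meson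
  then show "\<exists>p. \<forall>\<tau>. f (\<lambda>i. krull_pt i + \<tau> * u i) * g (\<lambda>i. krull_pt i + \<tau> * u i) = \<tau> ^ (j + k) * poly p \<tau>"
    by (intro exI[of _ "p * q"]) (simp add: power_add algebra_simps)
qed

lemma vanish_order_add:
  assumes "vanish_order k f" "vanish_order k g" shows "vanish_order k (\<lambda>x. f x + g x)"
  unfolding vanish_order_def
proof
  fix u
  obtain p q where "\<And>\<tau>. f (\<lambda>i. krull_pt i + \<tau> * u i) = \<tau> ^ k * poly p \<tau>"
    "\<And>\<tau>. g (\<lambda>i. krull_pt i + \<tau> * u i) = \<tau> ^ k * poly q \<tau>" using assms unfolding vanish_order_def by meson
  then show "\<exists>p. \<forall>\<tau>. f (\<lambda>i. krull_pt i + \<tau> * u i) + g (\<lambda>i. krull_pt i + \<tau> * u i) = \<tau> ^ k * poly p \<tau>"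
    by (intro exI[of _ "p + q"]) (simp add: algebra_simps)
qed

lemma vanish_order_zero: "vanish_order k (\<lambda>x. 0)"
  unfolding vanish_order_def by (intro allI exI[of _ 0]) simp

lemma vanish_order_sum: "(\<And>i. i \<in> I \<Longrightarrow> vanish_order k (f i)) \<Longrightarrow> vanish_order k (\<lambda>x. \<Sum>i\<in>I. f i x)"
  by (induction I rule: infinite_finite_induct) (auto intro: vanish_order_zero vanish_order_add)

lemma vanish_order_all:
  assumes "\<And>k. vanish_order k g" shows "g w = 0"
proof -
  define u where "u = (\<lambda>i. w i - krull_pt i)"
  obtain p where p: "\<And>\<tau>. g (\<lambda>i. krull_pt i + \<tau> * u i) = poly p \<tau>"
    using assms[of 0] unfolding vanish_order_def by fastforce
  \<comment> \<open>An order above the degree of \<open>p\<close> forces \<open>p\<close> to be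
    zero.\<close>
  obtain q where q: "\<And>\<tau>. g (\<lambda>i. krull_pt i + \<tau> * u i) = \<tau> ^ Suc (degree p) * poly q \<tau>"
    using assms[of "Suc (degree p)"] unfolding vanish_order_def by blast
  have "poly p = poly (monom 1 (Suc (degree p)) * q)" using p q by (auto simp: fun_eq_iff poly_monom)
  then have eq: "p = monom 1 (Suc (degree p)) * q" by (simp add: poly_eq_poly_eq_iff)
  have "q = 0"
  proof (rule ccontr)
    assume "q \<noteq> 0"
    then have "degree (monom 1 (Suc (degree p)) * q) = Suc (degree p) + degree q"
      by (subst degree_mult_eq) (auto simp: degree_monom_eq)
    then show False using eq by simp
  qed
  then have "poly p 1 = 0" using eq by (metis mult_zero_right poly_0)
  moreover have "(\<lambda>i. krull_pt i + 1 * u i) = w" by (simp add: u_def fun_eq_iff)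
  ultimately show ?thesis using p[of 1] by simp
qed

text \<open>The adic filtration at the base point, expressed by components. Elements of the pulled
  back ideal have components that vanish on the cone, hence lie in every step.\<close>

definition krull_filt :: "nat \<Rightarrow> ((nat \<Rightarrow> complex) \<Rightarrow> complex) set" where
  "krull_filt k = {f. \<exists>P. (\<forall>e\<in>resid. P e \<in> cpoly 12) \<and> f = free_comb P \<and>
     (\<forall>e\<in>resid. vanish_order k (\<lambda>w. P e (cone_pt w)))}"

lemma krull_filtI:
  "(\<And>e. e \<in> resid \<Longrightarrow> P e \<in> cpoly 12) \<Longrightarrow> f = free_comb P \<Longrightarrow>
   (\<And>e. e \<in> resid \<Longrightarrow> vanish_order k (\<lambda>w. P e (cone_pt w))) \<Longrightarrow> f \<in> krull_filt k"
  unfolding krull_filt_def by blast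

lemma krull_filtE:
  assumes "f \<in> krull_filt k"
  obtains P where "\<And>e. e \<in> resid \<Longrightarrow> P e \<in> cpoly 12" "f = free_comb P"
   "\<And>e. e \<in> resid \<Longrightarrow> vanish_order k (\<lambda>w. P e (cone_pt w))"
  using assms unfolding krull_filt_def by blast

lemma krull_filt_0:
  assumes "f \<in> cpoly 12" shows "f \<in> krull_filt 0"
proof -
  obtain P where P: "\<And>e. P e \<in> cpoly 12" "f = free_comb P" using free_comb_span[OF assms] by blast
  show ?thesis by (rule krull_filtI[OF P(1) P(2) vanish_order_0[OF cone_pt_cpoly[OF P(1)]]])
qed

lemma krull_filt_pulled_ideal:
  assumes "f \<in> pulled_ideal" shows "f \<in> krull_filt k"
proof -
  obtain P where P: "\<And>e. P e \<in> cpoly 12" "f = free_comb P" "\<And>e w. P e (cone_pt w) = 0"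
    using pulled_ideal_components[OF assms] by blast
  show ?thesis by (rule krull_filtI[OF P(1) P(2)]) (simp add: P(3) vanish_order_zero)
qed

lemma krull_filt_add:
  assumes "f \<in> krull_filt k" "g \<in> krull_filt k" shows "(\<lambda>v. f v + g v) \<in> krull_filt k"
proof -
  obtain P where P: "\<And>e. e \<in> resid \<Longrightarrow> P e \<in> cpoly 12" "f = free_comb P"
   "\<And>e. e \<in> resid \<Longrightarrow> vanish_order k (\<lambda>w. P e (cone_pt w))" using krull_filtE[OF assms(1)] by metis
  obtain Q where Q: "\<And>e. e \<in> resid \<Longrightarrow> Q e \<in> cpoly 12" "g = free_comb Q"
   "\<And>e. e \<in> resid \<Longrightarrow> vanish_order k (\<lambda>w. Q e (cone_pt w))" using krull_filtE[OF assms(2)] by metis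
  show ?thesis
    by (rule krull_filtI[where P = "\<lambda>e u. P e u + Q e u"])
      (auto intro!: cpoly_intros P Q vanish_order_add simp: P(2) Q(2) free_comb_add fun_eq_iff)
qed

lemma krull_filt_mult:
  assumes "f \<in> krull_filt k" "h \<in> cpoly 12" shows "(\<lambda>v. h v * f v) \<in> krull_filt k"
proof -
  obtain P where P: "\<And>e. e \<in> resid \<Longrightarrow> P e \<in> cpoly 12" "f = free_comb P"
   "\<And>e. e \<in> resid \<Longrightarrow> vanish_order k (\<lambda>w. P e (cone_pt w))" using krull_filtE[OF assms(1)] by metis
  \<comment> \<open>Structure constants: the product of \<open>h\<close> with each basis monomial,
    expanded in the basis again.\<close>
  have "\<forall>e. \<exists>H. (\<forall>e'. H e' \<in> cpoly 12) \<and> (\<lambda>v. h v * mon 12 e v) = free_comb H"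
    using free_comb_span cpoly_intros(8)[OF assms(2) mon_cpoly] by blast
  from choice[OF this] obtain H where H: "\<And>e e'. H e e' \<in> cpoly 12" "\<And>e. (\<lambda>v. h v * mon 12 e v) = free_comb (H e)"
    by blast
  have eq: "h v * f v = free_comb (\<lambda>e' u. \<Sum>e\<in>resid. H e e' u * P e u) v" for v
  proof -
    have "h v * f v = (\<Sum>e\<in>resid. (h v * mon 12 e v) * P e (detmap v))"
      unfolding P(2) free_comb_def by (simp add: sum_distrib_left mult.assoc)
    also have "\<dots> = (\<Sum>e\<in>resid. free_comb (H e) v * P e (detmap v))" using fun_cong[OF H(2)] by simp
    also have "\<dots> = free_comb (\<lambda>e' u. \<Sum>e\<in>resid. H e e' u * P e u) v"
      unfolding free_comb_mult free_comb_sum ..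
    finally show ?thesis .
  qed
  show ?thesis
  proof (rule krull_filtI[where P = "\<lambda>e' u. \<Sum>e\<in>resid. H e e' u * P e u"])
    show "vanish_order k (\<lambda>w. \<Sum>e\<in>resid. H e e' (cone_pt w) * P e (cone_pt w))" for e'
    proof (rule vanish_order_sum)
      fix e assume "e \<in> resid"
      from vanish_order_mult[OF vanish_order_0[OF cone_pt_cpoly[OF H(1)]] P(3)[OF this]]
      show "vanish_order k (\<lambda>w. H e e' (cone_pt w) * P e (cone_pt w))" by simp
    qed
  qed (auto intro!: cpoly_sum cpoly_intros H P simp: eq)
qed

lemma krull_filt_step:
  assumes "f \<in> krull_filt k" "Q \<in> cpoly 12" "Q (cone_pt krull_pt) = 0"
  shows "(\<lambda>v. Q (detmap v) * f v) \<in> krull_filt (Suc k)"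
proof -
  obtain P where P: "\<And>e. e \<in> resid \<Longrightarrow> P e \<in> cpoly 12" "f = free_comb P"
   "\<And>e. e \<in> resid \<Longrightarrow> vanish_order k (\<lambda>w. P e (cone_pt w))" using krull_filtE[OF assms(1)] by metis
  have "vanish_order (k + 1) (\<lambda>w. P e (cone_pt w) * Q (cone_pt w))" if "e \<in> resid" for e
    by (intro vanish_order_mult P that vanish_order_1 cone_pt_cpoly assms)
  moreover have "(\<lambda>v. Q (detmap v) * f v) = free_comb (\<lambda>e u. P e u * Q u)"
    by (rule ext) (simp only: P(2) free_comb_mult[symmetric] mult.commute[of "Q (detmap _)"])
  ultimately show ?thesis
    by (intro krull_filtI[where P = "\<lambda>e u. P e u * Q u"] cpoly_intros P assms) simp_all
qed

lemma krull_filt_Inter: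
  assumes "f \<in> cpoly 12" "\<And>k. f \<in> krull_filt k" shows "f \<in> pulled_ideal"
proof -
  obtain P where P: "\<And>e. P e \<in> cpoly 12" "f = free_comb P" using free_comb_span[OF assms(1)] by blast
  have "P e (cone_pt w) = 0" if e: "e \<in> resid" for e w
  proof (rule vanish_order_all[where g = "\<lambda>w. P e (cone_pt w)"])
    fix k
    obtain Q where Q: "\<And>e. e \<in> resid \<Longrightarrow> Q e \<in> cpoly 12" "f = free_comb Q"
     "\<And>e. e \<in> resid \<Longrightarrow> vanish_order k (\<lambda>w. Q e (cone_pt w))" using krull_filtE[OF assms(2)] by metis
    have "P e u = Q e u" for u by (rule free_comb_unique[OF P(1) Q(1) trans[OF P(2)[symmetric] Q(2)] e])
    then show "vanish_order k (\<lambda>w. P e (cone_pt w))" using Q(3)[OF e] by simp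
  qed
  then show ?thesis unfolding P(2) using P(1) by (intro pulled_ideal_free_comb)
qed

text \<open>Elements that raise the filtration by one step. They include the functions pulled back
  along \<open>detmap\<close> that vanish at the base point, so congruence modulo this ideal serves
  as congruence on the fibre.\<close>

definition krull_ideal :: "((nat \<Rightarrow> complex) \<Rightarrow> complex) set" where
  "krull_ideal = {h \<in> cpoly 12. \<forall>k f. f \<in> krull_filt k \<longrightarrow> (\<lambda>v. h v * f v) \<in> krull_filt (Suc k)}"

lemma krull_idealI:
  "h \<in> cpoly 12 \<Longrightarrow> (\<And>k f. f \<in> krull_filt k \<Longrightarrow> (\<lambda>v. h v * f v) \<in> krull_filt (Suc k)) \<Longrightarrow> h \<in> krull_ideal"
  unfolding krull_ideal_def by simp

lemma krull_idealD:
  "h \<in> krull_ideal \<Longrightarrow> h \<in> cpoly 12" "h \<in> krull_ideal \<Longrightarrow> f \<in> krull_filt k \<Longrightarrow> (\<lambda>v. h v * f v) \<in> krull_filt (Suc k)"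
  unfolding krull_ideal_def by simp_all

lemma krull_ideal_add:
  assumes "h \<in> krull_ideal" "h' \<in> krull_ideal" shows "(\<lambda>v. h v + h' v) \<in> krull_ideal"
proof (rule krull_idealI)
  show "(\<lambda>v. h v + h' v) \<in> cpoly 12" by (intro cpoly_intros krull_idealD assms)
  fix k f assume "f \<in> krull_filt k"
  from krull_filt_add[OF krull_idealD(2)[OF assms(1) this] krull_idealD(2)[OF assms(2) this]]
  show "(\<lambda>v. (h v + h' v) * f v) \<in> krull_filt (Suc k)" by (simp add: distrib_right)
qed

lemma krull_ideal_mult:
  assumes "h \<in> krull_ideal" "a \<in> cpoly 12" shows "(\<lambda>v. a v * h v) \<in> krull_ideal"
proof (rule krull_idealI)
  show "(\<lambda>v. a v * h v) \<in> cpoly 12" by (intro cpoly_intros krull_idealD assms)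
  fix k f assume "f \<in> krull_filt k"
  from krull_filt_mult[OF krull_idealD(2)[OF assms(1) this] assms(2)]
  show "(\<lambda>v. a v * h v * f v) \<in> krull_filt (Suc k)" by (simp add: mult.assoc)
qed

lemma krull_ideal_mult': "h \<in> krull_ideal \<Longrightarrow> a \<in> cpoly 12 \<Longrightarrow> (\<lambda>v. h v * a v) \<in> krull_ideal"
  using krull_ideal_mult[of h a] by (simp add: mult.commute)

lemma krull_ideal_diff: "h \<in> krull_ideal \<Longrightarrow> h' \<in> krull_ideal \<Longrightarrow> (\<lambda>v. h v - h' v) \<in> krull_ideal"
  using krull_ideal_add[of h "\<lambda>v. (-1) * h' v"] krull_ideal_mult[of h' "\<lambda>_. -1"] by (simp add: cpoly_intros)

lemma krull_ideal_gen:
  assumes "Q \<in> cpoly 12" "Q (cone_pt krull_pt) = 0" shows "(\<lambda>v. Q (detmap v)) \<in> krull_ideal"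
  by (intro krull_idealI krull_filt_step detmap_cpoly assms)

text \<open>In f = (1 - D g) f + g (D f) the first summand gains one order and the second lies in
  every step of the filtration. By induction \<open>f\<close> does too.\<close>

lemma non_zero_divisor:
  assumes D: "D \<in> cpoly 12" and g: "g \<in> cpoly 12" and inv: "(\<lambda>v. 1 - D v * g v) \<in> krull_ideal"
    and f: "f \<in> cpoly 12" and Df: "(\<lambda>v. D v * f v) \<in> pulled_ideal"
  shows "f \<in> pulled_ideal"
proof (rule krull_filt_Inter[OF f])
  fix k show "f \<in> krull_filt k"
  proof (induction k)
    case 0 show ?case using f by (rule krull_filt_0)
  next
    case (Suc k)
    have "(\<lambda>v. (1 - D v * g v) * f v) \<in> krull_filt (Suc k)"
      by (rule krull_idealD(2)[OF inv Suc])
    moreover have "(\<lambda>v. g v * (D v * f v)) \<in> krull_filt (Suc k)"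
      by (rule krull_filt_mult[OF krull_filt_pulled_ideal[OF Df] g])
    ultimately have "(\<lambda>v. (1 - D v * g v) * f v + g v * (D v * f v)) \<in> krull_filt (Suc k)"
      by (rule krull_filt_add)
    moreover have "(1 - D v * g v) * f v + g v * (D v * f v) = f v" for v by (simp add: algebra_simps)
    ultimately show ?case by simp
  qed
qed

text \<open>\<open>block0\<close>, \<open>block1\<close> and \<open>block2\<close> are the
  coefficients of x^2, xy and y^2 in the determinant of the lower right block of x times the first
  matrix plus y times the second.\<close>

definition block0 :: "(nat \<Rightarrow> complex) \<Rightarrow> complex" where "block0 v = (v 8 + v 4) * v 10 - (v 9)\<^sup>2"
definition block1 :: "(nat \<Rightarrow> complex) \<Rightarrow> complex" where "block1 v = (v 8 + v 4) * v 7 + (v 11 + v 5) * v 10 - 2 * v 9 * v 6"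
definition block2 :: "(nat \<Rightarrow> complex) \<Rightarrow> complex" where "block2 v = (v 11 + v 5) * v 7 - (v 6)\<^sup>2"

text \<open>The discriminant of the determinant of the lower right \<open>2 \<times> 2\<close> block of the pencil.\<close>

definition block_disc :: "(nat \<Rightarrow> complex) \<Rightarrow> complex" where
  "block_disc v = (block1 v)\<^sup>2 - 4 * block0 v * block2 v"

lemma block_cpoly: "block0 \<in> cpoly 12" "block1 \<in> cpoly 12" "block2 \<in> cpoly 12" "block_disc \<in> cpoly 12"
proof -
  show *: "block0 \<in> cpoly 12" "block1 \<in> cpoly 12" "block2 \<in> cpoly 12"
    unfolding block0_def[abs_def] block1_def[abs_def] block2_def[abs_def] by (intro cpoly_intros; simp)+
  show "block_disc \<in> cpoly 12"
    unfolding block_disc_def[abs_def] by (intro cpoly_intros *)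
qed

lemma block_disc_nzd:
  assumes f: "f \<in> cpoly 12" and Df: "(\<lambda>v. block_disc v * f v) \<in> pulled_ideal"
  shows "f \<in> pulled_ideal"
proof -
  note ci = krull_ideal_add krull_ideal_diff krull_ideal_mult'
  have y: "(\<lambda>v. v i) \<in> krull_ideal" if "i < 8" "i \<noteq> 4" for i
    using krull_ideal_gen[of "\<lambda>u. u i"] that by (simp add: cpoly_intros cone_pt_def krull_pt_def)
  have y4: "(\<lambda>v. v 4 - 1) \<in> krull_ideal"
    using krull_ideal_gen[of "\<lambda>u. u 4 - 1"] by (simp add: cpoly_intros cone_pt_def krull_pt_def)
  have A: "cA \<in> krull_ideal" and C: "cC \<in> krull_ideal" and D: "(\<lambda>v. cD v - 1) \<in> krull_ideal"
    using krull_ideal_gen[of "\<lambda>u. u 8"] krull_ideal_gen[of "\<lambda>u. u 10"] krull_ideal_gen[of "\<lambda>u. u 11 - 1"]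
    by (simp_all add: cpoly_intros cone_pt_def krull_pt_def)
  have y1: "(\<lambda>v. v 1) \<in> krull_ideal" by (rule y) simp_all
  note y' = y[of 0, simplified] y1 y[of 2, simplified] y[of 3, simplified]
    y[of 5, simplified] y[of 6, simplified] y[of 7, simplified] y4
  \<comment> \<open>Each relation of the fibre starts as a visible combination of members of the
    ideal, so that the closure rules give membership; a polynomial identity then reveals the reduced
    form.\<close>
  have "(\<lambda>v. (v 0 * ((v 8 + v 4) * v 10 - (v 9)\<^sup>2) + v 2 * (2 * v 9 * v 8 - v 10 * v 2) - (v 4 - 1) * (v 8)\<^sup>2) - cA v) \<in> krull_ideal"
    by (intro y' A ci cpoly_intros; simp)
  moreover have "(v 0 * ((v 8 + v 4) * v 10 - (v 9)\<^sup>2) + v 2 * (2 * v 9 * v 8 - v 10 * v 2) - (v 4 - 1) * (v 8)\<^sup>2) - cA v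
      = v 8 ^ 3 + (v 8)\<^sup>2" for v
    unfolding cA_def sdet_def by algebra
  ultimately have k1: "(\<lambda>v. v 8 ^ 3 + (v 8)\<^sup>2) \<in> krull_ideal" by (simp only:)
  have "(\<lambda>v. (v 5 * ((v 1 + v 9) * v 7 - (v 11)\<^sup>2) + v 6 * (2 * (v 10 + v 3) * v 11 - (v 1 + v 9) * v 6)
      + v 7 * ((v 1 + v 9) * v 11 - (v 10 + v 3)\<^sup>2)) - (cD v - 1)) \<in> krull_ideal"
    by (intro y' D ci cpoly_intros; simp)
  moreover have "(v 5 * ((v 1 + v 9) * v 7 - (v 11)\<^sup>2) + v 6 * (2 * (v 10 + v 3) * v 11 - (v 1 + v 9) * v 6)
      + v 7 * ((v 1 + v 9) * v 11 - (v 10 + v 3)\<^sup>2)) - (cD v - 1) = v 11 ^ 3 + 1" for v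
    unfolding cD_def sdet_def by algebra
  ultimately have k3: "(\<lambda>v. v 11 ^ 3 + 1) \<in> krull_ideal" by (simp only:)
  let ?X = "\<lambda>v. v 0 * ((v 11 + v 5) * v 7 - (v 6)\<^sup>2) + v 2 * (2 * (v 6 * v 11 - (v 10 + v 3) * v 7))
     + v 6 * (2 * v 8 * (v 10 + v 3) - 2 * v 9 * (v 1 + v 9)) + v 5 * (v 10 * v 9 - 2 * v 8 * v 11) + v 7 * ((v 8 + v 4) * (v 1 + v 9))
     - (v 4 - 1) * (v 11)\<^sup>2 + v 3 * (2 * v 9 * v 11 - v 10 * (2 * v 10 + v 3)) + v 1 * (v 10 * (v 11 + v 5))"
  have "(\<lambda>v. ?X v - cC v * 3) \<in> krull_ideal"
    by (intro y' C ci cpoly_intros; simp)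
  moreover have "?X v - cC v * 3 = 3 * v 8 * (v 11)\<^sup>2 + (v 11)\<^sup>2 - 3 * v 9 * v 10 * v 11 + v 10 ^ 3" for v
    unfolding cC_def spol_def by (simp add: field_simps) algebra
  ultimately have k2: "(\<lambda>v. 3 * v 8 * (v 11)\<^sup>2 + (v 11)\<^sup>2 - 3 * v 9 * v 10 * v 11 + v 10 ^ 3) \<in> krull_ideal" by (simp only:)
  let ?E = "\<lambda>v. v 7 * (v 8 + v 4) + v 5 * v 10 - v 6 * (2 * v 9)"
  have "(\<lambda>v. ?E v * (2 * (v 10 * v 11) + ?E v) - (v 7 * (v 11 + v 5) - v 6 * v 6) * (4 * block0 v)) \<in> krull_ideal"
    by (intro y' ci cpoly_intros block_cpoly; simp)
  moreover have "?E v * (2 * (v 10 * v 11) + ?E v) - (v 7 * (v 11 + v 5) - v 6 * v 6) * (4 * block0 v)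
     = block_disc v - (v 10 * v 11)\<^sup>2" for v
    unfolding block_disc_def block1_def block2_def by algebra
  ultimately have kD: "(\<lambda>v. block_disc v - (v 10 * v 11)\<^sup>2) \<in> krull_ideal" by (simp only:)
  define h where "h = (\<lambda>v::nat\<Rightarrow>complex. (3 * v 9 * v 11 - (v 10)\<^sup>2) * (3 - (3 * v 8 + 1)\<^sup>2))"
  have h: "h \<in> cpoly 12" unfolding h_def by (intro cpoly_intros; simp)
  \<comment> \<open>With \<open>e = 3 v\<^sub>8 + 1\<close> the relations give \<open>e \<equiv> - v\<^sub>1\<^sub>0 v\<^sub>1\<^sub>1 (3 v\<^sub>9 v\<^sub>1\<^sub>1 - v\<^sub>1\<^sub>0\<^sup>2)\<close> and \<open>e (3 - e\<^sup>2) \<equiv> 2\<close>.\<close>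
  let ?r = "\<lambda>v. ((v 11 ^ 3 + 1) * (3 * v 8 + 1) - (3 * v 8 * (v 11)\<^sup>2 + (v 11)\<^sup>2 - 3 * v 9 * v 10 * v 11 + v 10 ^ 3) * v 11) * (3 - (3 * v 8 + 1)\<^sup>2)
     + (v 8 ^ 3 + (v 8)\<^sup>2) * 27"
  have r: "?r \<in> krull_ideal" by (intro k1 k2 k3 ci cpoly_intros; simp)
  have re: "?r v = 2 + v 10 * v 11 * h v" for v unfolding h_def by algebra
  \<comment> \<open>Since \<open>v 10 * v 11 * h v\<close> is congruent to -2, its square is
    congruent to 4. As \<open>block_disc\<close> is congruent to the square of
    \<open>v 10 * v 11\<close>, a quarter of the square of \<open>h\<close> inverts it.\<close>
  have "(\<lambda>v. (2 + v 10 * v 11 * h v) * ((2 - v 10 * v 11 * h v) * (1/4)) - (block_disc v - (v 10 * v 11)\<^sup>2) * ((1/4) * (h v)\<^sup>2)) \<in> krull_ideal"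
    by (intro kD r[unfolded re] ci cpoly_intros h; simp)
  moreover have "(2 + v 10 * v 11 * h v) * ((2 - v 10 * v 11 * h v) * (1/4)) - (block_disc v - (v 10 * v 11)\<^sup>2) * ((1/4) * (h v)\<^sup>2)
     = 1 - block_disc v * ((h v)\<^sup>2 / 4)" for v by (simp add: field_simps power2_eq_square)
  ultimately have inv: "(\<lambda>v. 1 - block_disc v * ((h v)\<^sup>2 / 4)) \<in> krull_ideal" by (simp only:)
  show ?thesis
    by (rule non_zero_divisor[OF block_cpoly(4) _ inv f Df]) (intro cpoly_intros h)
qed

section \<open>Generic solution for the entry outside the block\<close>

definition indep01 :: "((nat \<Rightarrow> complex) \<Rightarrow> complex) set" where
  "indep01 = {f \<in> cpoly 12. \<forall>v x y. f (v(0 := x, 1 := y)) = f v}"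

lemma indep01_intros:
  "(\<lambda>_. c) \<in> indep01" "2 \<le> i \<Longrightarrow> i < 12 \<Longrightarrow> (\<lambda>v. v i) \<in> indep01"
  "f \<in> indep01 \<Longrightarrow> g \<in> indep01 \<Longrightarrow> (\<lambda>v. f v + g v) \<in> indep01"
  "f \<in> indep01 \<Longrightarrow> g \<in> indep01 \<Longrightarrow> (\<lambda>v. f v - g v) \<in> indep01"
  "f \<in> indep01 \<Longrightarrow> (\<lambda>v. - f v) \<in> indep01"
  "f \<in> indep01 \<Longrightarrow> (\<lambda>v. f v ^ n) \<in> indep01"
  "f \<in> indep01 \<Longrightarrow> g \<in> indep01 \<Longrightarrow> (\<lambda>v. f v * g v) \<in> indep01"
  unfolding indep01_def by (auto intro: cpoly_intros)

lemma indep01_cpoly: "f \<in> indep01 \<Longrightarrow> f \<in> cpoly 12"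
  unfolding indep01_def by simp

text \<open>Coordinates 0 and 1 give the upper left entries of the two matrices (the second one
  shifted by \<open>v 9\<close>), in which the determinant is affine.\<close>

definition affine01 :: "((nat \<Rightarrow> complex) \<Rightarrow> complex) set" where
  "affine01 = {(\<lambda>v. f0 v + f1 v * v 0 + f2 v * v 1) | f0 f1 f2. f0 \<in> indep01 \<and> f1 \<in> indep01 \<and> f2 \<in> indep01}"

lemma affine01I:
  "f0 \<in> indep01 \<Longrightarrow> f1 \<in> indep01 \<Longrightarrow> f2 \<in> indep01 \<Longrightarrow> (\<And>v. f v = f0 v + f1 v * v 0 + f2 v * v 1) \<Longrightarrow> f \<in> affine01"
  unfolding affine01_def by blast

lemma affine01E:
  assumes "f \<in> affine01"
  obtains f0 f1 f2 where "f0 \<in> indep01" "f1 \<in> indep01" "f2 \<in> indep01" "\<And>v. f v = f0 v + f1 v * v 0 + f2 v * v 1"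
  using assms unfolding affine01_def by blast

lemma affine01_add:
  assumes "f \<in> affine01" "g \<in> affine01" shows "(\<lambda>v. f v + g v) \<in> affine01"
proof -
  obtain f0 f1 f2 where f: "f0 \<in> indep01" "f1 \<in> indep01" "f2 \<in> indep01" "\<And>v. f v = f0 v + f1 v * v 0 + f2 v * v 1"
    using affine01E[OF assms(1)] by metis
  obtain g0 g1 g2 where g: "g0 \<in> indep01" "g1 \<in> indep01" "g2 \<in> indep01" "\<And>v. g v = g0 v + g1 v * v 0 + g2 v * v 1"
    using affine01E[OF assms(2)] by metis
  show ?thesis
    by (rule affine01I[of "\<lambda>v. f0 v + g0 v" "\<lambda>v. f1 v + g1 v" "\<lambda>v. f2 v + g2 v"])
      (auto intro: indep01_intros f g simp: f(4) g(4) algebra_simps)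
qed

lemma affine01_mult:
  assumes "f \<in> affine01" "g \<in> indep01" shows "(\<lambda>v. g v * f v) \<in> affine01"
proof -
  obtain f0 f1 f2 where f: "f0 \<in> indep01" "f1 \<in> indep01" "f2 \<in> indep01" "\<And>v. f v = f0 v + f1 v * v 0 + f2 v * v 1"
    using affine01E[OF assms(1)] by metis
  show ?thesis
    by (rule affine01I[of "\<lambda>v. g v * f0 v" "\<lambda>v. g v * f1 v" "\<lambda>v. g v * f2 v"])
      (auto intro: indep01_intros f assms simp: f(4) algebra_simps)
qed

lemma indep01_affine01: "f \<in> indep01 \<Longrightarrow> f \<in> affine01"
  by (rule affine01I[of f "\<lambda>_. 0" "\<lambda>_. 0"]) (auto intro: indep01_intros)

lemma block_indep01: "block0 \<in> indep01" "block1 \<in> indep01" "block2 \<in> indep01" "block_disc \<in> indep01"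
proof -
  show *: "block0 \<in> indep01" "block1 \<in> indep01" "block2 \<in> indep01"
    unfolding block0_def[abs_def] block1_def[abs_def] block2_def[abs_def] by (intro indep01_intros; simp)+
  show "block_disc \<in> indep01"
    unfolding block_disc_def[abs_def] by (intro indep01_intros *)
qed

text \<open>The upper left entry of a 3x3 matrix occurs in the determinant with the complementary
  minor as coefficient. The terms with \<open>v 9\<close> in \<open>?E1\<close>, \<open>?E2\<close>,
  \<open>?E3\<close> come from the entry being \<open>v 1 + v 9\<close>.\<close>

lemma coeff_affine:
  obtains E0 E1 E2 E3 where "E0 \<in> indep01" "E1 \<in> indep01" "E2 \<in> indep01" "E3 \<in> indep01"
    "\<And>v. cA v = v 0 * block0 v + E0 v" "\<And>v. 3 * cB v = v 0 * block1 v + v 1 * block0 v + E1 v"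
    "\<And>v. 3 * cC v = v 0 * block2 v + v 1 * block1 v + E2 v" "\<And>v. cD v = v 1 * block2 v + E3 v"
proof
  let ?E0 = "\<lambda>v. 2 * v 2 * v 9 * v 8 - (v 8 + v 4) * (v 8)\<^sup>2 - v 10 * (v 2)\<^sup>2 :: complex"
  let ?E1 = "\<lambda>v. v 9 * block0 v + 2 * (v 10 + v 3) * (v 9 * v 8 - v 2 * v 10) + 2 * v 11 * (v 2 * v 9 - (v 8 + v 4) * v 8)
      - (v 11 + v 5) * (v 8)\<^sup>2 + 2 * v 6 * (v 2 * v 8) - v 7 * (v 2)\<^sup>2"
  let ?E2 = "\<lambda>v. v 9 * block1 v + 2 * v 2 * (v 6 * v 11 - (v 10 + v 3) * v 7) + 2 * v 8 * ((v 10 + v 3) * v 6 - (v 11 + v 5) * v 11)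
      - (v 8 + v 4) * (v 11)\<^sup>2 + 2 * v 9 * ((v 10 + v 3) * v 11) - v 10 * (v 10 + v 3)\<^sup>2"
  let ?E3 = "\<lambda>v. v 9 * block2 v + 2 * (v 10 + v 3) * v 6 * v 11 - (v 11 + v 5) * (v 11)\<^sup>2 - v 7 * (v 10 + v 3)\<^sup>2"
  show "?E0 \<in> indep01" "?E1 \<in> indep01" "?E2 \<in> indep01" "?E3 \<in> indep01"
    by (intro indep01_intros block_indep01; simp)+
  show "cA v = v 0 * block0 v + ?E0 v" for v unfolding cA_def sdet_def block0_def by algebra
  show "cD v = v 1 * block2 v + ?E3 v" for v unfolding cD_def sdet_def block2_def by algebra
  show "3 * cB v = v 0 * block1 v + v 1 * block0 v + ?E1 v" for v
    unfolding cB_def spol_def block0_def block1_def by (simp add: field_simps power2_eq_square)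
  show "3 * cC v = v 0 * block2 v + v 1 * block1 v + ?E2 v" for v
    unfolding cC_def spol_def block2_def block1_def by (simp add: field_simps power2_eq_square)
qed

text \<open>Cramer's rule with the adjugate written out, the affine parts \<open>L1\<close>,
  \<open>L2\<close>, \<open>L3\<close> being carried along.\<close>

lemma solve_3x3:
  fixes X :: complex
  assumes "Q1 = a1 * X + b1 * Y + c1 * Z + L1" "Q2 = a2 * X + b2 * Y + c2 * Z + L2" "Q3 = a3 * X + b3 * Y + c3 * Z + L3"
    and "\<Delta> = a1 * (b2 * c3 - c2 * b3) - b1 * (a2 * c3 - c2 * a3) + c1 * (a2 * b3 - b2 * a3)"
  shows "\<Delta> * X + ((b2 * c3 - c2 * b3) * L1 + (c1 * b3 - b1 * c3) * L2 + (b1 * c2 - c1 * b2) * L3)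
      = (b2 * c3 - c2 * b3) * Q1 + (c1 * b3 - b1 * c3) * Q2 + (b1 * c2 - c1 * b2) * Q3"
    "\<Delta> * Y + ((c2 * a3 - a2 * c3) * L1 + (a1 * c3 - c1 * a3) * L2 + (c1 * a2 - a1 * c2) * L3)
      = (c2 * a3 - a2 * c3) * Q1 + (a1 * c3 - c1 * a3) * Q2 + (c1 * a2 - a1 * c2) * Q3"
    "\<Delta> * Z + ((a2 * b3 - b2 * a3) * L1 + (b1 * a3 - a1 * b3) * L2 + (a1 * b2 - b1 * a2) * L3)
      = (a2 * b3 - b2 * a3) * Q1 + (b1 * a3 - a1 * b3) * Q2 + (a1 * b2 - b1 * a2) * Q3"
  using assms by algebra+

text \<open>
  Once the block is fixed the determinant depends affinely on the two remaining entries, and the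
  three minors are quadrics in them whose leading forms are independent unless \<open>block_disc\<close>
  vanishes.
\<close>

lemma quadratic_reduction:
  obtains gX gY gZ where "gX \<in> affine01" "gY \<in> affine01" "gZ \<in> affine01"
    "(\<lambda>v. block_disc v ^ 3 * (v 0 * v 0) - gX v) \<in> pulled_ideal"
    "(\<lambda>v. block_disc v ^ 3 * (v 0 * v 1) - gY v) \<in> pulled_ideal"
    "(\<lambda>v. block_disc v ^ 3 * (v 1 * v 1) - gZ v) \<in> pulled_ideal"
proof -
  note found = that
  obtain E0 E1 E2 E3 where E: "E0 \<in> indep01" "E1 \<in> indep01" "E2 \<in> indep01" "E3 \<in> indep01"
    and e: "\<And>v. cA v = v 0 * block0 v + E0 v" "\<And>v. 3 * cB v = v 0 * block1 v + v 1 * block0 v + E1 v"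
    "\<And>v. 3 * cC v = v 0 * block2 v + v 1 * block1 v + E2 v" "\<And>v. cD v = v 1 * block2 v + E3 v"
    by (rule coeff_affine) blast
  \<comment> \<open>The coefficients of the three quadratic monomials in 9 times the minors; the
    factor 9 clears the thirds in \<open>cB\<close> and \<open>cC\<close>.\<close>
  define a1 b1 c1 where "a1 = (\<lambda>v. 3 * block0 v * block2 v - (block1 v)\<^sup>2)" and "b1 = (\<lambda>v. block0 v * block1 v)" and "c1 = (\<lambda>v. - (block0 v)\<^sup>2)"
  define a2 b2 c2 where "a2 = (\<lambda>v. - (block1 v * block2 v))" and "b2 = (\<lambda>v. 8 * block0 v * block2 v - (block1 v)\<^sup>2)" and "c2 = (\<lambda>v. - (block0 v * block1 v))"
  define a3 b3 c3 where "a3 = (\<lambda>v. - (block2 v)\<^sup>2)" and "b3 = (\<lambda>v. block1 v * block2 v)" and "c3 = (\<lambda>v. 3 * block0 v * block2 v - (block1 v)\<^sup>2)"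
  have co: "a1 \<in> indep01" "b1 \<in> indep01" "c1 \<in> indep01" "a2 \<in> indep01" "b2 \<in> indep01" "c2 \<in> indep01" "a3 \<in> indep01" "b3 \<in> indep01" "c3 \<in> indep01"
    unfolding a1_def b1_def c1_def a2_def b2_def c2_def a3_def b3_def c3_def
    by (intro indep01_intros block_indep01)+
  define L1 where "L1 = (\<lambda>v. (3 * E0 v * E2 v - (E1 v)\<^sup>2) + (3 * E0 v * block2 v + 3 * E2 v * block0 v - 2 * E1 v * block1 v) * v 0
     + (3 * E0 v * block1 v - 2 * E1 v * block0 v) * v 1)"
  define L2 where "L2 = (\<lambda>v. (9 * E0 v * E3 v - E1 v * E2 v) + (9 * block0 v * E3 v - block1 v * E2 v - E1 v * block2 v) * v 0
     + (9 * E0 v * block2 v - block0 v * E2 v - E1 v * block1 v) * v 1)"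
  define L3 where "L3 = (\<lambda>v. (3 * E1 v * E3 v - (E2 v)\<^sup>2) + (3 * block1 v * E3 v - 2 * block2 v * E2 v) * v 0
     + (3 * block0 v * E3 v + 3 * E1 v * block2 v - 2 * block1 v * E2 v) * v 1)"
  have L: "L1 \<in> affine01" "L2 \<in> affine01" "L3 \<in> affine01"
    unfolding L1_def L2_def L3_def
    by (rule affine01I[OF _ _ _ refl]; intro indep01_intros block_indep01 E)+
  have Q: "9 * mn1 (detmap v) = a1 v * (v 0 * v 0) + b1 v * (v 0 * v 1) + c1 v * (v 1 * v 1) + L1 v"
    "9 * mn2 (detmap v) = a2 v * (v 0 * v 0) + b2 v * (v 0 * v 1) + c2 v * (v 1 * v 1) + L2 v"
    "9 * mn3 (detmap v) = a3 v * (v 0 * v 0) + b3 v * (v 0 * v 1) + c3 v * (v 1 * v 1) + L3 v" for v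
    unfolding mn1_def mn2_def mn3_def detmap_simps a1_def b1_def c1_def a2_def b2_def c2_def a3_def b3_def c3_def L1_def L2_def L3_def
    using e[of v] by algebra+
  \<comment> \<open>The determinant of the leading forms is a power of the discriminant, which is
    why inverting \<open>block_disc\<close> suffices.\<close>
  have det: "- (block_disc v ^ 3) = a1 v * (b2 v * c3 v - c2 v * b3 v) - b1 v * (a2 v * c3 v - c2 v * a3 v) + c1 v * (a2 v * b3 v - b2 v * a3 v)" for v
    unfolding block_disc_def a1_def b1_def c1_def a2_def b2_def c2_def a3_def b3_def c3_def by algebra
  note S = solve_3x3[OF Q det]
  have gen: thesis if "p1 \<in> indep01" "p2 \<in> indep01" "p3 \<in> indep01" "q1 \<in> indep01" "q2 \<in> indep01" "q3 \<in> indep01"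
     "r1 \<in> indep01" "r2 \<in> indep01" "r3 \<in> indep01"
    and "\<And>v. - (block_disc v ^ 3) * (v 0 * v 0) + (p1 v * L1 v + p2 v * L2 v + p3 v * L3 v)
       = p1 v * (9 * mn1 (detmap v)) + p2 v * (9 * mn2 (detmap v)) + p3 v * (9 * mn3 (detmap v))"
      "\<And>v. - (block_disc v ^ 3) * (v 0 * v 1) + (q1 v * L1 v + q2 v * L2 v + q3 v * L3 v)
       = q1 v * (9 * mn1 (detmap v)) + q2 v * (9 * mn2 (detmap v)) + q3 v * (9 * mn3 (detmap v))"
      "\<And>v. - (block_disc v ^ 3) * (v 1 * v 1) + (r1 v * L1 v + r2 v * L2 v + r3 v * L3 v)
       = r1 v * (9 * mn1 (detmap v)) + r2 v * (9 * mn2 (detmap v)) + r3 v * (9 * mn3 (detmap v))" for p1 p2 p3 q1 q2 q3 r1 r2 r3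
  proof -
    have ideal: "(\<lambda>v. block_disc v ^ 3 * t v - (p1 v * L1 v + p2 v * L2 v + p3 v * L3 v)) \<in> pulled_ideal"
      if p: "p1 \<in> indep01" "p2 \<in> indep01" "p3 \<in> indep01" and
        eq: "\<And>v. - (block_disc v ^ 3) * t v + (p1 v * L1 v + p2 v * L2 v + p3 v * L3 v)
       = p1 v * (9 * mn1 (detmap v)) + p2 v * (9 * mn2 (detmap v)) + p3 v * (9 * mn3 (detmap v))" for p1 p2 p3 t
    proof (rule ideal3I)
      show "(\<lambda>v. (-9) * p1 v) \<in> cpoly 12" "(\<lambda>v. (-9) * p2 v) \<in> cpoly 12" "(\<lambda>v. (-9) * p3 v) \<in> cpoly 12"
        by (intro cpoly_intros indep01_cpoly p)+
      show "block_disc v ^ 3 * t v - (p1 v * L1 v + p2 v * L2 v + p3 v * L3 v)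
        = (-9) * p1 v * mn1 (detmap v) + (-9) * p2 v * mn2 (detmap v) + (-9) * p3 v * mn3 (detmap v)" for v
        using eq[of v] by algebra
    qed
    have aff: "(\<lambda>v. p1 v * L1 v + p2 v * L2 v + p3 v * L3 v) \<in> affine01" if "p1 \<in> indep01" "p2 \<in> indep01" "p3 \<in> indep01" for p1 p2 p3
      using that by (intro affine01_add affine01_mult L)
    show thesis
      by (rule found[of "\<lambda>v. p1 v * L1 v + p2 v * L2 v + p3 v * L3 v" "\<lambda>v. q1 v * L1 v + q2 v * L2 v + q3 v * L3 v"
            "\<lambda>v. r1 v * L1 v + r2 v * L2 v + r3 v * L3 v"]; (rule aff ideal; fact)?)
  qed
  show thesis
    by (rule gen[OF _ _ _ _ _ _ _ _ _ S]; intro indep01_intros co)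
qed

text \<open>Induction over the construction of \<open>f\<close>. A product of two affine functions
  is quadratic in the two entries, and \<open>quadratic_reduction\<close> makes it affine at the
  cost of three further powers of \<open>block_disc\<close>.\<close>

lemma generic_reduction:
  assumes "f \<in> cpoly 12"
  shows "\<exists>k g. g \<in> affine01 \<and> (\<lambda>v. block_disc v ^ k * f v - g v) \<in> pulled_ideal"
  using assms
proof (induction rule: cpoly_induct)
  case (const c)
  show ?case
    by (rule exI[of _ 0], rule exI[of _ "\<lambda>_. c"]) (auto intro: indep01_affine01 indep01_intros ideal3_cpoly)
next
  case (var i)
  have "(\<lambda>v. v i) \<in> affine01"
  proof -
    consider "i = 0" | "i = 1" | "2 \<le> i" by linarith
    then show ?thesis
    proof cases
      case 1 then show ?thesis by (intro affine01I[of "\<lambda>_. 0" "\<lambda>_. 1" "\<lambda>_. 0"] indep01_intros) simp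
    next
      case 2 then show ?thesis by (intro affine01I[of "\<lambda>_. 0" "\<lambda>_. 0" "\<lambda>_. 1"] indep01_intros) simp
    next
      case 3 with var show ?thesis by (intro indep01_affine01 indep01_intros)
    qed
  qed
  then show ?case by (intro exI[of _ 0] exI[of _ "\<lambda>v. v i"]) (simp add: ideal3_cpoly)
next
  case (add a b)
  then obtain k g l h where g: "g \<in> affine01" "(\<lambda>v. block_disc v ^ k * a v - g v) \<in> pulled_ideal"
    and h: "h \<in> affine01" "(\<lambda>v. block_disc v ^ l * b v - h v) \<in> pulled_ideal" by blast
  let ?g = "\<lambda>v. block_disc v ^ l * g v + block_disc v ^ k * h v"
  have "?g \<in> affine01" by (intro affine01_add affine01_mult indep01_intros block_indep01 g h)
  moreover have "(\<lambda>v. block_disc v ^ l * (block_disc v ^ k * a v - g v) + block_disc v ^ k * (block_disc v ^ l * b v - h v)) \<in> pulled_ideal"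
    by (intro ideal3_cpoly(1) ideal3_cpoly(2)[OF g(2)] ideal3_cpoly(2)[OF h(2)] cpoly_intros block_cpoly)
  moreover have "block_disc v ^ l * (block_disc v ^ k * a v - g v) + block_disc v ^ k * (block_disc v ^ l * b v - h v)
     = block_disc v ^ (k + l) * (a v + b v) - ?g v" for v
    by (simp add: power_add algebra_simps)
  ultimately show ?case by (intro exI[of _ "k + l"] exI[of _ ?g]) simp
next
  case (mult a b)
  then obtain k g l h where g: "g \<in> affine01" "(\<lambda>v. block_disc v ^ k * a v - g v) \<in> pulled_ideal"
    and h: "h \<in> affine01" "(\<lambda>v. block_disc v ^ l * b v - h v) \<in> pulled_ideal" by blast
  obtain g0 g1 g2 where gi: "g0 \<in> indep01" "g1 \<in> indep01" "g2 \<in> indep01" "\<And>v. g v = g0 v + g1 v * v 0 + g2 v * v 1"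
    using affine01E[OF g(1)] by metis
  obtain h0 h1 h2 where hi: "h0 \<in> indep01" "h1 \<in> indep01" "h2 \<in> indep01" "\<And>v. h v = h0 v + h1 v * v 0 + h2 v * v 1"
    using affine01E[OF h(1)] by metis
  obtain gX gY gZ where q: "gX \<in> affine01" "gY \<in> affine01" "gZ \<in> affine01"
    "(\<lambda>v. block_disc v ^ 3 * (v 0 * v 0) - gX v) \<in> pulled_ideal"
    "(\<lambda>v. block_disc v ^ 3 * (v 0 * v 1) - gY v) \<in> pulled_ideal"
    "(\<lambda>v. block_disc v ^ 3 * (v 1 * v 1) - gZ v) \<in> pulled_ideal"
    by (rule quadratic_reduction) blast
  define A where "A = (\<lambda>v. g0 v * h0 v + (g0 v * h1 v + g1 v * h0 v) * v 0 + (g0 v * h2 v + g2 v * h0 v) * v 1)"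
  have A: "A \<in> affine01" unfolding A_def by (rule affine01I[OF _ _ _ refl]; intro indep01_intros gi hi)
  let ?g = "\<lambda>v. block_disc v ^ 3 * A v + (g1 v * h1 v * gX v + (g1 v * h2 v + g2 v * h1 v) * gY v + g2 v * h2 v * gZ v)"
  have g_aff: "?g \<in> affine01" by (intro affine01_add affine01_mult indep01_intros block_indep01 A q gi hi)
  have hc: "h \<in> cpoly 12" unfolding hi(4)[abs_def] by (intro cpoly_intros indep01_cpoly hi; simp)
  have "(\<lambda>v. block_disc v ^ 3 * (block_disc v ^ l * b v * (block_disc v ^ k * a v - g v) + g v * (block_disc v ^ l * b v - h v))
     + (g1 v * h1 v * (block_disc v ^ 3 * (v 0 * v 0) - gX v) + (g1 v * h2 v + g2 v * h1 v) * (block_disc v ^ 3 * (v 0 * v 1) - gY v)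
        + g2 v * h2 v * (block_disc v ^ 3 * (v 1 * v 1) - gZ v))) \<in> pulled_ideal"
  proof -
    have gc: "g \<in> cpoly 12" unfolding gi(4)[abs_def] by (intro cpoly_intros indep01_cpoly gi; simp)
    show ?thesis
      by (intro ideal3_cpoly(1,2) g(2) h(2) q(4-6) cpoly_intros indep01_cpoly gi(1-3) hi(1-3) block_cpoly mult.hyps gc)
  qed
  moreover have "block_disc v ^ 3 * (block_disc v ^ l * b v * (block_disc v ^ k * a v - g v) + g v * (block_disc v ^ l * b v - h v))
     + (g1 v * h1 v * (block_disc v ^ 3 * (v 0 * v 0) - gX v) + (g1 v * h2 v + g2 v * h1 v) * (block_disc v ^ 3 * (v 0 * v 1) - gY v)
        + g2 v * h2 v * (block_disc v ^ 3 * (v 1 * v 1) - gZ v))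
     = block_disc v ^ (3 + k + l) * (a v * b v) - ?g v" for v
    unfolding A_def gi(4) hi(4) power_add by algebra
  ultimately show ?case using g_aff by (intro exI[of _ "3 + k + l"] exI[of _ ?g]) simp
qed

lemma block_disc_power_nzd:
  assumes "f \<in> cpoly 12" "(\<lambda>v. block_disc v ^ k * f v) \<in> pulled_ideal"
  shows "f \<in> pulled_ideal"
  using assms(2)
proof (induction k)
  case 0 then show ?case by simp
next
  case (Suc k)
  have "(\<lambda>v. block_disc v ^ k * f v) \<in> pulled_ideal"
    by (rule block_disc_nzd) (use Suc.prems assms(1) in \<open>auto intro!: cpoly_intros block_cpoly simp: mult.assoc\<close>)
  then show ?case by (rule Suc.IH)
qed

section \<open>A parametrisation\<close>

text \<open>
  The block is \<open>P diag(X, Y) P\<^sup>T\<close> with \<open>X = x\<^sub>1 \<xi>\<^sub>1 + x\<^sub>2 \<xi>\<^sub>2\<close>, \<open>Y = y\<^sub>1 \<xi>\<^sub>1 + y\<^sub>2 \<xi>\<^sub>2\<close>, \<open>P\<close> having the rows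
  \<open>(r, 1)\<close> and \<open>(1, s)\<close>; the rest of the first row is \<open>(e\<^sub>1 X + u\<^sup>3 Y, e\<^sub>2 Y + v\<^sup>3 X) P\<^sup>T\<close>. The remaining
  entry is then determined, up to replacing \<open>v\<close> by \<open>v\<close> times a cube root of unity, by the condition
  that the determinant be a cube, namely \<open>- (det P)\<^sup>2 (v\<^sup>2 X + u\<^sup>2 Y)\<^sup>3\<close>. The parameters
  \<open>w\<^sub>0, \<dots>, w\<^sub>9\<close> are \<open>r, s, x\<^sub>1, x\<^sub>2, y\<^sub>1, y\<^sub>2, e\<^sub>1, e\<^sub>2, u, v\<close>.
\<close>

definition par_block :: "(nat \<Rightarrow> complex) \<Rightarrow> nat \<Rightarrow> complex" where
  "par_block w = (\<lambda>i. [(w 0)\<^sup>2 * w 2 + w 4, w 0 * w 2 + w 1 * w 4, w 2 + (w 1)\<^sup>2 * w 4,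
     (w 0)\<^sup>2 * w 3 + w 5, w 0 * w 3 + w 1 * w 5, w 3 + (w 1)\<^sup>2 * w 5,
     w 0 * (w 6 * w 2 + w 8 ^ 3 * w 4) + (w 7 * w 4 + w 9 ^ 3 * w 2),
     w 0 * (w 6 * w 3 + w 8 ^ 3 * w 5) + (w 7 * w 5 + w 9 ^ 3 * w 3),
     (w 6 * w 2 + w 8 ^ 3 * w 4) + w 1 * (w 7 * w 4 + w 9 ^ 3 * w 2),
     (w 6 * w 3 + w 8 ^ 3 * w 5) + w 1 * (w 7 * w 5 + w 9 ^ 3 * w 3)] ! i)"

text \<open>The solution a of a X Y - X z2^2 - Y z1^2 = - (v^2 X + u^2 Y)^3 with z1 = e1 X + u^3 Y
  and z2 = e2 Y + v^3 X. The cubes in z1 and z2 make the terms X^3 and Y^3 cancel, so that division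
  by X Y is exact.\<close>

definition par_entry :: "(nat \<Rightarrow> complex) \<Rightarrow> complex \<Rightarrow> complex \<Rightarrow> complex" where
  "par_entry w x y = (2 * w 7 * w 9 ^ 3 + (w 6)\<^sup>2 - 3 * w 9 ^ 4 * (w 8)\<^sup>2) * x
     + ((w 7)\<^sup>2 + 2 * w 6 * w 8 ^ 3 - 3 * (w 9)\<^sup>2 * w 8 ^ 4) * y"

text \<open>The change from matrix entries to the linear coordinates: \<open>c\<close> lists the
  entries 22, 23, 33 of the first and then the second matrix, followed by both entries 12 and both
  entries 13, while \<open>a\<close>, \<open>b\<close> are the entries 11.\<close>

definition assemble :: "(nat \<Rightarrow> complex) \<Rightarrow> complex \<Rightarrow> complex \<Rightarrow> nat \<Rightarrow> complex" where
  "assemble c a b = (\<lambda>i. [a, b - c 1, c 6, c 7 - c 2, c 0 - c 8, c 3 - c 9, c 4, c 5, c 8, c 1, c 2, c 9] ! i)"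

definition par :: "(nat \<Rightarrow> complex) \<Rightarrow> nat \<Rightarrow> complex" where
  "par w = assemble (par_block w) (par_entry w (w 2) (w 4)) (par_entry w (w 3) (w 5))"

lemma assemble_simps [simp]:
  "assemble c a b 0 = a" "assemble c a b 1 = b - c 1" "assemble c a b (Suc 0) = b - c 1" "assemble c a b 2 = c 6"
  "assemble c a b 3 = c 7 - c 2" "assemble c a b 4 = c 0 - c 8" "assemble c a b 5 = c 3 - c 9"
  "assemble c a b 6 = c 4" "assemble c a b 7 = c 5" "assemble c a b 8 = c 8" "assemble c a b 9 = c 1"
  "assemble c a b 10 = c 2" "assemble c a b 11 = c 9"
  by (simp_all add: assemble_def)

lemma par_block_simps [simp]:
  "par_block w 0 = (w 0)\<^sup>2 * w 2 + w 4" "par_block w 1 = w 0 * w 2 + w 1 * w 4" "par_block w (Suc 0) = w 0 * w 2 + w 1 * w 4"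
  "par_block w 2 = w 2 + (w 1)\<^sup>2 * w 4"
  "par_block w 3 = (w 0)\<^sup>2 * w 3 + w 5" "par_block w 4 = w 0 * w 3 + w 1 * w 5" "par_block w 5 = w 3 + (w 1)\<^sup>2 * w 5"
  "par_block w 6 = w 0 * (w 6 * w 2 + w 8 ^ 3 * w 4) + (w 7 * w 4 + w 9 ^ 3 * w 2)"
  "par_block w 7 = w 0 * (w 6 * w 3 + w 8 ^ 3 * w 5) + (w 7 * w 5 + w 9 ^ 3 * w 3)"
  "par_block w 8 = (w 6 * w 2 + w 8 ^ 3 * w 4) + w 1 * (w 7 * w 4 + w 9 ^ 3 * w 2)"
  "par_block w 9 = (w 6 * w 3 + w 8 ^ 3 * w 5) + w 1 * (w 7 * w 5 + w 9 ^ 3 * w 3)"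
  by (simp_all add: par_block_def)

text \<open>The congruence by P on the last two coordinates contributes (det P)^2 and leaves the
  matrix with rows (a, z1, z2), (z1, X, 0), (z2, 0, Y).\<close>

lemma par_sdet:
  fixes X Y :: complex
  shows "sdet (par_entry w X Y) (w 0 * (w 6 * X + w 8 ^ 3 * Y) + (w 7 * Y + w 9 ^ 3 * X))
     ((w 6 * X + w 8 ^ 3 * Y) + w 1 * (w 7 * Y + w 9 ^ 3 * X)) ((w 0)\<^sup>2 * X + Y) (w 0 * X + w 1 * Y) (X + (w 1)\<^sup>2 * Y)
    = - ((w 0 * w 1 - 1)\<^sup>2 * ((w 9)\<^sup>2 * X + (w 8)\<^sup>2 * Y) ^ 3)"
proof -
  have "sdet a (r * z1 + z2) (z1 + s * z2) (r\<^sup>2 * X + Y) (r * X + s * Y) (X + s\<^sup>2 * Y)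
     = (r * s - 1)\<^sup>2 * (a * X * Y - X * z2\<^sup>2 - Y * z1\<^sup>2)" for a r z1 z2 s
    unfolding sdet_def by algebra
  moreover have "par_entry w X Y * X * Y - X * (w 7 * Y + w 9 ^ 3 * X)\<^sup>2 - Y * (w 6 * X + w 8 ^ 3 * Y)\<^sup>2
     = - (((w 9)\<^sup>2 * X + (w 8)\<^sup>2 * Y) ^ 3)"
    unfolding par_entry_def by algebra
  ultimately show ?thesis by simp
qed

lemma cubic_coeffs_eq:
  fixes a b c d :: complex
  assumes "\<And>x y. a * x^3 + 3 * b * x\<^sup>2 * y + 3 * c * x * y\<^sup>2 + d * y^3 = a' * x^3 + 3 * b' * x\<^sup>2 * y + 3 * c' * x * y\<^sup>2 + d' * y^3"
  shows "a = a' \<and> b = b' \<and> c = c' \<and> d = d'"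
proof -
  have 1: "a = a'" using assms[of 1 0] by simp
  have 2: "d = d'" using assms[of 0 1] by simp
  have 3: "3 * b + 3 * c = 3 * b' + 3 * c'" using assms[of 1 1] 1 2 by simp
  have 4: "- 3 * b + 3 * c = - 3 * b' + 3 * c'" using assms[of 1 "-1"] 1 2 by simp
  have "6 * c = 6 * c'" using 3 4 by algebra
  then have "c = c'" by simp
  then show ?thesis using 1 2 3 by simp
qed

lemma coeff_sdet:
  "cA v * x^3 + 3 * cB v * x\<^sup>2 * y + 3 * cC v * x * y\<^sup>2 + cD v * y^3
   = sdet (x * v 0 + y * (v 1 + v 9)) (x * v 2 + y * (v 10 + v 3)) (x * v 8 + y * v 11)
       (x * (v 8 + v 4) + y * (v 11 + v 5)) (x * v 9 + y * v 6) (x * v 10 + y * v 7)"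
  unfolding sdet_pencil cA_def cB_def cC_def cD_def by simp

lemma par_sdet_coeffs:
  "sdet (x * par w 0 + y * (par w 1 + par w 9)) (x * par w 2 + y * (par w 10 + par w 3)) (x * par w 8 + y * par w 11)
       (x * (par w 8 + par w 4) + y * (par w 11 + par w 5)) (x * par w 9 + y * par w 6) (x * par w 10 + y * par w 7)
   = - ((w 0 * w 1 - 1)\<^sup>2 * (((w 9)\<^sup>2 * w 2 + (w 8)\<^sup>2 * w 4) * x + ((w 9)\<^sup>2 * w 3 + (w 8)\<^sup>2 * w 5) * y) ^ 3)"
proof -
  let ?X = "w 2 * x + w 3 * y" and ?Y = "w 4 * x + w 5 * y"
  have "x * par w 0 + y * (par w 1 + par w 9) = par_entry w ?X ?Y"
    by (simp add: par_def par_entry_def algebra_simps)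
  moreover have "x * par w 2 + y * (par w 10 + par w 3) = w 0 * (w 6 * ?X + w 8 ^ 3 * ?Y) + (w 7 * ?Y + w 9 ^ 3 * ?X)"
    "x * par w 8 + y * par w 11 = (w 6 * ?X + w 8 ^ 3 * ?Y) + w 1 * (w 7 * ?Y + w 9 ^ 3 * ?X)"
    "x * (par w 8 + par w 4) + y * (par w 11 + par w 5) = (w 0)\<^sup>2 * ?X + ?Y"
    "x * par w 9 + y * par w 6 = w 0 * ?X + w 1 * ?Y"
    "x * par w 10 + y * par w 7 = ?X + (w 1)\<^sup>2 * ?Y"
    by (simp_all add: par_def algebra_simps)
  moreover have "((w 9)\<^sup>2 * w 2 + (w 8)\<^sup>2 * w 4) * x + ((w 9)\<^sup>2 * w 3 + (w 8)\<^sup>2 * w 5) * y = (w 9)\<^sup>2 * ?X + (w 8)\<^sup>2 * ?Y"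
    by (simp add: algebra_simps)
  ultimately show ?thesis by (simp only: par_sdet)
qed

lemma par_minors: "mn1 (detmap (par w)) = 0" "mn2 (detmap (par w)) = 0" "mn3 (detmap (par w)) = 0"
proof -
  let ?m = "- (w 0 * w 1 - 1)\<^sup>2" and ?K = "(w 9)\<^sup>2 * w 2 + (w 8)\<^sup>2 * w 4" and ?L = "(w 9)\<^sup>2 * w 3 + (w 8)\<^sup>2 * w 5"
  have "m * K ^ 3 * x^3 + 3 * (m * K\<^sup>2 * L) * x\<^sup>2 * y + 3 * (m * K * L\<^sup>2) * x * y\<^sup>2 + m * L ^ 3 * y^3 = m * (K * x + L * y) ^ 3"
    for m K L x y :: complex by algebra
  then have "cA (par w) = ?m * ?K ^ 3 \<and> cB (par w) = ?m * ?K\<^sup>2 * ?L \<and> cC (par w) = ?m * ?K * ?L\<^sup>2 \<and> cD (par w) = ?m * ?L ^ 3"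
    by (intro cubic_coeffs_eq) (simp only: coeff_sdet par_sdet_coeffs, simp)
  then show "mn1 (detmap (par w)) = 0" "mn2 (detmap (par w)) = 0" "mn3 (detmap (par w)) = 0"
    unfolding mn1_def mn2_def mn3_def detmap_simps by (simp_all add: power2_eq_square power3_eq_cube)
qed

text \<open>Open conditions: P is invertible, X and Y are independent, u and v are nonzero. They
  exclude members of rank at most one and make the three points over a block non-collinear.\<close>

definition par_good :: "(nat \<Rightarrow> complex) \<Rightarrow> bool" where
  "par_good w \<longleftrightarrow> w 0 * w 1 \<noteq> 1 \<and> w 2 * w 5 \<noteq> w 3 * w 4 \<and> w 8 \<noteq> 0 \<and> w 9 \<noteq> 0"

lemma growth_quotient:
  fixes a :: nat
  assumes "\<And>b. b \<in> set bs \<Longrightarrow> b < a"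
  shows "((\<lambda>\<tau>. (of_real \<tau> ^ a + (\<Sum>b\<leftarrow>bs. of_real \<tau> ^ b)) / complex_of_real \<tau> ^ a) \<longlongrightarrow> 1) at_top"
  using assms
proof (induction bs)
  case Nil
  show ?case by (rule tendsto_eventually) (use eventually_gt_at_top[of "0::real"] in eventually_elim, simp)
next
  case (Cons b bs)
  have "((\<lambda>\<tau>. inverse \<tau> ^ (a - b)) \<longlongrightarrow> (0::real) ^ (a - b)) at_top"
    by (intro tendsto_power tendsto_inverse_0_at_top filterlim_ident)
  then have "((\<lambda>\<tau>. complex_of_real (inverse \<tau> ^ (a - b))) \<longlongrightarrow> of_real 0) at_top"
    using Cons.prems[of b] by (intro tendsto_of_real) (simp add: power_0_left)
  then have "((\<lambda>\<tau>. (of_real \<tau> ^ a + (\<Sum>b\<leftarrow>bs. of_real \<tau> ^ b)) / complex_of_real \<tau> ^ a + complex_of_real (inverse \<tau> ^ (a - b))) \<longlongrightarrow> 1 + of_real 0) at_top"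
    using Cons by (intro tendsto_add) auto
  moreover have "\<forall>\<^sub>F \<tau> in at_top. (of_real \<tau> ^ a + (\<Sum>b\<leftarrow>bs. of_real \<tau> ^ b)) / complex_of_real \<tau> ^ a + complex_of_real (inverse \<tau> ^ (a - b))
      = (of_real \<tau> ^ a + (\<Sum>b\<leftarrow>b # bs. of_real \<tau> ^ b)) / complex_of_real \<tau> ^ a"
    using eventually_gt_at_top[of "0::real"]
  proof eventually_elim
    case (elim \<tau>)
    have "complex_of_real \<tau> ^ a = of_real \<tau> ^ b * of_real \<tau> ^ (a - b)"
      using Cons.prems[of b] by (simp flip: power_add)
    then have "complex_of_real (inverse \<tau> ^ (a - b)) = of_real \<tau> ^ b / complex_of_real \<tau> ^ a"
      using elim by (simp add: field_simps)
    then show ?case by (simp add: add_divide_distrib)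
  qed
  ultimately show ?case by (simp add: tendsto_cong)
qed

lemma less_10_cases: "(i::nat) < 10 \<Longrightarrow> i = 0 \<or> i = 1 \<or> i = 2 \<or> i = 3 \<or> i = 4 \<or> i = 5 \<or> i = 6 \<or> i = 7 \<or> i = 8 \<or> i = 9"
  by presburger

lemma less_12_cases: "(i::nat) < 12 \<Longrightarrow> i = 0 \<or> i = 1 \<or> i = 2 \<or> i = 3 \<or> i = 4 \<or> i = 5 \<or> i = 6 \<or> i = 7 \<or> i = 8 \<or> i = 9 \<or> i = 10 \<or> i = 11"
  by presburger

lemma sum_less_10: "(\<Sum>i<10. f i) = f 0 + f 1 + f 2 + f 3 + f 4 + f 5 + f 6 + f 7 + f 8 + f 9"
  for f :: "nat \<Rightarrow> nat"
  by (simp add: eval_nat_numeral)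

text \<open>
  The weights are such that each coordinate has a single leading term along \<open>w\<^sub>i = \<tau>\<close> to the power
  \<open>weight\<^sub>i\<close>, and the ten leading monomials are multiplicatively independent.
\<close>

lemma par_block_indep:
  assumes P: "P \<in> cpoly 10" and 0: "\<And>w. par_good w \<Longrightarrow> P (par_block w) = 0"
  shows "P c = 0"
proof (rule cpoly_zero_by_growth[OF P])
  fix B :: nat
  \<comment> \<open>The factor 13 keeps the digits \<open>m \<alpha> i\<close> below
    \<open>C\<close> and each perturbation \<open>C ^ i\<close> at most a thirteenth of
    \<open>N\<close>.\<close>
  define C where "C = 13 * Suc B"
  define N where "N = C ^ 10"
  \<comment> \<open>The multiples of \<open>N\<close> decide which term leads: in each coordinate of
    \<open>par_block\<close> one term is ahead by at least 5 in the coarse weights. The summands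
    \<open>C ^ i\<close> separate products of the leading terms.\<close>
  define p where "p i = N * ([10, 10, 5, 0, 0, 5, 3, 3, 1, 1] ! i) + C ^ i" for i
  define w :: "real \<Rightarrow> nat \<Rightarrow> complex" where "w = (\<lambda>\<tau> i. of_real \<tau> ^ p i)"
  have C13: "C \<ge> 13" by (simp add: C_def)
  have small: "13 * C ^ i \<le> N" if "i < 10" for i
  proof -
    have "13 * C ^ i \<le> C * C ^ i" using C13 by (rule mult_right_mono) simp
    also have "\<dots> = C ^ Suc i" by simp
    also have "\<dots> \<le> N" unfolding N_def using that C13 by (intro power_increasing) auto
    finally show ?thesis .
  qed
  note sm = small[of 0] small[of 1] small[of 2] small[of 3] small[of 4] small[of 5] small[of 6] small[of 7] small[of 8] small[of 9]
  have pos: "0 < C ^ i" for i using C13 by simp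
  note pp = p_def[of 0] p_def[of 1] p_def[of 1, unfolded One_nat_def] p_def[of 2] p_def[of 3] p_def[of 4] p_def[of 5] p_def[of 6] p_def[of 7] p_def[of 8] p_def[of 9]
  define K :: "nat list" where "K = [2 * p 0 + p 2, p 0 + p 2, 2 * p 1 + p 4, 2 * p 0 + p 3, p 1 + p 5, 2 * p 1 + p 5,
    p 0 + p 6 + p 2, p 0 + 3 * p 8 + p 5, p 1 + 3 * p 9 + p 2, p 1 + p 7 + p 5]"
  have lim: "((\<lambda>\<tau>. par_block (w \<tau>) i / of_real \<tau> ^ (K ! i)) \<longlongrightarrow> 1) at_top" if "i < 10" for i
  proof -
    have tp: "of_real \<tau> ^ (2 * p j) = (w \<tau> j)\<^sup>2" "of_real \<tau> ^ (3 * p j) = (w \<tau> j) ^ 3" "of_real \<tau> ^ p j = w \<tau> j" for \<tau> j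
      by (simp_all add: w_def mult.commute flip: power_mult)
    have *: ?thesis if "\<And>b. b \<in> set bs \<Longrightarrow> b < K ! i" and
      "\<And>\<tau>. par_block (w \<tau>) i = of_real \<tau> ^ (K ! i) + (\<Sum>b\<leftarrow>bs. of_real \<tau> ^ b)" for bs
      unfolding that(2) by (rule growth_quotient) (rule that(1))
    note pa = power_add tp
    show ?thesis using less_10_cases[OF that]
    proof (elim disjE)
      assume i: "i = 0" show ?thesis
        by (rule *[of "[p 4]"]; simp add: i K_def pa; use sm pos[of 4] in \<open>simp add: pp\<close>)
    next
      assume i: "i = 1" show ?thesis
        by (rule *[of "[p 1 + p 4]"]; simp add: i K_def pa; use sm in \<open>simp add: pp\<close>)
    next
      assume i: "i = 2" show ?thesis
        by (rule *[of "[p 2]"]; simp add: i K_def pa; use sm in \<open>simp add: pp\<close>)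
    next
      assume i: "i = 3" show ?thesis
        by (rule *[of "[p 5]"]; simp add: i K_def pa; use sm in \<open>simp add: pp\<close>)
    next
      assume i: "i = 4" show ?thesis
        by (rule *[of "[p 0 + p 3]"]; simp add: i K_def pa; use sm in \<open>simp add: pp\<close>)
    next
      assume i: "i = 5" show ?thesis
        by (rule *[of "[p 3]"]; simp add: i K_def pa; use sm in \<open>simp add: pp\<close>)
    next
      assume i: "i = 6" show ?thesis
        by (rule *[of "[p 0 + 3 * p 8 + p 4, p 7 + p 4, 3 * p 9 + p 2]"]; simp add: i K_def pa algebra_simps; use sm in \<open>auto simp: pp\<close>)
    next
      assume i: "i = 7" show ?thesis
        by (rule *[of "[p 0 + p 6 + p 3, p 7 + p 5, 3 * p 9 + p 3]"]; simp add: i K_def pa algebra_simps; use sm in \<open>auto simp: pp\<close>)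
    next
      assume i: "i = 8" show ?thesis
        by (rule *[of "[p 6 + p 2, 3 * p 8 + p 4, p 1 + p 7 + p 4]"]; simp add: i K_def pa algebra_simps; use sm in \<open>auto simp: pp\<close>)
    next
      assume i: "i = 9" show ?thesis
        by (rule *[of "[p 6 + p 3, 3 * p 8 + p 5, p 1 + 3 * p 9 + p 3]"]; simp add: i K_def pa algebra_simps; use sm in \<open>auto simp: pp\<close>)
    qed
  qed
  have inj: "inj_on (\<lambda>\<alpha>. \<Sum>i<10. \<alpha> i * (K ! i)) (expbox 10 B)"
  proof (rule inj_onI)
    fix \<alpha> \<beta> assume ab: "\<alpha> \<in> expbox 10 B" "\<beta> \<in> expbox 10 B" and eq: "(\<Sum>i<10. \<alpha> i * (K ! i)) = (\<Sum>i<10. \<beta> i * (K ! i))"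
    \<comment> \<open>\<open>m \<alpha> i\<close> is the exponent of the parameter
      \<open>w i\<close> in the product of the leading monomials taken with multiplicities
      \<open>\<alpha>\<close>.\<close>
    define m :: "(nat \<Rightarrow> nat) \<Rightarrow> nat \<Rightarrow> nat" where
      "m \<alpha> i = [2 * \<alpha> 0 + \<alpha> 1 + 2 * \<alpha> 3 + \<alpha> 6 + \<alpha> 7, 2 * \<alpha> 2 + \<alpha> 4 + 2 * \<alpha> 5 + \<alpha> 8 + \<alpha> 9,
         \<alpha> 0 + \<alpha> 1 + \<alpha> 6 + \<alpha> 8, \<alpha> 3, \<alpha> 2, \<alpha> 4 + \<alpha> 5 + \<alpha> 7 + \<alpha> 9, \<alpha> 6, \<alpha> 9, 3 * \<alpha> 7, 3 * \<alpha> 8] ! i" for \<alpha> i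
    have sumK: "(\<Sum>i<10. \<alpha> i * (K ! i)) = N * (\<Sum>i<10. m \<alpha> i * ([10, 10, 5, 0, 0, 5, 3, 3, 1, 1] ! i)) + (\<Sum>i<10. m \<alpha> i * C ^ i)" for \<alpha>
      unfolding sum_less_10 by (simp add: K_def m_def pp algebra_simps)
    have mC: "m \<alpha> i < C" if "\<alpha> \<in> expbox 10 B" "i < 10" for \<alpha> i
    proof -
      have "\<alpha> j < Suc B" if "j < 10" for j using \<open>\<alpha> \<in> _\<close> that unfolding expbox_def by (auto intro: less_SucI)
      from this[of 0] this[of 1] this[of 2] this[of 3] this[of 4] this[of 5] this[of 6] this[of 7] this[of 8] this[of 9]
      show ?thesis using less_10_cases[OF that(2)] by (auto simp: m_def C_def)
    qed
    have low: "(\<Sum>i<n. m \<alpha> i * C ^ i) < C ^ n" if "\<alpha> \<in> expbox 10 B" "n \<le> 10" for \<alpha> n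
      using that(2)
    proof (induction n)
      case (Suc n)
      have "m \<alpha> n * C ^ n \<le> (C - 1) * C ^ n" using mC[OF that(1), of n] Suc.prems by (intro mult_right_mono) auto
      moreover have "(\<Sum>i<n. m \<alpha> i * C ^ i) < C ^ n" using Suc by simp
      moreover have "(C - 1) * C ^ n + C ^ n = C ^ Suc n" using C13 by (simp add: algebra_simps)
      moreover have "(\<Sum>i<Suc n. m \<alpha> i * C ^ i) = (\<Sum>i<n. m \<alpha> i * C ^ i) + m \<alpha> n * C ^ n" by simp
      ultimately show ?case by linarith
    qed simp
    \<comment> \<open>Reduction modulo \<open>N\<close> discards the coarse weights and leaves the
      number with base \<open>C\<close> digits \<open>m \<alpha> i\<close>.\<close>
    have mod: "(\<Sum>i<10. \<alpha> i * (K ! i)) mod N = (\<Sum>i<10. m \<alpha> i * C ^ i)" if "\<alpha> \<in> expbox 10 B" for \<alpha>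
      unfolding sumK using low[OF that, of 10] by (simp add: N_def)
    have "(\<Sum>i<10. m \<alpha> i * C ^ i) = (\<Sum>i<10. m \<beta> i * C ^ i)"
      using mod[OF ab(1)] mod[OF ab(2)] eq by simp
    then have me: "m \<alpha> i = m \<beta> i" if "i < 10" for i
      using kronecker_inj[of 10 "m \<alpha>" C "m \<beta>" i] mC ab that by blast
    show "\<alpha> = \<beta>"
    proof
      fix i show "\<alpha> i = \<beta> i"
      proof (cases "i < 10")
        case True
        show ?thesis
          using less_10_cases[OF True] me[of 0] me[of 1] me[of 2] me[of 3] me[of 4] me[of 5] me[of 6] me[of 7] me[of 8] me[of 9]
          by (elim disjE) (simp_all add: m_def)
      qed (use ab in \<open>auto simp: expbox_def\<close>)
    qed
  qed
  have "\<forall>\<^sub>F \<tau> in at_top. P (par_block (w \<tau>)) = 0"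
    using eventually_gt_at_top[of "1::real"]
  proof eventually_elim
    case (elim \<tau>)
    have ne: "complex_of_real \<tau> ^ a \<noteq> of_real \<tau> ^ b" if "a \<noteq> b" for a b
    proof -
      have "\<tau> ^ a \<noteq> \<tau> ^ b" using elim that by (metis power_inject_exp)
      then show ?thesis by (metis of_real_eq_iff of_real_power)
    qed
    have "p 0 + p 1 \<noteq> 0" "p 2 + p 5 \<noteq> p 3 + p 4" using sm pos[of 0] by (auto simp: pp)
    then have "par_good (w \<tau>)"
      using elim ne[of "p 0 + p 1" 0] ne[of "p 2 + p 5" "p 3 + p 4"] by (simp add: par_good_def w_def power_add)
    then show ?case by (rule 0)
  qed
  then show "\<exists>h \<kappa> l. (\<forall>i<10. ((\<lambda>\<tau>. h i \<tau> / of_real \<tau> ^ \<kappa> i) \<longlongrightarrow> l i) at_top \<and> l i \<noteq> 0) \<and>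
       inj_on (\<lambda>\<alpha>. \<Sum>i<10. \<alpha> i * \<kappa> i) (expbox 10 B) \<and> (\<forall>\<^sub>F \<tau> in at_top. P (\<lambda>i. h i (\<tau>::real)) = 0)"
    using lim inj by (intro exI[of _ "\<lambda>i \<tau>. par_block (w \<tau>) i"] exI[of _ "\<lambda>i. K ! i"] exI[of _ "\<lambda>_. 1"]) auto
qed

text \<open>Such a function depends only on the ten entries other than the two upper left ones, and
  \<open>par_block\<close> is dominant onto these.\<close>

lemma indep01_zero:
  assumes f: "f \<in> indep01" and 0: "\<And>w. par_good w \<Longrightarrow> f (par w) = 0"
  shows "f v = 0"
proof -
  \<comment> \<open>The arguments 0 and \<open>c 1\<close> make coordinates 0 and 1 of the assembled
    point zero.\<close>
  let ?g = "\<lambda>c. f (assemble c 0 (c 1))"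
  have fi: "f (v(0 := x, 1 := y)) = f v" and fc: "f \<in> cpoly 12" for v x y using f unfolding indep01_def by auto
  have eq: "f (assemble c a b) = ?g c" for c a b
  proof -
    have "f ((assemble c 0 (c 1))(0 := a, 1 := b - c 1)) = ?g c" by (rule fi)
    moreover have "f ((assemble c 0 (c 1))(0 := a, 1 := b - c 1)) = f (assemble c a b)"
      by (rule cpoly_cong_vars[OF fc]) (auto simp: assemble_def nth_Cons split: nat.split)
    ultimately show ?thesis by simp
  qed
  have gc: "?g \<in> cpoly 10"
  proof (rule cpoly_subst[OF fc])
    fix i :: nat assume "i < 12"
    then consider "i = 0" | "i = 1" | "i = 2" | "i = 3" | "i = 4" | "i = 5" | "i = 6" | "i = 7" | "i = 8" | "i = 9" | "i = 10" | "i = 11" using less_12_cases by blast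
    then show "(\<lambda>c. assemble c 0 (c 1) i) \<in> cpoly 10"
      by cases (simp_all add: cpoly_intros)
  qed
  have g0: "?g c = 0" for c
  proof (rule par_block_indep[OF gc])
    fix w assume "par_good w"
    from 0[OF this] show "?g (par_block w) = 0" unfolding par_def by (rule trans[OF eq[symmetric]])
  qed
  define c where "c = (\<lambda>i. [v 8 + v 4, v 9, v 10, v 11 + v 5, v 6, v 7, v 2, v 10 + v 3, v 8, v 11] ! i)"
  have "f v = f (assemble c (v 0) (v 1 + v 9))"
  proof (rule cpoly_cong_vars[OF fc])
    fix i :: nat assume "i < 12"
    then consider "i = 0" | "i = 1" | "i = 2" | "i = 3" | "i = 4" | "i = 5" | "i = 6" | "i = 7" | "i = 8" | "i = 9" | "i = 10" | "i = 11" using less_12_cases by blast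
    then show "v i = assemble c (v 0) (v 1 + v 9) i" by cases (simp_all add: c_def)
  qed
  also have "\<dots> = ?g c" by (rule eq)
  also have "\<dots> = 0" by (rule g0)
  finally show ?thesis .
qed

theorem vanishing_ideal:
  assumes f: "f \<in> cpoly 12" and 0: "\<And>w. par_good w \<Longrightarrow> f (par w) = 0"
  shows "f \<in> pulled_ideal"
proof -
  obtain k g where g: "g \<in> affine01" "(\<lambda>v. block_disc v ^ k * f v - g v) \<in> pulled_ideal"
    using generic_reduction[OF f] by blast
  obtain f0 f1 f2 where fi: "f0 \<in> indep01" "f1 \<in> indep01" "f2 \<in> indep01" and ge: "\<And>v. g v = f0 v + f1 v * v 0 + f2 v * v 1"
    using affine01E[OF g(1)] by metis
  have J0: "h (par w) = 0" if "h \<in> pulled_ideal" for h w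
    using ideal3E[OF that] par_minors by (metis add.right_neutral mult_zero_right)
  have g0: "g (par w) = 0" if "par_good w" for w
    using J0[OF g(2), of w] 0[OF that] by simp
  obtain \<omega> :: complex where \<omega>: "1 + \<omega> + \<omega>\<^sup>2 = 0" "\<omega> ^ 3 = 1" using primitive_cube_root_unity by blast
  have z: "f0 (par w) = 0 \<and> f1 (par w) = 0 \<and> f2 (par w) = 0" if w: "par_good w" for w
  proof -
    let ?b = "par_block w"
    \<comment> \<open>Only the cube of \<open>w 9\<close> enters \<open>par_block\<close>, so
      twisting it by a cube root of unity moves the point within the fibre over the same
      block.\<close>
    have tw: "f0 (par w) + f1 (par w) * par_entry (w(9 := \<zeta> * w 9)) (w 2) (w 4)
       + f2 (par w) * (par_entry (w(9 := \<zeta> * w 9)) (w 3) (w 5) - ?b 1) = 0" if \<zeta>: "\<zeta> ^ 3 = 1" for \<zeta>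
    proof -
      have "\<zeta> \<noteq> 0" using \<zeta> by auto
      then have "par_good (w(9 := \<zeta> * w 9))" using w by (simp add: par_good_def)
      from g0[OF this] have "g (par (w(9 := \<zeta> * w 9))) = 0" .
      moreover have "par_block (w(9 := \<zeta> * w 9)) = ?b"
        unfolding par_block_def by (simp add: power_mult_distrib \<zeta>)
      moreover have asm: "f (assemble ?b a b) = f (par w)" if "f \<in> indep01" for f a b
      proof -
        have fi: "f (v(0 := x, 1 := y)) = f v" and fc: "f \<in> cpoly 12" for v x y using that unfolding indep01_def by auto
        have "f ((par w)(0 := a, 1 := b - ?b 1)) = f (assemble ?b a b)"
          by (rule cpoly_cong_vars[OF fc]) (auto simp: par_def assemble_def nth_Cons split: nat.split)
        then show ?thesis using fi by metis
      qed
      ultimately show ?thesis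
        unfolding ge by (simp add: par_def[of "w(9 := _)"] asm[OF fi(1)] asm[OF fi(2)] asm[OF fi(3)])
    qed
    have "(\<omega>\<^sup>2)^3 = 1" using \<omega> by algebra
    note e = tw[OF power_one] tw[OF \<omega>(2)] tw[OF this]
    \<comment> \<open>In \<open>par_entry\<close> the twist appears as zeta^4 = zeta in the X term
      and as zeta^2 in the Y term. Averaging over the three roots isolates each; one factor 3 comes
      from the averaging and one from \<open>par_entry\<close>.\<close>
    have 1: "9 * ((w 9)\<^sup>2 * w 8 ^ 4 * (f1 (par w) * w 4 + f2 (par w) * w 5)) = 0"
      using e \<omega> unfolding par_entry_def by simp algebra
    have 2: "9 * (w 9 ^ 4 * (w 8)\<^sup>2 * (f1 (par w) * w 2 + f2 (par w) * w 3)) = 0"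
      using e \<omega> unfolding par_entry_def by simp algebra
    have nz: "w 8 \<noteq> 0" "w 9 \<noteq> 0" "w 2 * w 5 - w 3 * w 4 \<noteq> 0" using w by (auto simp: par_good_def)
    have 3: "f1 (par w) * w 4 + f2 (par w) * w 5 = 0" "f1 (par w) * w 2 + f2 (par w) * w 3 = 0"
      using 1 2 nz by auto
    have "(w 2 * w 5 - w 3 * w 4) * f1 (par w) = 0" "(w 2 * w 5 - w 3 * w 4) * f2 (par w) = 0"
      using 3 by algebra+
    then have 4: "f1 (par w) = 0" "f2 (par w) = 0" using nz by auto
    then show ?thesis using e(1) by simp
  qed
  have "f0 v = 0" "f1 v = 0" "f2 v = 0" for v
    by (rule indep01_zero; use fi z in blast)+
  then have "g v = 0" for v unfolding ge by simp
  then have "(\<lambda>v. block_disc v ^ k * f v) \<in> pulled_ideal" using g(2) by simp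
  then show ?thesis by (rule block_disc_power_nzd[OF f])
qed

section \<open>Matrices of rank at most one\<close>

text \<open>Replaces the dimension of the row space by an outer product, from which relations
  between minors can be computed.\<close>

lemma rank_le_1_iff:
  fixes A :: "complex^'n^'m"
  shows "rank A \<le> 1 \<longleftrightarrow> (\<exists>x y. \<forall>r s. A $ r $ s = x $ r * y $ s)"
proof
  assume "rank A \<le> 1"
  then have dim: "vec.dim (rows A) \<le> 1" by (simp add: row_rank_def_gen)
  obtain B where B: "vec.independent B" "rows A \<subseteq> vec.span B" "card B = vec.dim (rows A)"
    using vec.basis_exists[of "rows A"] by metis
  have "finite B" using B(1) by (rule vec.finiteI_independent)
  then obtain b where "B \<subseteq> {b}"
    using B(3) dim by (metis card_le_Suc0_iff_eq One_nat_def empty_subsetI insertI1 subsetI subset_singletonD singletonD insert_iff)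
  then have "rows A \<subseteq> vec.span {b}" using B(2) vec.span_mono by blast
  then have "\<forall>r. \<exists>k. row r A = k *s b"
    using vec.span_singleton[of b] by (auto simp: rows_def)
  then obtain k where k: "\<And>r. row r A = k r *s b" by metis
  have "A $ r $ s = (\<chi> r. k r) $ r * b $ s" for r s
    using arg_cong[OF k[of r], of "\<lambda>v. v $ s"] by (simp add: row_def)
  then show "\<exists>x y. \<forall>r s. A $ r $ s = x $ r * y $ s" by blast
next
  assume "\<exists>x y. \<forall>r s. A $ r $ s = x $ r * y $ s"
  then obtain x y where xy: "\<And>r s. A $ r $ s = x $ r * y $ s" by blast
  have "rows A \<subseteq> vec.span {y}"
  proof
    fix c assume "c \<in> rows A"
    then obtain r where "c = row r A" by (auto simp: rows_def)
    then have "c = x $ r *s y" by (simp add: row_def vec_eq_iff xy)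
    then show "c \<in> vec.span {y}" by (simp add: vec.span_base vec.span_scale)
  qed
  then have "vec.dim (rows A) \<le> card {y}" by (rule vec.dim_le_card) simp
  then show "rank A \<le> 1" by (simp add: row_rank_def_gen)
qed

section \<open>Pencils in coordinates\<close>

definition sym3 :: "complex \<Rightarrow> complex \<Rightarrow> complex \<Rightarrow> complex \<Rightarrow> complex \<Rightarrow> complex \<Rightarrow> matF" where
  "sym3 a b c d e f = vector [vector [a, b, c], vector [b, d, e], vector [c, e, f]]"

lemma sym3_nth [simp]:
  "sym3 a b c d e f $ 1 $ 1 = a" "sym3 a b c d e f $ 1 $ 2 = b" "sym3 a b c d e f $ 1 $ 3 = c"
  "sym3 a b c d e f $ 2 $ 1 = b" "sym3 a b c d e f $ 2 $ 2 = d" "sym3 a b c d e f $ 2 $ 3 = e"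
  "sym3 a b c d e f $ 3 $ 1 = c" "sym3 a b c d e f $ 3 $ 2 = e" "sym3 a b c d e f $ 3 $ 3 = f"
  by (simp_all add: sym3_def)

lemma transpose_sym3: "transpose (sym3 a b c d e f) = sym3 a b c d e f"
  by (simp add: vec_eq_iff forall_3 transpose_def)

lemma det_sym3: "det (sym3 a b c d e f) = sdet a b c d e f"
  unfolding det_3 sdet_def sym3_nth by algebra

lemma pencil_eqI: "(\<And>i r s. pencil_entry M i r s = pencil_entry N i r s) \<Longrightarrow> M = N"
  by transfer (simp add: vec_eq_iff)

lemma pencil_entry_sym: "pencil_entry M i r s = pencil_entry M i s r"
  by transfer (metis (no_types, lifting) transpose_def vec_lambda_beta)

lift_definition mk_pencil :: "(nat \<Rightarrow> complex) \<Rightarrow> pencil" is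
  "\<lambda>v. \<chi> i. if i = 1 then sym3 (v 0) (v 2) (v 8) (v 8 + v 4) (v 9) (v 10)
     else sym3 (v 1 + v 9) (v 10 + v 3) (v 11) (v 11 + v 5) (v 6) (v 7)"
  by (simp add: transpose_sym3)

lemma mk_pencil_entry: "pencil_entry (mk_pencil v) i r s = (if i = 1 then sym3 (v 0) (v 2) (v 8) (v 8 + v 4) (v 9) (v 10) $ r $ s
     else sym3 (v 1 + v 9) (v 10 + v 3) (v 11) (v 11 + v 5) (v 6) (v 7) $ r $ s)"
  by transfer simp

definition coords :: "pencil \<Rightarrow> nat \<Rightarrow> complex" where
  "coords M = (let m = pencil_entry M in
     (\<lambda>i. [m 1 1 1, m 2 1 1 - m 1 2 3, m 1 1 2, m 2 1 2 - m 1 3 3, m 1 2 2 - m 1 1 3, m 2 2 2 - m 2 1 3,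
       m 2 2 3, m 2 3 3, m 1 1 3, m 1 2 3, m 1 3 3, m 2 1 3] ! i))"

lemma coords_simps [simp]:
  "coords M 0 = pencil_entry M 1 1 1" "coords M 1 = pencil_entry M 2 1 1 - pencil_entry M 1 2 3"
  "coords M (Suc 0) = pencil_entry M 2 1 1 - pencil_entry M 1 2 3"
  "coords M 2 = pencil_entry M 1 1 2" "coords M 3 = pencil_entry M 2 1 2 - pencil_entry M 1 3 3"
  "coords M 4 = pencil_entry M 1 2 2 - pencil_entry M 1 1 3" "coords M 5 = pencil_entry M 2 2 2 - pencil_entry M 2 1 3"
  "coords M 6 = pencil_entry M 2 2 3" "coords M 7 = pencil_entry M 2 3 3" "coords M 8 = pencil_entry M 1 1 3"
  "coords M 9 = pencil_entry M 1 2 3" "coords M 10 = pencil_entry M 1 3 3" "coords M 11 = pencil_entry M 2 1 3"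
  by (simp_all add: coords_def Let_def)

lemma mk_pencil_coords: "mk_pencil (coords M) = M"
proof (rule pencil_eqI)
  fix i :: 2 and r s :: 3
  show "pencil_entry (mk_pencil (coords M)) i r s = pencil_entry M i r s"
    using exhaust_2[of i] exhaust_3[of r] exhaust_3[of s]
    by (elim disjE) (simp_all add: mk_pencil_entry pencil_entry_sym[of M _ 2 1] pencil_entry_sym[of M _ 3 1] pencil_entry_sym[of M _ 3 2])
qed

lemma coords_mk_pencil: "i < 12 \<Longrightarrow> coords (mk_pencil v) i = v i"
  by (drule less_12_cases) (elim disjE; simp add: mk_pencil_entry)

lemma coords_poly: "i < 12 \<Longrightarrow> (\<lambda>M. coords M i) \<in> poly_ring pencil_space"
proof -
  have e: "(\<lambda>M. pencil_entry M i r s) \<in> poly_ring pencil_space" for i r s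
    by (rule polys.gen) (auto simp: pencil_space_def)
  assume "i < 12"
  from less_12_cases[OF this] show ?thesis
    by (elim disjE) (simp_all add: e polys_diff)
qed

lemma poly_pencil_to_cpoly:
  assumes "f \<in> poly_ring pencil_space" "\<And>i. i < 12 \<Longrightarrow> (\<lambda>x. h x i) \<in> cpoly n"
  shows "(\<lambda>x. f (mk_pencil (h x))) \<in> cpoly n"
  unfolding cpoly_def
proof (rule polys_compose[OF assms(1)], fold cpoly_def)
  fix l assume "l \<in> forms pencil_space"
  then obtain i r s where l: "l = (\<lambda>M. pencil_entry M i r s)" by (auto simp: pencil_space_def)
  show "(\<lambda>x. l (mk_pencil (h x))) \<in> cpoly n"
    unfolding l mk_pencil_entry using exhaust_2[of i] exhaust_3[of r] exhaust_3[of s]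
    by (elim disjE) (simp_all add: cpoly_intros(2) assms(2))
qed

lemma cpoly_to_poly_pencil: "P \<in> cpoly 12 \<Longrightarrow> (\<lambda>M. P (coords M)) \<in> poly_ring pencil_space"
  by (rule cpoly_compose) (auto intro: coords_poly)

lemma pencil_member_sym3:
  "pencil_member M \<xi> = sym3 (\<xi>$1 * pencil_entry M 1 1 1 + \<xi>$2 * pencil_entry M 2 1 1)
    (\<xi>$1 * pencil_entry M 1 1 2 + \<xi>$2 * pencil_entry M 2 1 2) (\<xi>$1 * pencil_entry M 1 1 3 + \<xi>$2 * pencil_entry M 2 1 3)
    (\<xi>$1 * pencil_entry M 1 2 2 + \<xi>$2 * pencil_entry M 2 2 2) (\<xi>$1 * pencil_entry M 1 2 3 + \<xi>$2 * pencil_entry M 2 2 3)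
    (\<xi>$1 * pencil_entry M 1 3 3 + \<xi>$2 * pencil_entry M 2 3 3)"
  by (simp add: vec_eq_iff forall_3 pencil_member_def sum_2 pencil_entry_sym[of M _ 2 1] pencil_entry_sym[of M _ 3 1] pencil_entry_sym[of M _ 3 2])

lemma det_pencil_member:
  "det (pencil_member M \<xi>) = cA (coords M) * (\<xi>$1)^3 + 3 * cB (coords M) * (\<xi>$1)\<^sup>2 * \<xi>$2
     + 3 * cC (coords M) * \<xi>$1 * (\<xi>$2)\<^sup>2 + cD (coords M) * (\<xi>$2)^3"
  unfolding pencil_member_sym3 det_sym3 coeff_sdet by simp

section \<open>Coefficients of binary cubics\<close>

definition vec2 :: "complex \<Rightarrow> complex \<Rightarrow> complex^2" where "vec2 x y = vector [x, y]"

lemma vec2_nth [simp]: "vec2 x y $ 1 = x" "vec2 x y $ 2 = y" by (simp_all add: vec2_def)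

definition kA :: "binary_cubic \<Rightarrow> complex" where "kA q = cubic_eval q (vec2 1 0)"
definition kD :: "binary_cubic \<Rightarrow> complex" where "kD q = cubic_eval q (vec2 0 1)"
definition kB :: "binary_cubic \<Rightarrow> complex" where
  "kB q = (cubic_eval q (vec2 1 1) - cubic_eval q (vec2 1 (-1)) - 2 * cubic_eval q (vec2 0 1)) / 6"
definition kC :: "binary_cubic \<Rightarrow> complex" where
  "kC q = (cubic_eval q (vec2 1 1) + cubic_eval q (vec2 1 (-1)) - 2 * cubic_eval q (vec2 1 0)) / 6"

lemma k_poly: "kA \<in> poly_ring cubic_space" "kB \<in> poly_ring cubic_space" "kC \<in> poly_ring cubic_space" "kD \<in> poly_ring cubic_space"
proof -
  have e: "(\<lambda>q. cubic_eval q \<xi>) \<in> poly_ring cubic_space" for \<xi>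
    by (rule polys.gen) (auto simp: cubic_space_def)
  show "kA \<in> poly_ring cubic_space" "kB \<in> poly_ring cubic_space" "kC \<in> poly_ring cubic_space" "kD \<in> poly_ring cubic_space"
    unfolding kA_def[abs_def] kB_def[abs_def] kC_def[abs_def] kD_def[abs_def]
    by (intro polys_divc polys_diff polys.add polys_cmul e)+
qed

lemma cubic_eval_coeffs:
  "cubic_eval q \<xi> = kA q * (\<xi>$1)^3 + 3 * kB q * (\<xi>$1)\<^sup>2 * \<xi>$2 + 3 * kC q * \<xi>$1 * (\<xi>$2)\<^sup>2 + kD q * (\<xi>$2)^3"
proof -
  have "cubic_eval q \<in> cubic_forms" by transfer
  then obtain a b c d where q: "\<And>\<xi>. cubic_eval q \<xi> = a * (\<xi>$1)^3 + b * (\<xi>$1)^2 * \<xi>$2 + c * \<xi>$1 * (\<xi>$2)^2 + d * (\<xi>$2)^3"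
    unfolding cubic_forms_def by blast
  have "kA q = a" "kD q = d" "3 * kB q = b" "3 * kC q = c"
    unfolding kA_def kB_def kC_def kD_def q by simp_all
  then show ?thesis using q[of \<xi>] by simp
qed

lemma cubic_eval_coeffs_unique:
  assumes "\<And>x y. cubic_eval q (vec2 x y) = a * x^3 + 3 * b * x\<^sup>2 * y + 3 * c * x * y\<^sup>2 + d * y^3"
  shows "kA q = a" "kB q = b" "kC q = c" "kD q = d"
  using cubic_coeffs_eq[of "kA q" "kB q" "kC q" "kD q" a b c d] assms unfolding cubic_eval_coeffs[of q "vec2 _ _"] vec2_nth
  by blast+

lemma binary_cubic_eqI: "(\<And>\<xi>. cubic_eval p \<xi> = cubic_eval q \<xi>) \<Longrightarrow> p = q"
  by transfer auto

lift_definition mk_cubic :: "complex \<Rightarrow> complex \<Rightarrow> complex \<Rightarrow> complex \<Rightarrow> binary_cubic" is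
  "\<lambda>a b c d \<xi>. a * (\<xi>$1)^3 + 3 * b * (\<xi>$1)\<^sup>2 * \<xi>$2 + 3 * c * \<xi>$1 * (\<xi>$2)\<^sup>2 + d * (\<xi>$2)^3"
  unfolding cubic_forms_def by blast

lemma mk_cubic_eval: "cubic_eval (mk_cubic a b c d) \<xi> = a * (\<xi>$1)^3 + 3 * b * (\<xi>$1)\<^sup>2 * \<xi>$2 + 3 * c * \<xi>$1 * (\<xi>$2)\<^sup>2 + d * (\<xi>$2)^3"
  by transfer simp

lemma mk_cubic_k [simp]: "kA (mk_cubic a b c d) = a" "kB (mk_cubic a b c d) = b" "kC (mk_cubic a b c d) = c" "kD (mk_cubic a b c d) = d"
  by (rule cubic_eval_coeffs_unique, simp add: mk_cubic_eval)+

lemma mk_cubic_eta: "mk_cubic (kA q) (kB q) (kC q) (kD q) = q"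
  by (rule binary_cubic_eqI) (simp add: mk_cubic_eval cubic_eval_coeffs[of q])

lemma k_det_cubic:
  "kA (det_cubic M) = cA (coords M)" "kB (det_cubic M) = cB (coords M)"
  "kC (det_cubic M) = cC (coords M)" "kD (det_cubic M) = cD (coords M)"
  by (rule cubic_eval_coeffs_unique, simp add: cubic_eval_det_cubic det_pencil_member)+

definition hess1 :: "binary_cubic \<Rightarrow> complex" where "hess1 q = kA q * kC q - (kB q)\<^sup>2"
definition hess2 :: "binary_cubic \<Rightarrow> complex" where "hess2 q = kA q * kD q - kB q * kC q"
definition hess3 :: "binary_cubic \<Rightarrow> complex" where "hess3 q = kB q * kD q - (kC q)\<^sup>2"

lemma hess_det_cubic:
  "hess1 (det_cubic M) = mn1 (detmap (coords M))" "hess2 (det_cubic M) = mn2 (detmap (coords M))" "hess3 (det_cubic M) = mn3 (detmap (coords M))"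
  by (simp_all add: hess1_def hess2_def hess3_def mn1_def mn2_def mn3_def k_det_cubic)

lemma cubes_iff_hess: "q \<in> cubes \<longleftrightarrow> hess1 q = 0 \<and> hess2 q = 0 \<and> hess3 q = 0"
proof
  assume "q \<in> cubes"
  then obtain u :: "complex^2" where u: "\<And>\<xi>. cubic_eval q \<xi> = (u $ 1 * \<xi> $ 1 + u $ 2 * \<xi> $ 2) ^ 3"
    unfolding cubes_def by blast
  have "(p * x + r * y) ^ 3 = p^3 * x^3 + 3 * (p\<^sup>2 * r) * x\<^sup>2 * y + 3 * (p * r\<^sup>2) * x * y\<^sup>2 + r^3 * y^3" for p r x y :: complex
    by algebra
  then have "kA q = (u$1)^3" "kB q = (u$1)\<^sup>2 * u$2" "kC q = u$1 * (u$2)\<^sup>2" "kD q = (u$2)^3"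
    by (intro cubic_eval_coeffs_unique; simp add: u)+
  then show "hess1 q = 0 \<and> hess2 q = 0 \<and> hess3 q = 0"
    by (simp add: hess1_def hess2_def hess3_def power2_eq_square power3_eq_cube)
next
  assume h: "hess1 q = 0 \<and> hess2 q = 0 \<and> hess3 q = 0"
  have "\<exists>p r. kA q = p^3 \<and> kB q = p\<^sup>2 * r \<and> kC q = p * r\<^sup>2 \<and> kD q = r^3"
  proof (cases "kA q = 0")
    case True
    obtain r where "r^3 = kD q" using complex_cube_root by blast
    then show ?thesis using h True by (intro exI[of _ 0] exI[of _ r]) (auto simp: hess1_def hess2_def hess3_def)
  next
    case False
    obtain p where p: "p^3 = kA q" using complex_cube_root by blast
    with False have "p \<noteq> 0" by auto
    define r where "r = kB q / p\<^sup>2"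
    have B: "kB q = p\<^sup>2 * r" using \<open>p \<noteq> 0\<close> by (simp add: r_def)
    have "p^3 * kC q = p^3 * (p * r\<^sup>2)" using h p B unfolding hess1_def by algebra
    then have C: "kC q = p * r\<^sup>2" using \<open>p \<noteq> 0\<close> by simp
    have "p^3 * kD q = p^3 * r^3" using h p B C unfolding hess2_def by algebra
    then have "kD q = r^3" using \<open>p \<noteq> 0\<close> by simp
    then show ?thesis using p B C by metis
  qed
  then obtain p r where pr: "kA q = p^3" "kB q = p\<^sup>2 * r" "kC q = p * r\<^sup>2" "kD q = r^3" by blast
  have "cubic_eval q \<xi> = (vec2 p r $ 1 * \<xi> $ 1 + vec2 p r $ 2 * \<xi> $ 2) ^ 3" for \<xi>
    unfolding cubic_eval_coeffs[of q \<xi>] pr vec2_nth by algebra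
  then show "q \<in> cubes" unfolding cubes_def by blast
qed

section \<open>Points of the parametrisation\<close>

lemma par_mk_pencil:
  assumes "par_good w" shows "mk_pencil (par w) \<in> cube_pencils"
proof -
  let ?M = "mk_pencil (par w)"
  let ?X = "\<lambda>\<xi>::complex^2. w 2 * \<xi>$1 + w 3 * \<xi>$2" and ?Y = "\<lambda>\<xi>::complex^2. w 4 * \<xi>$1 + w 5 * \<xi>$2"
  have good: "w 0 * w 1 - 1 \<noteq> 0" "w 2 * w 5 - w 3 * w 4 \<noteq> 0" "w 8 \<noteq> 0" "w 9 \<noteq> 0" using assms by (auto simp: par_good_def)
  \<comment> \<open>A cube root of the scalar factor is absorbed into the linear form, since
    \<open>cube_pencils\<close> asks for an exact cube.\<close>
  obtain m where m: "m ^ 3 = - ((w 0 * w 1 - 1)\<^sup>2)" using complex_cube_root by blast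
  with good have "m \<noteq> 0" by auto
  let ?K = "(w 9)\<^sup>2 * w 2 + (w 8)\<^sup>2 * w 4" and ?L = "(w 9)\<^sup>2 * w 3 + (w 8)\<^sup>2 * w 5"
  have member: "pencil_member ?M \<xi> = sym3 (\<xi>$1 * par w 0 + \<xi>$2 * (par w 1 + par w 9)) (\<xi>$1 * par w 2 + \<xi>$2 * (par w 10 + par w 3)) (\<xi>$1 * par w 8 + \<xi>$2 * par w 11)
       (\<xi>$1 * (par w 8 + par w 4) + \<xi>$2 * (par w 11 + par w 5)) (\<xi>$1 * par w 9 + \<xi>$2 * par w 6) (\<xi>$1 * par w 10 + \<xi>$2 * par w 7)" for \<xi>
    unfolding pencil_member_sym3 by (simp add: mk_pencil_entry)
  have "det (pencil_member ?M \<xi>) = (vec2 (m * ?K) (m * ?L) $ 1 * \<xi> $ 1 + vec2 (m * ?K) (m * ?L) $ 2 * \<xi> $ 2) ^ 3" for \<xi>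
  proof -
    have "m * ?K * \<xi> $ 1 + m * ?L * \<xi> $ 2 = m * (?K * \<xi> $ 1 + ?L * \<xi> $ 2)" by (simp add: algebra_simps)
    then show ?thesis unfolding member det_sym3 par_sdet_coeffs vec2_nth by (simp add: power_mult_distrib m)
  qed
  moreover have "vec2 (m * ?K) (m * ?L) \<noteq> 0"
  proof
    assume "vec2 (m * ?K) (m * ?L) = 0"
    then have "m * ?K = 0" "m * ?L = 0" by (metis vec2_nth(1) zero_index, metis vec2_nth(2) zero_index)
    then have "?K = 0" "?L = 0" using \<open>m \<noteq> 0\<close> by simp_all
    then have "(w 9)\<^sup>2 * (w 2 * w 5 - w 3 * w 4) = 0" by algebra
    then show False using good by simp
  qed
  \<comment> \<open>After the congruence by P is undone, the minors used are X Y, X z2 and Y z1. If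
    all vanish, then one of X, Y is zero and the other is not; if Y = 0 then z2 = v^3 X is nonzero,
    a contradiction, and likewise for X = 0.\<close>
  moreover have "\<not> rank (pencil_member ?M \<xi>) \<le> 1" if "\<xi> \<noteq> 0" for \<xi>
  proof
    assume "rank (pencil_member ?M \<xi>) \<le> 1"
    then obtain x y where xy: "\<And>r s. pencil_member ?M \<xi> $ r $ s = x $ r * y $ s" unfolding rank_le_1_iff by blast
    let ?z1 = "w 6 * ?X \<xi> + w 8 ^ 3 * ?Y \<xi>" and ?z2 = "w 7 * ?Y \<xi> + w 9 ^ 3 * ?X \<xi>"
    have e: "pencil_member ?M \<xi> $ 1 $ 2 = w 0 * ?z1 + ?z2" "pencil_member ?M \<xi> $ 1 $ 3 = ?z1 + w 1 * ?z2"
      "pencil_member ?M \<xi> $ 2 $ 2 = (w 0)\<^sup>2 * ?X \<xi> + ?Y \<xi>" "pencil_member ?M \<xi> $ 2 $ 3 = w 0 * ?X \<xi> + w 1 * ?Y \<xi>"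
      "pencil_member ?M \<xi> $ 3 $ 2 = w 0 * ?X \<xi> + w 1 * ?Y \<xi>"
      "pencil_member ?M \<xi> $ 3 $ 3 = ?X \<xi> + (w 1)\<^sup>2 * ?Y \<xi>"
      unfolding member by (simp_all add: par_def algebra_simps)
    note e' = e[unfolded xy]
    have "(w 0 * w 1 - 1)\<^sup>2 * (?X \<xi> * ?Y \<xi>) = 0" using e'(3-6) by algebra
    then have XY: "?X \<xi> * ?Y \<xi> = 0" using good by simp
    have "(w 0 * w 1 - 1) * ((w 0 * w 1 - 1) * (?X \<xi> * ?z2)) = 0 \<and> (w 0 * w 1 - 1) * ((w 0 * w 1 - 1) * (?Y \<xi> * ?z1)) = 0"
    proof -
      have "(w 0 * ?z1 + ?z2) * (w 0 * ?X \<xi> + w 1 * ?Y \<xi>) = (?z1 + w 1 * ?z2) * ((w 0)\<^sup>2 * ?X \<xi> + ?Y \<xi>)"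
        "(w 0 * ?z1 + ?z2) * (?X \<xi> + (w 1)\<^sup>2 * ?Y \<xi>) = (?z1 + w 1 * ?z2) * (w 0 * ?X \<xi> + w 1 * ?Y \<xi>)"
        by (simp only: e'(1,2,3,4)[symmetric], simp) (simp only: e'(1,2,5,6)[symmetric], simp)
      then show ?thesis by algebra
    qed
    then have XZ: "?X \<xi> * ?z2 = 0" "?Y \<xi> * ?z1 = 0" using good by simp_all
    have "\<not> (?X \<xi> = 0 \<and> ?Y \<xi> = 0)"
    proof
      assume "?X \<xi> = 0 \<and> ?Y \<xi> = 0"
      then have "(w 2 * w 5 - w 3 * w 4) * \<xi>$1 = 0" "(w 2 * w 5 - w 3 * w 4) * \<xi>$2 = 0" by algebra+
      then have "\<xi>$1 = 0" "\<xi>$2 = 0" using good by simp_all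
      then show False using that by (simp add: vec_eq_iff forall_2)
    qed
    then show False using XY XZ good by auto
  qed
  ultimately show ?thesis unfolding cube_pencils_def by blast
qed

section \<open>The group action on pencils\<close>

definition pmat :: "pencil \<Rightarrow> 2 \<Rightarrow> matF" where "pmat M i = (\<chi> r s. pencil_entry M i r s)"

lemma pmat_eqI: "pmat M 1 = pmat N 1 \<Longrightarrow> pmat M 2 = pmat N 2 \<Longrightarrow> M = N"
proof (rule pencil_eqI)
  fix i r s assume "pmat M 1 = pmat N 1" "pmat M 2 = pmat N 2"
  then have "pmat M i = pmat N i" using exhaust_2[of i] by auto
  then have "pmat M i $ r $ s = pmat N i $ r $ s" by simp
  then show "pencil_entry M i r s = pencil_entry N i r s" by (simp add: pmat_def)
qed

lemma pmat_act:
  "pmat (pencil_act g h M) i = (\<Sum>j\<in>UNIV. (\<chi> r s. g $ i $ j * (h ** pmat M j ** transpose h) $ r $ s))"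
  unfolding pmat_def
  by transfer (simp add: vec_eq_iff)

lemma pmat_act_nth:
  "pmat (pencil_act g h M) i $ r $ s = (\<Sum>j\<in>UNIV. g $ i $ j * (h ** pmat M j ** transpose h) $ r $ s)"
  unfolding pmat_act by simp

lemma pmat_dilate: "pmat (pencil_dilate t M) i = (\<chi> r s. t * pmat M i $ r $ s)"
  unfolding pmat_def by transfer (simp add: vec_eq_iff)

lemma transpose_pmat: "transpose (pmat M i) = pmat M i"
  by (simp add: transpose_def pmat_def vec_eq_iff pencil_entry_sym)

lemma pmat_cong_nth: "(h ** A ** transpose h) $ r $ s = (\<Sum>k\<in>UNIV. \<Sum>l\<in>UNIV. h $ r $ k * A $ k $ l * h $ s $ l)"
  for h A :: "complex^'n^'n"
proof -
  have "(h ** A ** transpose h) $ r $ s = (\<Sum>l\<in>UNIV. \<Sum>k\<in>UNIV. h $ r $ k * A $ k $ l * h $ s $ l)"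
    by (simp add: matrix_matrix_mult_def transpose_def sum_distrib_right)
  then show ?thesis by (subst sum.swap)
qed

lemma pencil_member_pmat: "pencil_member M \<xi> $ r $ s = \<xi>$1 * pmat M 1 $ r $ s + \<xi>$2 * pmat M 2 $ r $ s"
  by (simp add: pencil_member_def pmat_def sum_2)

lemma pencil_member_act:
  "pencil_member (pencil_act g h M) \<xi> = h ** pencil_member M (transpose g *v \<xi>) ** transpose h"
proof -
  have t: "(transpose g *v \<xi>)$1 = g$1$1 * \<xi>$1 + g$2$1 * \<xi>$2" "(transpose g *v \<xi>)$2 = g$1$2 * \<xi>$1 + g$2$2 * \<xi>$2"
    by (simp_all add: transpose_def matrix_vector_mult_def sum_2)
  show ?thesis
    unfolding vec_eq_iff
  proof (intro allI)
    fix r s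
    show "pencil_member (pencil_act g h M) \<xi> $ r $ s = (h ** pencil_member M (transpose g *v \<xi>) ** transpose h) $ r $ s"
      unfolding pencil_member_pmat pmat_act_nth pmat_cong_nth t sum_2 sum_3
      by (simp add: algebra_simps)
  qed
qed

lemma det_pencil_member_act:
  "det (pencil_member (pencil_act g h M) \<xi>) = (det h)\<^sup>2 * det (pencil_member M (transpose g *v \<xi>))"
  by (simp add: pencil_member_act det_mul power2_eq_square)

lemma det_cubic_act: "det_cubic (pencil_act g h M) = cubic_act g h (det_cubic M)"
proof (rule binary_cubic_eqI)
  fix \<xi>
  have "cubic_eval (cubic_act g h q) \<xi> = (det h)\<^sup>2 * cubic_eval q (transpose g *v \<xi>)" for q
    by transfer simp
  then show "cubic_eval (det_cubic (pencil_act g h M)) \<xi> = cubic_eval (cubic_act g h (det_cubic M)) \<xi>"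
    by (simp add: cubic_eval_det_cubic det_pencil_member_act)
qed

lemma pencil_act_act: "pencil_act g h (pencil_act g' h' M) = pencil_act (g ** g') (h ** h') M"
proof -
  have *: "(h ** (h' ** A ** transpose h') ** transpose h) = (h ** h') ** A ** transpose (h ** h')" for A
    by (simp add: matrix_transpose_mul matrix_mul_assoc)
  have "pmat (pencil_act g h (pencil_act g' h' M)) i $ r $ s = pmat (pencil_act (g ** g') (h ** h') M) i $ r $ s" for i r s
  proof -
    have "(h ** pmat (pencil_act g' h' M) j ** transpose h) $ r $ s
       = (\<Sum>k\<in>UNIV. g' $ j $ k * ((h ** h') ** pmat M k ** transpose (h ** h')) $ r $ s)" for j
      unfolding *[symmetric] pmat_cong_nth[of h] pmat_act_nth sum_2 sum_3 by (simp add: algebra_simps)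
    then show ?thesis
      unfolding pmat_act_nth[of g h] pmat_act_nth[of "g ** g'"]
      by (simp add: matrix_matrix_mult_def sum_2 algebra_simps)
  qed
  then show ?thesis by (intro pmat_eqI) (simp_all add: vec_eq_iff)
qed

lemma pencil_act_1: "pencil_act (mat 1) (mat 1) M = M"
proof -
  have "(mat 1 :: matE) $ i $ j = (if i = j then 1 else 0)" for i j by (simp add: mat_def)
  then have "pmat (pencil_act (mat 1) (mat 1) M) i $ r $ s = pmat M i $ r $ s" for i r s
    using exhaust_2[of i] by (auto simp: pmat_act_nth sum_2 transpose_mat)
  then show ?thesis by (intro pmat_eqI) (simp_all add: vec_eq_iff)
qed

lemma invertible_mult_inv:
  fixes A :: "complex^'n^'n"
  assumes "invertible A" shows "A ** matrix_inv A = mat 1" "matrix_inv A ** A = mat 1"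
proof -
  have "A ** matrix_inv A = mat 1 \<and> matrix_inv A ** A = mat 1"
    unfolding matrix_inv_def by (rule someI_ex) (use assms in \<open>simp add: invertible_def\<close>)
  then show "A ** matrix_inv A = mat 1" "matrix_inv A ** A = mat 1" by auto
qed

lemma invertible_transpose_field: "invertible (transpose A) \<longleftrightarrow> invertible A" for A :: "complex^'n^'n"
  by (simp add: invertible_det_nz)

lemma invertible_matrix_inv: "invertible A \<Longrightarrow> invertible (matrix_inv A)" for A :: "complex^'n^'n"
  using invertible_mult_inv invertible_def by blast

lemma pencil_act_inv:
  assumes "invertible g" "invertible h"
  shows "pencil_act (matrix_inv g) (matrix_inv h) (pencil_act g h M) = M"
    "pencil_act g h (pencil_act (matrix_inv g) (matrix_inv h) M) = M"
  by (simp_all add: pencil_act_act invertible_mult_inv assms pencil_act_1)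

text \<open>Over the complex numbers the dilation and the two special linear groups together act
  with the same orbits as the product of the general linear groups.\<close>

lemma orbit9_GL: "M \<in> orbit9 \<longleftrightarrow> (\<exists>g h. invertible g \<and> invertible h \<and> M = pencil_act g h pencil9)"
proof
  assume "M \<in> orbit9"
  then obtain t g h where *: "M = pencil_dilate t (pencil_act g h pencil9)" "t \<noteq> 0" "det g = 1" "det h = 1"
    unfolding orbit9_def by blast
  let ?g = "(\<chi> i j. t * g $ i $ j) :: matE"
  have "pmat M i $ r $ s = pmat (pencil_act ?g h pencil9) i $ r $ s" for i r s
    unfolding *(1) pmat_dilate pmat_act_nth vec_lambda_beta sum_distrib_left by (simp only: mult.assoc)
  then have "M = pencil_act ?g h pencil9" by (intro pmat_eqI) (simp_all add: vec_eq_iff)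
  moreover have "det ?g = t * t * det g" by (simp add: det_2 algebra_simps)
  then have "invertible ?g" using * by (simp add: invertible_det_nz)
  ultimately show "\<exists>g h. invertible g \<and> invertible h \<and> M = pencil_act g h pencil9"
    using *(4) by (intro exI[of _ ?g] exI[of _ h]) (simp add: invertible_det_nz)
next
  assume "\<exists>g h. invertible g \<and> invertible h \<and> M = pencil_act g h pencil9"
  then obtain g h where gh: "det g \<noteq> 0" "det h \<noteq> 0" "M = pencil_act g h pencil9" by (auto simp: invertible_det_nz)
  \<comment> \<open>Scaling \<open>g\<close> by 1/a and \<open>h\<close> by 1/b normalises the
    determinants. As \<open>h\<close> acts twice, the scalar to restore is a b^2.\<close>
  obtain a where a: "a\<^sup>2 = det g" using power2_csqrt by blast
  obtain b where b: "b ^ 3 = det h" using complex_cube_root by blast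
  have nz: "a \<noteq> 0" "b \<noteq> 0" using a b gh by auto
  let ?g = "(\<chi> i j. g $ i $ j / a) :: matE" and ?h = "(\<chi> i j. h $ i $ j / b) :: matF"
  have "det ?g = det g / a\<^sup>2" using nz by (simp add: det_2 power2_eq_square field_simps)
  then have 1: "det ?g = 1" using a gh by simp
  have "det ?h = det h / b ^ 3" using nz by (simp add: det_3 power3_eq_cube field_simps)
  then have 2: "det ?h = 1" using b gh by simp
  have "(h ** A ** transpose h) $ r $ s = b\<^sup>2 * (?h ** A ** transpose ?h) $ r $ s" for A r s
    using nz by (simp add: pmat_cong_nth sum_distrib_left power2_eq_square)
  then have "M = pencil_dilate (a * b\<^sup>2) (pencil_act ?g ?h pencil9)"
  proof -
    have "a * b\<^sup>2 * (g $ i $ j / a * x) = g $ i $ j * (b\<^sup>2 * x)" for i j x using nz by simp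
    then have "pmat M i $ r $ s = pmat (pencil_dilate (a * b\<^sup>2) (pencil_act ?g ?h pencil9)) i $ r $ s" for i r s
      unfolding gh(3) pmat_dilate pmat_act_nth vec_lambda_beta sum_distrib_left
      using \<open>\<And>A r s. (h ** A ** transpose h) $ r $ s = _\<close> by simp
    then show ?thesis by (intro pmat_eqI) (simp_all add: vec_eq_iff)
  qed
  then show "M \<in> orbit9" unfolding orbit9_def using 1 2 nz by (intro CollectI exI[of _ "a * b\<^sup>2"] exI[of _ ?g] exI[of _ ?h]) simp
qed

lemma orbit9_act:
  assumes "invertible g" "invertible h" "pencil_act g h M \<in> orbit9"
  shows "M \<in> orbit9"
proof -
  obtain g' h' where "invertible g'" "invertible h'" "pencil_act g h M = pencil_act g' h' pencil9"
    using assms(3) unfolding orbit9_GL by blast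
  then have "M = pencil_act (matrix_inv g ** g') (matrix_inv h ** h') pencil9"
    using pencil_act_inv(1)[OF assms(1,2), of M] by (simp add: pencil_act_act)
  moreover have "invertible (matrix_inv g ** g')" "invertible (matrix_inv h ** h')"
    using \<open>invertible g'\<close> \<open>invertible h'\<close> assms by (auto intro: invertible_mult invertible_matrix_inv)
  ultimately show ?thesis unfolding orbit9_GL by blast
qed

section \<open>The orbit as a set of pencils\<close>

lemma pmat_pencil9: "pmat pencil9 1 = sym3 1 0 0 0 (1/2) 0" "pmat pencil9 2 = sym3 0 0 (1/2) 0 0 0"
proof -
  have e: "pencil_entry pencil9 i r s = (tens (axis 2 1) (sprod (axis 1 1) (axis 3 1))
   + tens (axis 1 1) (sprod (axis 2 1) (axis 3 1)) + tens (axis 1 1) (sprod (axis 1 1) (axis 1 1))) $ i $ r $ s" for i r s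
    by transfer simp
  show "pmat pencil9 1 = sym3 1 0 0 0 (1/2) 0" "pmat pencil9 2 = sym3 0 0 (1/2) 0 0 0"
    unfolding pmat_def e by (simp_all add: vec_eq_iff forall_3 tens_def sprod_def axis_def)
qed

lemma rank_congruence:
  fixes h A :: "complex^'n^'n"
  assumes "invertible h"
  shows "rank (h ** A ** transpose h) \<le> 1 \<longleftrightarrow> rank A \<le> 1"
proof -
  have *: "rank (k ** B ** transpose k) \<le> 1" if B: "rank B \<le> 1" for k B :: "complex^'n^'n"
  proof -
    obtain x y where xy: "\<And>r s. B $ r $ s = x $ r * y $ s" using B unfolding rank_le_1_iff by blast
    have "(k ** B ** transpose k) $ r $ s = (k *v x) $ r * (k *v y) $ s" for r s
      unfolding pmat_cong_nth by (simp add: xy matrix_vector_mult_def sum_product mult_ac)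
    then show ?thesis unfolding rank_le_1_iff by blast
  qed
  have "matrix_inv h ** (h ** A ** transpose h) ** transpose (matrix_inv h)
      = (matrix_inv h ** h) ** A ** transpose (matrix_inv h ** h)"
    by (simp add: matrix_transpose_mul matrix_mul_assoc)
  also have "\<dots> = A" by (simp add: invertible_mult_inv[OF assms] transpose_mat)
  finally show ?thesis using *[of A h] *[of "h ** A ** transpose h" "matrix_inv h"] by auto
qed

lemma transpose_mult_nz: "invertible g \<Longrightarrow> \<xi> \<noteq> 0 \<Longrightarrow> transpose g *v \<xi> \<noteq> 0" for g :: "complex^'n^'n"
  by (metis invertible_transpose_field matrix_left_invertible_ker invertible_left_inverse)

lemma cube_pencils_act:
  assumes M: "M \<in> cube_pencils" and g: "invertible g" and h: "invertible h"
  shows "pencil_act g h M \<in> cube_pencils"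
proof -
  obtain u :: "complex^2" where u: "u \<noteq> 0" "\<And>\<xi>. det (pencil_member M \<xi>) = (u $ 1 * \<xi> $ 1 + u $ 2 * \<xi> $ 2) ^ 3"
    and r: "\<And>\<xi>. \<xi> \<noteq> 0 \<Longrightarrow> \<not> rank (pencil_member M \<xi>) \<le> 1" using M unfolding cube_pencils_def by blast
  obtain m where m: "m ^ 3 = (det h)\<^sup>2" using complex_cube_root by blast
  have mnz: "m \<noteq> 0" using m h by (auto simp: invertible_det_nz)
  let ?u = "m *s (g *v u)"
  have "det (pencil_member (pencil_act g h M) \<xi>) = (?u $ 1 * \<xi> $ 1 + ?u $ 2 * \<xi> $ 2) ^ 3" for \<xi>
  proof -
    have "?u $ 1 * \<xi> $ 1 + ?u $ 2 * \<xi> $ 2 = m * (u $ 1 * (transpose g *v \<xi>) $ 1 + u $ 2 * (transpose g *v \<xi>) $ 2)"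
      by (simp add: matrix_vector_mult_def sum_2 transpose_def algebra_simps)
    then show ?thesis unfolding det_pencil_member_act u(2) by (simp add: power_mult_distrib m)
  qed
  moreover have "?u \<noteq> 0"
    using mnz u(1) transpose_mult_nz[of "transpose g" u] g by (simp add: invertible_transpose_field)
  moreover have "\<not> rank (pencil_member (pencil_act g h M) \<xi>) \<le> 1" if "\<xi> \<noteq> 0" for \<xi>
    unfolding pencil_member_act rank_congruence[OF h] using r transpose_mult_nz[OF g that] by blast
  ultimately show ?thesis unfolding cube_pencils_def by blast
qed

lemma pencil9_cube: "pencil9 \<in> cube_pencils"
proof -
  have member: "pencil_member pencil9 \<xi> = sym3 (\<xi>$1) 0 (\<xi>$2 / 2) 0 (\<xi>$1 / 2) 0" for \<xi>
    by (simp add: vec_eq_iff forall_3 pencil_member_pmat pmat_pencil9)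
  \<comment> \<open>The determinant of a member of \<open>pencil9\<close> is -1/4 times the cube of
    the first coordinate.\<close>
  obtain m :: complex where m: "m ^ 3 = - 1 / 4" using complex_cube_root by blast
  have "vec2 m 0 \<noteq> 0" using m by (metis vec2_nth(1) zero_index zero_power zero_less_numeral divide_eq_0_iff neg_equal_0_iff_equal zero_neq_one zero_neq_numeral)
  moreover have "det (pencil_member pencil9 \<xi>) = (vec2 m 0 $ 1 * \<xi> $ 1 + vec2 m 0 $ 2 * \<xi> $ 2) ^ 3" for \<xi>
    unfolding member det_sym3 sdet_def vec2_nth using m by (simp add: field_simps power_mult_distrib) algebra
  moreover have "\<not> rank (pencil_member pencil9 \<xi>) \<le> 1" if "\<xi> \<noteq> 0" for \<xi>
  proof
    assume "rank (pencil_member pencil9 \<xi>) \<le> 1"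
    then obtain x y where xy: "\<And>r s. pencil_member pencil9 \<xi> $ r $ s = x $ r * y $ s" unfolding rank_le_1_iff by blast
    have "pencil_member pencil9 \<xi> $ 2 $ 3 * pencil_member pencil9 \<xi> $ 3 $ 2 = pencil_member pencil9 \<xi> $ 2 $ 2 * pencil_member pencil9 \<xi> $ 3 $ 3"
      "pencil_member pencil9 \<xi> $ 1 $ 3 * pencil_member pencil9 \<xi> $ 3 $ 1 = pencil_member pencil9 \<xi> $ 1 $ 1 * pencil_member pencil9 \<xi> $ 3 $ 3"
      unfolding xy by simp_all
    then have "\<xi>$1 = 0" "\<xi>$2 = 0" unfolding member by simp_all
    then show False using that by (simp add: vec_eq_iff forall_2)
  qed
  ultimately show ?thesis unfolding cube_pencils_def by blast
qed

section \<open>Normal forms of pencils with cubic determinant\<close>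

definition mat3 :: "complex \<Rightarrow> complex \<Rightarrow> complex \<Rightarrow> complex \<Rightarrow> complex \<Rightarrow> complex \<Rightarrow> complex \<Rightarrow> complex \<Rightarrow> complex \<Rightarrow> matF" where
  "mat3 a b c d e f g h i = vector [vector [a, b, c], vector [d, e, f], vector [g, h, i]]"

lemma mat3_nth [simp]:
  "mat3 a b c d e f g h i $ 1 $ 1 = a" "mat3 a b c d e f g h i $ 1 $ 2 = b" "mat3 a b c d e f g h i $ 1 $ 3 = c"
  "mat3 a b c d e f g h i $ 2 $ 1 = d" "mat3 a b c d e f g h i $ 2 $ 2 = e" "mat3 a b c d e f g h i $ 2 $ 3 = f"
  "mat3 a b c d e f g h i $ 3 $ 1 = g" "mat3 a b c d e f g h i $ 3 $ 2 = h" "mat3 a b c d e f g h i $ 3 $ 3 = i"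
  by (simp_all add: mat3_def)

definition mat2 :: "complex \<Rightarrow> complex \<Rightarrow> complex \<Rightarrow> complex \<Rightarrow> matE" where
  "mat2 a b c d = vector [vector [a, b], vector [c, d]]"

lemma mat2_nth [simp]:
  "mat2 a b c d $ 1 $ 1 = a" "mat2 a b c d $ 1 $ 2 = b" "mat2 a b c d $ 2 $ 1 = c" "mat2 a b c d $ 2 $ 2 = d"
  by (simp_all add: mat2_def)

text \<open>\<open>?g\<close> multiplies the first matrix by \<open>\<alpha>\<close> and adds
  \<open>2 * \<gamma>\<close> times the second, which produces the entry 13. \<open>?h\<close>
  stretches the second basis vector to produce \<open>\<beta>\<close> and shears to produce
  \<open>\<epsilon>\<close>.\<close>

lemma normal_form_1:
  assumes 1: "pmat M 1 = sym3 \<alpha> 0 \<gamma> 0 \<beta> \<epsilon>" and 2: "pmat M 2 = sym3 0 0 (1/2) 0 0 0" and nz: "\<alpha> \<noteq> 0" "\<beta> \<noteq> 0"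
  shows "M \<in> orbit9"
proof -
  let ?g = "mat2 \<alpha> (2 * \<gamma>) 0 1" and ?h = "mat3 1 0 0 0 (2 * \<beta> / \<alpha>) 0 0 (\<epsilon> / \<alpha>) 1"
  have "pmat M 1 $ r $ s = pmat (pencil_act ?g ?h pencil9) 1 $ r $ s" "pmat M 2 $ r $ s = pmat (pencil_act ?g ?h pencil9) 2 $ r $ s" for r s
    unfolding 1 2 pmat_act_nth pmat_cong_nth sum_2 sum_3 pmat_pencil9
    using exhaust_3[of r] exhaust_3[of s] nz by (auto simp: field_simps)
  then have "M = pencil_act ?g ?h pencil9" by (intro pmat_eqI) (simp_all add: vec_eq_iff)
  moreover have "invertible ?g" "invertible ?h" using nz by (simp_all add: invertible_det_nz det_2 det_3)
  ultimately show ?thesis unfolding orbit9_GL by blast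
qed

text \<open>A nondegenerate binary quadratic form over the complex numbers has two independent
  isotropic vectors; scaling one of them fixes their pairing.\<close>

lemma hyperbolic_pair:
  fixes a b d :: complex
  assumes "a * d - b\<^sup>2 \<noteq> 0"
  shows "\<exists>p1 p2 q1 q2. p1 * q2 - p2 * q1 \<noteq> 0 \<and> a * p1\<^sup>2 + 2 * b * p1 * p2 + d * p2\<^sup>2 = 0 \<and>
    a * q1\<^sup>2 + 2 * b * q1 * q2 + d * q2\<^sup>2 = 0 \<and> a * p1 * q1 + b * (p1 * q2 + p2 * q1) + d * p2 * q2 = 1/2"
proof (cases "a = 0")
  case True
  then have b: "b \<noteq> 0" using assms by auto
  show ?thesis
    by (rule exI[of _ "1 / (2 * b)"], rule exI[of _ 0], rule exI[of _ "- d / (2 * b)"], rule exI[of _ 1])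
      (use True b in \<open>simp add: field_simps power2_eq_square\<close>)
next
  case False
  obtain t where t: "t\<^sup>2 = b\<^sup>2 - a * d" using power2_csqrt by blast
  have tnz: "t \<noteq> 0" using t assms by auto
  \<comment> \<open>The isotropic vectors (p, 1) and (q, 1) pair to -2 t^2 / a; \<open>k\<close>
    brings this to 1/2.\<close>
  define k where "k = - a / (4 * t\<^sup>2)"
  have k: "k \<noteq> 0" "4 * t\<^sup>2 * k = - a" using False tnz by (auto simp: k_def field_simps)
  define p where "p = (- b + t) / a" define q where "q = (- b - t) / a"
  have pq: "a * p = - b + t" "a * q = - b - t" using False by (simp_all add: p_def q_def)
  have "a * (a * p\<^sup>2 + 2 * b * p + d) = 0" "a * (a * q\<^sup>2 + 2 * b * q + d) = 0"
    using pq t by algebra+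
  then have 0: "a * p\<^sup>2 + 2 * b * p + d = 0" "a * q\<^sup>2 + 2 * b * q + d = 0" using False by simp_all
  have "a * (2 * (k * (a * p * q + b * (p + q) + d))) = a * 1" using pq t k(2) by algebra
  then have "2 * (k * (a * p * q + b * (p + q) + d)) = 1" using False by (metis mult_left_cancel)
  then have f: "k * (a * p * q + b * (p + q) + d) = 1/2" by (metis nonzero_mult_div_cancel_left zero_neq_numeral)
  have "a * (p - q) = 2 * t" using pq by algebra
  then have ne: "p - q \<noteq> 0" using tnz False by auto
  show ?thesis
  proof (rule exI[of _ "k * p"], rule exI[of _ k], rule exI[of _ q], rule exI[of _ 1], intro conjI)
    show "k * p * 1 - k * q \<noteq> 0" using ne k by (simp flip: right_diff_distrib)
    show "a * (k * p)\<^sup>2 + 2 * b * (k * p) * k + d * k\<^sup>2 = 0" using 0(1) by algebra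
    show "a * q\<^sup>2 + 2 * b * q * 1 + d * 1\<^sup>2 = 0" using 0(2) by simp
    show "a * (k * p) * q + b * (k * p * 1 + k * q) + d * k * 1 = 1/2" using f by (simp add: algebra_simps)
  qed
qed

lemma normal_form_rank2_aux:
  fixes S :: matF
  assumes S: "S = sym3 a b c d e f" and 0: "sdet a b c d e f = 0" and nz: "a * d - b\<^sup>2 \<noteq> 0"
  shows "\<exists>h. invertible h \<and> h ** S ** transpose h = sym3 0 0 (1/2) 0 0 0"
proof -
  obtain p1 p2 q1 q2 where pq: "p1 * q2 - p2 * q1 \<noteq> 0" "a * p1\<^sup>2 + 2 * b * p1 * p2 + d * p2\<^sup>2 = 0"
    "a * q1\<^sup>2 + 2 * b * q1 * q2 + d * q2\<^sup>2 = 0" "a * p1 * q1 + b * (p1 * q2 + p2 * q1) + d * p2 * q2 = 1/2"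
    using hyperbolic_pair[OF nz] by blast
  \<comment> \<open>The cofactors of the third row span the kernel. This vector becomes the middle
    row of \<open>?h\<close>, between the two isotropic ones.\<close>
  define n1 n2 n3 where n: "n1 = b * e - c * d" "n2 = b * c - a * e" "n3 = a * d - b\<^sup>2"
  have ker: "a * n1 + b * n2 + c * n3 = 0" "b * n1 + d * n2 + e * n3 = 0" "c * n1 + e * n2 + f * n3 = 0"
    using 0 unfolding n sdet_def by algebra+
  let ?h = "mat3 p1 p2 0 n1 n2 n3 q1 q2 0"
  have "det ?h = - n3 * (p1 * q2 - p2 * q1)" unfolding det_3 mat3_nth by algebra
  then have "invertible ?h" using pq(1) nz n(3) by (simp add: invertible_det_nz)
  moreover have "?h ** S ** transpose ?h = sym3 0 0 (1/2) 0 0 0"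
  proof -
    define B where "B x1 x2 x3 y1 y2 y3 = a * x1 * y1 + b * (x1 * y2 + x2 * y1) + c * (x1 * y3 + x3 * y1) + d * x2 * y2
      + e * (x2 * y3 + x3 * y2) + f * x3 * y3" for x1 x2 x3 y1 y2 y3
    have entry: "(?h ** S ** transpose ?h) $ r $ s = B (?h $ r $ 1) (?h $ r $ 2) (?h $ r $ 3) (?h $ s $ 1) (?h $ s $ 2) (?h $ s $ 3)" for r s
      unfolding pmat_cong_nth sum_3 S B_def sym3_nth by algebra
    have B0: "B n1 n2 n3 y1 y2 y3 = 0" "B y1 y2 y3 n1 n2 n3 = 0" for y1 y2 y3
      unfolding B_def using ker by algebra+
    have "B p1 p2 0 p1 p2 0 = 0" "B q1 q2 0 q1 q2 0 = 0" unfolding B_def using pq(2,3) by algebra+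
    moreover have "B p1 p2 0 q1 q2 0 = 1/2" "B q1 q2 0 p1 p2 0 = 1/2"
      unfolding B_def using pq(4) by (simp_all add: algebra_simps)
    ultimately show ?thesis by (simp add: vec_eq_iff forall_3 entry B0)
  qed
  ultimately show ?thesis by blast
qed

lemma symmetric_eq_sym3:
  fixes S :: matF
  assumes "transpose S = S"
  shows "S = sym3 (S$1$1) (S$1$2) (S$1$3) (S$2$2) (S$2$3) (S$3$3)"
proof -
  have "S $ r $ s = S $ s $ r" for r s
    using arg_cong[OF assms, of "\<lambda>T. T $ r $ s"] by (simp add: transpose_def)
  from this[of 2 1] this[of 3 1] this[of 3 2] show ?thesis by (simp add: vec_eq_iff forall_3)
qed

lemma swap_congruence:
  "mat3 1 0 0 0 0 1 0 1 0 ** sym3 a b c d e f ** transpose (mat3 1 0 0 0 0 1 0 1 0) = sym3 a c b f e d"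
  "mat3 0 0 1 0 1 0 1 0 0 ** sym3 a b c d e f ** transpose (mat3 0 0 1 0 1 0 1 0 0) = sym3 f e c d b a"
  by (simp_all add: vec_eq_iff forall_3 pmat_cong_nth sum_3)

lemma invertible_swap: "invertible (mat3 1 0 0 0 0 1 0 1 0)" "invertible (mat3 0 0 1 0 1 0 1 0 0)"
  by (simp_all add: invertible_det_nz det_3)

text \<open>A singular symmetric matrix of rank 2 has a nonzero principal 2x2 minor; a permutation
  of the basis moves it to the upper left corner.\<close>

lemma normal_form_rank2:
  fixes S :: matF
  assumes sym: "transpose S = S" and det: "det S = 0" and rank: "\<not> rank S \<le> 1"
  shows "\<exists>h. invertible h \<and> h ** S ** transpose h = sym3 0 0 (1/2) 0 0 0"
proof -
  obtain a b c d e f where S: "S = sym3 a b c d e f" using symmetric_eq_sym3[OF sym] by blast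
  have 0: "sdet a b c d e f = 0" using det unfolding S det_sym3 .
  have swap: ?thesis if k: "invertible k" "\<exists>h. invertible h \<and> h ** (k ** S ** transpose k) ** transpose h = sym3 0 0 (1/2) 0 0 0" for k
  proof -
    obtain h where h: "invertible h" "h ** (k ** S ** transpose k) ** transpose h = sym3 0 0 (1/2) 0 0 0" using k(2) by blast
    have "(h ** k) ** S ** transpose (h ** k) = sym3 0 0 (1/2) 0 0 0"
      using h(2) by (simp add: matrix_transpose_mul matrix_mul_assoc)
    then show ?thesis using invertible_mult[OF h(1) k(1)] by blast
  qed
  consider "a * d - b\<^sup>2 \<noteq> 0" | "a * f - c\<^sup>2 \<noteq> 0" | "f * d - e\<^sup>2 \<noteq> 0" | "a * d = b\<^sup>2" "a * f = c\<^sup>2" "f * d = e\<^sup>2" by auto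
  then show ?thesis
  proof cases
    case 1
    show ?thesis by (rule normal_form_rank2_aux[OF S 0 1])
  next
    case 2
    show ?thesis
      by (rule swap[OF invertible_swap(1)], unfold S swap_congruence(1), rule normal_form_rank2_aux[OF refl _ 2])
        (use 0 in \<open>simp add: sdet_def algebra_simps\<close>)
  next
    case 3
    show ?thesis
      by (rule swap[OF invertible_swap(2)], unfold S swap_congruence(2), rule normal_form_rank2_aux[OF refl _ 3])
        (use 0 in \<open>simp add: sdet_def algebra_simps\<close>)
  next
    case 4
    \<comment> \<open>By Jacobi's identity for the adjugate, the square of an off-diagonal minor is
      a product of two principal minors minus a diagonal entry times the determinant.\<close>
    have "(b * c - a * e)\<^sup>2 = 0" "(c * e - b * f)\<^sup>2 = 0" "(b * e - c * d)\<^sup>2 = 0"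
      using 4 0 unfolding sdet_def by algebra+
    then have m: "b * c = a * e" "c * e = b * f" "b * e = c * d" by simp_all
    have "\<exists>x y. \<forall>r s. S $ r $ s = x $ r * y $ s"
    proof -
      consider "a \<noteq> 0" | "a = 0" "d \<noteq> 0" | "a = 0" "d = 0" by blast
      then show ?thesis
      proof cases
        case 1
        then show ?thesis unfolding S forall_3 sym3_nth
          by (intro exI[of _ "vector [1, b / a, c / a]"] exI[of _ "vector [a, b, c]"])
            (use 4 m in \<open>simp add: field_simps power2_eq_square\<close>)
      next
        case 2
        then have "b = 0" using 4 by simp
        moreover have "c = 0" using m(3) 2 calculation by simp
        ultimately show ?thesis using 2 unfolding S forall_3 sym3_nth
          by (intro exI[of _ "vector [0, 1, e / d]"] exI[of _ "vector [0, d, e]"])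
            (use 4 m in \<open>simp add: field_simps power2_eq_square\<close>)
      next
        case 3
        then have "b = 0" "c = 0" "e = 0" using 4 by simp_all
        then show ?thesis using 3 unfolding S forall_3 sym3_nth
          by (intro exI[of _ "vector [0, 0, 1]"] exI[of _ "vector [0, 0, f]"]) simp
      qed
    qed
    then show ?thesis using rank unfolding rank_le_1_iff by blast
  qed
qed

text \<open>Move the linear form to the first coordinate. The second matrix is then singular, of
  rank 2 by assumption, and gets the hyperbolic normal form; the vanishing coefficients of the
  determinant constrain the first matrix enough for \<open>normal_form_1\<close>.\<close>

lemma cube_pencils_subset_orbit9:
  assumes M: "M \<in> cube_pencils" shows "M \<in> orbit9"
proof -
  obtain u :: "complex^2" where u: "u \<noteq> 0" "\<And>\<xi>. det (pencil_member M \<xi>) = (u $ 1 * \<xi> $ 1 + u $ 2 * \<xi> $ 2) ^ 3"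
    using M unfolding cube_pencils_def by blast
  \<comment> \<open>Chosen so that the linear form with coefficients \<open>u\<close>, composed with
    the transpose of \<open>g\<close>, is the first coordinate.\<close>
  define g where "g = (if u $ 1 \<noteq> 0 then mat2 (1 / u $ 1) 0 (- u $ 2) (u $ 1) else mat2 0 (1 / u $ 2) 1 0)"
  have u12: "u $ 1 \<noteq> 0 \<or> u $ 2 \<noteq> 0" using u(1) by (auto simp: vec_eq_iff forall_2)
  have g: "invertible g" using u12 by (auto simp: g_def invertible_det_nz det_2)
  let ?M = "pencil_act g (mat 1) M"
  have i1: "invertible (mat 1 :: matF)" by (simp add: invertible_det_nz)
  have M1: "?M \<in> cube_pencils" by (rule cube_pencils_act[OF M g i1])
  have det1: "det (pencil_member ?M \<xi>) = (\<xi> $ 1) ^ 3" for \<xi>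
  proof -
    have "u $ 1 * (transpose g *v \<xi>) $ 1 + u $ 2 * (transpose g *v \<xi>) $ 2 = \<xi> $ 1"
      using u12 by (auto simp: g_def matrix_vector_mult_def sum_2 transpose_def field_simps)
    then show ?thesis unfolding det_pencil_member_act u(2) by simp
  qed
  have S: "pmat ?M 2 = pencil_member ?M (vec2 0 1)" by (simp add: vec_eq_iff pencil_member_pmat)
  have "vec2 0 1 \<noteq> 0" by (metis vec2_nth(2) zero_index zero_neq_one)
  then have "\<not> rank (pmat ?M 2) \<le> 1" using M1 unfolding S cube_pencils_def by blast
  moreover have "det (pmat ?M 2) = 0" unfolding S det1 by simp
  ultimately obtain h where h: "invertible h" "h ** pmat ?M 2 ** transpose h = sym3 0 0 (1/2) 0 0 0"
    using normal_form_rank2[OF transpose_pmat] by blast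
  let ?N = "pencil_act (mat 1) h ?M"
  have i2: "invertible (mat 1 :: matE)" by (simp add: invertible_det_nz)
  have m1: "(mat 1 :: matE) $ i $ j = (if i = j then 1 else 0)" for i j by (simp add: mat_def)
  have N2: "pmat ?N 2 = sym3 0 0 (1/2) 0 0 0"
    unfolding h(2)[symmetric] by (simp add: vec_eq_iff pmat_act_nth[of "mat 1"] sum_2 m1)
  obtain \<alpha> \<beta>' \<gamma> \<mu> \<beta> \<epsilon> where N1: "pmat ?N 1 = sym3 \<alpha> \<beta>' \<gamma> \<mu> \<beta> \<epsilon>"
    using symmetric_eq_sym3[OF transpose_pmat] by blast
  have detN: "det (pencil_member ?N \<xi>) = (det h)\<^sup>2 * (\<xi> $ 1) ^ 3" for \<xi>
    unfolding det_pencil_member_act[of "mat 1" h ?M] transpose_mat matrix_vector_mul_lid det1 ..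
  have memN: "pencil_member ?N \<xi> = sym3 (\<xi>$1 * \<alpha> + \<xi>$2 * 0) (\<xi>$1 * \<beta>' + \<xi>$2 * 0) (\<xi>$1 * \<gamma> + \<xi>$2 * (1/2))
     (\<xi>$1 * \<mu> + \<xi>$2 * 0) (\<xi>$1 * \<beta> + \<xi>$2 * 0) (\<xi>$1 * \<epsilon> + \<xi>$2 * 0)" for \<xi>
    by (simp add: vec_eq_iff forall_3 pencil_member_pmat N1 N2)
  have co: "sdet \<alpha> \<beta>' \<gamma> \<mu> \<beta> \<epsilon> = (det h)\<^sup>2 \<and> spol \<alpha> \<beta>' \<gamma> \<mu> \<beta> \<epsilon> 0 0 (1/2) 0 0 0 / 3 = 0 \<and>
    spol 0 0 (1/2) 0 0 0 \<alpha> \<beta>' \<gamma> \<mu> \<beta> \<epsilon> / 3 = 0 \<and> sdet 0 0 (1/2) 0 0 0 = 0"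
  proof (rule cubic_coeffs_eq)
    fix x y :: complex
    show "sdet \<alpha> \<beta>' \<gamma> \<mu> \<beta> \<epsilon> * x^3 + 3 * (spol \<alpha> \<beta>' \<gamma> \<mu> \<beta> \<epsilon> 0 0 (1/2) 0 0 0 / 3) * x\<^sup>2 * y
       + 3 * (spol 0 0 (1/2) 0 0 0 \<alpha> \<beta>' \<gamma> \<mu> \<beta> \<epsilon> / 3) * x * y\<^sup>2 + sdet 0 0 (1/2) 0 0 0 * y^3
       = (det h)\<^sup>2 * x^3 + 3 * 0 * x\<^sup>2 * y + 3 * 0 * x * y\<^sup>2 + 0 * y^3"
      using detN[of "vec2 x y"] unfolding memN det_sym3 sdet_pencil vec2_nth by simp
  qed
  \<comment> \<open>The coefficient of x y^2 is -\<open>\<mu>\<close>/4 and that of x^2 y is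
    \<open>\<beta>' * \<beta> - \<mu> * \<gamma>\<close>.\<close>
  then have \<mu>: "\<mu> = 0" unfolding spol_def by simp
  have \<beta>\<beta>: "\<beta>' * \<beta> = 0" using co \<mu> unfolding spol_def by simp
  have "sdet \<alpha> \<beta>' \<gamma> \<mu> \<beta> \<epsilon> \<noteq> 0" using co h(1) by (simp add: invertible_det_nz)
  then have nz: "- \<alpha> * \<beta>\<^sup>2 - \<epsilon> * \<beta>'\<^sup>2 \<noteq> 0" using \<mu> \<beta>\<beta> unfolding sdet_def by auto
  have "?N \<in> orbit9"
  proof (cases "\<beta>' = 0")
    case True
    show ?thesis by (rule normal_form_1[OF N1[unfolded True \<mu>] N2]) (use nz True in auto)
  next
    case False
    then have b: "\<beta> = 0" using \<beta>\<beta> by simp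
    \<comment> \<open>Exchanging the first and third basis vectors fixes the second matrix and swaps
      \<open>\<alpha>\<close> with \<open>\<epsilon>\<close> and \<open>\<beta>'\<close> with
      \<open>\<beta>\<close>.\<close>
    let ?k = "mat3 0 0 1 0 1 0 1 0 0"
    have "pmat (pencil_act (mat 1) ?k ?N) 1 = ?k ** pmat ?N 1 ** transpose ?k"
      "pmat (pencil_act (mat 1) ?k ?N) 2 = ?k ** pmat ?N 2 ** transpose ?k"
      by (simp_all add: vec_eq_iff pmat_act_nth[of "mat 1" ?k] sum_2 m1)
    then have "pmat (pencil_act (mat 1) ?k ?N) 1 = sym3 \<epsilon> 0 \<gamma> 0 \<beta>' \<alpha>"
      "pmat (pencil_act (mat 1) ?k ?N) 2 = sym3 0 0 (1/2) 0 0 0"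
      unfolding N1 N2 swap_congruence \<mu> b by simp_all
    then have "pencil_act (mat 1) ?k ?N \<in> orbit9" by (rule normal_form_1) (use nz b False in auto)
    then show ?thesis by (rule orbit9_act[OF i2 invertible_swap(2)])
  qed
  then have "?M \<in> orbit9" by (rule orbit9_act[OF i2 h(1)])
  then show ?thesis by (rule orbit9_act[OF g i1])
qed

theorem orbit9_eq_cube_pencils: "orbit9 = cube_pencils"
proof
  show "orbit9 \<subseteq> cube_pencils"
  proof
    fix M assume "M \<in> orbit9"
    then obtain g h where "invertible g" "invertible h" "M = pencil_act g h pencil9" unfolding orbit9_GL by blast
    then show "M \<in> cube_pencils" using cube_pencils_act[OF pencil9_cube] by simp
  qed
  show "cube_pencils \<subseteq> orbit9" using cube_pencils_subset_orbit9 by (rule subsetI)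
qed

section \<open>Vanishing ideal, closure and dimension of the orbit\<close>

abbreviation "minors_ideal G \<delta> \<equiv> ideal3 (poly_ring G) (\<lambda>x. hess1 (\<delta> x)) (\<lambda>x. hess2 (\<delta> x)) (\<lambda>x. hess3 (\<delta> x))"

lemma par_in_orbit9: "par_good w \<Longrightarrow> mk_pencil (par w) \<in> orbit9"
  unfolding orbit9_eq_cube_pencils by (rule par_mk_pencil)

text \<open>Vanishing is required only at the parametrised points, so the lemma serves the closure,
  the dimension and the exactness of the complex at once.\<close>

lemma par_vanishing:
  assumes f: "f \<in> poly_ring pencil_space" and 0: "\<And>w. par_good w \<Longrightarrow> f (mk_pencil (par w)) = 0"
  shows "f \<in> minors_ideal pencil_space det_cubic"
proof -
  have mem: "(\<lambda>v. f (mk_pencil v)) \<in> pulled_ideal"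
    by (rule vanishing_ideal) (use poly_pencil_to_cpoly[OF f, of "\<lambda>v. v"] 0 in \<open>auto intro: cpoly_intros\<close>)
  show ?thesis
  proof (rule ideal3E[OF mem])
    fix p q r assume pqr: "p \<in> cpoly 12" "q \<in> cpoly 12" "r \<in> cpoly 12"
      "\<And>v. f (mk_pencil v) = p v * mn1 (detmap v) + q v * mn2 (detmap v) + r v * mn3 (detmap v)"
    show ?thesis
    by (rule ideal3I[OF cpoly_to_poly_pencil[OF pqr(1)] cpoly_to_poly_pencil[OF pqr(2)] cpoly_to_poly_pencil[OF pqr(3)]])
      (simp only: pqr(4)[symmetric] hess_det_cubic mk_pencil_coords)
  qed
qed

lemma det_cubic_cube_pencils: "M \<in> cube_pencils \<Longrightarrow> det_cubic M \<in> cubes"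
  unfolding cube_pencils_def cubes_def mem_Collect_eq cubic_eval_det_cubic by (elim conjE exE) (rule exI)

lemma minors_ideal_vanishes: "f \<in> minors_ideal G \<delta> \<Longrightarrow> \<delta> x \<in> cubes \<Longrightarrow> f x = 0"
  by (auto elim!: ideal3E simp: cubes_iff_hess)

lemma hess_det_poly: "(\<lambda>M. hess1 (det_cubic M)) \<in> poly_ring pencil_space" "(\<lambda>M. hess2 (det_cubic M)) \<in> poly_ring pencil_space"
  "(\<lambda>M. hess3 (det_cubic M)) \<in> poly_ring pencil_space"
  unfolding hess_det_cubic by (intro cpoly_to_poly_pencil[OF detmap_cpoly] mn_cpoly)+

lemma closure_orbit9: "zariski_closure pencil_space orbit9 = {M. det_cubic M \<in> cubes}"
proof (intro equalityI subsetI CollectI)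
  fix M assume M: "M \<in> zariski_closure pencil_space orbit9"
  have *: "h M = 0" if "h \<in> poly_ring pencil_space" "\<And>N. det_cubic N \<in> cubes \<Longrightarrow> h N = 0" for h
    using M that(1) that(2)[OF det_cubic_cube_pencils] unfolding zariski_closure_def orbit9_eq_cube_pencils by simp
  show "det_cubic M \<in> cubes" unfolding cubes_iff_hess
    using *[OF hess_det_poly(1)] *[OF hess_det_poly(2)] *[OF hess_det_poly(3)] cubes_iff_hess by simp
next
  fix M assume M: "M \<in> {M. det_cubic M \<in> cubes}"
  show "M \<in> zariski_closure pencil_space orbit9"
    unfolding zariski_closure_def
  proof (intro CollectI ballI impI)
    fix a assume "a \<in> poly_ring pencil_space" "\<forall>s\<in>orbit9. a s = 0"
    then have "a \<in> minors_ideal pencil_space det_cubic"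
      by (intro par_vanishing) (simp_all add: par_in_orbit9)
    then show "a M = 0" by (rule minors_ideal_vanishes) (use M in simp)
  qed
qed

text \<open>For the upper bound, \<open>n + 1\<close> polynomials become polynomials in
  \<open>n\<close> parameters and are therefore algebraically dependent; density carries the
  relation to \<open>S\<close>.\<close>

lemma has_dim_by_param:
  assumes h: "\<And>i. i < 12 \<Longrightarrow> (\<lambda>x. h x i) \<in> cpoly n"
    and dense: "\<And>f. f \<in> poly_ring pencil_space \<Longrightarrow> (\<And>x. f (mk_pencil (h x)) = 0) \<Longrightarrow> (\<forall>M\<in>S. f M = 0)"
    and F: "\<And>i. i < n \<Longrightarrow> F i \<in> poly_ring pencil_space" "alg_independent_on S n F"
  shows "has_dim pencil_space S n"
  unfolding has_dim_def
proof (intro conjI notI)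
  show "\<exists>F. (\<forall>i<n. F i \<in> poly_ring pencil_space) \<and> alg_independent_on S n F" using F by blast
  assume "\<exists>F. (\<forall>i<Suc n. F i \<in> poly_ring pencil_space) \<and> alg_independent_on S (Suc n) F"
  then obtain F where F: "\<And>i. i < Suc n \<Longrightarrow> F i \<in> poly_ring pencil_space" "alg_independent_on S (Suc n) F" by blast
  obtain p where p: "p \<in> cpoly (Suc n)" "\<And>x. p (\<lambda>i. F i (mk_pencil (h x))) = 0" "\<exists>v. p v \<noteq> 0"
  proof -
    have "(\<lambda>x. F i (mk_pencil (h x))) \<in> cpoly n" if "i < Suc n" for i by (rule poly_pencil_to_cpoly[OF F(1)[OF that] h])
    from cpoly_alg_dependent[of n "\<lambda>i x. F i (mk_pencil (h x))", OF this] show ?thesis using that by blast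
  qed
  have "(\<lambda>M. p (\<lambda>i. F i M)) \<in> poly_ring pencil_space" by (rule cpoly_compose[OF p(1)]) (rule F(1))
  from dense[OF this p(2)] have "\<forall>M\<in>S. p (\<lambda>i. F i M) = 0" .
  then show False using F(2)[unfolded alg_independent_on_def, folded cpoly_def, rule_format, OF p(1)] p(3) by simp
qed

lemma dim_pencils: "has_dim pencil_space UNIV 12"
proof (rule has_dim_by_param[where h = "\<lambda>v. v" and F = "\<lambda>i M. coords M i"])
  show "alg_independent_on UNIV 12 (\<lambda>i M. coords M i)"
    unfolding alg_independent_on_def
  proof (intro ballI impI allI, fold cpoly_def)
    fix p v assume p: "p \<in> cpoly 12" "\<forall>M\<in>UNIV. p (\<lambda>i. coords M i) = 0"
    have "p v = p (\<lambda>i. coords (mk_pencil v) i)" by (rule cpoly_cong_vars[OF p(1)]) (simp add: coords_mk_pencil)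
    then show "p v = 0" using p(2) by simp
  qed
  show "\<forall>M\<in>UNIV. f M = 0" if "\<And>x. f (mk_pencil x) = 0" for f using that mk_pencil_coords by metis
qed (auto intro: cpoly_intros coords_poly)

definition block_coords :: "pencil \<Rightarrow> nat \<Rightarrow> complex" where
  "block_coords M = (let v = coords M in (\<lambda>i. [v 8 + v 4, v 9, v 10, v 11 + v 5, v 6, v 7, v 2, v 10 + v 3, v 8, v 11] ! i))"

lemma dim_orbit9: "has_dim pencil_space orbit9 10"
proof (rule has_dim_by_param[where h = par and F = "\<lambda>i M. block_coords M i"])
  have c12: "coords (mk_pencil v) i = v i" if "i < 12" for v i using that by (rule coords_mk_pencil)
  show "alg_independent_on orbit9 10 (\<lambda>i M. block_coords M i)"
    unfolding alg_independent_on_def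
  proof (intro ballI impI allI, fold cpoly_def)
    fix p v assume p: "p \<in> cpoly 10" "\<forall>M\<in>orbit9. p (\<lambda>i. block_coords M i) = 0"
    show "p v = 0"
    proof (rule par_block_indep[OF p(1)])
      fix w assume w: "par_good w"
      have "p (par_block w) = p (\<lambda>i. block_coords (mk_pencil (par w)) i)"
      proof (rule cpoly_cong_vars[OF p(1)])
        fix i :: nat assume "i < 10"
        from less_10_cases[OF this] show "par_block w i = block_coords (mk_pencil (par w)) i"
          by (elim disjE) (simp_all add: block_coords_def Let_def c12 par_def del: coords_simps)
      qed
      also have "\<dots> = 0" using p(2) par_in_orbit9[OF w] by blast
      finally show "p (par_block w) = 0" .
    qed
  qed
  show "(\<lambda>M. block_coords M i) \<in> poly_ring pencil_space" if "i < 10" for i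
    using less_10_cases[OF that]
    by (elim disjE) (simp_all add: block_coords_def Let_def coords_poly polys.add del: coords_simps)
  show "(\<lambda>w. par w i) \<in> cpoly 10" if "i < 12" for i
    using less_12_cases[OF that]
    by (elim disjE) (simp_all add: par_def par_entry_def cpoly_intros)
  show "\<forall>M\<in>orbit9. f M = 0" if "f \<in> poly_ring pencil_space" "\<And>w. f (mk_pencil (par w)) = 0" for f
    unfolding orbit9_eq_cube_pencils
    by (intro ballI minors_ideal_vanishes[OF par_vanishing[OF that]] det_cubic_cube_pencils)
qed

lemma codim_orbit9: "has_codim pencil_space orbit9 2"
  unfolding has_codim_def using dim_orbit9 dim_pencils by (intro exI[of _ 10]) simp

section \<open>The representations and the free modules\<close>

lemma span_family: "cfun.span (e ` {..<n::nat}) = {(\<lambda>w. \<Sum>j<n. c j * e j w) | c. True}"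
proof (intro equalityI subsetI)
  fix f assume "f \<in> cfun.span (e ` {..<n})"
  then show "f \<in> {(\<lambda>w. \<Sum>j<n. c j * e j w) | c. True}"
  proof (induction rule: cfun.span_induct_alt)
    case base
    show ?case by (rule CollectI, rule exI[of _ "\<lambda>_. 0"]) (simp add: fun_eq_iff)
  next
    case (step a x y)
    then obtain c i where c: "y = (\<lambda>w. \<Sum>j<n. c j * e j w)" and i: "i < n" "x = e i" by auto
    have "a * x w + y w = (\<Sum>j<n. (c j + (if j = i then a else 0)) * e j w)" for w
      using i(1) by (simp add: c i(2) distrib_right sum.distrib if_distrib[of "\<lambda>z. z * _"] cong: if_cong)
    then show ?case by (intro CollectI exI[of _ "\<lambda>j. c j + (if j = i then a else 0)"]) (simp add: fun_eq_iff)
  qed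
next
  fix f assume "f \<in> {(\<lambda>w. \<Sum>j<n. c j * e j w) | c. True}"
  then obtain c where f: "f = (\<lambda>w. \<Sum>j<n. c j * e j w)" by auto
  have "f = (\<Sum>j<n. (\<lambda>w. c j * e j w))" by (simp add: f fun_eq_iff sum_fun_apply)
  also have "\<dots> \<in> cfun.span (e ` {..<n})"
    by (intro cfun.span_sum cfun.span_scale cfun.span_base imageI)
  finally show "f \<in> cfun.span (e ` {..<n})" .
qed

text \<open>The weight basis of binary forms of degree \<open>n\<close> twisted by the power
  \<open>b\<close> of the determinant.\<close>

definition form2 :: "nat \<Rightarrow> nat \<Rightarrow> nat \<Rightarrow> matE \<Rightarrow> complex" where
  "form2 n b j P = P$1$1 ^ (n - j) * P$2$1 ^ j * det P ^ b"

lemma transpose_mult_11: "(transpose k ** P)$1$1 = k$1$1 * P$1$1 + k$2$1 * P$2$1" for k P :: matE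
  by (simp add: matrix_matrix_mult_def transpose_def sum_2)

text \<open>Translates of the highest weight vector are powers of linear forms; \<open>k\<close>
  completes the coefficients to a matrix of determinant 1 with first column (x, y).\<close>

lemma power_in_schur:
  assumes "x \<noteq> 0 \<or> y \<noteq> 0"
  shows "(\<lambda>P :: matE. (x * P$1$1 + y * P$2$1) ^ n * det P ^ b) \<in> schur ([1, 2] :: 2 list) [n + b, b]"
proof -
  define k where "k = (if x \<noteq> 0 then mat2 x 0 y (1 / x) else mat2 0 (- 1 / y) y 0)"
  have k: "det k = 1" "k$1$1 = x" "k$2$1 = y" using assms by (auto simp: k_def det_2)
  have "highest_weight_vector ([1, 2] :: 2 list) [n + b, b] (transpose k ** P) = (x * P$1$1 + y * P$2$1) ^ n * det P ^ b" for P
    unfolding highest_weight_vector_2 transpose_mult_11 using k by (simp add: det_mul)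
  then show ?thesis unfolding schur_def using k(1)
    by (intro cfun.span_base CollectI exI[of _ k]) (simp add: invertible_det_nz)
qed

text \<open>Polarisation: in degree at most 3 the powers of the linear forms at (1,0), (0,1), (1,1),
  (1,-1) span all binary forms.\<close>

lemma form2_in_schur:
  assumes "n \<in> {1, 2, 3}" "j < Suc n"
  shows "form2 n b j \<in> schur ([1, 2] :: 2 list) [n + b, b]"
proof -
  let ?S = "schur ([1, 2] :: 2 list) [n + b, b]"
  let ?p = "\<lambda>x y (P :: matE). (x * P$1$1 + y * P$2$1) ^ n * det P ^ b"
  have p: "?p x y \<in> ?S" if "x \<noteq> 0 \<or> y \<noteq> 0" for x y using power_in_schur[OF that] .
  have lin: "(\<lambda>P. f P + g P) \<in> ?S" if "f \<in> ?S" "g \<in> ?S" for f g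
    using that cfun.span_add[of f _ g] unfolding schur_def by (simp add: plus_fun_def)
  have scl: "(\<lambda>P. c * f P) \<in> ?S" if "f \<in> ?S" for f c
    using that unfolding schur_def by (rule cfun.span_scale)
  have comb: "(\<lambda>P. a * ?p 1 0 P + (b' * ?p 0 1 P + (c * ?p 1 1 P + d * ?p 1 (-1) P))) \<in> ?S" for a b' c d
    by (intro lin scl p) simp_all
  have *: ?thesis if "\<And>P. form2 n b j P = a * ?p 1 0 P + (b' * ?p 0 1 P + (c * ?p 1 1 P + d * ?p 1 (-1) P))" for a b' c d
    using comb[of a b' c d] unfolding that[symmetric] .
  have "n = 1 \<or> n = 2 \<or> n = 3" using assms(1) by blast
  then have "n = 1 \<and> (j = 0 \<or> j = 1) \<or> n = 2 \<and> (j = 0 \<or> j = 1 \<or> j = 2) \<or> n = 3 \<and> (j = 0 \<or> j = 1 \<or> j = 2 \<or> j = 3)"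
    using assms(2) by presburger
  then consider "n = 1" "j = 0" | "n = 1" "j = 1" | "n = 2" "j = 0" | "n = 2" "j = 1" | "n = 2" "j = 2"
    | "n = 3" "j = 0" | "n = 3" "j = 1" | "n = 3" "j = 2" | "n = 3" "j = 3" by blast
  then show ?thesis
  proof cases
    case 1 then show ?thesis by (intro *[of 1 0 0 0]) (simp add: form2_def)
  next
    case 2 then show ?thesis by (intro *[of 0 1 0 0]) (simp add: form2_def)
  next
    case 3 then show ?thesis by (intro *[of 1 0 0 0]) (simp add: form2_def)
  next
    case 4 then show ?thesis by (intro *[of 0 0 "1/4" "-1/4"]) (simp add: form2_def power2_eq_square field_simps)
  next
    case 5 then show ?thesis by (intro *[of 0 1 0 0]) (simp add: form2_def)
  next
    case 6 then show ?thesis by (intro *[of 1 0 0 0]) (simp add: form2_def)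
  next
    case 7 then show ?thesis by (intro *[of 0 "-1/3" "1/6" "-1/6"]) (simp add: form2_def power2_eq_square power3_eq_cube field_simps)
  next
    case 8 then show ?thesis by (intro *[of "-1/3" 0 "1/6" "1/6"]) (simp add: form2_def power2_eq_square power3_eq_cube field_simps)
  next
    case 9 then show ?thesis by (intro *[of 0 1 0 0]) (simp add: form2_def)
  qed
qed

lemma schur2:
  assumes "n \<in> {1, 2, 3}"
  shows "schur ([1, 2] :: 2 list) [n + b, b] = cfun.span (form2 n b ` {..<Suc n})"
proof (rule antisym)
  show "cfun.span (form2 n b ` {..<Suc n}) \<subseteq> schur ([1, 2] :: 2 list) [n + b, b]"
  proof (rule cfun.span_minimal)
    show "form2 n b ` {..<Suc n} \<subseteq> schur ([1, 2] :: 2 list) [n + b, b]" using form2_in_schur[OF assms] by blast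
  qed (simp add: schur_def)
  show "schur ([1, 2] :: 2 list) [n + b, b] \<subseteq> cfun.span (form2 n b ` {..<Suc n})"
    unfolding schur_def
  proof (rule cfun.span_minimal)
    show "{(\<lambda>P. highest_weight_vector ([1, 2] :: 2 list) [n + b, b] (transpose k ** P)) | k. invertible k} \<subseteq> cfun.span (form2 n b ` {..<Suc n})"
    proof safe
      fix k :: matE
      have "highest_weight_vector ([1, 2] :: 2 list) [n + b, b] (transpose k ** P)
          = (\<Sum>j<Suc n. (of_nat (n choose j) * k$2$1 ^ j * k$1$1 ^ (n - j) * det k ^ b) * form2 n b j P)" for P
      proof -
        have "highest_weight_vector ([1, 2] :: 2 list) [n + b, b] (transpose k ** P) = (k$2$1 * P$2$1 + k$1$1 * P$1$1) ^ n * (det k * det P) ^ b"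
          unfolding highest_weight_vector_2 transpose_mult_11 by (simp add: det_mul add.commute)
        also have "\<dots> = (\<Sum>j<Suc n. (of_nat (n choose j) * k$2$1 ^ j * k$1$1 ^ (n - j) * det k ^ b) * form2 n b j P)"
          unfolding binomial_ring sum_distrib_right lessThan_Suc_atMost form2_def
          by (rule sum.cong) (simp_all add: power_mult_distrib mult_ac)
        finally show ?thesis .
      qed
      then show "(\<lambda>P. highest_weight_vector ([1, 2] :: 2 list) [n + b, b] (transpose k ** P)) \<in> cfun.span (form2 n b ` {..<Suc n})"
        unfolding span_family by (intro CollectI exI[of _ "\<lambda>j. of_nat (n choose j) * k$2$1 ^ j * k$1$1 ^ (n - j) * det k ^ b"]) (simp add: fun_eq_iff)
    qed
  qed simp
qed

lemma schur3: "schur ([1, 2, 3] :: 3 list) [m, m, m] = cfun.span {\<lambda>Q :: matF. det Q ^ m}"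
proof (rule antisym)
  have hw: "highest_weight_vector ([1, 2, 3] :: 3 list) [m, m, m] (transpose k ** Q) = det k ^ m * det Q ^ m" for k Q :: matF
    unfolding highest_weight_vector_3 by (simp add: det_mul power_mult_distrib)
  show "schur ([1, 2, 3] :: 3 list) [m, m, m] \<subseteq> cfun.span {\<lambda>Q :: matF. det Q ^ m}"
    unfolding schur_def
  proof (rule cfun.span_minimal)
    show "{(\<lambda>P. highest_weight_vector ([1, 2, 3] :: 3 list) [m, m, m] (transpose k ** P)) | k. invertible k} \<subseteq> cfun.span {\<lambda>Q :: matF. det Q ^ m}"
      unfolding hw
    proof safe
      fix k :: matF
      show "(\<lambda>Q. det k ^ m * det Q ^ m) \<in> cfun.span {\<lambda>Q :: matF. det Q ^ m}"
        by (rule cfun.span_scale, rule cfun.span_base) simp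
    qed
  qed simp
  show "cfun.span {\<lambda>Q :: matF. det Q ^ m} \<subseteq> schur ([1, 2, 3] :: 3 list) [m, m, m]"
    unfolding schur_def
  proof (intro cfun.span_mono subsetI)
    fix f :: "matF \<Rightarrow> complex" assume "f \<in> {\<lambda>Q :: matF. det Q ^ m}"
    then have "f = (\<lambda>Q. highest_weight_vector ([1, 2, 3] :: 3 list) [m, m, m] (transpose (mat 1) ** Q))"
      unfolding hw by simp
    then show "f \<in> {(\<lambda>P. highest_weight_vector ([1, 2, 3] :: 3 list) [m, m, m] (transpose k ** P)) | k. invertible k}"
      using invertible_det_nz[of "mat 1 :: matF"] by (intro CollectI exI[of _ "mat 1"]) simp
  qed
qed

definition tform :: "nat \<Rightarrow> nat \<Rightarrow> nat \<Rightarrow> nat \<Rightarrow> frames \<Rightarrow> complex" where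
  "tform n b m j = (\<lambda>(P, Q). P$1$1 ^ (n - j) * P$2$1 ^ j * det P ^ b * det Q ^ m)"

lemma schur_tensor_span:
  assumes "n \<in> {1, 2, 3}"
  shows "schur_tensor [n + b, b] [m, m, m] = cfun.span (tform n b m ` {..<Suc n})"
proof (rule antisym)
  show "schur_tensor [n + b, b] [m, m, m] \<subseteq> cfun.span (tform n b m ` {..<Suc n})"
    unfolding schur_tensor_def
  proof (rule cfun.span_minimal)
    show "{(\<lambda>(P, Q). f P * h Q) | f h. f \<in> schur ([1, 2] :: 2 list) [n + b, b] \<and> h \<in> schur ([1, 2, 3] :: 3 list) [m, m, m]}
      \<subseteq> cfun.span (tform n b m ` {..<Suc n})"
    proof safe
      fix f :: "matE \<Rightarrow> complex" and h :: "matF \<Rightarrow> complex"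
      assume "f \<in> schur ([1, 2] :: 2 list) [n + b, b]" "h \<in> schur ([1, 2, 3] :: 3 list) [m, m, m]"
      then obtain c d where f: "f = (\<lambda>P. \<Sum>j<Suc n. c j * form2 n b j P)" and h: "h = (\<lambda>Q. d * det Q ^ m)"
        unfolding schur2[OF assms] schur3 span_family cfun.span_singleton by auto
      have "f P * h Q = (\<Sum>j<Suc n. (c j * d) * tform n b m j (P, Q))" for P Q
        unfolding f h sum_distrib_right by (rule sum.cong) (simp_all add: tform_def form2_def mult_ac)
      then show "(\<lambda>(P, Q). f P * h Q) \<in> cfun.span (tform n b m ` {..<Suc n})"
        unfolding span_family by (intro CollectI exI[of _ "\<lambda>j. c j * d"]) (auto simp: fun_eq_iff simp del: sum.lessThan_Suc)
    qed
  qed simp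
  show "cfun.span (tform n b m ` {..<Suc n}) \<subseteq> schur_tensor [n + b, b] [m, m, m]"
    unfolding schur_tensor_def
  proof (intro cfun.span_mono subsetI)
    fix w assume "w \<in> tform n b m ` {..<Suc n}"
    then obtain j where j: "j < Suc n" "w = tform n b m j" by auto
    have "(\<lambda>Q. det Q ^ m) \<in> schur ([1, 2, 3] :: 3 list) [m, m, m]" unfolding schur3 by (rule cfun.span_base) simp
    moreover have "w = (\<lambda>(P, Q). form2 n b j P * det Q ^ m)" by (simp add: j tform_def form2_def fun_eq_iff)
    ultimately show "w \<in> {(\<lambda>(P, Q). f P * h Q) | f h. f \<in> schur ([1, 2] :: 2 list) [n + b, b] \<and> h \<in> schur ([1, 2, 3] :: 3 list) [m, m, m]}"
      using form2_in_schur[OF assms j(1), of b] by (intro CollectI exI[of _ "form2 n b j"] exI[of _ "\<lambda>Q. det Q ^ m"] conjI)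
  qed
qed

section \<open>Free modules through coefficient functions\<close>

lemma free_module_car:
  fixes n :: nat
  assumes "schur_tensor l m = cfun.span (e ` {..<n})"
  shows "mcar (free_module G (l, m, d)) = {(\<lambda>(x, w). \<Sum>j<n. A j x * e j w) | A. \<forall>j<n. A j \<in> poly_ring G}"
proof (rule antisym)
  have car: "mcar (free_module G (l, m, d)) = cfun.span {(\<lambda>(x, w). a x * f w) | a f. a \<in> poly_ring G \<and> f \<in> schur_tensor l m}"
    by (simp add: free_module_def Let_def)
  show "mcar (free_module G (l, m, d)) \<subseteq> {(\<lambda>(x, w). \<Sum>j<n. A j x * e j w) | A. \<forall>j<n. A j \<in> poly_ring G}"
  proof
    fix \<phi> assume "\<phi> \<in> mcar (free_module G (l, m, d))"
    then show "\<phi> \<in> {(\<lambda>(x, w). \<Sum>j<n. A j x * e j w) | A. \<forall>j<n. A j \<in> poly_ring G}"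
      unfolding car
    proof (induction rule: cfun.span_induct_alt)
      case base
      show ?case by (intro CollectI exI[of _ "\<lambda>_ _. 0"]) (auto simp: fun_eq_iff intro: polys.const)
    next
      case (step c \<psi> y)
      then obtain A a f where A: "y = (\<lambda>(x, w). \<Sum>j<n. A j x * e j w)" "\<forall>j<n. A j \<in> poly_ring G"
        and a: "\<psi> = (\<lambda>(x, w). a x * f w)" "a \<in> poly_ring G" "f \<in> schur_tensor l m" by blast
      obtain b where b: "f = (\<lambda>w. \<Sum>j<n. b j * e j w)" using a(3) unfolding assms span_family by auto
      have "c * \<psi> (x, w) + y (x, w) = (\<Sum>j<n. ((c * b j) * a x + A j x) * e j w)" for x w
        unfolding A(1) a(1) b by (simp add: sum_distrib_left sum.distrib algebra_simps)
      moreover have "(\<lambda>x. (c * b j) * a x + A j x) \<in> poly_ring G" if "j < n" for j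
        using that A(2) a(2) by (intro polys.add polys_cmul) auto
      ultimately show ?case
        by (intro CollectI exI[of _ "\<lambda>j x. (c * b j) * a x + A j x"]) (auto simp: fun_eq_iff)
    qed
  qed
  show "{(\<lambda>(x, w). \<Sum>j<n. A j x * e j w) | A. \<forall>j<n. A j \<in> poly_ring G} \<subseteq> mcar (free_module G (l, m, d))"
  proof safe
    fix A assume A: "\<forall>j<n. A j \<in> poly_ring G"
    have "(\<lambda>(x, w). \<Sum>j<n. A j x * e j w) = (\<Sum>j<n. (\<lambda>(x, w). A j x * e j w))"
      by (auto simp: fun_eq_iff sum_fun_apply)
    also have "\<dots> \<in> mcar (free_module G (l, m, d))"
      unfolding car
    proof (intro cfun.span_sum cfun.span_base CollectI)
      fix j assume "j \<in> {..<n}"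
      then have "e j \<in> schur_tensor l m" unfolding assms by (auto intro: cfun.span_base)
      then show "\<exists>a f. (\<lambda>(x, w). A j x * e j w) = (\<lambda>(x, w). a x * f w) \<and> a \<in> poly_ring G \<and> f \<in> schur_tensor l m"
        using A \<open>j \<in> {..<n}\<close> by blast
    qed
    finally show "(\<lambda>(x, w). \<Sum>j<n. A j x * e j w) \<in> mcar (free_module G (l, m, d))" .
  qed
qed

text \<open>[4,2] is the second symmetric power twisted by det^2, [5,4] in \<open>lin_el\<close> is
  the standard representation twisted by det^4; the F parts are powers of the determinant.\<close>

definition quad_el :: "('x \<Rightarrow> complex) \<Rightarrow> ('x \<Rightarrow> complex) \<Rightarrow> ('x \<Rightarrow> complex) \<Rightarrow> 'x \<times> frames \<Rightarrow> complex" where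
  "quad_el a b c = (\<lambda>(x, P, Q). (a x * (P$1$1)\<^sup>2 + b x * (P$1$1 * P$2$1) + c x * (P$2$1)\<^sup>2) * (det P ^ 2 * det Q ^ 4))"

definition lin_el :: "('x \<Rightarrow> complex) \<Rightarrow> ('x \<Rightarrow> complex) \<Rightarrow> 'x \<times> frames \<Rightarrow> complex" where
  "lin_el a b = (\<lambda>(x, P, Q). (a x * P$1$1 + b x * P$2$1) * (det P ^ 4 * det Q ^ 6))"

lemma free_module_quad:
  "mcar (free_module G ([4,2], [4,4,4], d)) = {quad_el a b c | a b c. a \<in> poly_ring G \<and> b \<in> poly_ring G \<and> c \<in> poly_ring G}"
proof -
  have S: "schur_tensor [4,2] [4,4,4] = cfun.span (tform 2 2 4 ` {..<Suc 2})" using schur_tensor_span[of 2 2 4] by simp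
  have sum: "(\<lambda>(x, w). \<Sum>j<Suc 2. A j x * tform 2 2 4 j w) = quad_el (A 0) (A 1) (A 2)" for A :: "nat \<Rightarrow> 'a \<Rightarrow> complex"
  proof (rule ext, clarify)
    fix x :: 'a and P :: matE and Q :: matF
    have "(\<Sum>j<Suc 2. f j) = f 0 + f 1 + f 2" for f :: "nat \<Rightarrow> complex" by (simp add: numeral_2_eq_2)
    moreover have "tform 2 2 4 0 (P, Q) = (P$1$1)\<^sup>2 * (det P ^ 2 * det Q ^ 4)" "tform 2 2 4 1 (P, Q) = P$1$1 * P$2$1 * (det P ^ 2 * det Q ^ 4)"
      "tform 2 2 4 2 (P, Q) = (P$2$1)\<^sup>2 * (det P ^ 2 * det Q ^ 4)"
      unfolding tform_def prod.case by (simp_all add: mult.assoc)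
    ultimately show "(\<Sum>j<Suc 2. A j x * tform 2 2 4 j (P, Q)) = quad_el (A 0) (A 1) (A 2) (x, P, Q)"
      unfolding quad_el_def prod.case by (simp only: distrib_right mult.assoc)
  qed
  show ?thesis unfolding free_module_car[OF S] sum
  proof safe
    fix A :: "nat \<Rightarrow> 'a \<Rightarrow> complex" assume "\<forall>j<Suc 2. A j \<in> poly_ring G"
    then show "\<exists>a b c. quad_el (A 0) (A 1) (A 2) = quad_el a b c \<and> a \<in> poly_ring G \<and> b \<in> poly_ring G \<and> c \<in> poly_ring G"
      by (intro exI[of _ "A 0"] exI[of _ "A 1"] exI[of _ "A 2"]) simp
  next
    fix a b c assume abc: "a \<in> poly_ring G" "b \<in> poly_ring G" "c \<in> poly_ring G"
    show "\<exists>A. quad_el a b c = quad_el (A 0) (A 1) (A 2) \<and> (\<forall>j<Suc 2. A j \<in> poly_ring G)"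
      by (rule exI[of _ "\<lambda>j. if j = 0 then a else if j = 1 then b else c"]) (simp add: abc)
  qed
qed

lemma free_module_lin:
  "mcar (free_module G ([5,4], [6,6,6], d)) = {lin_el a b | a b. a \<in> poly_ring G \<and> b \<in> poly_ring G}"
proof -
  have S: "schur_tensor [5,4] [6,6,6] = cfun.span (tform 1 4 6 ` {..<Suc 1})" using schur_tensor_span[of 1 4 6] by simp
  have sum: "(\<lambda>(x, w). \<Sum>j<Suc 1. A j x * tform 1 4 6 j w) = lin_el (A 0) (A 1)" for A :: "nat \<Rightarrow> 'a \<Rightarrow> complex"
  proof (rule ext, clarify)
    fix x :: 'a and P :: matE and Q :: matF
    have "(\<Sum>j<Suc 1. f j) = f 0 + f 1" for f :: "nat \<Rightarrow> complex" by simp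
    moreover have "tform 1 4 6 0 (P, Q) = P$1$1 * (det P ^ 4 * det Q ^ 6)" "tform 1 4 6 1 (P, Q) = P$2$1 * (det P ^ 4 * det Q ^ 6)"
      unfolding tform_def prod.case by (simp_all only: diff_zero diff_self_eq_0 power_0 power_one_right mult_1_left mult_1_right mult.assoc)
    ultimately show "(\<Sum>j<Suc 1. A j x * tform 1 4 6 j (P, Q)) = lin_el (A 0) (A 1) (x, P, Q)"
      unfolding lin_el_def prod.case by (simp only: distrib_right mult.assoc)
  qed
  show ?thesis unfolding free_module_car[OF S] sum
  proof safe
    fix A :: "nat \<Rightarrow> 'a \<Rightarrow> complex" assume "\<forall>j<Suc 1. A j \<in> poly_ring G"
    then show "\<exists>a b. lin_el (A 0) (A 1) = lin_el a b \<and> a \<in> poly_ring G \<and> b \<in> poly_ring G"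
      by (intro exI[of _ "A 0"] exI[of _ "A 1"]) simp
  next
    fix a b assume ab: "a \<in> poly_ring G" "b \<in> poly_ring G"
    show "\<exists>A. lin_el a b = lin_el (A 0) (A 1) \<and> (\<forall>j<Suc 1. A j \<in> poly_ring G)"
      by (rule exI[of _ "\<lambda>j. if j = 0 then a else b"]) (simp add: ab)
  qed
qed

lemma schur_tensor_cubic:
  "schur_tensor [3,0] [2,2,2] = {(\<lambda>(P, Q). (a * P$1$1 ^ 3 + b * (P$1$1)\<^sup>2 * P$2$1 + c * P$1$1 * (P$2$1)\<^sup>2 + d * P$2$1 ^ 3) * det Q ^ 2) | a b c d. True}"
proof -
  have S: "schur_tensor [3,0] [2,2,2] = cfun.span (tform 3 0 2 ` {..<Suc 3})" using schur_tensor_span[of 3 0 2] by simp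
  have sum: "(\<Sum>j<Suc 3. A j * tform 3 0 2 j (P, Q)) = (A 0 * P$1$1 ^ 3 + A 1 * (P$1$1)\<^sup>2 * P$2$1 + A 2 * P$1$1 * (P$2$1)\<^sup>2 + A 3 * P$2$1 ^ 3) * det Q ^ 2"
    for A P Q
    by (simp add: tform_def eval_nat_numeral algebra_simps)
  have eq: "(\<lambda>w. \<Sum>j<Suc 3. A j * tform 3 0 2 j w) = (\<lambda>(P, Q). (A 0 * P$1$1 ^ 3 + A 1 * (P$1$1)\<^sup>2 * P$2$1 + A 2 * P$1$1 * (P$2$1)\<^sup>2 + A 3 * P$2$1 ^ 3) * det Q ^ 2)" for A
    by (rule ext) (clarify, simp only: sum prod.case)
  show ?thesis unfolding S span_family eq
  proof safe
    fix a b c d :: complex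
    show "\<exists>A. (\<lambda>(P, Q). (a * P$1$1 ^ 3 + b * (P$1$1)\<^sup>2 * P$2$1 + c * P$1$1 * (P$2$1)\<^sup>2 + d * P$2$1 ^ 3) * det Q ^ 2)
      = (\<lambda>(P :: matE, Q :: matF). (A 0 * P$1$1 ^ 3 + A 1 * (P$1$1)\<^sup>2 * P$2$1 + A 2 * P$1$1 * (P$2$1)\<^sup>2 + A (3::nat) * P$2$1 ^ 3) * det Q ^ 2) \<and> True"
      by (rule exI[of _ "\<lambda>j. [a, b, c, d] ! j"]) simp
  qed blast
qed

section \<open>Covariants of binary cubics\<close>

lemma cubic_eval_act: "cubic_eval (cubic_act g h q) \<xi> = (det h)\<^sup>2 * cubic_eval q (transpose g *v \<xi>)"
  by transfer simp

lemma k_cubic_act: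
  fixes g :: matE and h :: matF and q :: binary_cubic
  defines "a \<equiv> kA q" and "b \<equiv> kB q" and "c \<equiv> kC q" and "d \<equiv> kD q"
    and "g1 \<equiv> g$1$1" and "g2 \<equiv> g$1$2" and "g3 \<equiv> g$2$1" and "g4 \<equiv> g$2$2"
  shows "kA (cubic_act g h q) = (det h)\<^sup>2 * (a * g1^3 + 3 * b * g1\<^sup>2 * g2 + 3 * c * g1 * g2\<^sup>2 + d * g2^3)"
    "kB (cubic_act g h q) = (det h)\<^sup>2 * (a * g1\<^sup>2 * g3 + b * (g1\<^sup>2 * g4 + 2 * g1 * g2 * g3) + c * (2 * g1 * g2 * g4 + g2\<^sup>2 * g3) + d * g2\<^sup>2 * g4)"
    "kC (cubic_act g h q) = (det h)\<^sup>2 * (a * g1 * g3\<^sup>2 + b * (2 * g1 * g3 * g4 + g2 * g3\<^sup>2) + c * (g1 * g4\<^sup>2 + 2 * g2 * g3 * g4) + d * g2 * g4\<^sup>2)"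
    "kD (cubic_act g h q) = (det h)\<^sup>2 * (a * g3^3 + 3 * b * g3\<^sup>2 * g4 + 3 * c * g3 * g4\<^sup>2 + d * g4^3)"
proof -
  have t: "(transpose g *v vec2 x y)$1 = g1 * x + g3 * y" "(transpose g *v vec2 x y)$2 = g2 * x + g4 * y" for x y
    unfolding g1_def g2_def g3_def g4_def by (simp_all add: transpose_def matrix_vector_mult_def sum_2)
  have "cubic_eval (cubic_act g h q) (vec2 x y)
    = ((det h)\<^sup>2 * (a * g1^3 + 3 * b * g1\<^sup>2 * g2 + 3 * c * g1 * g2\<^sup>2 + d * g2^3)) * x^3
     + 3 * ((det h)\<^sup>2 * (a * g1\<^sup>2 * g3 + b * (g1\<^sup>2 * g4 + 2 * g1 * g2 * g3) + c * (2 * g1 * g2 * g4 + g2\<^sup>2 * g3) + d * g2\<^sup>2 * g4)) * x\<^sup>2 * y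
     + 3 * ((det h)\<^sup>2 * (a * g1 * g3\<^sup>2 + b * (2 * g1 * g3 * g4 + g2 * g3\<^sup>2) + c * (g1 * g4\<^sup>2 + 2 * g2 * g3 * g4) + d * g2 * g4\<^sup>2)) * x * y\<^sup>2
     + ((det h)\<^sup>2 * (a * g3^3 + 3 * b * g3\<^sup>2 * g4 + 3 * c * g3 * g4\<^sup>2 + d * g4^3)) * y^3" for x y
    unfolding cubic_eval_act cubic_eval_coeffs[of q] t a_def[symmetric] b_def[symmetric] c_def[symmetric] d_def[symmetric] by algebra
  from cubic_eval_coeffs_unique[OF this] show
    "kA (cubic_act g h q) = (det h)\<^sup>2 * (a * g1^3 + 3 * b * g1\<^sup>2 * g2 + 3 * c * g1 * g2\<^sup>2 + d * g2^3)"
    "kB (cubic_act g h q) = (det h)\<^sup>2 * (a * g1\<^sup>2 * g3 + b * (g1\<^sup>2 * g4 + 2 * g1 * g2 * g3) + c * (2 * g1 * g2 * g4 + g2\<^sup>2 * g3) + d * g2\<^sup>2 * g4)"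
    "kC (cubic_act g h q) = (det h)\<^sup>2 * (a * g1 * g3\<^sup>2 + b * (2 * g1 * g3 * g4 + g2 * g3\<^sup>2) + c * (g1 * g4\<^sup>2 + 2 * g2 * g3 * g4) + d * g2 * g4\<^sup>2)"
    "kD (cubic_act g h q) = (det h)\<^sup>2 * (a * g3^3 + 3 * b * g3\<^sup>2 * g4 + 3 * c * g3 * g4\<^sup>2 + d * g4^3)" by blast+
qed

text \<open>The Hessian is a quadratic covariant of weight 2; being quadratic in a cubic that scales
  with (det h)^2, it picks up (det h)^4.\<close>

lemma hess_cubic_act:
  fixes g :: matE and h :: matF and q :: binary_cubic
  defines "m \<equiv> (det g)\<^sup>2 * (det h) ^ 4"
  shows "hess1 (cubic_act g h q) = m * ((g$1$1)\<^sup>2 * hess1 q + g$1$1 * g$1$2 * hess2 q + (g$1$2)\<^sup>2 * hess3 q)"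
    "hess2 (cubic_act g h q) = m * (2 * g$1$1 * g$2$1 * hess1 q + (g$1$1 * g$2$2 + g$1$2 * g$2$1) * hess2 q + 2 * g$1$2 * g$2$2 * hess3 q)"
    "hess3 (cubic_act g h q) = m * ((g$2$1)\<^sup>2 * hess1 q + g$2$1 * g$2$2 * hess2 q + (g$2$2)\<^sup>2 * hess3 q)"
  unfolding hess1_def hess2_def hess3_def k_cubic_act m_def det_2 by algebra+

lemma cubic_act_cancel:
  assumes "invertible g" "invertible h"
  shows "cubic_act (matrix_inv g) (matrix_inv h) (cubic_act g h q) = q"
proof (rule binary_cubic_eqI)
  fix \<xi>
  have "det (matrix_inv h) * det h = 1" by (simp add: invertible_mult_inv[OF assms(2)] flip: det_mul)
  then have "(det (matrix_inv h))\<^sup>2 * (det h)\<^sup>2 = 1" by (simp flip: power_mult_distrib)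
  moreover have "transpose g *v (transpose (matrix_inv g) *v \<xi>) = \<xi>"
  proof -
    have "transpose g *v (transpose (matrix_inv g) *v \<xi>) = transpose (matrix_inv g ** g) *v \<xi>"
      by (simp only: matrix_transpose_mul matrix_vector_mul_assoc)
    also have "\<dots> = \<xi>" by (simp only: invertible_mult_inv[OF assms(1)] transpose_mat matrix_vector_mul_lid)
    finally show ?thesis .
  qed
  ultimately show "cubic_eval (cubic_act (matrix_inv g) (matrix_inv h) (cubic_act g h q)) \<xi> = cubic_eval q \<xi>"
    by (simp only: cubic_eval_act mult.assoc[symmetric] mult_1_left)
qed

lemma cubes_act:
  assumes "invertible g" "invertible h"
  shows "cubic_act g h q \<in> cubes \<longleftrightarrow> q \<in> cubes"
proof -
  have *: "cubic_act g h q \<in> cubes" if "q \<in> cubes" for g h q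
    using that unfolding cubes_iff_hess hess_cubic_act by simp
  show ?thesis using *[of q g h] *[of "cubic_act g h q" "matrix_inv g" "matrix_inv h"] cubic_act_cancel[OF assms] by auto
qed

lemma k_dilate: "kA (cubic_dilate t q) = t * kA q" "kB (cubic_dilate t q) = t * kB q" "kC (cubic_dilate t q) = t * kC q" "kD (cubic_dilate t q) = t * kD q"
proof -
  have "cubic_eval (cubic_dilate t q) \<xi> = t * cubic_eval q \<xi>" for \<xi> by transfer simp
  then show "kA (cubic_dilate t q) = t * kA q" "kB (cubic_dilate t q) = t * kB q" "kC (cubic_dilate t q) = t * kC q" "kD (cubic_dilate t q) = t * kD q"
    by (simp_all add: kA_def kB_def kC_def kD_def algebra_simps)
qed

lemma hess_dilate: "hess1 (cubic_dilate t q) = t\<^sup>2 * hess1 q" "hess2 (cubic_dilate t q) = t\<^sup>2 * hess2 q" "hess3 (cubic_dilate t q) = t\<^sup>2 * hess3 q"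
  unfolding hess1_def hess2_def hess3_def k_dilate by algebra+

section \<open>The complex\<close>

text \<open>Frames \<open>(P, 1)\<close> with \<open>det P = 1\<close> and first column \<open>e\<^sub>1\<close>, \<open>e\<^sub>2\<close>, \<open>e\<^sub>1 + e\<^sub>2\<close>, \<open>e\<^sub>1 - e\<^sub>2\<close>.\<close>

definition frame1 :: frames where "frame1 = (mat2 1 0 0 1, mat 1)"
definition frame2 :: frames where "frame2 = (mat2 0 (-1) 1 0, mat 1)"
definition frame12 :: frames where "frame12 = (mat2 1 0 1 1, mat 1)"
definition frame12' :: frames where "frame12' = (mat2 1 0 (-1) 1, mat 1)"

text \<open>
  \<open>diff1\<close> pairs quadratic forms on \<open>E\<close> with the Hessian of the cubic; \<open>diff2\<close> sends
  \<open>l \<in> E\<^sup>*\<close> to the derivative of the cubic along \<open>l\<close>, transported to \<open>E\<close> by the symplectic form.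
  The coefficients of their arguments are read off as values at the frames above.
\<close>

definition diff1 :: "('x \<Rightarrow> binary_cubic) \<Rightarrow> ('x \<times> frames \<Rightarrow> complex) \<Rightarrow> 'x \<Rightarrow> complex" where
  "diff1 \<delta> \<phi> x = \<phi> (x, frame1) * hess1 (\<delta> x)
     + (\<phi> (x, frame12) - \<phi> (x, frame1) - \<phi> (x, frame2)) / 2 * hess2 (\<delta> x) + \<phi> (x, frame2) * hess3 (\<delta> x)"

definition diff2 :: "('x \<Rightarrow> binary_cubic) \<Rightarrow> ('x \<times> frames \<Rightarrow> complex) \<Rightarrow> 'x \<times> frames \<Rightarrow> complex" where
  "diff2 \<delta> \<phi> = (\<lambda>(x, P, Q).
     (\<phi> (x, frame1) * (kC (\<delta> x) * (P$1$1)\<^sup>2 - 2 * kB (\<delta> x) * (P$1$1 * P$2$1) + kA (\<delta> x) * (P$2$1)\<^sup>2)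
      + \<phi> (x, frame2) * (kD (\<delta> x) * (P$1$1)\<^sup>2 - 2 * kC (\<delta> x) * (P$1$1 * P$2$1) + kB (\<delta> x) * (P$2$1)\<^sup>2))
     * (det P ^ 2 * det Q ^ 4))"

lemma quad_el_frames:
  "quad_el a b c (x, frame1) = a x" "quad_el a b c (x, frame2) = c x" "quad_el a b c (x, frame12) = a x + b x + c x"
  by (simp_all add: quad_el_def frame1_def frame2_def frame12_def det_2)

lemma lin_el_frames: "lin_el a b (x, frame1) = a x" "lin_el a b (x, frame2) = b x"
  by (simp_all add: lin_el_def frame1_def frame2_def det_2)

text \<open>The half at the middle coefficient belongs to the invariant pairing of two quadratic
  forms written without binomial factors.\<close>

lemma diff1_quad_el: "diff1 \<delta> (quad_el a b c) = (\<lambda>x. a x * hess1 (\<delta> x) + b x / 2 * hess2 (\<delta> x) + c x * hess3 (\<delta> x))"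
  by (simp add: fun_eq_iff diff1_def quad_el_frames)

text \<open>The columns are the Hilbert-Burch syzygies (c, -b, a) and (d, -c, b), with the middle
  entry doubled to compensate the half in \<open>diff1\<close>.\<close>

lemma diff2_lin_el: "diff2 \<delta> (lin_el a b) = quad_el (\<lambda>x. a x * kC (\<delta> x) + b x * kD (\<delta> x))
   (\<lambda>x. -2 * (a x * kB (\<delta> x) + b x * kC (\<delta> x))) (\<lambda>x. a x * kA (\<delta> x) + b x * kB (\<delta> x))"
proof (rule ext, clarify)
  fix x and P :: matE and Q :: matF
  show "diff2 \<delta> (lin_el a b) (x, P, Q) = quad_el (\<lambda>x. a x * kC (\<delta> x) + b x * kD (\<delta> x))
   (\<lambda>x. -2 * (a x * kB (\<delta> x) + b x * kC (\<delta> x))) (\<lambda>x. a x * kA (\<delta> x) + b x * kB (\<delta> x)) (x, P, Q)"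
    unfolding diff2_def prod.case lin_el_frames by (simp add: quad_el_def algebra_simps)
qed

text \<open>Both differentials see a point only through its image under \<open>\<delta>\<close>,
  which makes one complex the base change of the other.\<close>

lemma diff_pullback:
  "diff2 \<delta> (pullback \<delta> \<phi>) = pullback \<delta> (diff2 (\<lambda>q. q) \<phi>)" "diff1 \<delta> (pullback \<delta> \<phi>) = diff1 (\<lambda>q. q) \<phi> \<circ> \<delta>"
  by (auto simp: fun_eq_iff diff1_def diff2_def pullback_def)

lemma det_mat2: "det (mat2 a b c d) = a * d - b * c" by (simp add: det_2)

lemma mult_col1: "(g ** P)$1$1 = g$1$1 * P$1$1 + g$1$2 * P$2$1" "(g ** P)$2$1 = g$2$1 * P$1$1 + g$2$2 * P$2$1" for g P :: matE
  by (simp_all add: matrix_matrix_mult_def sum_2)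

lemma free_module_sel:
  "msmul (free_module G (l, m, d)) = (\<lambda>a \<phi> (x, w). a x * \<phi> (x, w))"
  "mact (free_module G (l, m, d)) g h \<phi> = (\<lambda>(x, P, Q). \<phi> (gact G (matrix_inv g) (matrix_inv h) x, (matrix_inv g ** P, matrix_inv h ** Q)))"
  "mdeg (free_module G (l, m, d)) n = {\<phi> \<in> mcar (free_module G (l, m, d)). \<forall>t x w. t ^ d * \<phi> (dilate G t x, w) = t ^ n * \<phi> (x, w)}"
  by (simp_all add: free_module_def Let_def frames_act_def fun_eq_iff)

lemma coord_ring_sel:
  "mcar (coord_ring G Z) = restr Z ` poly_ring G" "msmul (coord_ring G Z) = (\<lambda>a m x. a x * m x)"
  "mact (coord_ring G Z) g h m = (\<lambda>x. m (gact G (matrix_inv g) (matrix_inv h) x))"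
  "mdeg (coord_ring G Z) n = restr Z ` homogeneous G n"
  by (simp_all add: coord_ring_def fun_eq_iff)

lemma restr_UNIV [simp]: "restr UNIV a = a" "restr UNIV ` A = A"
  by (simp_all add: restr_def image_def)

text \<open>Collects what the resolution requires of an equivariant map to binary cubics:
  injectivity comes from \<open>hess1_nzd\<close>, exactness in the middle from
  \<open>syzygies\<close>, and the identification of the cokernel from
  \<open>vanishing\<close>.\<close>

locale cubic_covariant =
  fixes G :: "'x gspace" and \<delta> :: "'x \<Rightarrow> binary_cubic" and k :: nat
  assumes k_pos: "k > 0"
    and act: "\<And>g h x. \<delta> (gact G g h x) = cubic_act g h (\<delta> x)"
    and dil: "\<And>t x. \<delta> (dilate G t x) = cubic_dilate (t ^ k) (\<delta> x)"
    and poly: "(\<lambda>x. kA (\<delta> x)) \<in> poly_ring G" "(\<lambda>x. kB (\<delta> x)) \<in> poly_ring G" "(\<lambda>x. kC (\<delta> x)) \<in> poly_ring G" "(\<lambda>x. kD (\<delta> x)) \<in> poly_ring G"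
    and hess1_nzd: "\<And>p x. p \<in> poly_ring G \<Longrightarrow> (\<And>x. hess1 (\<delta> x) * p x = 0) \<Longrightarrow> p x = 0"
    and syzygies: "\<And>a b c. a \<in> poly_ring G \<Longrightarrow> b \<in> poly_ring G \<Longrightarrow> c \<in> poly_ring G \<Longrightarrow>
       (\<And>x. a x * hess1 (\<delta> x) + b x * hess2 (\<delta> x) + c x * hess3 (\<delta> x) = 0) \<Longrightarrow>
       \<exists>p \<in> poly_ring G. \<exists>q \<in> poly_ring G. \<forall>x. a x = p x * kC (\<delta> x) + q x * kD (\<delta> x) \<and>
         b x = - p x * kB (\<delta> x) - q x * kC (\<delta> x) \<and> c x = p x * kA (\<delta> x) + q x * kB (\<delta> x)"
    and vanishing: "\<And>f. f \<in> poly_ring G \<Longrightarrow> (\<And>x. \<delta> x \<in> cubes \<Longrightarrow> f x = 0) \<Longrightarrow> f \<in> minors_ideal G \<delta>"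
begin

lemma hpoly: "(\<lambda>x. hess1 (\<delta> x)) \<in> poly_ring G" "(\<lambda>x. hess2 (\<delta> x)) \<in> poly_ring G" "(\<lambda>x. hess3 (\<delta> x)) \<in> poly_ring G"
  unfolding hess1_def hess2_def hess3_def by (intro polys_diff polys.mult polys_power poly)+

abbreviation "F0 \<equiv> coord_ring G UNIV"
abbreviation "F1 \<equiv> free_module G ([4,2], [4,4,4], 2 * k)"
abbreviation "F2 \<equiv> free_module G ([5,4], [6,6,6], 3 * k)"
abbreviation "Z \<equiv> {x. \<delta> x \<in> cubes}"

section \<open>Equivariance and degrees of the differentials\<close>

lemma F1E:
  assumes "\<phi> \<in> mcar F1"
  obtains a b c where "a \<in> poly_ring G" "b \<in> poly_ring G" "c \<in> poly_ring G" "\<phi> = quad_el a b c"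
  using assms unfolding free_module_quad by blast

lemma F2E:
  assumes "\<phi> \<in> mcar F2"
  obtains a b where "a \<in> poly_ring G" "b \<in> poly_ring G" "\<phi> = lin_el a b"
  using assms unfolding free_module_lin by blast

lemma F1I: "a \<in> poly_ring G \<Longrightarrow> b \<in> poly_ring G \<Longrightarrow> c \<in> poly_ring G \<Longrightarrow> quad_el a b c \<in> mcar F1"
  unfolding free_module_quad by blast

lemma F2I: "a \<in> poly_ring G \<Longrightarrow> b \<in> poly_ring G \<Longrightarrow> lin_el a b \<in> mcar F2"
  unfolding free_module_lin by blast

lemma diff2_car: "\<phi> \<in> mcar F2 \<Longrightarrow> diff2 \<delta> \<phi> \<in> mcar F1"
  by (erule F2E, simp only: diff2_lin_el, intro F1I polys.add polys.mult polys_cmul poly)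

lemma diff1_car: "\<phi> \<in> mcar F1 \<Longrightarrow> diff1 \<delta> \<phi> \<in> poly_ring G"
  by (erule F1E, simp only: diff1_quad_el, intro polys.add polys.mult polys_divc hpoly)

lemma diff2_hom: "equivariant_graded_hom G F2 F1 (diff2 \<delta>)"
  unfolding equivariant_graded_hom_def
proof (intro conjI ballI allI impI)
  show "diff2 \<delta> m \<in> mcar F1" if "m \<in> mcar F2" for m using diff2_car[OF that] .
  show "diff2 \<delta> (m + m') = diff2 \<delta> m + diff2 \<delta> m'" for m m'
    by (auto simp: fun_eq_iff diff2_def algebra_simps)
  show "diff2 \<delta> (msmul F2 a m) = msmul F1 a (diff2 \<delta> m)" for a m
    by (auto simp: fun_eq_iff diff2_def free_module_sel algebra_simps)
  show "diff2 \<delta> (mact F2 g h m) = mact F1 g h (diff2 \<delta> m)" if m: "m \<in> mcar F2" for g h m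
  proof (rule ext)
    fix y :: "'x \<times> frames"
    obtain x P Q where y: "y = (x, P, Q)" by (cases y) auto
    obtain a b where m: "m = lin_el a b" using F2E[OF m] by metis
    let ?g = "matrix_inv g" and ?h = "matrix_inv h"
    let ?y = "gact G ?g ?h x"
    have 1: "mact F2 g h (lin_el a b) (x, frame1) = (a ?y * ?g$1$1 + b ?y * ?g$2$1) * (det ?g ^ 4 * det ?h ^ 6)"
      unfolding free_module_sel frame1_def prod.case lin_el_def mult_col1 by (simp add: det_mul det_mat2)
    have 2: "mact F2 g h (lin_el a b) (x, frame2) = (a ?y * ?g$1$2 + b ?y * ?g$2$2) * (det ?g ^ 4 * det ?h ^ 6)"
      unfolding free_module_sel frame2_def prod.case lin_el_def mult_col1 by (simp add: det_mul det_mat2)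
    have L: "diff2 \<delta> (mact F2 g h (lin_el a b)) (x, P, Q) =
       ((a ?y * ?g$1$1 + b ?y * ?g$2$1) * (kC (\<delta> x) * (P$1$1)\<^sup>2 - 2 * kB (\<delta> x) * (P$1$1 * P$2$1) + kA (\<delta> x) * (P$2$1)\<^sup>2)
        + (a ?y * ?g$1$2 + b ?y * ?g$2$2) * (kD (\<delta> x) * (P$1$1)\<^sup>2 - 2 * kC (\<delta> x) * (P$1$1 * P$2$1) + kB (\<delta> x) * (P$2$1)\<^sup>2))
       * (det ?g ^ 4 * det ?h ^ 6 * (det P ^ 2 * det Q ^ 4))"
      unfolding diff2_def prod.case 1 2 by algebra
    have R: "mact F1 g h (diff2 \<delta> (lin_el a b)) (x, P, Q) =
       (a ?y * (kC (\<delta> ?y) * ((?g ** P)$1$1)\<^sup>2 - 2 * kB (\<delta> ?y) * ((?g ** P)$1$1 * (?g ** P)$2$1) + kA (\<delta> ?y) * ((?g ** P)$2$1)\<^sup>2)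
        + b ?y * (kD (\<delta> ?y) * ((?g ** P)$1$1)\<^sup>2 - 2 * kC (\<delta> ?y) * ((?g ** P)$1$1 * (?g ** P)$2$1) + kB (\<delta> ?y) * ((?g ** P)$2$1)\<^sup>2))
       * (det ?g ^ 2 * det ?h ^ 4 * (det P ^ 2 * det Q ^ 4))"
      unfolding free_module_sel diff2_def prod.case lin_el_frames det_mul power_mult_distrib by (simp only: mult_ac)
    \<comment> \<open>The two polar quadratic forms are mixed by \<open>?g\<close>. The factor (det
      ?g)^2 is the price of the symplectic form, once for each slot of a quadratic form.\<close>
    have S: "kC (\<delta> ?y) * ((?g ** P)$1$1)\<^sup>2 - 2 * kB (\<delta> ?y) * ((?g ** P)$1$1 * (?g ** P)$2$1) + kA (\<delta> ?y) * ((?g ** P)$2$1)\<^sup>2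
        = (det ?g)\<^sup>2 * (det ?h)\<^sup>2 * (?g$1$1 * (kC (\<delta> x) * (P$1$1)\<^sup>2 - 2 * kB (\<delta> x) * (P$1$1 * P$2$1) + kA (\<delta> x) * (P$2$1)\<^sup>2)
           + ?g$1$2 * (kD (\<delta> x) * (P$1$1)\<^sup>2 - 2 * kC (\<delta> x) * (P$1$1 * P$2$1) + kB (\<delta> x) * (P$2$1)\<^sup>2))"
      "kD (\<delta> ?y) * ((?g ** P)$1$1)\<^sup>2 - 2 * kC (\<delta> ?y) * ((?g ** P)$1$1 * (?g ** P)$2$1) + kB (\<delta> ?y) * ((?g ** P)$2$1)\<^sup>2
        = (det ?g)\<^sup>2 * (det ?h)\<^sup>2 * (?g$2$1 * (kC (\<delta> x) * (P$1$1)\<^sup>2 - 2 * kB (\<delta> x) * (P$1$1 * P$2$1) + kA (\<delta> x) * (P$2$1)\<^sup>2)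
           + ?g$2$2 * (kD (\<delta> x) * (P$1$1)\<^sup>2 - 2 * kC (\<delta> x) * (P$1$1 * P$2$1) + kB (\<delta> x) * (P$2$1)\<^sup>2))"
      unfolding act k_cubic_act mult_col1 det_2 by algebra+
    \<comment> \<open>Abstracted over the polar forms so that only few complex variables
      remain.\<close>
    have "((a * g1 + b * g3) * s + (a * g2 + b * g4) * s') * (D ^ 4 * H ^ 6 * F)
       = (a * (D\<^sup>2 * H\<^sup>2 * (g1 * s + g2 * s')) + b * (D\<^sup>2 * H\<^sup>2 * (g3 * s + g4 * s'))) * (D ^ 2 * H ^ 4 * F)"
      for a b g1 g2 g3 g4 s s' D H F :: complex by algebra
    then show "diff2 \<delta> (mact F2 g h m) y = mact F1 g h (diff2 \<delta> m) y"
      unfolding y m L R S .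
  qed
  show "diff2 \<delta> m \<in> mdeg F1 n" if m: "m \<in> mdeg F2 n" for n m
  proof -
    have car: "m \<in> mcar F2" and deg: "\<And>t x w. t ^ (3 * k) * m (dilate G t x, w) = t ^ n * m (x, w)"
      using m unfolding free_module_sel by blast+
    have "t ^ (2 * k) * diff2 \<delta> m (dilate G t x, w) = t ^ n * diff2 \<delta> m (x, w)" for t x w
    proof -
      obtain P Q where w: "w = (P, Q)" by (cases w) auto
      have e: "t ^ (3 * k) = t ^ (2 * k) * t ^ k" by (simp flip: power_add)
      have "S * ((m1 * (T * c * u - 2 * (T * b) * v + T * a * r) + m2 * (T * d * u - 2 * (T * c) * v + T * b * r)) * F)
         = N * ((n1 * (c * u - 2 * b * v + a * r) + n2 * (d * u - 2 * c * v + b * r)) * F)"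
        if "S * T * m1 = N * n1" "S * T * m2 = N * n2" for S T N m1 m2 n1 n2 a b c d u v r F :: complex
        using that by algebra
      from this[OF deg[of t x frame1, unfolded e] deg[of t x frame2, unfolded e]]
      show ?thesis unfolding w diff2_def prod.case dil k_dilate .
    qed
    then show ?thesis unfolding free_module_sel using diff2_car[OF car] by blast
  qed
qed

lemma diff1_hom: "equivariant_graded_hom G F1 F0 (diff1 \<delta>)"
  unfolding equivariant_graded_hom_def
proof (intro conjI ballI allI impI)
  show "diff1 \<delta> m \<in> mcar F0" if "m \<in> mcar F1" for m using diff1_car[OF that] by (simp add: coord_ring_sel)
  show "diff1 \<delta> (m + m') = diff1 \<delta> m + diff1 \<delta> m'" for m m'
    by (auto simp: fun_eq_iff diff1_def field_simps)
  show "diff1 \<delta> (msmul F1 a m) = msmul F0 a (diff1 \<delta> m)" for a m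
    by (auto simp: fun_eq_iff diff1_def free_module_sel coord_ring_sel field_simps)
  show "diff1 \<delta> (mact F1 g h m) = mact F0 g h (diff1 \<delta> m)" if m: "m \<in> mcar F1" for g h m
  proof (rule F1E[OF m], rule ext)
    fix a b c x
    let ?g = "matrix_inv g" and ?h = "matrix_inv h"
    let ?y = "gact G ?g ?h x" and ?D = "det ?g ^ 2 * det ?h ^ 4"
    have 1: "mact F1 g h (quad_el a b c) (x, frame1) = (a ?y * (?g$1$1)\<^sup>2 + b ?y * (?g$1$1 * ?g$2$1) + c ?y * (?g$2$1)\<^sup>2) * ?D"
      unfolding free_module_sel frame1_def prod.case quad_el_def mult_col1 by (simp add: det_mul det_mat2)
    have 2: "mact F1 g h (quad_el a b c) (x, frame2) = (a ?y * (?g$1$2)\<^sup>2 + b ?y * (?g$1$2 * ?g$2$2) + c ?y * (?g$2$2)\<^sup>2) * ?D"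
      unfolding free_module_sel frame2_def prod.case quad_el_def mult_col1 by (simp add: det_mul det_mat2)
    have 3: "mact F1 g h (quad_el a b c) (x, frame12) = (a ?y * (?g$1$1 + ?g$1$2)\<^sup>2
        + b ?y * ((?g$1$1 + ?g$1$2) * (?g$2$1 + ?g$2$2)) + c ?y * (?g$2$1 + ?g$2$2)\<^sup>2) * ?D"
      unfolding free_module_sel frame12_def prod.case quad_el_def mult_col1 by (simp add: det_mul det_mat2)
    assume "m = quad_el a b c"
    then show "diff1 \<delta> (mact F1 g h m) x = mact F0 g h (diff1 \<delta> m) x"
      unfolding diff1_def coord_ring_sel by (simp only: 1 2 3 quad_el_frames act hess_cubic_act) (simp add: field_simps power2_eq_square)
  qed
  show "diff1 \<delta> m \<in> mdeg F0 n" if m: "m \<in> mdeg F1 n" for n m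
  proof -
    have car: "m \<in> mcar F1" and deg: "\<And>t x w. t ^ (2 * k) * m (dilate G t x, w) = t ^ n * m (x, w)"
      using m unfolding free_module_sel by blast+
    have "diff1 \<delta> m (dilate G t x) = t ^ n * diff1 \<delta> m x" for t x
    proof -
      have e: "t ^ (2 * k) = (t ^ k)\<^sup>2" by (simp add: power_mult mult.commute)
      note d = deg[of t x frame1, unfolded e] deg[of t x frame2, unfolded e] deg[of t x frame12, unfolded e]
      have "m1 * (S * h1) + (m12 - m1 - m2) / 2 * (S * h2) + m2 * (S * h3) = N * (n1 * h1 + (n12 - n1 - n2) / 2 * h2 + n2 * h3)"
        if "S * m1 = N * n1" "S * m2 = N * n2" "S * m12 = N * n12" for S N m1 m2 m12 n1 n2 n12 h1 h2 h3 :: complex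
      proof -
        have "S * ((m12 - m1 - m2) / 2) = N * ((n12 - n1 - n2) / 2)"
          unfolding times_divide_eq_right by (simp only: right_diff_distrib that)
        with that(1,2) show ?thesis by algebra
      qed
      from this[OF d] show ?thesis unfolding diff1_def dil hess_dilate .
    qed
    then show ?thesis unfolding coord_ring_sel homogeneous_def using diff1_car[OF car] by simp
  qed
qed

lemma restr_hom: "equivariant_graded_hom G F0 (coord_ring G Z) (restr Z)"
  unfolding equivariant_graded_hom_def coord_ring_sel restr_UNIV
proof (intro conjI ballI allI impI)
  fix g :: matE and h :: matF and m :: "'x \<Rightarrow> complex" assume "invertible g" "invertible h"
  then have "gact G (matrix_inv g) (matrix_inv h) x \<in> Z \<longleftrightarrow> x \<in> Z" for x
    by (simp add: act cubes_act invertible_matrix_inv)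
  then show "restr Z (\<lambda>x. m (gact G (matrix_inv g) (matrix_inv h) x)) = (\<lambda>x. restr Z m (gact G (matrix_inv g) (matrix_inv h) x))"
    by (simp add: restr_def fun_eq_iff)
qed (auto simp: restr_def fun_eq_iff)

section \<open>Exactness\<close>

lemma diff2_inj: "inj_on (diff2 \<delta>) (mcar F2)"
proof (rule inj_onI)
  fix \<phi> \<psi> assume "\<phi> \<in> mcar F2" "\<psi> \<in> mcar F2" and eq: "diff2 \<delta> \<phi> = diff2 \<delta> \<psi>"
  obtain a b where ab: "a \<in> poly_ring G" "b \<in> poly_ring G" "\<phi> = lin_el a b" using F2E[OF \<open>\<phi> \<in> _\<close>] by metis
  obtain a' b' where ab': "a' \<in> poly_ring G" "b' \<in> poly_ring G" "\<psi> = lin_el a' b'" using F2E[OF \<open>\<psi> \<in> _\<close>] by metis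
  define p q where "p = (\<lambda>x. a x - a' x)" and "q = (\<lambda>x. b x - b' x)"
  have pq: "p \<in> poly_ring G" "q \<in> poly_ring G" unfolding p_def q_def by (intro polys_diff ab ab')+
  have v: "diff2 \<delta> \<phi> (x, w) = diff2 \<delta> \<psi> (x, w)" for x w using eq by simp
  have e: "p x * kC (\<delta> x) + q x * kD (\<delta> x) = 0 \<and> p x * kA (\<delta> x) + q x * kB (\<delta> x) = 0 \<and> p x * kB (\<delta> x) + q x * kC (\<delta> x) = 0" for x
  proof -
    note u = v[of x, unfolded ab(3) ab'(3) diff2_lin_el]
    have 1: "p x * kC (\<delta> x) + q x * kD (\<delta> x) = 0" using u[of frame1] unfolding quad_el_frames p_def q_def by algebra
    have 2: "p x * kA (\<delta> x) + q x * kB (\<delta> x) = 0" using u[of frame2] unfolding quad_el_frames p_def q_def by algebra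
    have "2 * (p x * kB (\<delta> x) + q x * kC (\<delta> x)) = 0"
      using u[of frame12] 1 2 unfolding quad_el_frames p_def q_def by algebra
    then have "p x * kB (\<delta> x) + q x * kC (\<delta> x) = 0" by (metis mult_eq_0_iff zero_neq_numeral)
    then show ?thesis using 1 2 by blast
  qed
  \<comment> \<open>Cramer's rule for the matrix with rows (A, B) and (B, C), whose determinant is
    \<open>hess1\<close>.\<close>
  have "hess1 (\<delta> x) * p x = 0" "hess1 (\<delta> x) * q x = 0" for x
    using e[of x] unfolding hess1_def by algebra+
  then have "p x = 0" "q x = 0" for x using hess1_nzd pq by blast+
  then have "a = a'" "b = b'" by (simp_all add: p_def q_def fun_eq_iff)
  then show "\<phi> = \<psi>" using ab ab' by simp
qed

lemma exact1: "diff2 \<delta> ` mcar F2 = {\<phi> \<in> mcar F1. diff1 \<delta> \<phi> = 0}"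
proof (intro equalityI subsetI)
  fix \<psi> assume "\<psi> \<in> diff2 \<delta> ` mcar F2"
  then obtain \<phi> where \<phi>: "\<phi> \<in> mcar F2" "\<psi> = diff2 \<delta> \<phi>" by blast
  obtain a b where ab: "a \<in> poly_ring G" "b \<in> poly_ring G" "\<phi> = lin_el a b" using F2E[OF \<phi>(1)] by metis
  have "diff1 \<delta> \<psi> x = 0" for x
  proof -
    have half: "-2 * t / 2 = - t" for t :: complex by simp
    show ?thesis unfolding \<phi>(2) ab(3) diff2_lin_el diff1_quad_el half hess1_def hess2_def hess3_def by algebra
  qed
  then show "\<psi> \<in> {\<phi> \<in> mcar F1. diff1 \<delta> \<phi> = 0}" using diff2_car[OF \<phi>(1)] unfolding \<phi>(2)[symmetric] by (simp add: fun_eq_iff)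
next
  fix \<psi> assume "\<psi> \<in> {\<phi> \<in> mcar F1. diff1 \<delta> \<phi> = 0}"
  then have car: "\<psi> \<in> mcar F1" and 0: "diff1 \<delta> \<psi> = 0" by auto
  obtain a b c where abc: "a \<in> poly_ring G" "b \<in> poly_ring G" "c \<in> poly_ring G" "\<psi> = quad_el a b c" using F1E[OF car] by metis
  have "a x * hess1 (\<delta> x) + b x / 2 * hess2 (\<delta> x) + c x * hess3 (\<delta> x) = 0" for x
    using fun_cong[OF 0, of x] unfolding abc(4) diff1_quad_el by simp
  from syzygies[OF abc(1) polys_divc[OF abc(2)] abc(3) this]
  obtain p q where pq: "p \<in> poly_ring G" "q \<in> poly_ring G" and
    e: "\<And>x. a x = p x * kC (\<delta> x) + q x * kD (\<delta> x) \<and> b x / 2 = - p x * kB (\<delta> x) - q x * kC (\<delta> x) \<and> c x = p x * kA (\<delta> x) + q x * kB (\<delta> x)"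
    by blast
  have "b x = -2 * (p x * kB (\<delta> x) + q x * kC (\<delta> x))" for x using e[of x] by (simp add: field_simps)
  then have "\<psi> = diff2 \<delta> (lin_el p q)"
    unfolding abc(4) diff2_lin_el using e by (simp add: fun_eq_iff quad_el_def)
  then show "\<psi> \<in> diff2 \<delta> ` mcar F2" using F2I[OF pq] by blast
qed

lemma exact0: "diff1 \<delta> ` mcar F1 = {a \<in> mcar F0. restr Z a = 0}"
proof (intro equalityI subsetI)
  fix f assume "f \<in> diff1 \<delta> ` mcar F1"
  then obtain \<phi> where \<phi>: "\<phi> \<in> mcar F1" "f = diff1 \<delta> \<phi>" by blast
  have "f x = 0" if "\<delta> x \<in> cubes" for x using that unfolding \<phi>(2) diff1_def cubes_iff_hess by simp
  then show "f \<in> {a \<in> mcar F0. restr Z a = 0}"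
    using diff1_car[OF \<phi>(1)] unfolding \<phi>(2)[symmetric] by (simp add: coord_ring_sel restr_def fun_eq_iff)
next
  fix f assume "f \<in> {a \<in> mcar F0. restr Z a = 0}"
  then have f: "f \<in> poly_ring G" and 0: "restr Z f = 0" by (auto simp: coord_ring_sel)
  have "f x = 0" if "\<delta> x \<in> cubes" for x using fun_cong[OF 0, of x] that by (simp add: restr_def)
  from vanishing[OF f this] show "f \<in> diff1 \<delta> ` mcar F1"
  proof (rule ideal3E)
    fix p q r assume pqr: "p \<in> poly_ring G" "q \<in> poly_ring G" "r \<in> poly_ring G"
      "\<And>x. f x = p x * hess1 (\<delta> x) + q x * hess2 (\<delta> x) + r x * hess3 (\<delta> x)"
    have "f = diff1 \<delta> (quad_el p (\<lambda>x. 2 * q x) r)" by (simp add: diff1_quad_el fun_eq_iff pqr(4))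
    then show ?thesis using F1I[OF pqr(1) polys_cmul[OF pqr(2)] pqr(3)] by blast
  qed
qed

section \<open>Minimality\<close>

lemma irrelevant: "(\<lambda>x. kA (\<delta> x)) \<in> irrelevant_ideal G" "(\<lambda>x. kB (\<delta> x)) \<in> irrelevant_ideal G"
  "(\<lambda>x. kC (\<delta> x)) \<in> irrelevant_ideal G" "(\<lambda>x. kD (\<delta> x)) \<in> irrelevant_ideal G"
  "(\<lambda>x. hess1 (\<delta> x)) \<in> irrelevant_ideal G" "(\<lambda>x. hess2 (\<delta> x)) \<in> irrelevant_ideal G" "(\<lambda>x. hess3 (\<delta> x)) \<in> irrelevant_ideal G"
  using k_pos poly hpoly by (simp_all add: irrelevant_ideal_def dil k_dilate hess_dilate)

lemma minimal2: "diff2 \<delta> ` mcar F2 \<subseteq> irrelevant_multiple G F1"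
proof safe
  fix \<phi> assume "\<phi> \<in> mcar F2"
  then obtain a b where ab: "a \<in> poly_ring G" "b \<in> poly_ring G" "\<phi> = lin_el a b" using F2E by metis
  let ?z = "\<lambda>x::'x. 0 :: complex"
  \<comment> \<open>\<open>diff2\<close> is linear in the four coefficients of the cubic; sorting by
    them exhibits the factors in the irrelevant ideal.\<close>
  define A where "A i = [\<lambda>x. kA (\<delta> x), \<lambda>x. kB (\<delta> x), \<lambda>x. kC (\<delta> x), \<lambda>x. kD (\<delta> x)] ! i" for i
  define m where "m i = [quad_el ?z ?z a, quad_el ?z (\<lambda>x. -2 * a x) b, quad_el a (\<lambda>x. -2 * b x) ?z, quad_el b ?z ?z] ! i" for i
  have lt: "i < 4 \<Longrightarrow> i = 0 \<or> i = 1 \<or> i = 2 \<or> i = 3" for i :: nat by linarith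
  have "A i \<in> irrelevant_ideal G \<and> m i \<in> mcar F1" if "i < 4" for i
    using lt[OF that] by (elim disjE) (simp_all add: A_def m_def irrelevant F1I ab polys.const polys_cmul polys_minus)
  moreover have "diff2 \<delta> \<phi> = (\<Sum>i<(4::nat). msmul F1 (A i) (m i))"
  proof (rule ext, clarify)
    fix x and P :: matE and Q :: matF
    have "(\<Sum>i<(4::nat). msmul F1 (A i) (m i)) (x, P, Q) = A 0 x * m 0 (x, P, Q) + A 1 x * m 1 (x, P, Q) + A 2 x * m 2 (x, P, Q) + A 3 x * m 3 (x, P, Q)"
      unfolding sum_fun_apply free_module_sel prod.case by (simp add: eval_nat_numeral)
    also have "\<dots> = diff2 \<delta> \<phi> (x, P, Q)"
    proof -
      have A: "A 0 x = kA (\<delta> x)" "A 1 x = kB (\<delta> x)" "A 2 x = kC (\<delta> x)" "A 3 x = kD (\<delta> x)" by (simp_all add: A_def)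
      have m: "m 0 = quad_el ?z ?z a" "m 1 = quad_el ?z (\<lambda>x. -2 * a x) b" "m 2 = quad_el a (\<lambda>x. -2 * b x) ?z" "m 3 = quad_el b ?z ?z"
        by (simp_all add: m_def)
      show ?thesis unfolding ab(3) diff2_lin_el A m quad_el_def prod.case by algebra
    qed
    finally show "diff2 \<delta> \<phi> (x, P, Q) = (\<Sum>i<(4::nat). msmul F1 (A i) (m i)) (x, P, Q)" ..
  qed
  ultimately show "diff2 \<delta> \<phi> \<in> irrelevant_multiple G F1"
    unfolding irrelevant_multiple_def by (intro CollectI exI[of _ "4::nat"] exI[of _ A] exI[of _ m] conjI allI impI) simp_all
qed

lemma minimal1: "diff1 \<delta> ` mcar F1 \<subseteq> irrelevant_multiple G F0"
proof safe
  fix \<phi> assume "\<phi> \<in> mcar F1"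
  then obtain a b c where abc: "a \<in> poly_ring G" "b \<in> poly_ring G" "c \<in> poly_ring G" "\<phi> = quad_el a b c" using F1E by metis
  define A where "A i = [\<lambda>x. hess1 (\<delta> x), \<lambda>x. hess2 (\<delta> x), \<lambda>x. hess3 (\<delta> x)] ! i" for i
  define m where "m i = [a, \<lambda>x. b x / 2, c] ! i" for i
  have lt: "i < 3 \<Longrightarrow> i = 0 \<or> i = 1 \<or> i = 2" for i :: nat by linarith
  have "A i \<in> irrelevant_ideal G \<and> m i \<in> mcar F0" if "i < 3" for i
    using lt[OF that] by (elim disjE) (simp_all add: A_def m_def irrelevant abc polys_divc coord_ring_sel)
  moreover have "diff1 \<delta> \<phi> = (\<Sum>i<(3::nat). msmul F0 (A i) (m i))"
  proof
    fix x
    have "(\<Sum>i<(3::nat). msmul F0 (A i) (m i)) x = A 0 x * m 0 x + A 1 x * m 1 x + A 2 x * m 2 x"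
      unfolding sum_fun_apply coord_ring_sel by (simp add: eval_nat_numeral)
    also have "\<dots> = diff1 \<delta> \<phi> x"
      unfolding abc(4) diff1_quad_el A_def m_def by simp
    finally show "diff1 \<delta> \<phi> x = (\<Sum>i<(3::nat). msmul F0 (A i) (m i)) x" ..
  qed
  ultimately show "diff1 \<delta> \<phi> \<in> irrelevant_multiple G F0"
    unfolding irrelevant_multiple_def by (intro CollectI exI[of _ "3::nat"] exI[of _ A] exI[of _ m] conjI allI impI) simp_all
qed

theorem resolution: "minimal_free_resolution G Z ([4,2], [4,4,4], 2 * k) ([5,4], [6,6,6], 3 * k) (diff1 \<delta>) (diff2 \<delta>)"
  unfolding minimal_free_resolution_def Let_def
  using diff2_hom diff1_hom restr_hom diff2_inj exact1 exact0 minimal2 minimal1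
  by (simp add: coord_ring_sel)

end

section \<open>The two resolutions\<close>

lemma hess_mk_pencil:
  "hess1 (det_cubic (mk_pencil v)) = mn1 (detmap v)" "hess2 (det_cubic (mk_pencil v)) = mn2 (detmap v)"
  "hess3 (det_cubic (mk_pencil v)) = mn3 (detmap v)"
proof -
  have *: "P (detmap (coords (mk_pencil v))) = P (detmap v)" if "P \<in> cpoly 12" for P
    by (rule cpoly_cong_vars[OF detmap_cpoly[OF that]], erule coords_mk_pencil)
  show "hess1 (det_cubic (mk_pencil v)) = mn1 (detmap v)" "hess2 (det_cubic (mk_pencil v)) = mn2 (detmap v)"
    "hess3 (det_cubic (mk_pencil v)) = mn3 (detmap v)"
    unfolding hess_det_cubic by (rule *, rule mn_cpoly)+
qed

lemma pencil_poly_nzd: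
  assumes p: "p \<in> poly_ring pencil_space" and 0: "\<And>M. hess1 (det_cubic M) * p M = 0"
  shows "p M = 0"
proof -
  have "p (mk_pencil (coords M)) = 0"
  \<comment> \<open>At this point the first three coefficients are -1, -1 and -4/3, so the minor is
    1/3.\<close>
  proof (rule cpoly_domain[where f = "\<lambda>v. mn1 (detmap v)" and n = 12 and g = "\<lambda>v. p (mk_pencil v)" and x = "(\<lambda>_. 0)(8 := 1, 10 := 1, 11 := 1)"])
    show "(\<lambda>v. p (mk_pencil v)) \<in> cpoly 12" by (rule poly_pencil_to_cpoly[OF p]) (rule cpoly_var)
    show "mn1 (detmap v) * p (mk_pencil v) = 0" for v
      using 0[of "mk_pencil v"] unfolding hess_mk_pencil .
  qed (simp_all add: detmap_cpoly mn_cpoly, simp add: mn1_def cA_def cB_def cC_def sdet_def spol_def)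
  then show ?thesis by (simp add: mk_pencil_coords)
qed

interpretation pencils: cubic_covariant pencil_space det_cubic 3
proof
  show "det_cubic (gact pencil_space g h x) = cubic_act g h (det_cubic x)" for g h x
    by (simp add: pencil_space_def det_cubic_act)
  show "det_cubic (dilate pencil_space t x) = cubic_dilate (t ^ 3) (det_cubic x)" for t x
  proof (rule binary_cubic_eqI)
    fix \<xi>
    have e: "pencil_entry (pencil_dilate t x) i r s = t * pencil_entry x i r s" for i r s by transfer simp
    have "cubic_eval (cubic_dilate (t ^ 3) (det_cubic x)) \<xi> = t ^ 3 * cubic_eval (det_cubic x) \<xi>" by transfer simp
    moreover have "det (pencil_member (pencil_dilate t x) \<xi>) = t ^ 3 * det (pencil_member x \<xi>)"
      unfolding pencil_member_sym3 det_sym3 e sdet_def by algebra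
    ultimately show "cubic_eval (det_cubic (dilate pencil_space t x)) \<xi> = cubic_eval (cubic_dilate (t ^ 3) (det_cubic x)) \<xi>"
      by (simp add: pencil_space_def cubic_eval_det_cubic)
  qed
  show "(\<lambda>x. kA (det_cubic x)) \<in> poly_ring pencil_space" "(\<lambda>x. kB (det_cubic x)) \<in> poly_ring pencil_space"
    "(\<lambda>x. kC (det_cubic x)) \<in> poly_ring pencil_space" "(\<lambda>x. kD (det_cubic x)) \<in> poly_ring pencil_space"
    unfolding k_det_cubic by (intro cpoly_to_poly_pencil coeff_cpoly)+
  show "p x = 0" if "p \<in> poly_ring pencil_space" "\<And>x. hess1 (det_cubic x) * p x = 0" for p x
    by (rule pencil_poly_nzd[OF that])
  fix a b c assume abc: "a \<in> poly_ring pencil_space" "b \<in> poly_ring pencil_space" "c \<in> poly_ring pencil_space"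
    and rel: "\<And>x. a x * hess1 (det_cubic x) + b x * hess2 (det_cubic x) + c x * hess3 (det_cubic x) = 0"
  have to: "(\<lambda>v. f (mk_pencil v)) \<in> cpoly 12" if "f \<in> poly_ring pencil_space" for f
    by (rule poly_pencil_to_cpoly[OF that]) (rule cpoly_var)
  obtain p q where pq: "p \<in> cpoly 12" "q \<in> cpoly 12"
    "\<And>v. a (mk_pencil v) = p v * cC v + q v * cD v \<and> b (mk_pencil v) = - p v * cB v - q v * cC v \<and> c (mk_pencil v) = p v * cA v + q v * cB v"
    using pulled_syzygies[OF to[OF abc(1)] to[OF abc(2)] to[OF abc(3)] rel[of "mk_pencil _", unfolded hess_mk_pencil]] by blast
  show "\<exists>p \<in> poly_ring pencil_space. \<exists>q \<in> poly_ring pencil_space. \<forall>x. a x = p x * kC (det_cubic x) + q x * kD (det_cubic x) \<and>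
         b x = - p x * kB (det_cubic x) - q x * kC (det_cubic x) \<and> c x = p x * kA (det_cubic x) + q x * kB (det_cubic x)"
    unfolding k_det_cubic
    by (rule bexI[OF _ cpoly_to_poly_pencil[OF pq(1)]], rule bexI[OF _ cpoly_to_poly_pencil[OF pq(2)]])
      (use pq(3)[of "coords _"] in \<open>simp add: mk_pencil_coords\<close>)
next
  show "f \<in> minors_ideal pencil_space det_cubic"
    if "f \<in> poly_ring pencil_space" "\<And>x. det_cubic x \<in> cubes \<Longrightarrow> f x = 0" for f
    by (rule par_vanishing[OF that(1)]) (intro that(2) det_cubic_cube_pencils par_mk_pencil)
qed simp

text \<open>The eight parameters are set to zero so that the results on the cone in
  \<open>cpoly 12\<close> apply to binary cubics as well.\<close>

definition cubic_coords :: "binary_cubic \<Rightarrow> nat \<Rightarrow> complex" where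
  "cubic_coords q = (\<lambda>i. if i = 8 then kA q else if i = 9 then kB q else if i = 10 then kC q else if i = 11 then kD q else 0)"

lemma cubic_coords_poly: "P \<in> cpoly 12 \<Longrightarrow> (\<lambda>q. P (cubic_coords q)) \<in> poly_ring cubic_space"
proof (erule cpoly_compose)
  fix i :: nat
  show "(\<lambda>q. cubic_coords q i) \<in> poly_ring cubic_space"
    unfolding cubic_coords_def
    by (cases "i = 8"; cases "i = 9"; cases "i = 10"; cases "i = 11") (simp_all add: k_poly polys.const)
qed

lemma cubic_poly_to_cpoly:
  assumes "f \<in> poly_ring cubic_space"
  shows "(\<lambda>v. f (mk_cubic (v 8) (v 9) (v 10) (v 11))) \<in> cpoly 12"
  unfolding cpoly_def
proof (rule polys_compose[OF assms], fold cpoly_def)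
  fix l assume "l \<in> forms cubic_space"
  then obtain \<xi> where "l = (\<lambda>q. cubic_eval q \<xi>)" by (auto simp: cubic_space_def)
  then show "(\<lambda>v. l (mk_cubic (v 8) (v 9) (v 10) (v 11))) \<in> cpoly 12"
    by (simp only: mk_cubic_eval) (intro cpoly_intros; simp)
qed

lemma hess_mk_cubic:
  "hess1 (mk_cubic (v 8) (v 9) (v 10) (v 11)) = mn1 v" "hess2 (mk_cubic (v 8) (v 9) (v 10) (v 11)) = mn2 v"
  "hess3 (mk_cubic (v 8) (v 9) (v 10) (v 11)) = mn3 v"
  by (simp_all add: hess1_def hess2_def hess3_def mn1_def mn2_def mn3_def)

lemma cubic_coords_simps [simp]:
  "cubic_coords q 8 = kA q" "cubic_coords q 9 = kB q" "cubic_coords q 10 = kC q" "cubic_coords q 11 = kD q"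
  by (simp_all add: cubic_coords_def)

interpretation cubics: cubic_covariant cubic_space "\<lambda>q. q" 1
proof
  show "gact cubic_space g h x = cubic_act g h x" for g h x by (simp add: cubic_space_def)
  show "dilate cubic_space t x = cubic_dilate (t ^ 1) x" for t x by (simp add: cubic_space_def)
  show "(\<lambda>x. kA x) \<in> poly_ring cubic_space" "(\<lambda>x. kB x) \<in> poly_ring cubic_space"
    "(\<lambda>x. kC x) \<in> poly_ring cubic_space" "(\<lambda>x. kD x) \<in> poly_ring cubic_space" by (rule k_poly)+
  show "p x = 0" if p: "p \<in> poly_ring cubic_space" "\<And>x. hess1 x * p x = 0" for p x
  proof -
    have "p (mk_cubic (cubic_coords x 8) (cubic_coords x 9) (cubic_coords x 10) (cubic_coords x 11)) = 0"
    proof (rule cpoly_domain[where f = mn1 and n = 12 and g = "\<lambda>v. p (mk_cubic (v 8) (v 9) (v 10) (v 11))" and x = "(\<lambda>_. 0)(9 := 1)"])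
      show "mn1 v * p (mk_cubic (v 8) (v 9) (v 10) (v 11)) = 0" for v
        using p(2)[of "mk_cubic (v 8) (v 9) (v 10) (v 11)"] by (simp only: hess_mk_cubic)
    qed (simp_all add: mn_cpoly cubic_poly_to_cpoly p, simp add: mn1_def)
    then show ?thesis by (simp add: mk_cubic_eta)
  qed
  fix a b c assume abc: "a \<in> poly_ring cubic_space" "b \<in> poly_ring cubic_space" "c \<in> poly_ring cubic_space"
    and rel: "\<And>x. a x * hess1 x + b x * hess2 x + c x * hess3 x = 0"
  note to = cubic_poly_to_cpoly
  have rel': "a (mk_cubic (v 8) (v 9) (v 10) (v 11)) * mn1 v + b (mk_cubic (v 8) (v 9) (v 10) (v 11)) * mn2 v
     + c (mk_cubic (v 8) (v 9) (v 10) (v 11)) * mn3 v = 0" for v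
    using rel[of "mk_cubic (v 8) (v 9) (v 10) (v 11)"] unfolding hess_mk_cubic .
  obtain p q where pq: "p \<in> cpoly 12" "q \<in> cpoly 12"
    "\<And>v. a (mk_cubic (v 8) (v 9) (v 10) (v 11)) = p v * v 10 + q v * v 11 \<and> b (mk_cubic (v 8) (v 9) (v 10) (v 11)) = - p v * v 9 - q v * v 10
      \<and> c (mk_cubic (v 8) (v 9) (v 10) (v 11)) = p v * v 8 + q v * v 9"
    using cone_syzygies[OF to[OF abc(1)] to[OF abc(2)] to[OF abc(3)] rel'] by blast
  show "\<exists>p \<in> poly_ring cubic_space. \<exists>q \<in> poly_ring cubic_space. \<forall>x. a x = p x * kC x + q x * kD x \<and>
         b x = - p x * kB x - q x * kC x \<and> c x = p x * kA x + q x * kB x"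
    by (rule bexI[OF _ cubic_coords_poly[OF pq(1)]], rule bexI[OF _ cubic_coords_poly[OF pq(2)]])
      (use pq(3)[of "cubic_coords _"] in \<open>simp add: mk_cubic_eta\<close>)
next
  fix f assume f: "f \<in> poly_ring cubic_space" and 0: "\<And>q. q \<in> cubes \<Longrightarrow> f q = 0"
  have "(\<lambda>v. f (mk_cubic (v 8) (v 9) (v 10) (v 11))) \<in> cone_ideal"
  proof (rule cone_ideal_radical[OF cubic_poly_to_cpoly[OF f]])
    show "f (mk_cubic (cone_pt w 8) (cone_pt w 9) (cone_pt w 10) (cone_pt w 11)) = 0" for w
      by (rule 0) (simp only: cubes_iff_hess hess_mk_cubic cone_pt_minors simp_thms)
  qed
  then show "f \<in> minors_ideal cubic_space (\<lambda>q. q)"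
  proof (rule ideal3E)
    fix p q r assume pqr: "p \<in> cpoly 12" "q \<in> cpoly 12" "r \<in> cpoly 12"
      "\<And>v. f (mk_cubic (v 8) (v 9) (v 10) (v 11)) = p v * mn1 v + q v * mn2 v + r v * mn3 v"
    show ?thesis
      by (rule ideal3I[OF cubic_coords_poly[OF pqr(1)] cubic_coords_poly[OF pqr(2)] cubic_coords_poly[OF pqr(3)]])
        (use pqr(4)[of "cubic_coords _"] in \<open>simp add: mk_cubic_eta mn1_def mn2_def mn3_def hess1_def hess2_def hess3_def\<close>)
  qed
qed simp

section \<open>The determinant covariant\<close>

text \<open>The invariant pairing with the determinant, whose coefficients are taken in binomial
  normalisation. The values at the four frames are combined so that each bracket recovers one
  coefficient of the cubic form \<open>w\<close>.\<close>

definition pair_cubic :: "(frames \<Rightarrow> complex) \<Rightarrow> pencil \<Rightarrow> complex" where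
  "pair_cubic w M = w frame1 * kA (det_cubic M) + ((w frame12 - w frame12') / 2 - w frame2) * kB (det_cubic M)
     + ((w frame12 + w frame12') / 2 - w frame1) * kC (det_cubic M) + w frame2 * kD (det_cubic M)"

definition cubic_el :: "complex \<Rightarrow> complex \<Rightarrow> complex \<Rightarrow> complex \<Rightarrow> frames \<Rightarrow> complex" where
  "cubic_el a b c d = (\<lambda>(P, Q). (a * P$1$1 ^ 3 + b * (P$1$1)\<^sup>2 * P$2$1 + c * P$1$1 * (P$2$1)\<^sup>2 + d * P$2$1 ^ 3) * det Q ^ 2)"

lemma schur_tensor_cubic_el: "schur_tensor [3,0] [2,2,2] = {cubic_el a b c d | a b c d. True}"
  unfolding schur_tensor_cubic cubic_el_def ..

lemma pair_cubic_el: "pair_cubic (cubic_el a b c d) = (\<lambda>M. a * kA (det_cubic M) + b * kB (det_cubic M) + c * kC (det_cubic M) + d * kD (det_cubic M))"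
  by (simp add: fun_eq_iff pair_cubic_def cubic_el_def frame1_def frame2_def frame12_def frame12'_def field_simps)

lemma pair_cubic_inj: "inj_on pair_cubic (schur_tensor [3,0] [2,2,2])"
proof (rule inj_onI)
  fix v w assume vw: "v \<in> schur_tensor [3,0] [2,2,2]" "w \<in> schur_tensor [3,0] [2,2,2]" and eq: "pair_cubic v = pair_cubic w"
  obtain a b c d where v: "v = cubic_el a b c d" using vw(1) unfolding schur_tensor_cubic_el by blast
  obtain a' b' c' d' where w: "w = cubic_el a' b' c' d'" using vw(2) unfolding schur_tensor_cubic_el by blast
  have e: "a * kA (det_cubic M) + b * kB (det_cubic M) + c * kC (det_cubic M) + d * kD (det_cubic M)
     = a' * kA (det_cubic M) + b' * kB (det_cubic M) + c' * kC (det_cubic M) + d' * kD (det_cubic M)" for M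
    using fun_cong[OF eq, of M] unfolding v w pair_cubic_el .
  \<comment> \<open>Diagonal pencils with determinant \<open>(p \<xi>\<^sub>1 + q \<xi>\<^sub>2) (p' \<xi>\<^sub>1 + q' \<xi>\<^sub>2) (p'' \<xi>\<^sub>1 + q'' \<xi>\<^sub>2)\<close>.\<close>
  define D where "D p q p' q' p'' q'' = mk_pencil (\<lambda>i. [p, q, 0, - p'', p', q', 0, q'', 0, 0, p'', 0] ! i)" for p q p' q' p'' q''
  have k: "kA (det_cubic (D p q p' q' p'' q'')) = p * p' * p''" "3 * kB (det_cubic (D p q p' q' p'' q'')) = q * p' * p'' + p * q' * p'' + p * p' * q''"
    "3 * kC (det_cubic (D p q p' q' p'' q'')) = p * q' * q'' + q * p' * q'' + q * q' * p''" "kD (det_cubic (D p q p' q' p'' q'')) = q * q' * q''"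
    for p q p' q' p'' q''
    unfolding k_det_cubic D_def cA_def cB_def cC_def cD_def sdet_def spol_def
    by (simp_all add: mk_pencil_entry algebra_simps)
  \<comment> \<open>The four diagonal pencils have determinants x^3, y^3, x^2 y and x y^2, one for
    each coefficient.\<close>
  have "a = a'" using e[of "D 1 0 1 0 1 0"] k[of 1 0 1 0 1 0] by simp
  moreover have "d = d'" using e[of "D 0 1 0 1 0 1"] k[of 0 1 0 1 0 1] by simp
  moreover have "b = b'" using e[of "D 0 1 1 0 1 0"] k[of 0 1 1 0 1 0] by auto
  moreover have "c = c'" using e[of "D 1 0 0 1 0 1"] k[of 1 0 0 1 0 1] by auto
  ultimately show "v = w" unfolding v w by simp
qed

lemma pair_cubic_image:
  "pair_cubic ` schur_tensor [3,0] [2,2,2] = cfun.span ((\<lambda>l. l \<circ> det_cubic) ` forms cubic_space)"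
proof (rule antisym)
  let ?T = "cfun.span ((\<lambda>l. l \<circ> det_cubic) ` forms cubic_space)"
  have ev: "(\<lambda>M. cubic_eval (det_cubic M) \<xi>) \<in> ?T" for \<xi>
    by (rule cfun.span_base) (auto simp: cubic_space_def image_iff fun_eq_iff)
  have lin: "(\<lambda>M. f M + g M) \<in> ?T" if "f \<in> ?T" "g \<in> ?T" for f g
    using cfun.span_add[OF that] by (simp add: plus_fun_def)
  have scl: "(\<lambda>M. c * f M) \<in> ?T" if "f \<in> ?T" for f c using that by (rule cfun.span_scale)
  show "pair_cubic ` schur_tensor [3,0] [2,2,2] \<subseteq> ?T"
  proof safe
    fix w assume "w \<in> schur_tensor [3,0] [2,2,2]"
    then obtain a b c d where w: "w = cubic_el a b c d" unfolding schur_tensor_cubic_el by blast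
    let ?e = "\<lambda>x y M. cubic_eval (det_cubic M) (vec2 x y)"
    have "(\<lambda>M. (a - c / 3) * ?e 1 0 M + ((d - b / 3) * ?e 0 1 M + ((b + c) / 6 * ?e 1 1 M + (c - b) / 6 * ?e 1 (-1) M))) \<in> ?T"
      by (intro lin scl ev)
    moreover have "pair_cubic w M = (a - c / 3) * ?e 1 0 M + ((d - b / 3) * ?e 0 1 M + ((b + c) / 6 * ?e 1 1 M + (c - b) / 6 * ?e 1 (-1) M))" for M
      unfolding w pair_cubic_el kA_def kB_def kC_def kD_def by (simp add: field_simps)
    ultimately show "pair_cubic w \<in> ?T" by presburger
  qed
  show "?T \<subseteq> pair_cubic ` schur_tensor [3,0] [2,2,2]"
  proof
    fix f assume "f \<in> ?T"
    then have "\<exists>a b c d. f = pair_cubic (cubic_el a b c d)"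
    proof (induction rule: cfun.span_induct_alt)
      case base
      show ?case by (intro exI[of _ 0]) (simp add: pair_cubic_el fun_eq_iff)
    next
      case (step r x y)
      obtain l where "l \<in> forms cubic_space" "x = l \<circ> det_cubic" using step(1) by blast
      then obtain \<xi> where x: "x = (\<lambda>M. cubic_eval (det_cubic M) \<xi>)" unfolding cubic_space_def by (auto simp: comp_def)
      obtain a b c d where y: "y = pair_cubic (cubic_el a b c d)" using step(2) by blast
      show ?case
        by (intro exI[of _ "r * (\<xi>$1)^3 + a"] exI[of _ "3 * r * (\<xi>$1)\<^sup>2 * \<xi>$2 + b"] exI[of _ "3 * r * \<xi>$1 * (\<xi>$2)\<^sup>2 + c"] exI[of _ "r * (\<xi>$2)^3 + d"])
          (simp add: x y pair_cubic_el fun_eq_iff cubic_eval_coeffs[of _ \<xi>] algebra_simps)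
    qed
    then show "f \<in> pair_cubic ` schur_tensor [3,0] [2,2,2]" unfolding schur_tensor_cubic_el by blast
  qed
qed

lemma pair_cubic_homogeneous:
  assumes "w \<in> schur_tensor [3,0] [2,2,2]" shows "pair_cubic w \<in> homogeneous pencil_space 3"
proof -
  obtain a b c d where w: "w = cubic_el a b c d" using assms unfolding schur_tensor_cubic_el by blast
  have "pair_cubic w \<in> poly_ring pencil_space"
    unfolding w pair_cubic_el by (intro polys.add polys_cmul pencils.poly)
  moreover have "pair_cubic w (dilate pencil_space t M) = t ^ 3 * pair_cubic w M" for t M
    unfolding w pair_cubic_el pencils.dil k_dilate by (simp add: algebra_simps)
  ultimately show ?thesis unfolding homogeneous_def by blast
qed

lemma pair_cubic_act:
  assumes "w \<in> schur_tensor [3,0] [2,2,2]"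
  shows "pair_cubic (frames_act g h w) = mact (coord_ring pencil_space UNIV) g h (pair_cubic w)"
proof
  fix M
  obtain a b c d where w: "w = cubic_el a b c d" using assms unfolding schur_tensor_cubic_el by blast
  let ?g = "matrix_inv g" and ?h = "matrix_inv h"
  let ?c = "\<lambda>x y. a * x ^ 3 + b * x\<^sup>2 * y + c * x * y\<^sup>2 + d * y ^ 3"
  have f: "frames_act g h w frame1 = ?c (?g$1$1) (?g$2$1) * (det ?h)\<^sup>2" "frames_act g h w frame2 = ?c (?g$1$2) (?g$2$2) * (det ?h)\<^sup>2"
    "frames_act g h w frame12 = ?c (?g$1$1 + ?g$1$2) (?g$2$1 + ?g$2$2) * (det ?h)\<^sup>2"
    "frames_act g h w frame12' = ?c (?g$1$1 - ?g$1$2) (?g$2$1 - ?g$2$2) * (det ?h)\<^sup>2"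
    unfolding w frames_act_def cubic_el_def frame1_def frame2_def frame12_def frame12'_def prod.case mult_col1 by simp_all
  \<comment> \<open>Polarisation of a cubic form: the odd and even parts at the sum and the
    difference of two vectors give the mixed terms.\<close>
  have half: "(?c (x + x') (y + y') * D - ?c (x - x') (y - y') * D) / 2 - ?c x' y' * D
       = (3 * a * x\<^sup>2 * x' + b * (x\<^sup>2 * y' + 2 * x * x' * y) + c * (x' * y\<^sup>2 + 2 * x * y * y') + 3 * d * y\<^sup>2 * y') * D"
    "(?c (x + x') (y + y') * D + ?c (x - x') (y - y') * D) / 2 - ?c x y * D
       = (3 * a * x * x'\<^sup>2 + b * (x'\<^sup>2 * y + 2 * x * x' * y') + c * (x * y'\<^sup>2 + 2 * x' * y * y') + 3 * d * y * y'\<^sup>2) * D" for x x' y y' D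
    by (simp_all add: field_simps power2_eq_square power3_eq_cube)
  show "pair_cubic (frames_act g h w) M = mact (coord_ring pencil_space UNIV) g h (pair_cubic w) M"
    unfolding coord_ring_sel pair_cubic_def[of "frames_act g h w"] f half
    unfolding w pair_cubic_el pencils.act k_cubic_act by algebra
qed

theorem mainTheorem17:
  shows "has_codim pencil_space orbit9 2 \<and> orbit9 = cube_pencils \<and>
    (\<exists>d1 d2 c1 c2.
      minimal_free_resolution pencil_space (zariski_closure pencil_space orbit9)
        ([4,2], [4,4,4], 6) ([5,4], [6,6,6], 9) d1 d2 \<and>
      minimal_free_resolution cubic_space cubes
        ([4,2], [4,4,4], 2) ([5,4], [6,6,6], 3) c1 c2 \<and>
      (\<forall>\<phi> \<in> mcar (free_module cubic_space ([5,4], [6,6,6], 3)).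
        d2 (pullback det_cubic \<phi>) = pullback det_cubic (c2 \<phi>)) \<and>
      (\<forall>\<phi> \<in> mcar (free_module cubic_space ([4,2], [4,4,4], 2)).
        d1 (pullback det_cubic \<phi>) = c1 \<phi> \<circ> det_cubic)) \<and>
    (\<exists>\<psi>. bij_betw \<psi> (schur_tensor [3,0] [2,2,2])
            (cfun.span ((\<lambda>l. l \<circ> det_cubic) ` forms cubic_space)) \<and>
      (\<forall>w \<in> schur_tensor [3,0] [2,2,2]. \<psi> w \<in> homogeneous pencil_space 3) \<and>
      (\<forall>c. \<forall>v \<in> schur_tensor [3,0] [2,2,2]. \<forall>w \<in> schur_tensor [3,0] [2,2,2].
        \<psi> (\<lambda>p. c * v p + w p) = (\<lambda>M. c * \<psi> v M + \<psi> w M)) \<and>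
      (\<forall>g h. invertible g \<longrightarrow> invertible h \<longrightarrow> (\<forall>w \<in> schur_tensor [3,0] [2,2,2].
        \<psi> (frames_act g h w) = mact (coord_ring pencil_space UNIV) g h (\<psi> w))))"
proof (intro conjI)
  show "has_codim pencil_space orbit9 2" by (rule codim_orbit9)
  show "orbit9 = cube_pencils" by (rule orbit9_eq_cube_pencils)
  \<comment> \<open>For the determinant k = 3, so the twists 2k and 3k are 6 and 9;
    \<open>closure_orbit9\<close> identifies the zero set with the closure of the orbit.\<close>
  have "minimal_free_resolution pencil_space (zariski_closure pencil_space orbit9)
      ([4,2], [4,4,4], 6) ([5,4], [6,6,6], 9) (diff1 det_cubic) (diff2 det_cubic)"
    using pencils.resolution unfolding closure_orbit9 by simp
  moreover have "minimal_free_resolution cubic_space cubes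
      ([4,2], [4,4,4], 2) ([5,4], [6,6,6], 3) (diff1 (\<lambda>q. q)) (diff2 (\<lambda>q. q))"
    using cubics.resolution by simp
  ultimately show "\<exists>d1 d2 c1 c2.
      minimal_free_resolution pencil_space (zariski_closure pencil_space orbit9)
        ([4,2], [4,4,4], 6) ([5,4], [6,6,6], 9) d1 d2 \<and>
      minimal_free_resolution cubic_space cubes
        ([4,2], [4,4,4], 2) ([5,4], [6,6,6], 3) c1 c2 \<and>
      (\<forall>\<phi> \<in> mcar (free_module cubic_space ([5,4], [6,6,6], 3)).
        d2 (pullback det_cubic \<phi>) = pullback det_cubic (c2 \<phi>)) \<and>
      (\<forall>\<phi> \<in> mcar (free_module cubic_space ([4,2], [4,4,4], 2)).
        d1 (pullback det_cubic \<phi>) = c1 \<phi> \<circ> det_cubic)"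
    by (intro exI[of _ "diff1 det_cubic"] exI[of _ "diff2 det_cubic"] exI[of _ "diff1 (\<lambda>q. q)"] exI[of _ "diff2 (\<lambda>q. q)"]
        conjI ballI diff_pullback)
  have "bij_betw pair_cubic (schur_tensor [3,0] [2,2,2]) (cfun.span ((\<lambda>l. l \<circ> det_cubic) ` forms cubic_space))"
    unfolding bij_betw_def using pair_cubic_inj pair_cubic_image by blast
  moreover have "pair_cubic (\<lambda>p. c * v p + w p) = (\<lambda>M. c * pair_cubic v M + pair_cubic w M)" for c v w
    by (simp add: fun_eq_iff pair_cubic_def field_simps)
  ultimately show "\<exists>\<psi>. bij_betw \<psi> (schur_tensor [3,0] [2,2,2])
            (cfun.span ((\<lambda>l. l \<circ> det_cubic) ` forms cubic_space)) \<and>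
      (\<forall>w \<in> schur_tensor [3,0] [2,2,2]. \<psi> w \<in> homogeneous pencil_space 3) \<and>
      (\<forall>c. \<forall>v \<in> schur_tensor [3,0] [2,2,2]. \<forall>w \<in> schur_tensor [3,0] [2,2,2].
        \<psi> (\<lambda>p. c * v p + w p) = (\<lambda>M. c * \<psi> v M + \<psi> w M)) \<and>
      (\<forall>g h. invertible g \<longrightarrow> invertible h \<longrightarrow> (\<forall>w \<in> schur_tensor [3,0] [2,2,2].
        \<psi> (frames_act g h w) = mact (coord_ring pencil_space UNIV) g h (\<psi> w)))"
    using pair_cubic_homogeneous pair_cubic_act by (intro exI[of _ pair_cubic]) simp
qed

end
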